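(* Let $\mathcal{T}_h$ be a tetrahedral triangulation of $\Omega$ and let $$\Sigma_h=\{\tau\in H(\mathrm{div},\Omega;\mathbb{S}):\ \tau|_K\in P_3(K;\mathbb{S})\ \forall K\in\mathcal{T}_h,\ \tau\text{ is continuous at the vertices of }\mathcal{T}_h\}.$$ The following set of degrees of freedom for $\tau\in\Sigma_h$ is unisolvent for $\Sigma_h$: (a) $\tau(x)$ for all vertices $x$ of $\mathcal{T}_h$; (b) $(\bm{n}^T\tau\bm{n},q)_F$ for all $q\in P_0(F)$ and all faces $F$ of $\mathcal{T}_h$; (c) $(\Pi_F(\tau\bm{n}),v)_F$ for all $v\in ND_1(F)$ and all faces $F$ of $\mathcal{T}_h$; (d) $(\tau,\xi)_K$ for all $\xi\in P_1(K;\mathbb{S})$ and all $K\in\mathcal{T}_h$; (e) for every boundary edge $e$: $\big((\bm{n}_1^T\tau\bm{t}_1)|_{F_1},q\big)_e$ and $\big((\bm{n}_i^T\tau\bm{n}_i)|_{F_i},q\big)_e$ for all $q\in P_1(e)$, $1\le i\le m_e+1$; (f) for every interior edge $e$ with $m_e$ odd: $\big((\bm{n}_i^T\tau\bm{n}_i)|_{F_i},q\big)_e$ for all $q\in P_1(e)$, $1\le i\le m_e$; (g) for every interior non-singular edge $e$ with $m_e$ even: $\big((\bm{n}_1^T\tau\bm{t}_1)|_{F_1},q\big)_e$ and $\big((\bm{n}_i^T\tau\bm{n}_i)|_{F_i},q\big)_e$ for all $q\in P_1(e)$, $2\le i\le m_e$; (h) for every singular edge $e$: $\big((\bm{n}_1^T\tau\bm{t}_1)|_{F_1},q\big)_e$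 and $\big((\bm{n}_i^T\tau\bm{n}_i)|_{F_i},q\big)_e$ for all $q\in P_1(e)$, $1\le i\le 4$.
   Context: $\Omega\subset\mathbb{R}^3$ is a simply-connected bounded polyhedral domain and $\mathcal{T}_h$ is a (conforming, shape-regular) triangulation of $\Omega$ into tetrahedra. $\mathbb{S}=\mathbb{R}^{3\times3}_{\mathrm{sym}}$; $H(\mathrm{div},\Omega;\mathbb{S})=\{\tau\in L^2(\Omega;\mathbb{S}):\mathrm{div}\,\tau\in L^2(\Omega;\mathbb{R}^3)\}$ with row-wise divergence. $P_k(\omega;X)$ is the space of $X$-valued polynomials of degree at most $k$ on $\omega$. $(\cdot,\cdot)_\omega$ is the $L^2$ inner product over $\omega$ (an element, face or edge). "Continuous at vertices" means that at each vertex $x$ the values $\tau|_K(x)$ agree for all $K\in\mathcal{T}_h$ containing $x$. For a face $F$ with unit normal $\bm{n}$: $\Pi_F(v)=(\bm{n}\times v)\times\bm{n}$ is the projection onto the tangent plane of $F$, and $ND_1(F)=\{v\in (P_1(F))^3+(P_1(F))^3\times\bm{x}:\ v\cdot\bm{n}=0\}$ is the first-kind Nédélec space on $F$, $\bm{x}$ being the position vector. Edge patch. For an edge $e$, $\omega_e$ is the union of all elements having $e$ as an edge, and $m_e$ is the number of these elements. They are labelled $K_1,\dots,K_{m_e}$, and the faces containing $e$ are labelled $F_1,\dots,F_{m_e+1}$, so that $F_i\subset\partial K_i$ and $F_{i+1}\subset\partial K_i$ for $1\le i\le m_e$. If $e$ is interior, $F_{m_e+1}=F_1$; if $e$ is a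 boundary edge, $F_1$ and $F_{m_e+1}$ are the boundary faces. $\bm{n}_i$ is a unit normal of $F_i$, $\bm{t}$ is a tangential vector along $e$, and $\bm{t}_i=\bm{n}_i\times\bm{t}$. $\theta_i$ is the dihedral angle (of $K_i$) between $F_i$ and $F_{i+1}$. An interior edge is singular if $m_e=4$ and $\theta_1+\theta_2=\theta_2+\theta_3=\pi$. If $e$ is an interior non-singular edge with $m_e$ even, the labelling is chosen so that $\theta_1+\theta_{m_e}\neq\pi$. Degrees of freedom indexed by a space of test functions are counted with respect to a basis of that space (and the six independent entries of $\tau(x)$ in (a)). "Unisolvent" means that the number of degrees of freedom equals $\dim\Sigma_h$ and that $\tau\in\Sigma_h$ with all degrees of freedom zero must be $\tau=0$; i.e. each assignment of values to the degrees of freedom determines exactly one $\tau\in\Sigma_h$. *)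

theory Defs
  imports "HOL-Analysis.Analysis" "HOL-Library.Function_Algebras"
begin

section \<open>The vector space of functions\<close>

definition scale_fun :: "real \<Rightarrow> ('a \<Rightarrow> 'b::real_vector) \<Rightarrow> 'a \<Rightarrow> 'b" where
  "scale_fun c f = (\<lambda>x. c *\<^sub>R f x)"

interpretation fn: vector_space "scale_fun :: real \<Rightarrow> ('a \<Rightarrow> 'b::real_vector) \<Rightarrow> 'a \<Rightarrow> 'b"
  by unfold_locales
    (auto simp: scale_fun_def fun_eq_iff scaleR_add_right scaleR_add_left)

definition is_basis :: "('a \<Rightarrow> 'b::real_vector) set \<Rightarrow> ('a \<Rightarrow> 'b) set \<Rightarrow> bool" where
  "is_basis B V \<longleftrightarrow> fn.independent B \<and> fn.span B = V"

definition unisolvent ::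
    "('a \<Rightarrow> 'b::real_vector) set \<Rightarrow> 'd set \<Rightarrow> (('a \<Rightarrow> 'b) \<Rightarrow> 'd \<Rightarrow> real) \<Rightarrow> bool" where
  "unisolvent V D val \<longleftrightarrow>
     finite D \<and> card D = fn.dim V \<and> (\<forall>v\<in>V. (\<forall>d\<in>D. val v d = 0) \<longrightarrow> v = 0)"


section \<open>Polynomials\<close>

text \<open>A function on a set \<open>\<omega>\<close> is represented by its extension by zero, so that functions on \<open>\<omega>\<close>
  form a subspace of the function space above (on a face or an edge, different polynomials of
  three variables may restrict to the same function).\<close>

definition restr :: "'a set \<Rightarrow> ('a \<Rightarrow> 'b::zero) \<Rightarrow> 'a \<Rightarrow> 'b" where
  "restr \<omega> f = (\<lambda>x. if x \<in> \<omega> then f x else 0)"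

text \<open>The sum ranges over the multi-indices \<open>\<alpha>\<close> of order at most \<open>k\<close>.\<close>

definition polys :: "nat \<Rightarrow> (real^3 \<Rightarrow> 'b::real_vector) set" where
  "polys k = {p. \<exists>c. \<forall>x. p x =
     (\<Sum>\<alpha> | (\<Sum>i\<in>UNIV. \<alpha> i) \<le> k. (\<Prod>i\<in>UNIV. (x$i) ^ \<alpha> i) *\<^sub>R c (\<alpha> :: 3 \<Rightarrow> nat))}"

definition polys_on :: "nat \<Rightarrow> (real^3) set \<Rightarrow> 'b set \<Rightarrow> (real^3 \<Rightarrow> 'b::real_vector) set" where
  "polys_on k \<omega> X = {restr \<omega> p | p. p \<in> polys k \<and> (\<forall>x\<in>\<omega>. p x \<in> X)}"

definition sym_mats :: "(real^3^3) set" where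
  "sym_mats = {A. transpose A = A}"

definition nedelec1 :: "(real^3) set \<Rightarrow> real^3 \<Rightarrow> (real^3 \<Rightarrow> real^3) set" where
  "nedelec1 F n = {restr F (\<lambda>x. p x + cross3 (q x) x) | p q.
     p \<in> polys 1 \<and> q \<in> polys 1 \<and> (\<forall>x\<in>F. (p x + cross3 (q x) x) \<bullet> n = 0)}"


section \<open>The space \<open>H(div, \<Omega>; S)\<close>\<close>

primrec C_k :: "nat \<Rightarrow> (real^3 \<Rightarrow> real) \<Rightarrow> bool" where
  "C_k 0 f \<longleftrightarrow> continuous_on UNIV f"
| "C_k (Suc k) f \<longleftrightarrow>
     (\<exists>f'. (\<forall>x. (f has_derivative f' x) (at x)) \<and> (\<forall>v. C_k k (\<lambda>x. f' x v)))"

definition test_function :: "(real^3) set \<Rightarrow> (real^3 \<Rightarrow> real) \<Rightarrow> bool" where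
  "test_function \<Omega> \<phi> \<longleftrightarrow> (\<forall>k. C_k k \<phi>) \<and>
     compact (closure {x. \<phi> x \<noteq> 0}) \<and> closure {x. \<phi> x \<noteq> 0} \<subseteq> \<Omega>"

definition square_integrable :: "(real^3) set \<Rightarrow> (real^3 \<Rightarrow> 'b::euclidean_space) \<Rightarrow> bool" where
  "square_integrable \<Omega> f \<longleftrightarrow> set_borel_measurable lebesgue \<Omega> f \<and>
     set_integrable lebesgue \<Omega> (\<lambda>x. (norm (f x))\<^sup>2)"

text \<open>Row-wise distributional divergence; \<open>frechet_derivative \<phi> (at x) (\<tau> x $ i)\<close> is the inner
  product of row \<open>i\<close> of \<open>\<tau> x\<close> with the gradient of \<open>\<phi>\<close> at \<open>x\<close>.\<close>

definition weak_div ::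
    "(real^3) set \<Rightarrow> (real^3 \<Rightarrow> real^3^3) \<Rightarrow> (real^3 \<Rightarrow> real^3) \<Rightarrow> bool" where
  "weak_div \<Omega> \<tau> g \<longleftrightarrow> (\<forall>\<phi> i. test_function \<Omega> \<phi> \<longrightarrow>
     (LINT x:\<Omega>|lebesgue. frechet_derivative \<phi> (at x) (\<tau> x $ i)) =
     - (LINT x:\<Omega>|lebesgue. g x $ i * \<phi> x))"

definition Hdiv_sym :: "(real^3) set \<Rightarrow> (real^3 \<Rightarrow> real^3^3) set" where
  "Hdiv_sym \<Omega> = {\<tau>. square_integrable \<Omega> \<tau> \<and>
     (AE x in lebesgue. x \<in> \<Omega> \<longrightarrow> \<tau> x \<in> sym_mats) \<and>
     (\<exists>g. square_integrable \<Omega> g \<and> weak_div \<Omega> \<tau> g)}"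


section \<open>Domain and triangulation\<close>

text \<open>The condition \<open>interior (closure \<Omega>) = \<Omega>\<close> excludes slits.\<close>

definition polyhedral_domain :: "(real^3) set \<Rightarrow> bool" where
  "polyhedral_domain \<Omega> \<longleftrightarrow> \<Omega> \<noteq> {} \<and> open \<Omega> \<and> connected \<Omega> \<and> interior (closure \<Omega>) = \<Omega> \<and>
     (\<exists>\<P>. finite \<P> \<and> (\<forall>P\<in>\<P>. polytope P) \<and> closure \<Omega> = \<Union>\<P>)"

definition tet_triangulation :: "(real^3) set \<Rightarrow> (real^3) set set \<Rightarrow> bool" where
  "tet_triangulation \<Omega> \<T> \<longleftrightarrow>
     triangulation \<T> \<and> (\<forall>K\<in>\<T>. 3 simplex K) \<and> \<Union>\<T> = closure \<Omega>"

definition vertices :: "(real^3) set set \<Rightarrow> (real^3) set" where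
  "vertices \<T> = {x. \<exists>K\<in>\<T>. x extreme_point_of K}"

definition edges :: "(real^3) set set \<Rightarrow> (real^3) set set" where
  "edges \<T> = {e. \<exists>K\<in>\<T>. e face_of K \<and> aff_dim e = 1}"

definition faces :: "(real^3) set set \<Rightarrow> (real^3) set set" where
  "faces \<T> = {F. \<exists>K\<in>\<T>. F face_of K \<and> aff_dim F = 2}"

definition unit_normal :: "(real^3) set \<Rightarrow> real^3 \<Rightarrow> bool" where
  "unit_normal F n \<longleftrightarrow> norm n = 1 \<and> (\<forall>x\<in>F. \<forall>y\<in>F. n \<bullet> (y - x) = 0)"

definition tangential :: "(real^3) set \<Rightarrow> real^3 \<Rightarrow> bool" where
  "tangential e t \<longleftrightarrow> t \<noteq> 0 \<and> (\<exists>x\<in>e. \<exists>y\<in>e. \<exists>c. t = c *\<^sub>R (y - x))"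


section \<open>Edge patches\<close>

definition boundary_edge :: "(real^3) set \<Rightarrow> (real^3) set \<Rightarrow> bool" where
  "boundary_edge \<Omega> e \<longleftrightarrow> e \<subseteq> frontier \<Omega>"

definition patch_size :: "(real^3) set set \<Rightarrow> (real^3) set \<Rightarrow> nat" where
  "patch_size \<T> e = card {K\<in>\<T>. e face_of K}"

definition edge_labelling ::
    "(real^3) set \<Rightarrow> (real^3) set set \<Rightarrow> (real^3) set \<Rightarrow>
     (nat \<Rightarrow> (real^3) set) \<Rightarrow> (nat \<Rightarrow> (real^3) set) \<Rightarrow> bool" where
  "edge_labelling \<Omega> \<T> e K F \<longleftrightarrow> (let m = patch_size \<T> e in
     bij_betw K {1..m} {K\<in>\<T>. e face_of K} \<and>
     (\<forall>i\<in>{1..m}. F i face_of K i \<and> F (i + 1) face_of K i) \<and>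
     (if boundary_edge \<Omega> e
      then bij_betw F {1..m + 1} {F\<in>faces \<T>. e face_of F} \<and>
           F 1 \<subseteq> frontier \<Omega> \<and> F (m + 1) \<subseteq> frontier \<Omega>
      else bij_betw F {1..m} {F\<in>faces \<T>. e face_of F} \<and> F (m + 1) = F 1))"

text \<open>The unit vector in the plane of \<open>F\<close> that is orthogonal to its edge \<open>e\<close> and points from \<open>e\<close>
  into \<open>F\<close>.\<close>

definition conormal :: "(real^3) set \<Rightarrow> (real^3) set \<Rightarrow> real^3" where
  "conormal e F = (THE \<nu>. norm \<nu> = 1 \<and> (\<forall>x\<in>e. \<forall>y\<in>e. \<nu> \<bullet> (y - x) = 0) \<and>
     (\<exists>x\<in>e. \<exists>s>0. x + s *\<^sub>R \<nu> \<in> F))"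

definition dihedral_angle :: "(real^3) set \<Rightarrow> (real^3) set \<Rightarrow> (real^3) set \<Rightarrow> real" where
  "dihedral_angle e F G = arccos (conormal e F \<bullet> conormal e G)"

definition theta :: "(real^3) set \<Rightarrow> (nat \<Rightarrow> (real^3) set) \<Rightarrow> nat \<Rightarrow> real" where
  "theta e F i = dihedral_angle e (F i) (F (i + 1))"

definition singular_edge ::
    "(real^3) set \<Rightarrow> (real^3) set set \<Rightarrow> (real^3) set \<Rightarrow> (nat \<Rightarrow> (real^3) set) \<Rightarrow> bool" where
  "singular_edge \<Omega> \<T> e F \<longleftrightarrow> \<not> boundary_edge \<Omega> e \<and> patch_size \<T> e = 4 \<and>
     theta e F 1 + theta e F 2 = pi \<and> theta e F 2 + theta e F 3 = pi"


section \<open>The finite element space\<close>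

text \<open>The value at a point \<open>x\<close> of the closed element \<open>K\<close> of the continuous extension of \<open>\<tau>\<close> from
  the interior of \<open>K\<close>.\<close>

definition elem_value ::
    "(real^3 \<Rightarrow> real^3^3) \<Rightarrow> (real^3) set \<Rightarrow> real^3 \<Rightarrow> real^3^3" where
  "elem_value \<tau> K x = Lim (at x within interior K) \<tau>"

text \<open>Elements of \<open>H(div, \<Omega>; S)\<close> are determined up to null sets. Each class in the finite element
  space is represented by its member that is polynomial in the interior of each element and zero
  at all other points.\<close>

definition Sigma_h :: "(real^3) set \<Rightarrow> (real^3) set set \<Rightarrow> (real^3 \<Rightarrow> real^3^3) set" where
  "Sigma_h \<Omega> \<T> = {\<tau>. \<tau> \<in> Hdiv_sym \<Omega> \<and>
     (\<forall>K\<in>\<T>. restr (interior K) \<tau> \<in> polys_on 3 (interior K) sym_mats) \<and>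
     (\<forall>x. x \<notin> (\<Union>K\<in>\<T>. interior K) \<longrightarrow> \<tau> x = 0) \<and>
     (\<forall>x\<in>vertices \<T>. \<forall>K\<in>\<T>. \<forall>K'\<in>\<T>. x \<in> K \<and> x \<in> K' \<longrightarrow> elem_value \<tau> K x = elem_value \<tau> K' x)}"


section \<open>Integrals over faces and edges\<close>

text \<open>The integral over a planar or straight set \<open>S\<close> with respect to area or length is the Lebesgue
  integral in an isometric chart of the affine hull of \<open>S\<close>; it does not depend on the chart.\<close>

definition isometric_chart :: "(real^3) set \<Rightarrow> ('a::euclidean_space \<Rightarrow> real^3) \<Rightarrow> bool" where
  "isometric_chart S \<phi> \<longleftrightarrow> (\<forall>u v. dist (\<phi> u) (\<phi> v) = dist u v) \<and> range \<phi> = affine hull S"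

definition face_integral :: "(real^3) set \<Rightarrow> (real^3 \<Rightarrow> real) \<Rightarrow> real" where
  "face_integral F f =
     (let \<phi> = (SOME \<phi> :: real^2 \<Rightarrow> real^3. isometric_chart F \<phi>)
      in LINT u:(\<phi> -` F)|lebesgue. f (\<phi> u))"

definition edge_integral :: "(real^3) set \<Rightarrow> (real^3 \<Rightarrow> real) \<Rightarrow> real" where
  "edge_integral e f =
     (let \<phi> = (SOME \<phi> :: real \<Rightarrow> real^3. isometric_chart e \<phi>)
      in LINT u:(\<phi> -` e)|lebesgue. f (\<phi> u))"


section \<open>Degrees of freedom\<close>

definition common_value :: "(real^3) set set \<Rightarrow> ((real^3) set \<Rightarrow> 'b) \<Rightarrow> 'b" where
  "common_value \<K> g = (THE w. \<forall>K\<in>\<K>. g K = w)"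

definition vertex_value ::
    "(real^3) set set \<Rightarrow> (real^3 \<Rightarrow> real^3^3) \<Rightarrow> real^3 \<Rightarrow> real^3^3" where
  "vertex_value \<T> \<tau> x = common_value {K\<in>\<T>. x \<in> K} (\<lambda>K. elem_value \<tau> K x)"

text \<open>Only those components of \<open>\<tau>\<close> on \<open>F\<close> are used below that are determined by \<open>\<tau> n\<close>; they
  agree for the elements sharing \<open>F\<close>.\<close>

definition face_value ::
    "(real^3) set set \<Rightarrow> (real^3 \<Rightarrow> real^3^3) \<Rightarrow> (real^3) set \<Rightarrow> (real^3^3 \<Rightarrow> 'b) \<Rightarrow> real^3 \<Rightarrow> 'b" where
  "face_value \<T> \<tau> F L x = common_value {K\<in>\<T>. F face_of K} (\<lambda>K. L (elem_value \<tau> K x))"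

definition tangential_part :: "real^3 \<Rightarrow> real^3 \<Rightarrow> real^3" where
  "tangential_part n v = cross3 (cross3 n v) n"

datatype dof =
    Vertex_dof "real^3" 3 3
  | Face_nn_dof "(real^3) set" "real^3 \<Rightarrow> real"
  | Face_tangential_dof "(real^3) set" "real^3 \<Rightarrow> real^3"
  | Element_dof "(real^3) set" "real^3 \<Rightarrow> real^3^3"
  | Edge_nt_dof "(real^3) set" "real^3 \<Rightarrow> real"
  | Edge_nn_dof "(real^3) set" nat "real^3 \<Rightarrow> real"

text \<open>In the following two definitions \<open>nrm\<close> gives the unit normal of each face, \<open>tng\<close> a tangential
  vector of each edge, and \<open>F e i\<close> is the \<open>i\<close>-th face at the edge \<open>e\<close>. \<open>Edge_nt_dof\<close> always refers
  to the first face. The inner product of matrices is the Frobenius product.\<close>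

fun dof_value ::
    "(real^3) set set \<Rightarrow> ((real^3) set \<Rightarrow> nat \<Rightarrow> (real^3) set) \<Rightarrow> ((real^3) set \<Rightarrow> real^3) \<Rightarrow>
     ((real^3) set \<Rightarrow> real^3) \<Rightarrow> (real^3 \<Rightarrow> real^3^3) \<Rightarrow> dof \<Rightarrow> real" where
  "dof_value \<T> F nrm tng \<tau> (Vertex_dof x i j) = vertex_value \<T> \<tau> x $ i $ j"
| "dof_value \<T> F nrm tng \<tau> (Face_nn_dof f q) =
     face_integral f (\<lambda>x. face_value \<T> \<tau> f (\<lambda>A. nrm f \<bullet> (A *v nrm f)) x * q x)"
| "dof_value \<T> F nrm tng \<tau> (Face_tangential_dof f v) =
     face_integral f
       (\<lambda>x. face_value \<T> \<tau> f (\<lambda>A. tangential_part (nrm f) (A *v nrm f)) x \<bullet> v x)"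
| "dof_value \<T> F nrm tng \<tau> (Element_dof K \<xi>) = (LINT x:K|lebesgue. \<tau> x \<bullet> \<xi> x)"
| "dof_value \<T> F nrm tng \<tau> (Edge_nt_dof e q) =
     (let n = nrm (F e 1); t = cross3 n (tng e)
      in edge_integral e (\<lambda>x. face_value \<T> \<tau> (F e 1) (\<lambda>A. n \<bullet> (A *v t)) x * q x))"
| "dof_value \<T> F nrm tng \<tau> (Edge_nn_dof e i q) =
     (let n = nrm (F e i)
      in edge_integral e (\<lambda>x. face_value \<T> \<tau> (F e i) (\<lambda>A. n \<bullet> (A *v n)) x * q x))"

text \<open>\<open>B0\<close>, \<open>BN\<close>, \<open>BK\<close> and \<open>BE\<close> are bases of the test spaces on faces (piecewise constants and
  Nedelec functions), elements and edges.\<close>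

definition dofs ::
    "(real^3) set \<Rightarrow> (real^3) set set \<Rightarrow> ((real^3) set \<Rightarrow> nat \<Rightarrow> (real^3) set) \<Rightarrow>
     ((real^3) set \<Rightarrow> (real^3 \<Rightarrow> real) set) \<Rightarrow> ((real^3) set \<Rightarrow> (real^3 \<Rightarrow> real^3) set) \<Rightarrow>
     ((real^3) set \<Rightarrow> (real^3 \<Rightarrow> real^3^3) set) \<Rightarrow> ((real^3) set \<Rightarrow> (real^3 \<Rightarrow> real) set) \<Rightarrow>
     dof set" where
  "dofs \<Omega> \<T> F B0 BN BK BE =
     {Vertex_dof x i j | x i j. x \<in> vertices \<T> \<and> i \<le> j} \<union>
     {Face_nn_dof f q | f q. f \<in> faces \<T> \<and> q \<in> B0 f} \<union>
     {Face_tangential_dof f v | f v. f \<in> faces \<T> \<and> v \<in> BN f} \<union>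
     {Element_dof K \<xi> | K \<xi>. K \<in> \<T> \<and> \<xi> \<in> BK K} \<union>
     (\<Union>e\<in>{e\<in>edges \<T>. boundary_edge \<Omega> e}.
        {Edge_nt_dof e q | q. q \<in> BE e} \<union>
        {Edge_nn_dof e i q | i q. i \<in> {1..patch_size \<T> e + 1} \<and> q \<in> BE e}) \<union>
     (\<Union>e\<in>{e\<in>edges \<T>. \<not> boundary_edge \<Omega> e \<and> odd (patch_size \<T> e)}.
        {Edge_nn_dof e i q | i q. i \<in> {1..patch_size \<T> e} \<and> q \<in> BE e}) \<union>
     (\<Union>e\<in>{e\<in>edges \<T>. \<not> boundary_edge \<Omega> e \<and> even (patch_size \<T> e) \<and>
             \<not> singular_edge \<Omega> \<T> e (F e)}.
        {Edge_nt_dof e q | q. q \<in> BE e} \<union>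
        {Edge_nn_dof e i q | i q. i \<in> {2..patch_size \<T> e} \<and> q \<in> BE e}) \<union>
     (\<Union>e\<in>{e\<in>edges \<T>. singular_edge \<Omega> \<T> e (F e)}.
        {Edge_nt_dof e q | q. q \<in> BE e} \<union>
        {Edge_nn_dof e i q | i q. i \<in> {1..4} \<and> q \<in> BE e})"

end

theory Submission
  imports Defs
begin

text \<open>
  Let \<open>F\<close> and \<open>F'\<close> be the two faces of an element \<open>K\<close> at an edge with tangent \<open>t\<close>, with normals \<open>n\<close> and
  \<open>n'\<close>. Since the four vectors \<open>n, n', n \<times> t, n' \<times> t\<close> lie in the plane orthogonal to \<open>t\<close>, on which a
  symmetric matrix has only three entries, the traces of \<open>\<tau>\<close> on the edge satisfy
  \<open>n \<tau> (n \<times> t) + n' \<tau> (n' \<times> t) = \<kappa> (n' \<tau> n' - n \<tau> n)\<close>, where \<open>\<kappa>\<close> is, up to sign and the length of \<open>t\<close>, the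
  cotangent of the dihedral angle. Apart from this relation the vertex values, the face and element
  moments and the edge moments of both components on the four faces are independent on one element:
  they determine the normal traces, hence an element with vanishing data is a combination of bubbles
  and is killed by the moments against linear matrices, and their number is \<open>120 = dim P\<^sub>3(K;S)\<close>.
  Membership in \<open>H(div)\<close> means that the normal traces agree on shared faces. The global problem
  therefore decouples into one linear system per edge and edge test function, with unknowns
  \<open>a\<^sub>i\<close> and \<open>b\<^sub>i\<close> (the two kinds of moments on the face \<open>F\<^sub>i\<close>) and the equations
  \<open>b\<^sub>i + b\<^sub>i\<^sub>+\<^sub>1 = \<kappa>\<^sub>i (a\<^sub>i\<^sub>+\<^sub>1 - a\<^sub>i)\<close>. On a boundary edge these form a path, solved step by step from \<open>b\<^sub>1\<close>;
  on an interior edge they form a cycle, where the parity of \<open>m\<^sub>e\<close> and the values of \<open>\<kappa>\<close> decide which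
  moments are free.
\<close>

text \<open>The dimension of \<open>Sigma_h\<close> is never computed. Once the degrees of freedom
  separate the space and take arbitrary values, their number is the dimension; so a \<tau> has to be
  produced for every assignment of values. On one element this follows from injectivity and a bound
  on the number of moments, which spares a dual basis.

  Eliminating the b's around an edge explains the different lists (e) to (h). The homogeneous
  solution alternates in sign. On an odd cycle it does not close, so the b's follow from the a's. On
  an even cycle it closes: \<open>b 1\<close> is free, and in return the alternating sum of the
  equations constrains the a's alone. There the coefficient of \<open>a 1\<close> is
  \<open>\<kappa> 1 + \<kappa> m\<close>, nonzero by the choice of the labelling. At a singular edge
  the \<kappa> alternate, the sum telescopes to nothing, and all four a's stay free.

  That membership in H(div) forces matching normal traces is seen with test functions concentrating
  at a face: the volume terms vanish in the limit, the jump term stays.\<close>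

section \<open>Dimension counts for linear functionals\<close>

lemma sum_fun_apply: "(\<Sum>i\<in>A. f i) x = (\<Sum>i\<in>A. f i x)"
  for f :: "'i \<Rightarrow> 'a \<Rightarrow> 'b::comm_monoid_add"
  by (induction A rule: infinite_finite_induct) auto

text \<open>An injective linear map from a space of dimension \<open>card I\<close> into one of
  dimension \<open>card D \<le> card I\<close> is onto, so separating functionals that are few
  enough take arbitrary values. Their independence is a consequence, not an input.\<close>

lemma exists_functional_values:
  fixes \<l> :: "'d \<Rightarrow> ('i \<Rightarrow> real) \<Rightarrow> real" and g :: "'d \<Rightarrow> real"
  assumes fin: "finite I" "finite D" and card: "card D \<le> card I"
    and add: "\<And>d f h. d \<in> D \<Longrightarrow> \<l> d (f + h) = \<l> d f + \<l> d h"
    and scale: "\<And>d c f. d \<in> D \<Longrightarrow> \<l> d (scale_fun c f) = c * \<l> d f"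
    and inj: "\<And>f. (\<And>i. i \<notin> I \<Longrightarrow> f i = 0) \<Longrightarrow> (\<And>d. d \<in> D \<Longrightarrow> \<l> d f = 0) \<Longrightarrow> f = 0"
  shows "\<exists>f. (\<forall>i. i \<notin> I \<longrightarrow> f i = 0) \<and> (\<forall>d\<in>D. \<l> d f = g d)"
proof -
  interpret vp: vector_space_pair "scale_fun :: real \<Rightarrow> ('i \<Rightarrow> real) \<Rightarrow> _" "scale_fun :: real \<Rightarrow> ('d \<Rightarrow> real) \<Rightarrow> _"
    by unfold_locales
  define \<Phi> where "\<Phi> = (\<lambda>f d. if d \<in> D then \<l> d f else 0)"
  have lin: "Vector_Spaces.linear scale_fun scale_fun \<Phi>"
    apply unfold_locales apply (simp_all add: \<Phi>_def fun_eq_iff add scale) apply (simp add: scale_fun_def) done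
  define \<delta> where "\<delta> = (\<lambda>(i::'i) j. if j = i then 1 else 0 :: real)"
  define \<epsilon> where "\<epsilon> = (\<lambda>(i::'d) j. if j = i then 1 else 0 :: real)"
  have spanI: "f \<in> fn.span (\<delta> ` I)" if "\<And>i. i \<notin> I \<Longrightarrow> f i = 0" for f
  proof -
    have "f = (\<Sum>i\<in>I. scale_fun (f i) (\<delta> i))"
      using that fin by (auto simp: fun_eq_iff sum_fun_apply scale_fun_def \<delta>_def if_distrib cong: if_cong)
    also have "\<dots> \<in> fn.span (\<delta> ` I)"
      by (intro fn.span_sum fn.span_scale fn.span_base) auto
    finally show ?thesis .
  qed
  have spanD: "f \<in> fn.span (\<epsilon> ` D)" if "\<And>i. i \<notin> D \<Longrightarrow> f i = 0" for f
  proof -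
    have "f = (\<Sum>i\<in>D. scale_fun (f i) (\<epsilon> i))"
      using that fin by (auto simp: fun_eq_iff sum_fun_apply scale_fun_def \<epsilon>_def if_distrib cong: if_cong)
    also have "\<dots> \<in> fn.span (\<epsilon> ` D)"
      by (intro fn.span_sum fn.span_scale fn.span_base) auto
    finally show ?thesis .
  qed
  have spanI': "f i = 0" if "f \<in> fn.span (\<delta> ` I)" "i \<notin> I" for f i
    using that by (induction rule: fn.span_induct_alt) (auto simp: \<delta>_def scale_fun_def split: if_splits)
  have inj\<delta>: "inj_on \<delta> I"
    by (rule inj_onI) (metis \<delta>_def zero_neq_one)
  have ind: "fn.independent (\<delta> ` I)"
  proof -
    have "\<forall>v\<in>\<delta> ` I. u v = 0" if "(\<Sum>v\<in>\<delta> ` I. scale_fun (u v) v) = 0" for u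
    proof (intro ballI, clarify)
      fix i assume "i \<in> I"
      have "0 = (\<Sum>v\<in>\<delta> ` I. scale_fun (u v) v) i" using that by simp
      also have "\<dots> = (\<Sum>j\<in>I. u (\<delta> j) * \<delta> j i)"
        by (simp add: sum.reindex inj\<delta> sum_fun_apply scale_fun_def)
      also have "\<dots> = u (\<delta> i)" using \<open>i \<in> I\<close> fin by (simp add: \<delta>_def if_distrib cong: if_cong)
      finally show "u (\<delta> i) = 0" by simp
    qed
    then show ?thesis using fin by (auto simp: fn.dependent_finite)
  qed
  have injP: "inj_on \<Phi> (fn.span (\<delta> ` I))"
  proof -
    have "x = 0" if "x \<in> fn.span (\<delta> ` I)" "\<Phi> x = 0" for x
      using inj[of x] spanI'[OF that(1)] that(2) by (auto simp: \<Phi>_def fun_eq_iff split: if_splits)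
    then show ?thesis
      using vp.linear_inj_on_iff_eq_0[OF lin fn.subspace_span] by blast
  qed
  let ?B = "\<Phi> ` \<delta> ` I"
  have indB: "fn.independent ?B"
    by (rule vp.linear_independent_injective_image[OF lin ind injP])
  have cardB: "card ?B = card I"
    using inj\<delta> injP by (metis card_image fn.span_superset inj_on_subset)
  define g' where "g' = (\<lambda>d. if d \<in> D then g d else 0)"
  \<comment> \<open>Otherwise \<open>g'\<close> and the \<open>card I\<close> images would be
    independent in a space spanned by at most \<open>card D\<close> vectors.\<close>
  have "g' \<in> fn.span ?B"
  proof (rule ccontr)
    assume n: "g' \<notin> fn.span ?B"
    then have "fn.independent (insert g' ?B)"
      using indB by (simp add: fn.independent_insertI)
    moreover have "insert g' ?B \<subseteq> fn.span (\<epsilon> ` D)"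
      by (auto intro!: spanD simp: g'_def \<Phi>_def)
    ultimately have "card (insert g' ?B) \<le> card (\<epsilon> ` D)"
      using fn.independent_span_bound[of "\<epsilon> ` D"] fin by auto
    moreover have "card (insert g' ?B) = card I + 1"
      using n fn.span_superset[of ?B] cardB fin by (subst card_insert_disjoint) auto
    ultimately show False using card card_image_le[OF fin(2), of \<epsilon>] by linarith
  qed
  then obtain f where f: "f \<in> fn.span (\<delta> ` I)" "g' = \<Phi> f"
    using vp.linear_span_image[OF lin, of "\<delta> ` I"] by auto
  then have "\<forall>d\<in>D. \<l> d f = g d" by (auto simp: g'_def \<Phi>_def fun_eq_iff split: if_splits)
  then show ?thesis using spanI' f(1) by blast
qed

text \<open>Surjectivity supplies a family dual to the functionals, and injectivity makes it span:
  what remains after subtracting the interpolant is annihilated by all functionals. Hence the family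
  is a basis indexed by \<open>D\<close>.\<close>

lemma unisolventI:
  assumes fin: "finite D" and V: "fn.subspace V"
    and add: "\<And>u v d. u \<in> V \<Longrightarrow> v \<in> V \<Longrightarrow> d \<in> D \<Longrightarrow> val (u + v) d = val u d + val v d"
    and scale: "\<And>c v d. v \<in> V \<Longrightarrow> d \<in> D \<Longrightarrow> val (scale_fun c v) d = c * val v d"
    and inj: "\<And>v. v \<in> V \<Longrightarrow> (\<And>d. d \<in> D \<Longrightarrow> val v d = 0) \<Longrightarrow> v = 0"
    and surj: "\<And>g. \<exists>v\<in>V. \<forall>d\<in>D. val v d = g d"
  shows "unisolvent V D val"
proof -
  have ex: "\<exists>v. v \<in> V \<and> (\<forall>d'\<in>D. val v d' = (if d' = d then 1 else 0))" for d
    using surj[of "\<lambda>d'. if d' = d then 1 else 0"] by blast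
  define w where "w d = (SOME v. v \<in> V \<and> (\<forall>d'\<in>D. val v d' = (if d' = d then 1 else 0)))" for d
  have wV: "w d \<in> V" and w: "d' \<in> D \<Longrightarrow> val (w d) d' = (if d' = d then 1 else 0)" for d d'
    using someI_ex[OF ex[of d]] unfolding w_def by auto
  have z: "val 0 d = 0" if "d \<in> D" for d
    using scale[of 0 d 0] that V fn.subspace_0 by (auto simp: scale_fun_def zero_fun_def)
  have vsum: "(\<Sum>i\<in>A. scale_fun (c i) (w i)) \<in> V \<and>
      val (\<Sum>i\<in>A. scale_fun (c i) (w i)) d = (\<Sum>i\<in>A. c i * val (w i) d)"
    if "finite A" "d \<in> D" for A c d
    using that(1)
  proof (induction rule: finite_induct)
    case empty then show ?case using z that fn.subspace_0[OF V] by (auto simp: zero_fun_def)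
  next
    case (insert x F)
    have 1: "scale_fun (c x) (w x) \<in> V" by (intro fn.subspace_scale[OF V] wV)
    note sums = sum.insert[OF insert.hyps, of "\<lambda>i. scale_fun (c i) (w i)"]
    have "val (\<Sum>i\<in>insert x F. scale_fun (c i) (w i)) d = c x * val (w x) d + (\<Sum>i\<in>F. c i * val (w i) d)"
      unfolding sums using insert.IH add[OF 1 _ that(2)] scale[OF wV that(2)] by metis
    moreover have "(\<Sum>i\<in>insert x F. scale_fun (c i) (w i)) \<in> V"
      unfolding sums using insert.IH 1 by (blast intro: fn.subspace_add[OF V])
    ultimately show ?case by (simp only: sum.insert[OF insert.hyps] simp_thms)
  qed
  have inj_w: "inj_on w D"
    by (rule inj_onI) (metis w zero_neq_one)
  have ind: "fn.independent (w ` D)"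
  proof -
    have "\<forall>v\<in>w ` D. u v = 0" if 0: "(\<Sum>v\<in>w ` D. scale_fun (u v) v) = 0" for u
    proof (intro ballI, clarify)
      fix d assume d: "d \<in> D"
      have "0 = val (\<Sum>i\<in>D. scale_fun (u (w i)) (w i)) d"
        using 0 z d by (simp add: sum.reindex inj_w)
      also have "\<dots> = (\<Sum>i\<in>D. u (w i) * val (w i) d)"
        using vsum[OF fin d, of "\<lambda>i. u (w i)"] by simp
      also have "\<dots> = u (w d)" using d fin by (simp add: w if_distrib cong: if_cong)
      finally show "u (w d) = 0" by simp
    qed
    then show ?thesis using fin by (auto simp: fn.dependent_finite)
  qed
  have "v \<in> fn.span (w ` D)" if v: "v \<in> V" for v
  proof -
    let ?s = "\<Sum>i\<in>D. scale_fun (val v i) (w i)"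
    have sV: "?s \<in> V" using V wV by (intro fn.subspace_sum fn.subspace_scale) auto
    have "v + scale_fun (-1) ?s = 0"
    proof (rule inj)
      show "v + scale_fun (-1) ?s \<in> V"
        by (intro fn.subspace_add[OF V] fn.subspace_scale[OF V] v sV)
      fix d assume d: "d \<in> D"
      show "val (v + scale_fun (-1) ?s) d = 0"
        using add[OF v fn.subspace_scale[OF V sV] d, of "- 1"] scale[OF sV d, of "- 1"]
          vsum[OF fin d, of "val v"] fin d
        by (simp only:) (simp add: w if_distrib cong: if_cong)
    qed
    then have "v = ?s" by (auto simp: fun_eq_iff scale_fun_def)
    also have "?s \<in> fn.span (w ` D)"
      by (intro fn.span_sum fn.span_scale fn.span_base) auto
    finally show ?thesis .
  qed
  moreover have "fn.span (w ` D) \<subseteq> V"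
    using V wV by (intro fn.span_minimal) auto
  ultimately have "fn.span (w ` D) = V" by blast
  moreover have "fn.span V = V" using V fn.span_eq_iff by blast
  ultimately have "fn.span (w ` D) = fn.span V" by metis
  then have "fn.dim V = card (w ` D)"
    using ind by (rule fn.dim_eq_card)
  then show ?thesis
    unfolding unisolvent_def using fin inj inj_w by (auto simp: card_image)
qed

section \<open>The recurrence around an edge\<close>

text \<open>The forward solution of the edge equations from \<open>b\<close> at index 1. Labels
  start at 1; the value at 0 is a default.\<close>

primrec loop_seq :: "(nat \<Rightarrow> real) \<Rightarrow> (nat \<Rightarrow> real) \<Rightarrow> real \<Rightarrow> nat \<Rightarrow> real" where
  "loop_seq \<kappa> a b 0 = b"
| "loop_seq \<kappa> a b (Suc i) = (if i = 0 then b else \<kappa> i * (a (Suc i) - a i) - loop_seq \<kappa> a b i)"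

lemma loop_seq_step: "1 \<le> i \<Longrightarrow> loop_seq \<kappa> a b i + loop_seq \<kappa> a b (i + 1) = \<kappa> i * (a (i + 1) - a i)"
  by (cases i) auto

lemma loop_seq_1 [simp]: "loop_seq \<kappa> a b 1 = b" "loop_seq \<kappa> a b (Suc 0) = b" by auto

definition loop_rel :: "nat \<Rightarrow> (nat \<Rightarrow> real) \<Rightarrow> (nat \<Rightarrow> real) \<Rightarrow> (nat \<Rightarrow> real) \<Rightarrow> bool" where
  "loop_rel m \<kappa> a b \<longleftrightarrow> (\<forall>i\<in>{1..m}. b i + b (i + 1) = \<kappa> i * (a (i + 1) - a i))"

lemma loop_rel_seq: "loop_rel m \<kappa> a (loop_seq \<kappa> a b)"
  using loop_seq_step by (auto simp: loop_rel_def simp del: loop_seq.simps)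

text \<open>With vanishing right-hand sides the recurrence reads
  \<open>b (i + 1) = - b i\<close>.\<close>

lemma loop_rel_b:
  assumes "loop_rel m \<kappa> a b" "\<And>i. i \<in> {2..m+1} \<Longrightarrow> \<kappa> (i - 1) * (a i - a (i - 1)) = 0" "i \<in> {1..m+1}"
  shows "b i = (- 1) ^ (i - 1) * b 1"
  using assms(3)
proof (induction i)
  case (Suc i)
  show ?case
  proof (cases "i = 0")
    case False
    then have "b i + b (i + 1) = \<kappa> i * (a (i + 1) - a i)" "\<kappa> i * (a (i + 1) - a i) = 0"
      using assms(1) assms(2)[of "i + 1"] Suc.prems by (auto simp: loop_rel_def)
    then have "b (Suc i) = - b i" by (metis Suc_eq_plus1 add_eq_0_iff)
    also have "\<dots> = (- 1) ^ (Suc i - 1) * b 1" using Suc False by (cases i) auto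
    finally show ?thesis .
  qed auto
qed auto

lemma loop_zero_path:
  assumes "loop_rel m \<kappa> a b" "\<And>i. i \<in> {1..m+1} \<Longrightarrow> a i = 0" "b 1 = 0" "i \<in> {1..m+1}"
  shows "b i = 0"
proof -
  have "b i = (- 1) ^ (i - 1) * b 1"
  proof (rule loop_rel_b[OF assms(1) _ assms(4)])
    fix j assume "j \<in> {2..m + 1}"
    then show "\<kappa> (j - 1) * (a j - a (j - 1)) = 0"
      using assms(2)[of j] assms(2)[of "j - 1"] by fastforce
  qed
  then show ?thesis using assms(3) by simp
qed

text \<open>One turn around an odd cycle changes the sign of \<open>b 1\<close>, while closing the
  cycle preserves it.\<close>

lemma loop_zero_odd:
  assumes "loop_rel m \<kappa> a b" "odd m" "a (m + 1) = a 1" "b (m + 1) = b 1"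
    "\<And>i. i \<in> {1..m} \<Longrightarrow> a i = 0" "i \<in> {1..m+1}"
  shows "b i = 0"
proof -
  have a: "a i = 0" if "i \<in> {1..m+1}" for i
    using that assms(2,3,5) by (cases "i = m + 1") (auto simp: odd_pos Suc_leI)
  have "b (m + 1) = (- 1) ^ (m + 1 - 1) * b 1"
  proof (rule loop_rel_b[OF assms(1)])
    fix j assume "j \<in> {2..m + 1}"
    then show "\<kappa> (j - 1) * (a j - a (j - 1)) = 0"
      using a[of j] a[of "j - 1"] by fastforce
  qed auto
  then have "b (m + 1) = - b 1" using assms(2) by simp
  then have "b 1 = 0" using assms(4) by simp
  then show ?thesis using loop_zero_path[OF assms(1)] a assms(6) by blast
qed

text \<open>The closing condition of an even cycle: alternating summation eliminates all \<open>b\<close>.\<close>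

lemma loop_even_first:
  assumes rel: "loop_rel m \<kappa> a b" and m: "even m" "m \<ge> 2"
    and a: "\<And>i. i \<in> {2..m} \<Longrightarrow> a i = 0" and b1: "b 1 = 0"
  shows "b (m + 1) = \<kappa> m * a (m + 1) + \<kappa> 1 * a 1"
proof -
  have bi: "b i = (- 1) ^ (i - 1) * (\<kappa> 1 * a 1)" if "i \<in> {2..m}" for i
    using that
  proof (induction i)
    case (Suc i)
    have r: "b i + b (i + 1) = \<kappa> i * (a (i + 1) - a i)"
      using rel Suc.prems by (auto simp: loop_rel_def)
    show ?case
    proof (cases "i = 1")
      case True
      then show ?thesis using r a[of 2] b1 m by (simp add: numeral_2_eq_2)
    next
      case False
      then have "i \<in> {2..m}" "Suc i \<in> {2..m}" using Suc.prems by auto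
      then have "b (Suc i) = - b i" using r a by auto
      then show ?thesis using Suc.IH \<open>i \<in> {2..m}\<close> by (cases i) auto
    qed
  qed auto
  have "b m + b (m + 1) = \<kappa> m * (a (m + 1) - a m)"
    using rel m by (auto simp: loop_rel_def)
  moreover have "b m = - (\<kappa> 1 * a 1)" using bi[of m] m by simp
  ultimately show ?thesis using a[of m] m by simp
qed

text \<open>The closing condition reduces to \<open>(\<kappa> 1 + \<kappa> m) * a 1 = 0\<close>;
  then the argument for a path applies.\<close>

lemma loop_zero_even:
  assumes rel: "loop_rel m \<kappa> a b" and m: "even m" "m \<ge> 2"
    and cyc: "a (m + 1) = a 1" "b (m + 1) = b 1" and \<kappa>: "\<kappa> 1 + \<kappa> m \<noteq> 0"
    and a: "\<And>i. i \<in> {2..m} \<Longrightarrow> a i = 0" and b1: "b 1 = 0" and i: "i \<in> {1..m+1}"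
  shows "a i = 0" "b i = 0"
proof -
  have "(\<kappa> 1 + \<kappa> m) * a 1 = 0"
    using loop_even_first[OF rel m a b1] cyc b1 by (simp add: algebra_simps)
  then have "a 1 = 0" using \<kappa> by simp
  then have *: "a i = 0" if "i \<in> {1..m+1}" for i
    using a[of i] that cyc by (cases "i = 1"; cases "i = m + 1") auto
  then show "a i = 0" "b i = 0" using loop_zero_path[OF rel _ b1 i] i by auto
qed

lemma loop_ex_odd:
  assumes "odd m" "a (m + 1) = a (1::nat)"
  shows "\<exists>b. loop_rel m \<kappa> a b \<and> b (m + 1) = b 1"
proof -
  let ?s = "loop_seq \<kappa> a 0"
  \<comment> \<open>Adding \<open>c * (- 1) ^ (i - 1)\<close> changes the closing defect
    \<open>b (m + 1) - b 1\<close> by \<open>- 2 * c\<close> when \<open>m\<close> is odd;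
    \<open>c = ?s (m + 1) / 2\<close> cancels the defect of the solution starting at 0.\<close>
  define b where "b = (\<lambda>i. ?s i + (- 1) ^ (i - 1) * (?s (m + 1) / 2))"
  have "loop_rel m \<kappa> a b"
    using loop_rel_seq[of m \<kappa> a 0] unfolding loop_rel_def b_def
  proof (intro ballI, goal_cases)
    case (1 i)
    then have "(- 1 :: real) ^ (i - 1) + (- 1) ^ (i + 1 - 1) = 0" by (cases i) auto
    then have "(- 1) ^ (i - 1) * (?s (m + 1) / 2) + (- 1) ^ (i + 1 - 1) * (?s (m + 1) / 2) = 0"
      by (metis (no_types) distrib_right mult_zero_left)
    then show ?case using 1 by force
  qed
  moreover have "b (m + 1) = b 1" using assms(1) by (simp add: b_def del: loop_seq.simps(2))
  ultimately show ?thesis by blast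
qed

lemma loop_ex_even:
  fixes a :: "nat \<Rightarrow> real"
  assumes m: "even m" "m \<ge> 2" and \<kappa>: "\<kappa> 1 + \<kappa> m \<noteq> 0"
  shows "\<exists>a' b'. loop_rel m \<kappa> a' b' \<and> a' (m + 1) = a' 1 \<and> b' (m + 1) = b' 1 \<and> b' 1 = b \<and>
    (\<forall>i\<in>{2..m}. a' i = a i)"
proof -
  define a0 where "a0 = (\<lambda>i. if i \<in> {2..m} then a i else 0)"
  let ?s = "loop_seq \<kappa> a0 b"
  \<comment> \<open>By linearity a value \<open>z\<close> for \<open>a 1 = a (m + 1)\<close> shifts
    the closing defect by \<open>(\<kappa> 1 + \<kappa> m) * z\<close>; this \<open>z\<close>
    cancels the defect of \<open>?s\<close>, which was computed with the value 0 there.\<close>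
  define z where "z = (b - ?s (m + 1)) / (\<kappa> 1 + \<kappa> m)"
  define d where "d = (\<lambda>i. if i \<in> {2..m} then 0 else z)"
  let ?t = "loop_seq \<kappa> d 0"
  have t: "?t (m + 1) = b - ?s (m + 1)"
  proof -
    have "?t (m + 1) = (\<kappa> 1 + \<kappa> m) * z"
      using loop_even_first[OF loop_rel_seq m, of d \<kappa> 0] m
      by (simp add: d_def algebra_simps del: loop_seq.simps(2))
    then show ?thesis using \<kappa> by (simp add: z_def del: loop_seq.simps(2))
  qed
  define a' where "a' = (\<lambda>i. a0 i + d i)"
  define b' where "b' = (\<lambda>i. ?s i + ?t i)"
  have "loop_rel m \<kappa> a' b'"
    unfolding loop_rel_def
  proof
    fix i assume "i \<in> {1..m}"
    then have "?s i + ?s (i + 1) = \<kappa> i * (a0 (i + 1) - a0 i)" "?t i + ?t (i + 1) = \<kappa> i * (d (i + 1) - d i)"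
      using loop_seq_step by auto
    then show "b' i + b' (i + 1) = \<kappa> i * (a' (i + 1) - a' i)"
      unfolding a'_def b'_def by (simp add: algebra_simps del: loop_seq.simps)
  qed
  moreover have "a' (m + 1) = a' 1" using m by (simp add: a'_def a0_def d_def)
  moreover have "b' 1 = b" by (simp add: b'_def)
  moreover have "b' (m + 1) = b" using t by (simp add: b'_def del: loop_seq.simps)
  moreover have "\<forall>i\<in>{2..m}. a' i = a i" by (simp add: a'_def a0_def d_def)
  ultimately show ?thesis by blast
qed

text \<open>With alternating \<kappa> the alternating sum of the four equations telescopes around
  the cycle to a multiple of \<open>a 5 - a 1\<close>, so the closing condition holds for every
  choice of the a's and of \<open>b\<close>.\<close>

lemma loop_ex_singular:
  fixes a :: "nat \<Rightarrow> real"
  assumes "\<kappa> 2 = - \<kappa> 1" "\<kappa> 3 = \<kappa> 1" "\<kappa> 4 = - \<kappa> 1" "a 5 = a 1"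
  shows "\<exists>b'. loop_rel 4 \<kappa> a b' \<and> b' 5 = b' 1 \<and> b' 1 = b"
proof (intro exI conjI)
  show "loop_rel 4 \<kappa> a (loop_seq \<kappa> a b)" by (rule loop_rel_seq)
  have s: "loop_seq \<kappa> a b (Suc i) = \<kappa> i * (a (Suc i) - a i) - loop_seq \<kappa> a b i" if "i \<ge> 1" for i
    using that by simp
  have "loop_seq \<kappa> a b 5 = \<kappa> 4 * (a 5 - a 4) - (\<kappa> 3 * (a 4 - a 3) - (\<kappa> 2 * (a 3 - a 2) - (\<kappa> 1 * (a 2 - a 1) - b)))"
    using s[of 4] s[of 3] s[of 2] s[of 1] by (simp del: loop_seq.simps(2) add: eval_nat_numeral)
  then show "loop_seq \<kappa> a b 5 = loop_seq \<kappa> a b 1"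
    using assms by (simp add: algebra_simps del: loop_seq.simps(2))
qed simp

section \<open>Polynomials\<close>

lemma finite_multi_indices [simp]: "finite {\<alpha> :: 3 \<Rightarrow> nat. (\<Sum>i\<in>UNIV. \<alpha> i) \<le> k}"
proof -
  have "{\<alpha> :: 3 \<Rightarrow> nat. (\<Sum>i\<in>UNIV. \<alpha> i) \<le> k} \<subseteq> PiE UNIV (\<lambda>_. {..k})"
  proof
    fix \<alpha> :: "3 \<Rightarrow> nat" assume "\<alpha> \<in> {\<alpha>. (\<Sum>i\<in>UNIV. \<alpha> i) \<le> k}"
    moreover have "\<alpha> i \<le> (\<Sum>i\<in>UNIV. \<alpha> i)" for i by (rule member_le_sum) auto
    ultimately show "\<alpha> \<in> PiE UNIV (\<lambda>_. {..k})" by (auto intro: order_trans)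
  qed
  then show ?thesis by (rule finite_subset) (simp add: finite_PiE)
qed

text \<open>Explicit triples in place of functions on the type \<open>3\<close>, so that sums over
  multi-indices become nested sums that simplification can expand.\<close>

definition triples :: "nat \<Rightarrow> (nat \<times> nat \<times> nat) set" where
  "triples k = {(i, j, l). i + j + l \<le> k}"

lemma finite_triples [simp]: "finite (triples k)"
  by (rule finite_subset[of _ "{..k} \<times> {..k} \<times> {..k}"]) (auto simp: triples_def)

lemma prod_UNIV_3: "(\<Prod>i\<in>(UNIV :: 3 set). f i) = f 1 * f 2 * (f 3 :: 'a::comm_monoid_mult)"
  unfolding UNIV_3 by (simp add: mult.assoc)

lemma fun_3_eta: "(\<lambda>n. if n = 1 then \<alpha> 1 else if n = 2 then \<alpha> 2 else \<alpha> 3) = (\<alpha> :: 3 \<Rightarrow> 'a)"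
  by (simp add: fun_eq_iff forall_3)

lemma mem_triples [simp]: "(i, j, l) \<in> triples k \<longleftrightarrow> i + j + l \<le> k"
  by (simp add: triples_def)

lemma sum_multi_indices:
  fixes g :: "(3 \<Rightarrow> nat) \<Rightarrow> 'b::comm_monoid_add"
  shows "(\<Sum>\<alpha> | (\<Sum>i\<in>UNIV. \<alpha> i) \<le> k. g \<alpha>) =
    (\<Sum>(i, j, l)\<in>triples k. g (\<lambda>n. if n = 1 then i else if n = 2 then j else l))"
proof -
  define e :: "nat \<times> nat \<times> nat \<Rightarrow> 3 \<Rightarrow> nat"
    where "e = (\<lambda>(i, j, l) n. if n = 1 then i else if n = 2 then j else l)"
  have e: "e (\<alpha> 1, \<alpha> 2, \<alpha> 3) = \<alpha>" for \<alpha>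
    by (simp add: e_def fun_3_eta)
  have e': "e t 1 = fst t" "e t 2 = fst (snd t)" "e t 3 = snd (snd t)" for t
    by (simp_all add: e_def case_prod_beta)
  have "(\<Sum>\<alpha> | (\<Sum>i\<in>UNIV. \<alpha> i) \<le> k. g \<alpha>) = (\<Sum>t\<in>triples k. g (e t))"
    by (rule sum.reindex_bij_witness[where j = "\<lambda>\<alpha>. (\<alpha> 1, \<alpha> 2, \<alpha> 3)" and i = e])
      (auto simp: triples_def sum_3 e e')
  then show ?thesis by (simp add: case_prod_beta e_def)
qed

lemma polys_iff:
  "p \<in> polys k \<longleftrightarrow> (\<exists>c. \<forall>x. p x = (\<Sum>(i, j, l)\<in>triples k. ((x$1) ^ i * (x$2) ^ j * (x$3) ^ l) *\<^sub>R c i j l))"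
  (is "_ \<longleftrightarrow> ?R")
proof
  assume "p \<in> polys k"
  then obtain c where "\<forall>x. p x = (\<Sum>\<alpha> | (\<Sum>i\<in>UNIV. \<alpha> i) \<le> k. (\<Prod>i\<in>UNIV. (x$i) ^ \<alpha> i) *\<^sub>R c (\<alpha> :: 3 \<Rightarrow> nat))"
    by (auto simp: polys_def)
  then show ?R
    unfolding sum_multi_indices
    by (intro exI[of _ "\<lambda>i j l. c (\<lambda>n. if n = 1 then i else if n = 2 then j else l)"])
       (simp add: prod_UNIV_3)
next
  assume ?R
  then obtain c where c: "\<forall>x. p x = (\<Sum>(i, j, l)\<in>triples k. ((x$1) ^ i * (x$2) ^ j * (x$3) ^ l) *\<^sub>R c i j l)" by blast
  have "\<forall>x. p x = (\<Sum>\<alpha> | (\<Sum>i\<in>UNIV. \<alpha> i) \<le> k. (\<Prod>i\<in>UNIV. (x$i) ^ \<alpha> i) *\<^sub>R c (\<alpha> 1) (\<alpha> 2) (\<alpha> 3))"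
    unfolding sum_multi_indices using c by (simp add: prod_UNIV_3)
  then show "p \<in> polys k"
    unfolding polys_def by (intro CollectI exI[of _ "\<lambda>\<alpha>. c (\<alpha> 1) (\<alpha> 2) (\<alpha> 3)"])
qed

lemma polys_add [intro]: "p \<in> polys k \<Longrightarrow> q \<in> polys k \<Longrightarrow> (\<lambda>x. p x + q x) \<in> polys k"
proof -
  assume "p \<in> polys k" "q \<in> polys k"
  then obtain c d where "\<forall>x. p x = (\<Sum>(i, j, l)\<in>triples k. ((x$1) ^ i * (x$2) ^ j * (x$3) ^ l) *\<^sub>R c i j l)"
    "\<forall>x. q x = (\<Sum>(i, j, l)\<in>triples k. ((x$1) ^ i * (x$2) ^ j * (x$3) ^ l) *\<^sub>R d i j l)"
    by (auto simp: polys_iff)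
  then show ?thesis
    unfolding polys_iff
    by (intro exI[of _ "\<lambda>i j l. c i j l + d i j l"])
       (simp add: sum.distrib[symmetric] case_prod_beta scaleR_add_right)
qed

lemma polys_linear:
  assumes p: "p \<in> polys k" and L: "linear L"
  shows "(\<lambda>x. L (p x)) \<in> polys k"
proof -
  obtain c where "\<forall>x. p x = (\<Sum>(i, j, l)\<in>triples k. ((x$1) ^ i * (x$2) ^ j * (x$3) ^ l) *\<^sub>R c i j l)"
    using p by (auto simp: polys_iff)
  then show ?thesis
    unfolding polys_iff
    by (intro exI[of _ "\<lambda>i j l. L (c i j l)"])
       (simp add: linear_sum[OF L] case_prod_beta linear_scale[OF L])
qed

lemma polys_scaleR [intro]: "p \<in> polys k \<Longrightarrow> (\<lambda>x. c *\<^sub>R p x) \<in> polys k"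
  by (rule polys_linear[of p k "\<lambda>y. c *\<^sub>R y"]) (auto simp: linear_iff scaleR_add_right)

lemma polys_zero [intro, simp]: "(\<lambda>x. 0) \<in> polys k"
  unfolding polys_iff by (rule exI[of _ "\<lambda>_ _ _. 0"]) simp

lemma polys_const [intro, simp]: "(\<lambda>x. c) \<in> polys k"
proof -
  have "(\<Sum>(i, j, l)\<in>triples k. ((x$1) ^ i * (x$2) ^ j * (x$3) ^ l) *\<^sub>R (if (i, j, l) = (0, 0, 0) then c else 0)) = c"
    for x :: "real^3"
  proof -
    have "(\<Sum>(i, j, l)\<in>triples k. ((x$1) ^ i * (x$2) ^ j * (x$3) ^ l) *\<^sub>R (if (i, j, l) = (0, 0, 0) then c else 0)) =
      (\<Sum>t\<in>triples k. if t = (0, 0, 0) then c else 0)"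
      by (rule sum.cong) (auto split: if_splits)
    also have "\<dots> = c" by simp
    finally show ?thesis .
  qed
  then show ?thesis
    unfolding polys_iff by (intro exI[of _ "\<lambda>i j l. if (i, j, l) = (0, 0, 0) then c else 0"]) simp
qed

lemma polys_sum [intro]: "(\<And>i. i \<in> I \<Longrightarrow> f i \<in> polys k) \<Longrightarrow> (\<lambda>x. \<Sum>i\<in>I. f i x) \<in> polys k"
  by (induction I rule: infinite_finite_induct) (auto intro: polys_add)

lemma polys_minus [intro]: "p \<in> polys k \<Longrightarrow> (\<lambda>x. - p x) \<in> polys k"
  using polys_scaleR[of p k "-1"] by simp

lemma polys_diff [intro]: "p \<in> polys k \<Longrightarrow> q \<in> polys k \<Longrightarrow> (\<lambda>x. p x - q x) \<in> polys k"
  using polys_add[OF _ polys_minus] by simp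

lemma polys_mono: "p \<in> polys k \<Longrightarrow> k \<le> m \<Longrightarrow> p \<in> polys m"
proof -
  assume p: "p \<in> polys k" and "k \<le> m"
  then obtain c where c: "\<forall>x. p x = (\<Sum>(i, j, l)\<in>triples k. ((x$1) ^ i * (x$2) ^ j * (x$3) ^ l) *\<^sub>R c i j l)"
    using p by (auto simp: polys_iff)
  have "p x = (\<Sum>(i, j, l)\<in>triples m. ((x$1) ^ i * (x$2) ^ j * (x$3) ^ l) *\<^sub>R (if i + j + l \<le> k then c i j l else 0))" for x
    unfolding c[rule_format]
    by (rule sum.mono_neutral_cong_left) (use \<open>k \<le> m\<close> in \<open>auto split: if_splits\<close>)
  then show ?thesis
    unfolding polys_iff by (intro exI[of _ "\<lambda>i j l. if i + j + l \<le> k then c i j l else 0"]) simp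
qed

lemma polys_coord:
  assumes p: "p \<in> polys k"
  shows "(\<lambda>x. (x$n) *\<^sub>R p x) \<in> polys (Suc k)"
proof -
  obtain c where c: "\<forall>x. p x = (\<Sum>(i, j, l)\<in>triples k. ((x$1) ^ i * (x$2) ^ j * (x$3) ^ l) *\<^sub>R c i j l)"
    using p by (auto simp: polys_iff)
  consider "n = 1" | "n = 2" | "n = 3" using exhaust_3 by blast
  then show ?thesis
  proof cases
    case 1
    \<comment> \<open>Shifts the first exponent. Target monomials with exponent 0 have no source and
      get coefficient 0, so \<open>i - 1\<close> is never truncated.\<close>
    have "(x$n) *\<^sub>R p x = (\<Sum>(i, j, l)\<in>triples (Suc k). ((x$1) ^ i * (x$2) ^ j * (x$3) ^ l) *\<^sub>R
        (if i = 0 then 0 else c (i - 1) j l))" for x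
      unfolding c[rule_format] scaleR_sum_right case_prod_beta
      by (rule sum.reindex_bij_witness_not_neutral[where S' = "{}" and T' = "{t\<in>triples (Suc k). fst t = 0}" and
         j = "\<lambda>t. (Suc (fst t), snd t)" and i = "\<lambda>t. (fst t - 1, snd t)"])
        (auto simp: 1 power_eq_if split: if_splits)
    then show ?thesis unfolding polys_iff by (intro exI[of _ "\<lambda>i j l. if i = 0 then 0 else c (i - 1) j l"]) simp
  next
    case 2
    have "(x$n) *\<^sub>R p x = (\<Sum>(i, j, l)\<in>triples (Suc k). ((x$1) ^ i * (x$2) ^ j * (x$3) ^ l) *\<^sub>R
        (if j = 0 then 0 else c i (j - 1) l))" for x
      unfolding c[rule_format] scaleR_sum_right case_prod_beta
      by (rule sum.reindex_bij_witness_not_neutral[where S' = "{}" and T' = "{t\<in>triples (Suc k). fst (snd t) = 0}" and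
         j = "\<lambda>t. (fst t, Suc (fst (snd t)), snd (snd t))" and i = "\<lambda>t. (fst t, fst (snd t) - 1, snd (snd t))"])
        (auto simp: 2 power_eq_if mult_ac split: if_splits)
    then show ?thesis unfolding polys_iff by (intro exI[of _ "\<lambda>i j l. if j = 0 then 0 else c i (j - 1) l"]) simp
  next
    case 3
    have "(x$n) *\<^sub>R p x = (\<Sum>(i, j, l)\<in>triples (Suc k). ((x$1) ^ i * (x$2) ^ j * (x$3) ^ l) *\<^sub>R
        (if l = 0 then 0 else c i j (l - 1)))" for x
      unfolding c[rule_format] scaleR_sum_right case_prod_beta
      by (rule sum.reindex_bij_witness_not_neutral[where S' = "{}" and T' = "{t\<in>triples (Suc k). snd (snd t) = 0}" and
         j = "\<lambda>t. (fst t, fst (snd t), Suc (snd (snd t)))" and i = "\<lambda>t. (fst t, fst (snd t), snd (snd t) - 1)"])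
        (auto simp: 3 power_eq_if mult_ac split: if_splits)
    then show ?thesis unfolding polys_iff by (intro exI[of _ "\<lambda>i j l. if l = 0 then 0 else c i j (l - 1)"]) simp
  qed
qed

lemma polys_affine_mult:
  assumes p: "p \<in> polys k"
  shows "(\<lambda>x. (c + g \<bullet> x) *\<^sub>R p x) \<in> polys (Suc k)"
proof -
  have "(\<lambda>x. c *\<^sub>R p x + (\<Sum>n\<in>UNIV. (g$n) *\<^sub>R ((x$n) *\<^sub>R p x))) \<in> polys (Suc k)"
    by (intro polys_add polys_sum polys_scaleR polys_coord p polys_mono[OF p]) auto
  then show ?thesis
    by (simp add: inner_vec_def scaleR_add_left scaleR_sum_left)
qed

lemma polys_affine_power_mult:
  assumes p: "p \<in> polys k"
  shows "(\<lambda>x. (c + g \<bullet> x) ^ n *\<^sub>R p x) \<in> polys (n + k)"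
proof (induction n)
  case (Suc n)
  then show ?case using polys_affine_mult[OF Suc, of c g] by simp
qed (use p in simp)

text \<open>Every coordinate of the argument is affine in \<open>x\<close>, so a monomial of degree
  at most \<open>k\<close> becomes a product of at most \<open>k\<close> affine factors. The
  directions may be dependent or zero, which covers restrictions to planes.\<close>

lemma polys_compose_affine:
  assumes p: "p \<in> polys k"
  shows "(\<lambda>x. p (x0 + x$1 *\<^sub>R u + x$2 *\<^sub>R v + x$3 *\<^sub>R w)) \<in> polys k"
proof -
  obtain c where c: "\<forall>x. p x = (\<Sum>(i, j, l)\<in>triples k. ((x$1) ^ i * (x$2) ^ j * (x$3) ^ l) *\<^sub>R c i j l)"
    using p by (auto simp: polys_iff)
  define g :: "3 \<Rightarrow> real^3" where "g n = vector [u$n, v$n, w$n]" for n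
  have g: "(x0 + x$1 *\<^sub>R u + x$2 *\<^sub>R v + x$3 *\<^sub>R w) $ n = x0$n + g n \<bullet> x" for x :: "real^3" and n
    by (simp add: g_def inner_vec_def sum_3 vector_3 algebra_simps)
  have m: "(\<lambda>x. ((x0$1 + g 1 \<bullet> x) ^ i * (x0$2 + g 2 \<bullet> x) ^ j * (x0$3 + g 3 \<bullet> x) ^ l) *\<^sub>R c i j l) \<in> polys k"
    if "(i, j, l) \<in> triples k" for i j l
  proof -
    have "(\<lambda>x. (x0$1 + g 1 \<bullet> x) ^ i *\<^sub>R ((x0$2 + g 2 \<bullet> x) ^ j *\<^sub>R ((x0$3 + g 3 \<bullet> x) ^ l *\<^sub>R c i j l))) \<in> polys (i + (j + (l + 0)))"
      by (intro polys_affine_power_mult polys_const)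
    then have "(\<lambda>x. (x0$1 + g 1 \<bullet> x) ^ i *\<^sub>R ((x0$2 + g 2 \<bullet> x) ^ j *\<^sub>R ((x0$3 + g 3 \<bullet> x) ^ l *\<^sub>R c i j l))) \<in> polys k"
      by (rule polys_mono) (use that in \<open>auto simp: triples_def\<close>)
    then show ?thesis by (simp add: mult.assoc)
  qed
  have "(\<lambda>x. \<Sum>t\<in>triples k. (case t of (i, j, l) \<Rightarrow> ((x0$1 + g 1 \<bullet> x) ^ i * (x0$2 + g 2 \<bullet> x) ^ j * (x0$3 + g 3 \<bullet> x) ^ l) *\<^sub>R c i j l)) \<in> polys k"
    by (rule polys_sum) (use m in auto)
  then show ?thesis unfolding c[rule_format] g by simp
qed

lemma polys_affine: "(\<lambda>x. c + g \<bullet> x) \<in> polys 1"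
  using polys_affine_mult[of "\<lambda>_. 1 :: real" 0 c g] by simp

lemma polys_mult:
  assumes f: "f \<in> polys j" and p: "p \<in> polys k"
  shows "(\<lambda>x. f x *\<^sub>R p x) \<in> polys (j + k)"
proof -
  obtain c where c: "\<forall>x. f x = (\<Sum>(i, j, l)\<in>triples j. ((x$1) ^ i * (x$2) ^ j * (x$3) ^ l) *\<^sub>R c i j l)"
    using f by (auto simp: polys_iff)
  have m: "(\<lambda>x. ((x$1) ^ i * (x$2) ^ j' * (x$3) ^ l) *\<^sub>R p x) \<in> polys (j + k)" if "(i, j', l) \<in> triples j" for i j' l
  proof -
    have "(\<lambda>x. (0 + axis 1 1 \<bullet> x) ^ i *\<^sub>R ((0 + axis 2 1 \<bullet> x) ^ j' *\<^sub>R ((0 + axis 3 1 \<bullet> x) ^ l *\<^sub>R p x))) \<in> polys (i + (j' + (l + k)))"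
      by (intro polys_affine_power_mult p)
    then have "(\<lambda>x. (0 + axis 1 1 \<bullet> x) ^ i *\<^sub>R ((0 + axis 2 1 \<bullet> x) ^ j' *\<^sub>R ((0 + axis 3 1 \<bullet> x) ^ l *\<^sub>R p x))) \<in> polys (j + k)"
      by (rule polys_mono) (use that in \<open>auto simp: triples_def\<close>)
    then show ?thesis by (simp add: mult.assoc inner_axis')
  qed
  have "(\<lambda>x. \<Sum>t\<in>triples j. case t of (i, j', l) \<Rightarrow> c i j' l *\<^sub>R (((x$1) ^ i * (x$2) ^ j' * (x$3) ^ l) *\<^sub>R p x)) \<in> polys (j + k)"
    by (rule polys_sum) (auto split: prod.splits simp del: scaleR_scaleR intro!: polys_scaleR m)
  then show ?thesis
    unfolding c[rule_format] scaleR_sum_left by (simp add: case_prod_beta mult_ac)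
qed

lemma sum_triples:
  "(\<Sum>(i, j, l)\<in>triples k. g i j l) = (\<Sum>i\<le>k. \<Sum>j\<le>k - i. \<Sum>l\<le>k - i - j. g i j l)"
proof -
  have "triples k = (SIGMA i:{..k}. SIGMA j:{..k - i}. {..k - i - j})"
    by (auto simp: triples_def)
  then show ?thesis by (simp add: sum.Sigma)
qed

lemma polys_continuous: "p \<in> polys k \<Longrightarrow> continuous_on S (p :: real^3 \<Rightarrow> 'b::real_normed_vector)"
proof -
  assume "p \<in> polys k"
  then obtain c where "p = (\<lambda>x. \<Sum>t\<in>triples k. ((x$1) ^ fst t * (x$2) ^ fst (snd t) * (x$3) ^ snd (snd t)) *\<^sub>R c (fst t) (fst (snd t)) (snd (snd t)))"
    by (auto simp: polys_iff fun_eq_iff case_prod_beta)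
  then show ?thesis by (auto intro!: continuous_intros)
qed

section \<open>Continuously differentiable maps\<close>

text \<open>The unfolding of \<open>C_k (Suc 0)\<close> with arbitrary source and target, so that
  test functions, polynomials and their products are treated alike.\<close>

definition C1_map :: "('a::real_normed_vector \<Rightarrow> 'b::real_normed_vector) \<Rightarrow> bool" where
  "C1_map f \<longleftrightarrow> (\<exists>f'. (\<forall>x. (f has_derivative f' x) (at x)) \<and> (\<forall>v. continuous_on UNIV (\<lambda>x. f' x v)))"

lemma C1_map_bounded_linear: "bounded_linear f \<Longrightarrow> C1_map f"
  unfolding C1_map_def by (rule exI[of _ "\<lambda>_. f"]) (auto intro: bounded_linear_imp_has_derivative)

lemma C1_map_const: "C1_map (\<lambda>x. c)"
  unfolding C1_map_def by (rule exI[of _ "\<lambda>_ _. 0"]) auto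

lemma C1_map_continuous: "C1_map f \<Longrightarrow> continuous_on S f"
  unfolding C1_map_def
  by (meson continuous_on_subset has_derivative_continuous_on subset_UNIV)

lemma C1_map_add: "C1_map f \<Longrightarrow> C1_map g \<Longrightarrow> C1_map (\<lambda>x. f x + g x)"
  unfolding C1_map_def
proof (elim exE conjE)
  fix f' g' assume "\<forall>x. (f has_derivative f' x) (at x)" "\<forall>v. continuous_on UNIV (\<lambda>x. f' x v)"
    "\<forall>x. (g has_derivative g' x) (at x)" "\<forall>v. continuous_on UNIV (\<lambda>x. g' x v)"
  then show "\<exists>h'. (\<forall>x. ((\<lambda>x. f x + g x) has_derivative h' x) (at x)) \<and> (\<forall>v. continuous_on UNIV (\<lambda>x. h' x v))"
    by (intro exI[of _ "\<lambda>x v. f' x v + g' x v"]) (auto intro!: derivative_eq_intros continuous_intros)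
qed

lemma C1_map_scaleR: "C1_map f \<Longrightarrow> C1_map g \<Longrightarrow> C1_map (\<lambda>x. f x *\<^sub>R g x)"
proof -
  assume a: "C1_map f" "C1_map g"
  note c = C1_map_continuous[OF a(1)] C1_map_continuous[OF a(2)]
  from a show ?thesis
    unfolding C1_map_def
  proof (elim exE conjE)
    fix f' g' assume "\<forall>x. (f has_derivative f' x) (at x)" "\<forall>v. continuous_on UNIV (\<lambda>x. f' x v)"
      "\<forall>x. (g has_derivative g' x) (at x)" "\<forall>v. continuous_on UNIV (\<lambda>x. g' x v)"
    then show "\<exists>h'. (\<forall>x. ((\<lambda>x. f x *\<^sub>R g x) has_derivative h' x) (at x)) \<and> (\<forall>v. continuous_on UNIV (\<lambda>x. h' x v))"
      by (intro exI[of _ "\<lambda>x v. f x *\<^sub>R g' x v + f' x v *\<^sub>R g x"]) (auto intro!: derivative_eq_intros continuous_intros c)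
  qed
qed

lemma C1_map_linear_comp: "C1_map f \<Longrightarrow> bounded_linear L \<Longrightarrow> C1_map (\<lambda>x. L (f x))"
  unfolding C1_map_def
proof (elim exE conjE)
  fix f' assume "\<forall>x. (f has_derivative f' x) (at x)" "\<forall>v. continuous_on UNIV (\<lambda>x. f' x v)" and L: "bounded_linear L"
  then show "\<exists>h'. (\<forall>x. ((\<lambda>x. L (f x)) has_derivative h' x) (at x)) \<and> (\<forall>v. continuous_on UNIV (\<lambda>x. h' x v))"
    by (intro exI[of _ "\<lambda>x v. L (f' x v)"]) (auto intro!: bounded_linear.has_derivative[OF L] bounded_linear.continuous_on[OF L])
qed

lemma C1_map_sum: "(\<And>i. i \<in> I \<Longrightarrow> C1_map (f i)) \<Longrightarrow> C1_map (\<lambda>x. \<Sum>i\<in>I. f i x)"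
  by (induction I rule: infinite_finite_induct) (auto intro: C1_map_const C1_map_add)

lemma C1_map_power: "C1_map f \<Longrightarrow> C1_map (\<lambda>x. f x ^ n :: real)"
  by (induction n) (auto intro: C1_map_const dest: C1_map_scaleR simp: real_scaleR_def)

lemma polys_C1: "p \<in> polys k \<Longrightarrow> C1_map (p :: real^3 \<Rightarrow> 'b::real_normed_vector)"
proof -
  assume "p \<in> polys k"
  then obtain c where "p = (\<lambda>x. \<Sum>t\<in>triples k. (x$1) ^ fst t *\<^sub>R ((x$2) ^ fst (snd t) *\<^sub>R ((x$3) ^ snd (snd t) *\<^sub>R c (fst t) (fst (snd t)) (snd (snd t)))))"
    by (auto simp: polys_iff fun_eq_iff case_prod_beta mult.assoc)
  moreover have "C1_map (\<lambda>x. (x$1) ^ i *\<^sub>R ((x$2) ^ j *\<^sub>R ((x$3) ^ l *\<^sub>R d)))" for i j l and d :: 'b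
    by (intro C1_map_scaleR C1_map_power C1_map_const C1_map_bounded_linear[OF bounded_linear_vec_nth])
  ultimately show ?thesis
    by (auto intro!: C1_map_sum simp del: scaleR_scaleR)
qed

section \<open>Integrals over triangles, faces and edges\<close>

definition simplex2 :: "(real^2) set" where
  "simplex2 = {u. 0 \<le> u$1 \<and> 0 \<le> u$2 \<and> u$1 + u$2 \<le> 1}"

definition simplex3 :: "(real^3) set" where
  "simplex3 = {u. 0 \<le> u$1 \<and> 0 \<le> u$2 \<and> 0 \<le> u$3 \<and> u$1 + u$2 + u$3 \<le> 1}"

lemma compact_simplex2: "compact simplex2"
proof -
  have "closed simplex2"
    unfolding simplex2_def by (intro closed_Collect_conj closed_Collect_le continuous_intros)
  moreover have "simplex2 \<subseteq> cbox 0 1"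
    by (auto simp: simplex2_def mem_box_cart forall_2)
  ultimately show ?thesis
    using compact_eq_bounded_closed bounded_subset bounded_cbox by blast
qed

lemma compact_simplex3: "compact simplex3"
proof -
  have "closed simplex3"
    unfolding simplex3_def by (intro closed_Collect_conj closed_Collect_le continuous_intros)
  moreover have "simplex3 \<subseteq> cbox 0 1"
    by (auto simp: simplex3_def mem_box_cart forall_3)
  ultimately show ?thesis
    using compact_eq_bounded_closed bounded_subset bounded_cbox by blast
qed

lemma prod_Basis_cart: "(\<Prod>b\<in>Basis. (x :: real^'n) \<bullet> b) = (\<Prod>i\<in>UNIV. x $ i)"
proof -
  have "(Basis :: (real^'n) set) = range (\<lambda>i. axis i 1)"
    by (auto simp: Basis_vec_def)
  then have "(\<Prod>b\<in>Basis. x \<bullet> b) = (\<Prod>b\<in>range (\<lambda>i. axis i 1). x \<bullet> b)" by metis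
  also have "\<dots> = (\<Prod>i\<in>UNIV. x $ i)"
    by (subst prod.reindex) (auto simp: inj_on_def axis_eq_axis inner_axis)
  finally show ?thesis .
qed

lemma prod_UNIV_2: "(\<Prod>i\<in>(UNIV :: 2 set). f i) = f 1 * (f 2 :: 'a::comm_monoid_mult)"
  unfolding UNIV_2 by simp

text \<open>Agreement on boxes identifies Lebesgue measure on \<open>real^2\<close> with a product
  measure, to which Fubini's theorem applies.\<close>

lemma lborel_vec2:
  "(lborel :: (real^2) measure) = distr (lborel \<Otimes>\<^sub>M lborel) borel (\<lambda>(s, r). s *\<^sub>R axis 1 1 + r *\<^sub>R axis 2 1)"
  (is "_ = distr _ _ ?\<psi>")
proof (rule lborel_eqI)
  fix l u :: "real^2" assume "\<And>b. b \<in> Basis \<Longrightarrow> l \<bullet> b \<le> u \<bullet> b"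
  then have le: "l$i \<le> u$i" for i
    by (metis axis_in_Basis_iff inner_axis inner_real_def mult.right_neutral Basis_real_def insertI1)
  have "emeasure (distr (lborel \<Otimes>\<^sub>M lborel) borel ?\<psi>) (box l u) =
      emeasure (lborel \<Otimes>\<^sub>M lborel) (?\<psi> -` box l u \<inter> space (lborel \<Otimes>\<^sub>M lborel))"
    by (rule emeasure_distr) (auto simp: case_prod_beta)
  also have "?\<psi> -` box l u \<inter> space (lborel \<Otimes>\<^sub>M lborel) = box (l$1) (u$1) \<times> box (l$2) (u$2)"
    by (auto simp: mem_box_cart forall_2 space_pair_measure axis_def)
  also have "emeasure (lborel \<Otimes>\<^sub>M lborel) (box (l$1) (u$1) \<times> box (l$2) (u$2)) = ennreal ((u$1 - l$1) * (u$2 - l$2))"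
    by (subst lborel.emeasure_pair_measure_Times) (auto simp: le ennreal_mult)
  also have "(u$1 - l$1) * (u$2 - l$2) = (\<Prod>b\<in>Basis. (u - l) \<bullet> b)"
    unfolding prod_Basis_cart by (simp add: prod_UNIV_2)
  finally show "emeasure (distr (lborel \<Otimes>\<^sub>M lborel) borel ?\<psi>) (box l u) = ennreal (\<Prod>b\<in>Basis. (u - l) \<bullet> b)" .
qed auto

lemma lborel_vec3_measurable:
  "(\<lambda>(u :: real^2, t :: real). t *\<^sub>R axis 1 1 + u$1 *\<^sub>R axis 2 1 + u$2 *\<^sub>R axis 3 1 :: real^3) \<in> lborel \<Otimes>\<^sub>M lborel \<rightarrow>\<^sub>M borel"
  unfolding lborel_prod measurable_lborel2 case_prod_beta
  by (intro borel_measurable_continuous_onI continuous_intros)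

text \<open>The first coordinate is split off as the second factor: the inner integral of
  \<open>lint_simplex3_iterated\<close> runs in this direction, and a derivative is integrated along
  it in \<open>tet_directional_integral\<close>.\<close>

lemma lborel_vec3:
  "(lborel :: (real^3) measure) = distr (lborel \<Otimes>\<^sub>M lborel) borel
     (\<lambda>(u :: real^2, t :: real). t *\<^sub>R axis 1 1 + u$1 *\<^sub>R axis 2 1 + u$2 *\<^sub>R axis 3 1)"
  (is "_ = distr _ _ ?\<psi>")
proof (rule lborel_eqI)
  fix l u :: "real^3" assume "\<And>b. b \<in> Basis \<Longrightarrow> l \<bullet> b \<le> u \<bullet> b"
  then have le: "l$i \<le> u$i" for i
    by (metis axis_in_Basis_iff inner_axis inner_real_def mult.right_neutral Basis_real_def insertI1)
  define l' u' :: "real^2" where "l' = vector [l$2, l$3]" and "u' = vector [u$2, u$3]"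
  have le': "b \<in> Basis \<Longrightarrow> l' \<bullet> b \<le> u' \<bullet> b" for b
  proof -
    assume "b \<in> Basis"
    then obtain i :: 2 where b: "b = axis i 1" by (auto simp: Basis_vec_def)
    show ?thesis using exhaust_2[of i] le by (auto simp: b inner_axis l'_def u'_def vector_2)
  qed
  have "emeasure (distr (lborel \<Otimes>\<^sub>M lborel) borel ?\<psi>) (box l u) =
      emeasure (lborel \<Otimes>\<^sub>M lborel) (?\<psi> -` box l u \<inter> space (lborel \<Otimes>\<^sub>M lborel))"
    by (rule emeasure_distr[OF lborel_vec3_measurable]) auto
  also have "?\<psi> -` box l u \<inter> space (lborel \<Otimes>\<^sub>M lborel) = box l' u' \<times> box (l$1) (u$1)"
    by (auto simp: mem_box_cart forall_2 forall_3 space_pair_measure axis_def l'_def u'_def vector_2)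
  also have "emeasure (lborel \<Otimes>\<^sub>M lborel) (box l' u' \<times> box (l$1) (u$1)) = ennreal ((u$2 - l$2) * (u$3 - l$3) * (u$1 - l$1))"
  proof -
    have "emeasure lborel (box l' u') = ennreal ((u$2 - l$2) * (u$3 - l$3))"
      by (subst emeasure_lborel_box[OF le'], assumption) (simp add: prod_Basis_cart prod_UNIV_2 l'_def u'_def vector_2)
    moreover have "emeasure lborel (box (l$1) (u$1)) = ennreal (u$1 - l$1)" using le by simp
    ultimately show ?thesis
      by (subst lborel.emeasure_pair_measure_Times) (auto simp: le ennreal_mult)
  qed
  also have "(u$2 - l$2) * (u$3 - l$3) * (u$1 - l$1) = (\<Prod>b\<in>Basis. (u - l) \<bullet> b)"
    unfolding prod_Basis_cart by (simp add: prod_UNIV_3)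
  finally show "emeasure (distr (lborel \<Otimes>\<^sub>M lborel) borel ?\<psi>) (box l u) = ennreal (\<Prod>b\<in>Basis. (u - l) \<bullet> b)" .
qed auto

lemma lborel_vec2_measurable:
  "(\<lambda>(s :: real, r :: real). s *\<^sub>R axis 1 1 + r *\<^sub>R axis 2 1 :: real^2) \<in> lborel \<Otimes>\<^sub>M lborel \<rightarrow>\<^sub>M borel"
  by (auto simp: case_prod_beta)

lemma set_integrable_compact:
  fixes f :: "'a::euclidean_space \<Rightarrow> 'b::{banach, second_countable_topology}"
  assumes "compact S" "continuous_on S f"
  shows "set_integrable lborel S f" "set_integrable lebesgue S f"
    "(LINT x:S|lebesgue. f x) = (LINT x:S|lborel. f x)"
proof -
  have i: "integrable lborel (\<lambda>x. indicator S x *\<^sub>R f x)"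
    by (rule borel_integrable_compact[OF assms])
  then show "set_integrable lborel S f" "set_integrable lebesgue S f"
    by (auto simp: set_integrable_def integrable_completion)
  show "(LINT x:S|lebesgue. f x) = (LINT x:S|lborel. f x)"
    using i unfolding set_lebesgue_integral_def by (intro integral_completion) auto
qed

lemma lint_simplex2_iterated:
  fixes f :: "real^2 \<Rightarrow> real"
  assumes f: "continuous_on UNIV f"
  shows "(LINT u:simplex2|lborel. f u) =
    (LINT s:{0..1}|lborel. (LINT r:{0..1 - s}|lborel. f (s *\<^sub>R axis 1 1 + r *\<^sub>R axis 2 1)))"
proof -
  let ?\<psi> = "\<lambda>(s :: real, r :: real). s *\<^sub>R axis 1 1 + r *\<^sub>R axis 2 1 :: real^2"
  let ?h = "\<lambda>u. indicator simplex2 u *\<^sub>R f u"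
  have i: "integrable lborel ?h"
    by (rule borel_integrable_compact[OF compact_simplex2]) (rule continuous_on_subset[OF f], simp)
  then have i': "integrable (distr (lborel \<Otimes>\<^sub>M lborel) borel ?\<psi>) ?h"
    unfolding lborel_vec2[symmetric] .
  have ip: "integrable (lborel \<Otimes>\<^sub>M lborel) (\<lambda>p. ?h (?\<psi> p))"
    using integrable_distr[OF lborel_vec2_measurable i'] .
  have "(LINT u:simplex2|lborel. f u) = integral\<^sup>L (distr (lborel \<Otimes>\<^sub>M lborel) borel ?\<psi>) ?h"
    unfolding set_lebesgue_integral_def lborel_vec2[symmetric] ..
  also have "\<dots> = integral\<^sup>L (lborel \<Otimes>\<^sub>M lborel) (\<lambda>p. ?h (?\<psi> p))"
    using borel_measurable_integrable[OF i'] by (intro integral_distr lborel_vec2_measurable) auto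
  also have "\<dots> = (LINT s|lborel. LINT r|lborel. ?h (?\<psi> (s, r)))"
    using lborel_pair.integral_fst'[OF ip] by simp
  also have "\<dots> = (LINT s:{0..1}|lborel. (LINT r:{0..1 - s}|lborel. f (s *\<^sub>R axis 1 1 + r *\<^sub>R axis 2 1)))"
    unfolding set_lebesgue_integral_def
  proof (rule Bochner_Integration.integral_cong[OF refl])
    fix s :: real
    have "(LINT r|lborel. ?h (?\<psi> (s, r))) =
      (LINT r|lborel. indicator {0..1} s *\<^sub>R (indicator {0..1 - s} r *\<^sub>R f (s *\<^sub>R axis 1 1 + r *\<^sub>R axis 2 1)))"
      by (rule Bochner_Integration.integral_cong) (auto simp: simplex2_def axis_def indicator_def)
    then show "(LINT r|lborel. ?h (?\<psi> (s, r))) = indicat_real {0..1} s *\<^sub>R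
      (LINT r|lborel. indicat_real {0..1 - s} r *\<^sub>R f (s *\<^sub>R axis 1 1 + r *\<^sub>R axis 2 1))"
      by simp
  qed
  finally show ?thesis .
qed

lemma lint_simplex3_iterated:
  fixes f :: "real^3 \<Rightarrow> real"
  assumes f: "continuous_on UNIV f"
  shows "(LINT x:simplex3|lborel. f x) =
    (LINT u:simplex2|lborel. (LINT t:{0..1 - u$1 - u$2}|lborel. f (t *\<^sub>R axis 1 1 + u$1 *\<^sub>R axis 2 1 + u$2 *\<^sub>R axis 3 1)))"
proof -
  let ?\<psi> = "\<lambda>(u :: real^2, t :: real). t *\<^sub>R axis 1 1 + u$1 *\<^sub>R axis 2 1 + u$2 *\<^sub>R axis 3 1 :: real^3"
  let ?h = "\<lambda>u. indicator simplex3 u *\<^sub>R f u"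
  note m = lborel_vec3_measurable
  have i: "integrable lborel ?h"
    by (rule borel_integrable_compact[OF compact_simplex3]) (rule continuous_on_subset[OF f], simp)
  then have i': "integrable (distr (lborel \<Otimes>\<^sub>M lborel) borel ?\<psi>) ?h"
    unfolding lborel_vec3[symmetric] .
  have ip: "integrable (lborel \<Otimes>\<^sub>M lborel) (\<lambda>p. ?h (?\<psi> p))"
    using integrable_distr[OF m i'] .
  have "(LINT u:simplex3|lborel. f u) = integral\<^sup>L (distr (lborel \<Otimes>\<^sub>M lborel) borel ?\<psi>) ?h"
    unfolding set_lebesgue_integral_def lborel_vec3[symmetric] ..
  also have "\<dots> = integral\<^sup>L (lborel \<Otimes>\<^sub>M lborel) (\<lambda>p. ?h (?\<psi> p))"
    using borel_measurable_integrable[OF i'] by (intro integral_distr m) auto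
  also have "\<dots> = (LINT u|lborel. LINT t|lborel. ?h (?\<psi> (u, t)))"
    using lborel_pair.integral_fst'[OF ip] by simp
  also have "\<dots> = (LINT u:simplex2|lborel. (LINT t:{0..1 - u$1 - u$2}|lborel. f (t *\<^sub>R axis 1 1 + u$1 *\<^sub>R axis 2 1 + u$2 *\<^sub>R axis 3 1)))"
    unfolding set_lebesgue_integral_def
  proof (rule Bochner_Integration.integral_cong[OF refl])
    fix u :: "real^2"
    have "(LINT t|lborel. ?h (?\<psi> (u, t))) =
      (LINT t|lborel. indicator simplex2 u *\<^sub>R (indicator {0..1 - u$1 - u$2} t *\<^sub>R f (t *\<^sub>R axis 1 1 + u$1 *\<^sub>R axis 2 1 + u$2 *\<^sub>R axis 3 1)))"
      by (rule Bochner_Integration.integral_cong) (auto simp: simplex2_def simplex3_def axis_def indicator_def)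
    then show "(LINT t|lborel. ?h (?\<psi> (u, t))) = indicat_real simplex2 u *\<^sub>R
      (LINT t|lborel. indicat_real {0..1 - u$1 - u$2} t *\<^sub>R f (t *\<^sub>R axis 1 1 + u$1 *\<^sub>R axis 2 1 + u$2 *\<^sub>R axis 3 1))"
      by simp
  qed
  finally show ?thesis .
qed

section \<open>Beta and Dirichlet integrals\<close>

lemma has_vector_derivative_power_Suc:
  "((\<lambda>s. c * (s ^ Suc j / (real j + 1))) has_vector_derivative c * s ^ j) (at s within A)"
  using DERIV_cmult[OF DERIV_cdivide[OF DERIV_pow[of "Suc j" s A], of "real j + 1"], of c]
  by (simp add: has_real_derivative_iff_has_vector_derivative[symmetric] add.commute del: power_Suc)

text \<open>Induction by partial integration: \<open>s ^ (i + 1) * (1 - s) ^ (j + 1)\<close>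
  vanishes at both ends, so its derivative links the exponents \<open>(i, j + 1)\<close> to
  \<open>(i + 1, j)\<close>.\<close>

lemma beta_integral_nat:
  "((\<lambda>s. s ^ i * (1 - s) ^ j) has_integral (fact i * fact j / fact (i + j + 1) :: real)) {0..1}"
proof (induction j arbitrary: i)
  case 0
  have "((\<lambda>s. 1 * s ^ i) has_integral (1 * (1 ^ Suc i / (real i + 1)) - 1 * (0 ^ Suc i / (real i + 1)))) {0..1::real}"
    by (rule fundamental_theorem_of_calculus[OF _ has_vector_derivative_power_Suc]) simp
  moreover have "fact i * fact 0 / fact (i + 0 + 1) = 1 / (real i + 1)"
    by (simp add: divide_simps)
  ultimately show ?case by (simp add: add.commute)
next
  case (Suc j)
  have "((\<lambda>s. (real i + 1) * (s ^ i * (1 - s) ^ Suc j) - (real j + 1) * (s ^ Suc i * (1 - s) ^ j)) has_integral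
      1 ^ Suc i * (1 - 1) ^ Suc j - 0 ^ Suc i * (1 - 0) ^ Suc j) {0..1::real}"
  proof (rule fundamental_theorem_of_calculus[where f = "\<lambda>s. s ^ Suc i * (1 - s) ^ Suc j"])
    fix s :: real
    have "((\<lambda>s. 1 - s) has_real_derivative - 1) (at s within {0..1})"
      by (auto intro!: derivative_eq_intros)
    from DERIV_mult[OF DERIV_power_Suc[OF DERIV_ident, of i] DERIV_power_Suc[OF this, of j]]
    show "((\<lambda>s. s ^ Suc i * (1 - s) ^ Suc j) has_vector_derivative
        (real i + 1) * (s ^ i * (1 - s) ^ Suc j) - (real j + 1) * (s ^ Suc i * (1 - s) ^ j)) (at s within {0..1})"
      unfolding has_real_derivative_iff_has_vector_derivative[symmetric]
      by (rule DERIV_cong) (simp add: algebra_simps)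
  qed simp
  from has_integral_add[OF this has_integral_mult_right[OF Suc.IH[of "Suc i"], of "real j + 1"]]
  have *: "((\<lambda>s. (real i + 1) * (s ^ i * (1 - s) ^ Suc j)) has_integral
      (real j + 1) * (fact (Suc i) * fact j / fact (Suc i + j + 1))) {0..1}" by simp
  have cancel: "1 / (real i + 1) * ((real i + 1) * x) = x" for x by (simp add: field_simps)
  from has_integral_mult_right[OF *, of "1 / (real i + 1)"]
  have "((\<lambda>s. s ^ i * (1 - s) ^ Suc j) has_integral
      1 / (real i + 1) * ((real j + 1) * (fact (Suc i) * fact j / fact (Suc i + j + 1)))) {0..1}"
    by (simp only: cancel)
  moreover have "1 / (real i + 1) * ((real j + 1) * (fact (Suc i) * fact j / fact (Suc i + j + 1))) =
    (fact i * fact (Suc j) / fact (i + Suc j + 1) :: real)"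
    by (simp add: divide_simps) (simp add: algebra_simps)
  ultimately show ?case by simp
qed

text \<open>The inner integration turns \<open>r ^ j\<close> into
  \<open>(1 - s) ^ (j + 1) / (j + 1)\<close> and leaves a Beta integral.\<close>

lemma lint_simplex2_monomial:
  "(LINT u:simplex2|lborel. (u$1) ^ i * (u$2) ^ j) = (fact i * fact j / fact (i + j + 2) :: real)"
proof -
  have inner: "(LINT r:{0..1 - s}|lborel. s ^ i * r ^ j) = s ^ i * (1 - s) ^ (j + 1) / (real j + 1)"
    if "s \<in> {0..1}" for s :: real
  proof -
    have "((\<lambda>r. s ^ i * r ^ j) has_integral (s ^ i * ((1 - s) ^ Suc j / (real j + 1)) - s ^ i * (0 ^ Suc j / (real j + 1)))) {0..1 - s}"
      by (rule fundamental_theorem_of_calculus[OF _ has_vector_derivative_power_Suc]) (use that in simp)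
    from integral_unique[OF this] have "integral {0..1 - s} (\<lambda>r. s ^ i * r ^ j) = s ^ i * (1 - s) ^ (j + 1) / (real j + 1)"
      by (simp del: integral_mult_right)
    moreover have "(LINT r:{0..1 - s}|lborel. s ^ i * r ^ j) = integral {0..1 - s} (\<lambda>r. s ^ i * r ^ j)"
      by (rule set_borel_integral_eq_integral, rule set_integrable_compact) (auto intro!: continuous_intros)
    ultimately show ?thesis by simp
  qed
  have "(LINT u:simplex2|lborel. (u$1) ^ i * (u$2) ^ j) =
    (LINT s:{0..1}|lborel. (LINT r:{0..1 - s}|lborel. s ^ i * r ^ j))"
    by (subst lint_simplex2_iterated) (auto intro!: continuous_intros simp: axis_def)
  also have "\<dots> = (LINT s:{0..1}|lborel. s ^ i * (1 - s) ^ (j + 1) / (real j + 1))"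
    by (rule set_lebesgue_integral_cong) (use inner in auto)
  also have "\<dots> = integral {0..1} (\<lambda>s. s ^ i * (1 - s) ^ (j + 1) / (real j + 1))"
    by (rule set_borel_integral_eq_integral, rule set_integrable_compact) (auto intro!: continuous_intros)
  also have "\<dots> = fact i * fact (j + 1) / fact (i + (j + 1) + 1) / (real j + 1)"
    by (rule integral_unique, rule has_integral_divide[OF beta_integral_nat])
  also have "\<dots> = fact i * fact j / fact (i + j + 2)"
    by (simp add: divide_simps)
  finally show ?thesis .
qed

text \<open>A nonnegative integrand with integral zero vanishes almost everywhere, hence on the
  interior, where a nonzero value would persist on an open set. The interior of a convex body is
  dense in it, which covers the boundary.\<close>

lemma integral_zero_imp_zero:
  fixes f :: "'a::euclidean_space \<Rightarrow> real"
  assumes S: "compact S" "convex S" "interior S \<noteq> {}" and f: "continuous_on S f"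
    and nn: "\<And>x. x \<in> S \<Longrightarrow> 0 \<le> f x" and 0: "(LINT x:S|lebesgue. f x) = 0" and x: "x \<in> S"
  shows "f x = 0"
proof -
  let ?g = "\<lambda>x. indicator S x *\<^sub>R f x"
  have "integrable lebesgue ?g"
    using set_integrable_compact(2)[OF S(1) f] unfolding set_integrable_def .
  then have "AE x in lebesgue. ?g x = 0"
    using integral_nonneg_eq_0_iff_AE[of lebesgue ?g] 0 nn by (auto simp: set_lebesgue_integral_def indicator_def)
  have int: "f y = 0" if y: "y \<in> interior S" for y
  proof (rule ccontr)
    assume "f y \<noteq> 0"
    have "continuous_on (interior S) f" using f interior_subset continuous_on_subset by blast
    then have op: "open {z \<in> interior S. f z \<noteq> 0}"
      using continuous_open_preimage[OF _ open_interior, of S f "- {0}"]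
      by (auto simp: vimage_def Int_def)
    have "{z \<in> interior S. f z \<noteq> 0} \<subseteq> {z. \<not> ?g z = 0}"
      using interior_subset by (auto simp: indicator_def)
    moreover have "negligible {z. \<not> ?g z = 0}"
      using \<open>AE x in lebesgue. ?g x = 0\<close> by (simp add: eventually_ae_filter_negligible) (meson negligible_subset)
    ultimately have "negligible {z \<in> interior S. f z \<noteq> 0}" by (rule negligible_subset[rotated])
    then have "{z \<in> interior S. f z \<noteq> 0} = {}" using op open_not_negligible by blast
    then show False using y \<open>f y \<noteq> 0\<close> by blast
  qed
  have cl: "closure (interior S) = S"
    using convex_closure_interior[OF S(2,3)] compact_imp_closed[OF S(1)] by simp
  show ?thesis
    by (rule continuous_constant_on_closure[of "interior S" f 0]) (use cl f int x in auto)
qed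

lemma convex_hull_3_image:
  "convex hull {a, b, c} = (\<lambda>u. a + u$1 *\<^sub>R (b - a) + u$2 *\<^sub>R (c - a)) ` simplex2"
proof -
  have "a + u *\<^sub>R (b - a) + v *\<^sub>R (c - a) \<in> (\<lambda>u. a + u$1 *\<^sub>R (b - a) + u$2 *\<^sub>R (c - a)) ` simplex2"
    if "0 \<le> u" "0 \<le> v" "u + v \<le> 1" for u v
    by (rule image_eqI[of _ _ "vector [u, v]"]) (use that in \<open>auto simp: simplex2_def vector_2\<close>)
  then show ?thesis
    unfolding convex_hull_3_alt by (auto simp: simplex2_def)
qed

lemma convex_hull_4_image:
  fixes a :: "'a::real_vector"
  shows "convex hull {a, b, c, d} = (\<lambda>u. a + u$1 *\<^sub>R (b - a) + u$2 *\<^sub>R (c - a) + u$3 *\<^sub>R (d - a)) ` simplex3"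
    (is "_ = ?f ` _")
proof
  have "convex simplex3"
    unfolding simplex3_def
  proof (rule convexI)
    fix x y :: "real^3" and u v :: real
    assume *: "x \<in> {u. 0 \<le> u$1 \<and> 0 \<le> u$2 \<and> 0 \<le> u$3 \<and> u$1 + u$2 + u$3 \<le> 1}"
      "y \<in> {u. 0 \<le> u$1 \<and> 0 \<le> u$2 \<and> 0 \<le> u$3 \<and> u$1 + u$2 + u$3 \<le> 1}" "0 \<le> u" "0 \<le> v" "u + v = 1"
    then have "u * (x$1 + x$2 + x$3) + v * (y$1 + y$2 + y$3) \<le> 1" by (intro convex_bound_le) auto
    then show "u *\<^sub>R x + v *\<^sub>R y \<in> {u. 0 \<le> u$1 \<and> 0 \<le> u$2 \<and> 0 \<le> u$3 \<and> u$1 + u$2 + u$3 \<le> 1}"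
      using * by (simp add: algebra_simps)
  qed
  then have "convex ((\<lambda>x. a + x) ` (\<lambda>u. u$1 *\<^sub>R (b - a) + u$2 *\<^sub>R (c - a) + u$3 *\<^sub>R (d - a)) ` simplex3)"
    by (intro convex_translation convex_linear_image) (auto simp: linear_iff algebra_simps)
  then have "convex (?f ` simplex3)" by (simp add: image_image add.assoc)
  moreover have "a \<in> ?f ` simplex3" "b \<in> ?f ` simplex3" "c \<in> ?f ` simplex3" "d \<in> ?f ` simplex3"
    by (rule image_eqI[of _ _ 0], simp, simp add: simplex3_def,
        rule image_eqI[of _ _ "vector [1, 0, 0]"], simp add: vector_3, simp add: simplex3_def vector_3,
        rule image_eqI[of _ _ "vector [0, 1, 0]"], simp add: vector_3, simp add: simplex3_def vector_3,
        rule image_eqI[of _ _ "vector [0, 0, 1]"], simp add: vector_3, simp add: simplex3_def vector_3)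
  ultimately show "convex hull {a, b, c, d} \<subseteq> ?f ` simplex3"
    by (intro hull_minimal) auto
  show "?f ` simplex3 \<subseteq> convex hull {a, b, c, d}"
  proof clarify
    fix u :: "real^3" assume u: "u \<in> simplex3"
    let ?p = "\<lambda>i::nat. if i = 0 then a else if i = 1 then b else if i = 2 then c else d"
    let ?c = "\<lambda>i::nat. if i = 0 then 1 - u$1 - u$2 - u$3 else if i = 1 then u$1 else if i = 2 then u$2 else u$3"
    have p: "?p i \<in> convex hull {a, b, c, d}" for i by (auto intro: hull_inc)
    have "(\<Sum>i\<in>{0,1,2,3}. ?c i *\<^sub>R ?p i) \<in> convex hull {a, b, c, d}"
      by (rule convex_sum) (use u p in \<open>auto simp: simplex3_def hull_inc\<close>)
    then show "?f u \<in> convex hull {a, b, c, d}"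
      by (simp add: algebra_simps)
  qed
qed

section \<open>Isometric charts of faces and edges\<close>

text \<open>Guarantees that the choice operator in \<open>face_integral\<close> and
  \<open>edge_integral\<close> returns a chart: the direction space of the affine hull is isometric
  to the model space of the same dimension.\<close>

lemma chart_exists:
  fixes S :: "(real^3) set"
  assumes "S \<noteq> {}" "aff_dim S = int DIM('a::euclidean_space)"
  shows "\<exists>\<phi> :: 'a \<Rightarrow> real^3. isometric_chart S \<phi>"
proof -
  obtain a where a: "a \<in> S" using assms by blast
  then have a': "a \<in> affine hull S" by (rule hull_inc)
  let ?T = "(\<lambda>x. - a + x) ` (affine hull S)"
  have sub: "subspace ?T"
    using affine_diffs_subspace[OF affine_affine_hull a'] by simp
  have "aff_dim (affine hull S) = int (dim ?T)"
    by (rule aff_dim_eq_dim) (use a' in \<open>simp add: hull_inc\<close>)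
  then have "dim ?T = dim (UNIV :: 'a set)" using assms by simp
  then obtain f :: "'a \<Rightarrow> real^3" where f: "linear f" "f ` UNIV = ?T" "\<And>x. norm (f x) = norm x"
    using isometry_subspaces[OF subspace_UNIV sub] by (metis UNIV_I)
  have "isometric_chart S (\<lambda>u. a + f u)"
    unfolding isometric_chart_def
  proof (intro conjI allI)
    fix u v
    have "f u - f v = f (u - v)" using f(1) by (simp add: linear_diff)
    then show "dist (a + f u) (a + f v) = dist u v"
      using f(3)[of "u - v"] by (simp add: dist_norm)
    have "range (\<lambda>u. a + f u) = (\<lambda>x. a + x) ` (f ` UNIV)" by auto
    also have "\<dots> = affine hull S" unfolding f(2) by (simp add: image_image)
    finally show "range (\<lambda>u. a + f u) = affine hull S" .
  qed
  then show ?thesis by blast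
qed

text \<open>A chosen chart is only known to preserve distances. By polarisation it preserves inner
  products relative to \<open>\<phi> 0\<close>, and then the defects of additivity and homogeneity
  have norm zero.\<close>

lemma isometric_chart_linear:
  fixes \<phi> :: "'a::euclidean_space \<Rightarrow> real^3"
  assumes "isometric_chart S \<phi>"
  shows "linear (\<lambda>u. \<phi> u - \<phi> 0)" "(\<phi> u - \<phi> 0) \<bullet> (\<phi> v - \<phi> 0) = u \<bullet> v"
proof -
  define h where "h u = \<phi> u - \<phi> 0" for u
  have d: "dist (\<phi> u) (\<phi> v) = dist u v" for u v using assms by (auto simp: isometric_chart_def)
  have n: "h u \<bullet> h u = u \<bullet> u" for u
    using d[of u 0] by (simp add: h_def dist_norm dot_square_norm)
  have nd: "(h u - h v) \<bullet> (h u - h v) = (u - v) \<bullet> (u - v)" for u v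
    using d[of u v] by (simp add: h_def dist_norm dot_square_norm)
  have i: "h u \<bullet> h v = u \<bullet> v" for u v
    using nd[of u v] n[of u] n[of v] by (simp add: inner_diff_left inner_diff_right inner_commute)
  then show "(\<phi> u - \<phi> 0) \<bullet> (\<phi> v - \<phi> 0) = u \<bullet> v" by (simp add: h_def)
  have "h (u + v) = h u + h v" for u v
  proof -
    have "(h (u + v) - (h u + h v)) \<bullet> (h (u + v) - (h u + h v)) = 0"
      by (simp add: inner_diff_left inner_diff_right inner_add_left inner_add_right i inner_commute)
    then show ?thesis by simp
  qed
  moreover have "h (c *\<^sub>R u) = c *\<^sub>R h u" for c u
  proof -
    have "(h (c *\<^sub>R u) - c *\<^sub>R h u) \<bullet> (h (c *\<^sub>R u) - c *\<^sub>R h u) = 0"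
      by (simp add: inner_diff_left inner_diff_right i inner_commute)
    then show ?thesis by simp
  qed
  ultimately show "linear (\<lambda>u. \<phi> u - \<phi> 0)" by (simp add: linear_iff h_def)
qed

lemma isometric_chart_continuous: "isometric_chart S \<phi> \<Longrightarrow> continuous_on A \<phi>"
  by (auto simp: isometric_chart_def continuous_on_iff)

text \<open>Statements about full-dimensional convex bodies transfer to faces and edges because the
  preimage of the relative interior of \<open>S\<close> under the chart is open.\<close>

lemma isometric_chart_vimage:
  fixes \<phi> :: "'a::euclidean_space \<Rightarrow> real^3"
  assumes ch: "isometric_chart S \<phi>" and S: "compact S" "convex S" "S \<noteq> {}"
  shows "compact (\<phi> -` S)" "convex (\<phi> -` S)" "interior (\<phi> -` S) \<noteq> {}" "\<phi> ` (\<phi> -` S) = S"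
proof -
  have ran: "range \<phi> = affine hull S" and d: "\<And>u v. dist (\<phi> u) (\<phi> v) = dist u v"
    using ch by (auto simp: isometric_chart_def)
  show im: "\<phi> ` (\<phi> -` S) = S"
    using ran hull_subset[of S affine] by (auto simp: image_vimage_eq)
  have "closed (\<phi> -` S)"
    using continuous_closed_vimage[of S \<phi>] compact_imp_closed[OF S(1)] isometric_chart_continuous[OF ch, of UNIV]
    by (auto simp: continuous_on_eq_continuous_at)
  moreover have "bounded (\<phi> -` S)"
  proof -
    obtain B where B: "\<And>x. x \<in> S \<Longrightarrow> dist (\<phi> 0) x \<le> B"
      using compact_imp_bounded[OF S(1)] bounded_any_center by metis
    have "dist 0 u \<le> B" if "u \<in> \<phi> -` S" for u using B[of "\<phi> u"] that by (simp add: d)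
    then show ?thesis unfolding bounded_def by blast
  qed
  ultimately show "compact (\<phi> -` S)" by (simp add: compact_eq_bounded_closed)
  have aff: "\<phi> (s *\<^sub>R u + t *\<^sub>R v) = s *\<^sub>R \<phi> u + t *\<^sub>R \<phi> v" if "s + t = 1" for s t u v
  proof -
    have "\<phi> (s *\<^sub>R u + t *\<^sub>R v) - \<phi> 0 = s *\<^sub>R (\<phi> u - \<phi> 0) + t *\<^sub>R (\<phi> v - \<phi> 0)"
      by (simp only: linear_add[OF isometric_chart_linear(1)[OF ch]] linear_scale[OF isometric_chart_linear(1)[OF ch]])
    also have "\<dots> = s *\<^sub>R \<phi> u + t *\<^sub>R \<phi> v - (s + t) *\<^sub>R \<phi> 0" by (simp add: algebra_simps)
    finally show ?thesis using that by simp
  qed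
  show "convex (\<phi> -` S)"
    using S(2) by (auto simp: convex_def aff)
  have "openin (top_of_set (affine hull S)) (rel_interior S)" by (rule openin_rel_interior)
  then obtain U where U: "open U" "rel_interior S = affine hull S \<inter> U" by (auto simp: openin_open)
  then have "\<phi> -` rel_interior S = \<phi> -` U" using ran by auto
  moreover have "open (\<phi> -` U)"
    using continuous_open_vimage[of U \<phi>] U(1) isometric_chart_continuous[OF ch, of UNIV]
    by (auto simp: continuous_on_eq_continuous_at)
  moreover have "\<phi> -` rel_interior S \<subseteq> \<phi> -` S" using rel_interior_subset[of S] by auto
  ultimately have "\<phi> -` rel_interior S \<subseteq> interior (\<phi> -` S)" by (simp add: interior_maximal)
  moreover have "\<phi> -` rel_interior S \<noteq> {}"
  proof -
    obtain y where y: "y \<in> rel_interior S" using rel_interior_eq_empty[OF S(2)] S(3) by auto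
    then have "y \<in> S" using rel_interior_subset[of S] by blast
    then obtain u where "y = \<phi> u" using im by blast
    then show ?thesis using y by auto
  qed
  ultimately show "interior (\<phi> -` S) \<noteq> {}" by blast
qed

lemma face_integral_chart:
  assumes "aff_dim F = 2"
  obtains \<phi> :: "real^2 \<Rightarrow> real^3" where "isometric_chart F \<phi>" "\<And>f. face_integral F f = (LINT u:(\<phi> -` F)|lebesgue. f (\<phi> u))"
proof -
  have "\<exists>\<phi> :: real^2 \<Rightarrow> real^3. isometric_chart F \<phi>"
    using assms by (intro chart_exists) (auto simp: aff_dim_empty)
  then have "isometric_chart F (SOME \<phi> :: real^2 \<Rightarrow> real^3. isometric_chart F \<phi>)" by (rule someI_ex)
  then show ?thesis by (rule that) (simp add: face_integral_def Let_def)
qed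

lemma edge_integral_chart:
  assumes "aff_dim e = 1"
  obtains \<phi> :: "real \<Rightarrow> real^3" where "isometric_chart e \<phi>" "\<And>f. edge_integral e f = (LINT u:(\<phi> -` e)|lebesgue. f (\<phi> u))"
proof -
  have "\<exists>\<phi> :: real \<Rightarrow> real^3. isometric_chart e \<phi>"
    using assms by (intro chart_exists) (auto simp: aff_dim_empty)
  then have "isometric_chart e (SOME \<phi> :: real \<Rightarrow> real^3. isometric_chart e \<phi>)" by (rule someI_ex)
  then show ?thesis by (rule that) (simp add: edge_integral_def Let_def)
qed

lemma chart_set_integrable:
  fixes \<phi> :: "'a::euclidean_space \<Rightarrow> real^3" and f :: "real^3 \<Rightarrow> real"
  assumes ch: "isometric_chart S \<phi>" and S: "compact S" "convex S" "S \<noteq> {}" and f: "continuous_on S f"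
  shows "set_integrable lebesgue (\<phi> -` S) (\<lambda>u. f (\<phi> u))" "continuous_on (\<phi> -` S) (\<lambda>u. f (\<phi> u))"
proof -
  show *: "continuous_on (\<phi> -` S) (\<lambda>u. f (\<phi> u))"
    using continuous_on_compose2[OF f isometric_chart_continuous[OF ch]] by auto
  show "set_integrable lebesgue (\<phi> -` S) (\<lambda>u. f (\<phi> u))"
    by (rule set_integrable_compact(2)[OF isometric_chart_vimage(1)[OF ch S] *])
qed

lemma chart_integral_zero:
  fixes \<phi> :: "'a::euclidean_space \<Rightarrow> real^3" and f :: "real^3 \<Rightarrow> real"
  assumes ch: "isometric_chart S \<phi>" and S: "compact S" "convex S" "S \<noteq> {}" and f: "continuous_on S f"
    and nn: "\<And>x. x \<in> S \<Longrightarrow> 0 \<le> f x" and 0: "(LINT u:(\<phi> -` S)|lebesgue. f (\<phi> u)) = 0" and x: "x \<in> S"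
  shows "f x = 0"
proof -
  note v = isometric_chart_vimage[OF ch S]
  obtain u where u: "u \<in> \<phi> -` S" "x = \<phi> u" using x v(4) by blast
  have "f (\<phi> u) = 0"
    by (rule integral_zero_imp_zero[OF v(1-3) chart_set_integrable(2)[OF ch S f] _ 0 u(1)]) (use nn in auto)
  then show ?thesis using u by simp
qed

lemma face_integral_cong: "aff_dim F = 2 \<Longrightarrow> (\<And>x. x \<in> F \<Longrightarrow> f x = g x) \<Longrightarrow> face_integral F f = face_integral F g"
  unfolding face_integral_def Let_def set_lebesgue_integral_def
  by (intro Bochner_Integration.integral_cong) (auto simp: indicator_def)

lemma edge_integral_cong: "aff_dim F = 1 \<Longrightarrow> (\<And>x. x \<in> F \<Longrightarrow> f x = g x) \<Longrightarrow> edge_integral F f = edge_integral F g"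
  unfolding edge_integral_def Let_def set_lebesgue_integral_def
  by (intro Bochner_Integration.integral_cong) (auto simp: indicator_def)

lemma face_integral_scale: "face_integral F (\<lambda>x. c * f x) = c * face_integral F f"
  by (simp add: face_integral_def Let_def)

lemma edge_integral_scale: "edge_integral F (\<lambda>x. c * f x) = c * edge_integral F f"
  by (simp add: edge_integral_def Let_def)

lemma face_integral_add:
  assumes "aff_dim F = 2" "compact F" "convex F" "continuous_on F f" "continuous_on F g"
  shows "face_integral F (\<lambda>x. f x + g x) = face_integral F f + face_integral F g"
proof -
  obtain \<phi> :: "real^2 \<Rightarrow> real^3" where \<phi>: "isometric_chart F \<phi>" "\<And>f. face_integral F f = (LINT u:(\<phi> -` F)|lebesgue. f (\<phi> u))"
    using face_integral_chart[OF assms(1)] by blast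
  have "F \<noteq> {}" using assms(1) by auto
  then show ?thesis
    unfolding \<phi>(2) using chart_set_integrable(1)[OF \<phi>(1) assms(2,3)] assms(4,5) by (intro set_integral_add) auto
qed

lemma edge_integral_add:
  assumes "aff_dim F = 1" "compact F" "convex F" "continuous_on F f" "continuous_on F g"
  shows "edge_integral F (\<lambda>x. f x + g x) = edge_integral F f + edge_integral F g"
proof -
  obtain \<phi> :: "real \<Rightarrow> real^3" where \<phi>: "isometric_chart F \<phi>" "\<And>f. edge_integral F f = (LINT u:(\<phi> -` F)|lebesgue. f (\<phi> u))"
    using edge_integral_chart[OF assms(1)] by blast
  have "F \<noteq> {}" using assms(1) by auto
  then show ?thesis
    unfolding \<phi>(2) using chart_set_integrable(1)[OF \<phi>(1) assms(2,3)] assms(4,5) by (intro set_integral_add) auto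
qed

lemma face_integral_eq_0:
  assumes "aff_dim F = 2" "compact F" "convex F" "continuous_on F f" "\<And>x. x \<in> F \<Longrightarrow> 0 \<le> f x"
    "face_integral F f = 0" "x \<in> F"
  shows "f x = 0"
  using face_integral_chart[OF assms(1)] chart_integral_zero[OF _ assms(2,3) _ assms(4,5) _ assms(7)] assms(6,7)
  by (metis empty_iff)

lemma edge_integral_eq_0:
  assumes "aff_dim F = 1" "compact F" "convex F" "continuous_on F f" "\<And>x. x \<in> F \<Longrightarrow> 0 \<le> f x"
    "edge_integral F f = 0" "x \<in> F"
  shows "f x = 0"
  using edge_integral_chart[OF assms(1)] chart_integral_zero[OF _ assms(2,3) _ assms(4,5) _ assms(7)] assms(6,7)
  by (metis empty_iff)

lemma integral_affine_image:
  fixes g :: "real^'n::{finite,wellorder} \<Rightarrow> real^'n::_" and f :: "real^'n::_ \<Rightarrow> real"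
  assumes g: "linear g" "det (matrix g) \<noteq> 0" and S: "compact S" and f: "continuous_on ((\<lambda>x. \<alpha> + g x) ` S) f"
  shows "(LINT x:((\<lambda>x. \<alpha> + g x) ` S)|lebesgue. f x) = \<bar>det (matrix g)\<bar> * (LINT x:S|lebesgue. f (\<alpha> + g x))"
proof -
  let ?G = "\<lambda>x. \<alpha> + g x"
  obtain h where h: "\<And>x. h (g x) = x" "linear h"
    using g det_nz_iff_inj linear_injective_isomorphism by metis
  have cg: "continuous_on A g" for A using g(1) linear_continuous_on linear_conv_bounded_linear by blast
  have cG: "continuous_on S ?G" by (intro continuous_intros cg)
  have cS: "compact (?G ` S)" using S cG compact_continuous_image by blast
  have i1: "f absolutely_integrable_on (?G ` S)"
    by (rule set_integrable_compact(2)[OF cS f])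
  have i2: "(\<lambda>x. f (?G x)) absolutely_integrable_on S"
    by (rule set_integrable_compact(2)[OF S continuous_on_compose2[OF f cG]]) auto
  \<comment> \<open>The change of variables rule is formulated for vector-valued integrands, so the
    scalar \<open>f\<close> passes through \<open>real^1\<close>.\<close>
  define F :: "_ \<Rightarrow> real^1" where "F x = vec (f x)" for x
  have cF: "continuous_on (?G ` S) F"
    unfolding F_def vec_def by (intro continuous_on_vec_lambda f)
  have j1: "F absolutely_integrable_on (?G ` S)"
    by (rule set_integrable_compact(2)[OF cS cF])
  have j2: "(\<lambda>x. F (?G x)) absolutely_integrable_on S"
    by (rule set_integrable_compact(2)[OF S continuous_on_compose2[OF cF cG]]) auto
  have "(\<lambda>x. \<bar>det (matrix g)\<bar> *\<^sub>R F (?G x)) absolutely_integrable_on S \<and>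
      integral S (\<lambda>x. \<bar>det (matrix g)\<bar> *\<^sub>R F (?G x)) = integral (?G ` S) F"
  proof (rule iffD2[OF has_absolute_integral_change_of_variables_invertible[where h = "\<lambda>y. h (y - \<alpha>)"]])
    show "(?G has_derivative g) (at x within S)" for x
      using linear_imp_has_derivative[OF g(1)] by (auto intro!: derivative_eq_intros)
    have "continuous_on (?G ` S) (\<lambda>y. y - \<alpha>)" by (intro continuous_intros)
    then show "continuous_on (?G ` S) (\<lambda>y. h (y - \<alpha>))"
      using continuous_on_compose2[OF linear_continuous_on[of h UNIV], of "?G ` S" "\<lambda>y. y - \<alpha>"] h(2)
      by (simp add: linear_conv_bounded_linear)
  qed (use h j1 in auto)
  then have "integral (?G ` S) F $ 1 = (\<bar>det (matrix g)\<bar> *\<^sub>R integral S (\<lambda>x. F (?G x))) $ 1"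
    by simp
  moreover have "integral (?G ` S) F $ 1 = integral (?G ` S) f"
    using set_lebesgue_integral_eq_integral(1)[OF j1] by (subst integral_component_eq_cart[symmetric]) (auto simp: F_def)
  moreover have "integral S (\<lambda>x. F (?G x)) $ 1 = integral S (\<lambda>x. f (?G x))"
    using set_lebesgue_integral_eq_integral(1)[OF j2] by (subst integral_component_eq_cart[symmetric]) (auto simp: F_def)
  ultimately show ?thesis
    using set_lebesgue_integral_eq_integral(2)[OF i1] set_lebesgue_integral_eq_integral(2)[OF i2] by simp
qed

text \<open>The integral in the affine coordinates of the triangle, without the Jacobian. In this
  form the fundamental theorem along an edge direction gives differences of face terms
  directly.\<close>

definition tri :: "real^3 \<Rightarrow> real^3 \<Rightarrow> real^3 \<Rightarrow> (real^3 \<Rightarrow> real) \<Rightarrow> real" where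
  "tri a b c f = (LINT u:simplex2|lborel. f (a + u$1 *\<^sub>R (b - a) + u$2 *\<^sub>R (c - a)))"

lemma aff_dim_triangle:
  assumes "cross3 (b - a) (c - a) \<noteq> (0 :: real^3)"
  shows "aff_dim (convex hull {a, b, c}) = 2"
proof -
  have "\<not> collinear {0, b - a, c - a}" using assms cross_eq_0 by blast
  then have "\<not> collinear {b, a, c}" by (simp add: collinear_3[of b a c])
  then have "\<not> affine_dependent {b, a, c}" "card {b, a, c} = 3"
    by (auto simp: collinear_3_eq_affine_dependent card_insert_if)
  then show ?thesis
    using aff_dim_affine_independent[of "{b, a, c}"] by (simp add: aff_dim_convex_hull insert_commute)
qed

lemma face_integral_tri:
  assumes N: "cross3 (b - a) (c - a) \<noteq> 0" and f: "continuous_on (convex hull {a, b, c}) f"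
  shows "face_integral (convex hull {a, b, c}) f = norm (cross3 (b - a) (c - a)) * tri a b c f"
proof -
  let ?F = "convex hull {a, b, c}"
  obtain \<phi> :: "real^2 \<Rightarrow> real^3" where ch: "isometric_chart ?F \<phi>"
    and fi: "\<And>f. face_integral ?F f = (LINT u:(\<phi> -` ?F)|lebesgue. f (\<phi> u))"
    using face_integral_chart[OF aff_dim_triangle[OF N]] by blast
  have F: "compact ?F" "convex ?F" "?F \<noteq> {}" by (auto simp: finite_imp_compact_convex_hull)
  have "{a, b, c} \<subseteq> range \<phi>"
    using ch hull_subset[of ?F affine] hull_subset[of "{a,b,c}" convex] by (auto simp: isometric_chart_def)
  then obtain \<alpha> \<beta> \<gamma> where abc: "a = \<phi> \<alpha>" "b = \<phi> \<beta>" "c = \<phi> \<gamma>" by auto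
  note lin = isometric_chart_linear[OF ch]
  define p q where "p = \<beta> - \<alpha>" and "q = \<gamma> - \<alpha>"
  define g :: "real^2 \<Rightarrow> real^2" where "g u = u$1 *\<^sub>R p + u$2 *\<^sub>R q" for u
  have lg: "linear g" by (auto simp: g_def linear_iff algebra_simps)
  have hp: "b - a = \<phi> p - \<phi> 0" "c - a = \<phi> q - \<phi> 0"
    using linear_diff[OF lin(1), of \<beta> \<alpha>] linear_diff[OF lin(1), of \<gamma> \<alpha>] by (simp_all add: abc p_def q_def)
  have \<phi>G: "\<phi> (\<alpha> + g u) = a + u$1 *\<^sub>R (b - a) + u$2 *\<^sub>R (c - a)" for u
  proof -
    have "\<phi> (\<alpha> + g u) - \<phi> 0 = (\<phi> \<alpha> - \<phi> 0) + (u$1 *\<^sub>R (\<phi> p - \<phi> 0) + u$2 *\<^sub>R (\<phi> q - \<phi> 0))"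
      using lin(1) unfolding g_def linear_iff by metis
    then show ?thesis unfolding hp using abc(1) by (simp add: algebra_simps)
  qed
  have inj: "\<phi> u = \<phi> v \<Longrightarrow> u = v" for u v using ch by (metis dist_eq_0_iff isometric_chart_def)
  have vim: "\<phi> -` ?F = (\<lambda>u. \<alpha> + g u) ` simplex2"
  proof
    show "\<phi> -` ?F \<subseteq> (\<lambda>u. \<alpha> + g u) ` simplex2"
    proof
      fix v assume "v \<in> \<phi> -` ?F"
      then obtain u where "u \<in> simplex2" "\<phi> v = \<phi> (\<alpha> + g u)"
        by (auto simp: convex_hull_3_image \<phi>G)
      then show "v \<in> (\<lambda>u. \<alpha> + g u) ` simplex2" using inj by blast
    qed
    show "(\<lambda>u. \<alpha> + g u) ` simplex2 \<subseteq> \<phi> -` ?F"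
      by (auto simp: convex_hull_3_image \<phi>G)
  qed
  have det: "det (matrix g) = p$1 * q$2 - q$1 * p$2"
    by (simp add: det_2 matrix_def g_def axis_def)
  \<comment> \<open>Both sides are the Gram determinant of \<open>p\<close> and \<open>q\<close>:
    the chart preserves inner products, and Lagrange's identity expresses the norm of the cross
    product by them.\<close>
  have sq: "(det (matrix g))\<^sup>2 = (norm (cross3 (b - a) (c - a)))\<^sup>2"
  proof -
    have "(norm (cross3 (b - a) (c - a)))\<^sup>2 = (p \<bullet> p) * (q \<bullet> q) - (p \<bullet> q)\<^sup>2"
      unfolding norm_cross unfolding hp power2_norm_eq_inner lin(2) ..
    also have "\<dots> = (p$1 * q$2 - q$1 * p$2)\<^sup>2"
      by (simp add: inner_vec_def sum_2 power2_eq_square algebra_simps)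
    finally show ?thesis by (simp add: det)
  qed
  have d: "\<bar>det (matrix g)\<bar> = norm (cross3 (b - a) (c - a))"
    using arg_cong[OF sq, of sqrt] by (simp only: real_sqrt_abs abs_norm_cancel)
  have cf: "continuous_on ((\<lambda>u. \<alpha> + g u) ` simplex2) (\<lambda>u. f (\<phi> u))"
    using chart_set_integrable(2)[OF ch F f] unfolding vim .
  have cf2: "continuous_on simplex2 (\<lambda>u. f (\<phi> (\<alpha> + g u)))"
    unfolding \<phi>G by (rule continuous_on_compose2[OF f]) (auto intro!: continuous_intros simp: convex_hull_3_image)
  have "face_integral ?F f = \<bar>det (matrix g)\<bar> * (LINT u:simplex2|lebesgue. f (\<phi> (\<alpha> + g u)))"
    unfolding fi vim by (rule integral_affine_image[OF lg _ compact_simplex2 cf]) (use d N in auto)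
  also have "(LINT u:simplex2|lebesgue. f (\<phi> (\<alpha> + g u))) = (LINT u:simplex2|lborel. f (\<phi> (\<alpha> + g u)))"
    by (rule set_integrable_compact(3)[OF compact_simplex2 cf2])
  also have "\<dots> = tri a b c f" by (simp only: tri_def \<phi>G)
  finally show ?thesis unfolding d .
qed

section \<open>Tetrahedra and Gauss' theorem\<close>

text \<open>Cramer's rule: the cross products of two of the vectors form the dual basis up to the
  factor of the triple product. It is a polynomial identity in the coordinates, valid also for
  dependent vectors.\<close>

lemma cramer3:
  "(cross3 u v \<bullet> w) *\<^sub>R y = (cross3 v w \<bullet> y) *\<^sub>R u + (cross3 w u \<bullet> y) *\<^sub>R v + (cross3 u v \<bullet> y) *\<^sub>R w"
  by (simp add: vec_eq_iff forall_3 cross3_def inner_vec_def sum_3 vector_3 algebra_simps)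

text \<open>Nonzero signed volume. No orientation is fixed, so the vertices may be permuted
  freely.\<close>

definition tet :: "real^3 \<Rightarrow> real^3 \<Rightarrow> real^3 \<Rightarrow> real^3 \<Rightarrow> bool" where
  "tet a b c d \<longleftrightarrow> cross3 (b - a) (c - a) \<bullet> (d - a) \<noteq> 0"

lemma independent_3_iff_cross:
  fixes u v w :: "real^3"
  shows "independent {u, v, w} \<and> card {u, v, w} = 3 \<longleftrightarrow> cross3 u v \<bullet> w \<noteq> 0"
proof
  assume *: "independent {u, v, w} \<and> card {u, v, w} = 3"
  show "cross3 u v \<bullet> w \<noteq> 0"
  proof
    assume 0: "cross3 u v \<bullet> w = 0"
    have "span {u, v, w} = UNIV"
      using * dim_eq_card_independent[of "{u, v, w}"] dim_eq_full[of "{u, v, w}"] by auto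
    have "cross3 u v \<bullet> y = 0" for y
    proof -
      have "y \<in> span {u, v, w}" using \<open>span {u, v, w} = UNIV\<close> by simp
      then show ?thesis
        by (induction rule: span_induct_alt) (auto simp: inner_add_right 0 dot_cross_self)
    qed
    then have "cross3 u v = 0" using inner_eq_zero_iff by blast
    then have "collinear {0, u, v}" by (simp add: cross_eq_0)
    then consider "u = 0" | "v = 0" | c where "v = c *\<^sub>R u" using collinear_lemma by blast
    then show False
    proof cases
      case 3
      moreover have "u \<noteq> v" using * by (auto simp: card_insert_if split: if_splits)
      then have "u \<in> {u, v, w} - {v}" by blast
      ultimately have "v \<in> span ({u, v, w} - {v})" by (metis span_base span_scale)
      then show False using * unfolding dependent_def by blast
    qed (use * dependent_zero[of "{u, v, w}"] in simp_all)
  qed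
next
  assume D: "cross3 u v \<bullet> w \<noteq> 0"
  have orth: "g \<bullet> x = 0" if "x \<in> span S" "\<And>y. y \<in> S \<Longrightarrow> g \<bullet> y = 0" for g x :: "real^3" and S
    using that(1) by (induction rule: span_induct_alt) (auto simp: inner_add_right that(2))
  have 1: "cross3 v w \<bullet> u \<noteq> 0" "cross3 w u \<bullet> v \<noteq> 0" using D by (metis cross_triple)+
  have ne: "u \<noteq> v" "u \<noteq> w" "v \<noteq> w" using D 1 by (auto simp: dot_cross_self)
  have "independent {u, v, w}"
  proof
    assume "dependent {u, v, w}"
    then obtain x where x: "x \<in> {u, v, w}" "x \<in> span ({u, v, w} - {x})"
      unfolding dependent_def by blast
    from x(1) consider "x = u" | "x = v" | "x = w" by auto
    then show False
    proof cases
      case 1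
      have "cross3 v w \<bullet> x = 0" by (rule orth[OF x(2)]) (use 1 in \<open>auto simp: dot_cross_self\<close>)
      then show ?thesis using 1 \<open>cross3 v w \<bullet> u \<noteq> 0\<close> by simp
    next
      case 2
      have "cross3 w u \<bullet> x = 0" by (rule orth[OF x(2)]) (use 2 in \<open>auto simp: dot_cross_self\<close>)
      then show ?thesis using 2 \<open>cross3 w u \<bullet> v \<noteq> 0\<close> by simp
    next
      case 3
      have "cross3 u v \<bullet> x = 0" by (rule orth[OF x(2)]) (use 3 in \<open>auto simp: dot_cross_self\<close>)
      then show ?thesis using 3 D by simp
    qed
  qed
  then show "independent {u, v, w} \<and> card {u, v, w} = 3" using ne by simp
qed

lemma tet_iff: "tet a b c d \<longleftrightarrow> card {a, b, c, d} = 4 \<and> \<not> affine_dependent {a, b, c, d}"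
proof (cases "a \<in> {b, c, d}")
  case True
  then have "card {a, b, c, d} \<noteq> 4" by (auto simp: card_insert_if)
  moreover have "\<not> tet a b c d" using True by (auto simp: tet_def dot_cross_self)
  ultimately show ?thesis by blast
next
  case False
  have img: "(\<lambda>x. x - a) ` {b, c, d} = {b - a, c - a, d - a}" by auto
  have "card ((\<lambda>x. x - a) ` {b, c, d}) = card {b, c, d}" by (rule card_image) (auto simp: inj_on_def)
  then have "card {b - a, c - a, d - a} = card {b, c, d}" unfolding img .
  moreover have "affine_dependent {a, b, c, d} \<longleftrightarrow> dependent {b - a, c - a, d - a}"
    unfolding affine_dependent_iff_dependent[OF False] using img by (simp add: image_def)
  ultimately show ?thesis
    unfolding tet_def independent_3_iff_cross[symmetric] using False by auto
qed

lemma tet_set_cong: "tet a b c d \<Longrightarrow> {p, q, r, s} = {a, b, c, d} \<Longrightarrow> tet p q r s"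
  unfolding tet_iff by simp

lemma tet_perms:
  assumes "tet a b c d"
  shows "tet b a c d" "tet a c b d" "tet a b d c" "tet b c d a" "tet a c d b" "tet a d b c" "tet c d a b" "tet d b c a"
  by (rule tet_set_cong[OF assms], auto)+

lemma tet_cross_nz: "tet a b c d \<Longrightarrow> cross3 (b - a) (c - a) \<noteq> 0"
  by (auto simp: tet_def)

lemma tet_volume_integral:
  fixes f :: "real^3 \<Rightarrow> real"
  assumes t: "tet a b c d" and f: "continuous_on UNIV f"
  shows "(LINT x:(convex hull {a, b, c, d})|lebesgue. f x) = \<bar>cross3 (b - a) (c - a) \<bullet> (d - a)\<bar> *
    (LINT u:simplex3|lborel. f (a + u$1 *\<^sub>R (b - a) + u$2 *\<^sub>R (c - a) + u$3 *\<^sub>R (d - a)))"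
proof -
  define g :: "real^3 \<Rightarrow> real^3" where "g u = u$1 *\<^sub>R (b - a) + u$2 *\<^sub>R (c - a) + u$3 *\<^sub>R (d - a)" for u
  have lg: "linear g" by (auto simp: g_def linear_iff algebra_simps)
  have G: "convex hull {a, b, c, d} = (\<lambda>u. a + g u) ` simplex3"
    unfolding convex_hull_4_image by (simp add: g_def add.assoc)
  have det: "det (matrix g) = cross3 (b - a) (c - a) \<bullet> (d - a)"
    by (simp add: det_3 matrix_def g_def axis_def cross3_def inner_vec_def sum_3 vector_3 algebra_simps)
  have c: "continuous_on A (\<lambda>u. f (a + g u))" for A
    unfolding g_def by (intro continuous_on_compose2[OF f] continuous_intros) auto
  have "(LINT x:(convex hull {a, b, c, d})|lebesgue. f x) = \<bar>det (matrix g)\<bar> * (LINT u:simplex3|lebesgue. f (a + g u))"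
    unfolding G by (rule integral_affine_image[OF lg _ compact_simplex3])
      (use t f in \<open>auto simp: det tet_def intro: continuous_on_subset\<close>)
  also have "(LINT u:simplex3|lebesgue. f (a + g u)) = (LINT u:simplex3|lborel. f (a + g u))"
    by (rule set_integrable_compact(3)[OF compact_simplex3 c])
  finally show ?thesis unfolding det unfolding g_def by (simp only: add.assoc)
qed

text \<open>Lines parallel to \<open>b - a\<close> enter the tetrahedron through the face opposite
  \<open>b\<close> and leave it through the face opposite \<open>a\<close>; the fundamental theorem
  on each line leaves the difference of two face integrals.\<close>

lemma tet_directional_integral:
  fixes f :: "real^3 \<Rightarrow> real"
  assumes t: "tet a b c d" and f: "\<And>x. (f has_derivative f' x) (at x)"
    and f': "\<And>v. continuous_on UNIV (\<lambda>x. f' x v)"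
  shows "(LINT x:(convex hull {a, b, c, d})|lebesgue. f' x (b - a)) = \<bar>cross3 (b - a) (c - a) \<bullet> (d - a)\<bar> *
    (tri b c d f - tri a c d f)"
proof -
  have cf: "continuous_on UNIV f" using f has_derivative_continuous_on by blast
  let ?p = "\<lambda>t (u::real^2). a + t *\<^sub>R (b - a) + u$1 *\<^sub>R (c - a) + u$2 *\<^sub>R (d - a)"
  have inner: "(LINT t:{0..1 - u$1 - u$2}|lborel. f' (?p t u) (b - a)) =
      f (b + u$1 *\<^sub>R (c - b) + u$2 *\<^sub>R (d - b)) - f (a + u$1 *\<^sub>R (c - a) + u$2 *\<^sub>R (d - a))"
    if "u \<in> simplex2" for u
  proof -
    have "(LBINT t. indicat_real {0..1 - u$1 - u$2} t *\<^sub>R f' (?p t u) (b - a)) = f (?p (1 - u$1 - u$2) u) - f (?p 0 u)"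
    proof (rule integral_FTC_Icc)
      show "0 \<le> 1 - u$1 - u$2" using that by (simp add: simplex2_def)
      fix t
      have "((\<lambda>t. ?p t u) has_derivative (\<lambda>h. h *\<^sub>R (b - a))) (at t within {0..1 - u$1 - u$2})"
        by (auto intro!: derivative_eq_intros)
      then have "((\<lambda>t. f (?p t u)) has_derivative (\<lambda>h. f' (?p t u) (h *\<^sub>R (b - a)))) (at t within {0..1 - u$1 - u$2})"
        by (rule has_derivative_compose) (rule f)
      moreover have "f' (?p t u) (h *\<^sub>R (b - a)) = h *\<^sub>R f' (?p t u) (b - a)" for h
        using has_derivative_linear[OF f] linear_scale by blast
      ultimately show "((\<lambda>t. f (?p t u)) has_vector_derivative f' (?p t u) (b - a)) (at t within {0..1 - u$1 - u$2})"
        by (simp add: has_vector_derivative_def)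
    next
      show "continuous_on {0..1 - u$1 - u$2} (\<lambda>t. f' (?p t u) (b - a))"
        by (rule continuous_on_compose2[OF f']) (auto intro!: continuous_intros)
    qed
    moreover have "?p (1 - u$1 - u$2) u = b + u$1 *\<^sub>R (c - b) + u$2 *\<^sub>R (d - b)"
      by (simp add: algebra_simps)
    ultimately show ?thesis unfolding set_lebesgue_integral_def by simp
  qed
  have c1: "continuous_on simplex2 (\<lambda>u. f (b + u$1 *\<^sub>R (c - b) + u$2 *\<^sub>R (d - b)))"
    "continuous_on simplex2 (\<lambda>u. f (a + u$1 *\<^sub>R (c - a) + u$2 *\<^sub>R (d - a)))"
    by (rule continuous_on_compose2[OF cf]; auto intro!: continuous_intros)+
  have "(LINT x:(convex hull {a, b, c, d})|lebesgue. f' x (b - a)) = \<bar>cross3 (b - a) (c - a) \<bullet> (d - a)\<bar> *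
    (LINT u:simplex3|lborel. f' (a + u$1 *\<^sub>R (b - a) + u$2 *\<^sub>R (c - a) + u$3 *\<^sub>R (d - a)) (b - a))"
    by (rule tet_volume_integral[OF t f'])
  also have "(LINT u:simplex3|lborel. f' (a + u$1 *\<^sub>R (b - a) + u$2 *\<^sub>R (c - a) + u$3 *\<^sub>R (d - a)) (b - a)) =
      (LINT u:simplex2|lborel. (LINT t:{0..1 - u$1 - u$2}|lborel. f' (?p t u) (b - a)))"
  proof (subst lint_simplex3_iterated)
    show "continuous_on UNIV (\<lambda>u. f' (a + u$1 *\<^sub>R (b - a) + u$2 *\<^sub>R (c - a) + u$3 *\<^sub>R (d - a)) (b - a))"
      by (rule continuous_on_compose2[OF f']) (auto intro!: continuous_intros)
  qed (simp add: axis_def)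
  also have "\<dots> = (LINT u:simplex2|lborel. f (b + u$1 *\<^sub>R (c - b) + u$2 *\<^sub>R (d - b)) - f (a + u$1 *\<^sub>R (c - a) + u$2 *\<^sub>R (d - a)))"
    by (rule set_lebesgue_integral_cong) (use inner compact_simplex2 in \<open>auto intro: borel_compact\<close>)
  also have "\<dots> = tri b c d f - tri a c d f"
    unfolding tri_def by (intro set_integral_diff set_integrable_compact(1) compact_simplex2 c1)
  finally show ?thesis .
qed

text \<open>Both are the face integral over the same set, divided by the same nonzero area
  factor.\<close>

lemma tri_rotate:
  assumes N: "cross3 (b - a) (c - a) \<noteq> 0" and f: "continuous_on UNIV f"
  shows "tri b c a f = tri a b c f"
proof -
  have e: "cross3 (c - b) (a - b) = cross3 (b - a) (c - a)"
    by (simp add: vec_eq_iff forall_3 cross3_def vector_3 algebra_simps)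
  have s: "{b, c, a} = {a, b, c}" by blast
  have c: "continuous_on S f" for S using f continuous_on_subset by blast
  show ?thesis
    using face_integral_tri[OF N c] face_integral_tri[of c b a, unfolded e s, OF N c] N by simp
qed

text \<open>The sign of the triple product turns the normal of the face away from \<open>d\<close>,
  whatever the orientation of the vertices.\<close>

definition out_normal :: "real^3 \<Rightarrow> real^3 \<Rightarrow> real^3 \<Rightarrow> real^3 \<Rightarrow> real^3" where
  "out_normal a b c d = (- sgn (cross3 (b - a) (c - a) \<bullet> (d - a)) / norm (cross3 (b - a) (c - a))) *\<^sub>R cross3 (b - a) (c - a)"

lemma tri_cross_face_integral:
  assumes N: "tet a b c d" and f: "continuous_on UNIV u"
  shows "- sgn (cross3 (b - a) (c - a) \<bullet> (d - a)) * tri a b c (\<lambda>x. cross3 (b - a) (c - a) \<bullet> u x) =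
    face_integral (convex hull {a, b, c}) (\<lambda>x. out_normal a b c d \<bullet> u x)"
proof -
  let ?N = "cross3 (b - a) (c - a)" and ?s = "sgn (cross3 (b - a) (c - a) \<bullet> (d - a))"
  have nz: "?N \<noteq> 0" using N by (rule tet_cross_nz)
  have "face_integral (convex hull {a, b, c}) (\<lambda>x. out_normal a b c d \<bullet> u x) =
      (- ?s / norm ?N) * face_integral (convex hull {a, b, c}) (\<lambda>x. ?N \<bullet> u x)"
    unfolding out_normal_def by (simp add: face_integral_scale[symmetric])
  also have "face_integral (convex hull {a, b, c}) (\<lambda>x. ?N \<bullet> u x) = norm ?N * tri a b c (\<lambda>x. ?N \<bullet> u x)"
    by (rule face_integral_tri[OF nz]) (intro continuous_intros continuous_on_subset[OF f], simp)
  finally show ?thesis using nz by simp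
qed

text \<open>In the basis of the edge vectors at \<open>a\<close> the trace of the derivative is, up
  to the factor \<open>D\<close>, a sum of three directional derivatives paired with the dual
  vectors \<open>g1\<close>, \<open>g2\<close>, \<open>g3\<close>. Each integrates to a difference
  of two faces; on the face \<open>b, c, d\<close> the three contributions combine because
  \<open>g1 + g2 + g3\<close> is normal to it.\<close>

lemma gauss_tet:
  fixes u :: "real^3 \<Rightarrow> real^3"
  assumes t: "tet a b c d" and u: "\<And>x. (u has_derivative u' x) (at x)"
    and u': "\<And>v. continuous_on UNIV (\<lambda>x. u' x v)"
  shows "(LINT x:(convex hull {a, b, c, d})|lebesgue. (\<Sum>i\<in>Basis. u' x i \<bullet> i)) =
    face_integral (convex hull {b, c, d}) (\<lambda>x. out_normal b c d a \<bullet> u x) +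
    face_integral (convex hull {a, c, d}) (\<lambda>x. out_normal a c d b \<bullet> u x) +
    face_integral (convex hull {a, d, b}) (\<lambda>x. out_normal a d b c \<bullet> u x) +
    face_integral (convex hull {a, b, c}) (\<lambda>x. out_normal a b c d \<bullet> u x)"
proof -
  let ?K = "convex hull {a, b, c, d}"
  define w1 w2 w3 where "w1 = b - a" and "w2 = c - a" and "w3 = d - a"
  define g1 g2 g3 where "g1 = cross3 w2 w3" and "g2 = cross3 w3 w1" and "g3 = cross3 w1 w2"
  define D where "D = cross3 w1 w2 \<bullet> w3"
  have D: "D \<noteq> 0" using t by (simp add: tet_def D_def w1_def w2_def w3_def)
  have D': "cross3 w2 w3 \<bullet> w1 = D" "cross3 w3 w1 \<bullet> w2 = D" unfolding D_def by (metis cross_triple)+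
  have cu: "continuous_on UNIV u" using u has_derivative_continuous_on by blast
  have lin: "linear (u' x)" for x using u has_derivative_linear by blast
  have cr: "D *\<^sub>R y = (g1 \<bullet> y) *\<^sub>R w1 + (g2 \<bullet> y) *\<^sub>R w2 + (g3 \<bullet> y) *\<^sub>R w3" for y
    unfolding D_def g1_def g2_def g3_def by (rule cramer3)
  have div: "D * (\<Sum>i\<in>Basis. u' x i \<bullet> i) = g1 \<bullet> u' x w1 + g2 \<bullet> u' x w2 + g3 \<bullet> u' x w3" for x
  proof -
    have e: "g \<bullet> y = (\<Sum>i\<in>Basis. (g \<bullet> i) * (y \<bullet> i))" for g y :: "real^3" by (rule euclidean_inner)
    have "D * (u' x i \<bullet> i) = (g1 \<bullet> i) * (u' x w1 \<bullet> i) + (g2 \<bullet> i) * (u' x w2 \<bullet> i) + (g3 \<bullet> i) * (u' x w3 \<bullet> i)" for i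
    proof -
      have "D * (u' x i \<bullet> i) = u' x (D *\<^sub>R i) \<bullet> i" by (simp add: linear_scale[OF lin])
      then show ?thesis
        unfolding cr by (simp add: linear_add[OF lin] linear_scale[OF lin] inner_add_left)
    qed
    then show ?thesis
      unfolding e[of g1 "u' x w1"] e[of g2 "u' x w2"] e[of g3 "u' x w3"] by (simp add: sum_distrib_left sum.distrib)
  qed
  have int: "set_integrable lebesgue ?K (\<lambda>x. g \<bullet> u' x v)" for g v
    by (intro set_integrable_compact(2) finite_imp_compact_convex_hull continuous_intros continuous_on_subset[OF u' subset_UNIV]) simp
  have dir: "(LINT x:(convex hull {a, p, q, r})|lebesgue. g \<bullet> u' x (p - a)) = \<bar>cross3 (p - a) (q - a) \<bullet> (r - a)\<bar> *
    (tri p q r (\<lambda>x. g \<bullet> u x) - tri a q r (\<lambda>x. g \<bullet> u x))" if "tet a p q r" for p q r g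
    by (rule tet_directional_integral[OF that, where f' = "\<lambda>x v. g \<bullet> u' x v"])
      (auto intro!: has_derivative_inner_right u continuous_intros u')
  have K2: "convex hull {a, c, d, b} = ?K" "convex hull {a, d, b, c} = ?K"
    by (simp_all add: insert_commute)
  have t2: "tet a c d b" "tet a d b c" using tet_perms[OF t] by auto
  have tt: "tet b c d a" "tet a c d b" "tet a d b c" "tet a b c d" using tet_perms[OF t] t by auto
  let ?T = "\<lambda>p q r g. tri p q r (\<lambda>x. g \<bullet> u x)"
  have c: "continuous_on UNIV (\<lambda>x. g \<bullet> u x)" for g by (intro continuous_intros cu)
  have tadd: "?T b c d (g + h) = ?T b c d g + ?T b c d h" for g h
  proof -
    have "continuous_on simplex2 (\<lambda>v. g \<bullet> u (b + v$1 *\<^sub>R (c - b) + v$2 *\<^sub>R (d - b)))" for g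
      by (rule continuous_on_compose2[OF c]) (auto intro!: continuous_intros)
    then show ?thesis
      unfolding tri_def inner_add_left by (intro set_integral_add set_integrable_compact(1) compact_simplex2)
  qed
  have N0: "cross3 (c - b) (d - b) = g1 + g2 + g3"
    by (simp add: g1_def g2_def g3_def w1_def w2_def w3_def vec_eq_iff forall_3 cross3_def vector_3 algebra_simps)
  have rot: "?T c d b g = ?T b c d g" "?T d b c g = ?T b c d g" for g
  proof -
    show "?T c d b g = ?T b c d g" by (rule tri_rotate[OF tet_cross_nz[OF tt(1)] c])
    show "?T d b c g = ?T b c d g"
      using tri_rotate[of b d c, OF _ c, of g] tet_cross_nz[of d b c a] tet_perms(8)[OF t] by simp
  qed
  have "D * (LINT x:?K|lebesgue. (\<Sum>i\<in>Basis. u' x i \<bullet> i)) =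
      (LINT x:?K|lebesgue. g1 \<bullet> u' x w1 + g2 \<bullet> u' x w2 + g3 \<bullet> u' x w3)"
    unfolding div[symmetric] by simp
  also have "\<dots> = (LINT x:?K|lebesgue. g1 \<bullet> u' x w1) + (LINT x:?K|lebesgue. g2 \<bullet> u' x w2) + (LINT x:?K|lebesgue. g3 \<bullet> u' x w3)"
    using int by (simp add: set_integral_add)
  also have "\<dots> = \<bar>D\<bar> * (?T b c d g1 - ?T a c d g1) + \<bar>D\<bar> * (?T c d b g2 - ?T a d b g2) + \<bar>D\<bar> * (?T d b c g3 - ?T a b c g3)"
    using dir[OF t, of g1] dir[OF t2(1), of g2] dir[OF t2(2), of g3] D'
    by (simp add: K2 w1_def[symmetric] w2_def[symmetric] w3_def[symmetric] D_def[symmetric])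
  also have "\<dots> = \<bar>D\<bar> * (?T b c d (g1 + g2 + g3) - ?T a c d g1 - ?T a d b g2 - ?T a b c g3)"
    by (simp only: rot tadd right_diff_distrib distrib_left)
  also have "\<dots> = D * (sgn D * (?T b c d (g1 + g2 + g3) - ?T a c d g1 - ?T a d b g2 - ?T a b c g3))"
    by (simp add: abs_sgn)
  finally have *: "(LINT x:?K|lebesgue. (\<Sum>i\<in>Basis. u' x i \<bullet> i)) =
      sgn D * (?T b c d (g1 + g2 + g3) - ?T a c d g1 - ?T a d b g2 - ?T a b c g3)"
    using D by simp
  have s0: "cross3 (c - b) (d - b) \<bullet> (a - b) = - D"
  proof -
    have "a - b = - w1" by (simp add: w1_def)
    then show ?thesis unfolding N0 using D'
      by (simp add: inner_add_left g1_def g2_def g3_def dot_cross_self)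
  qed
  have N: "cross3 (c - a) (d - a) = g1" "cross3 (d - a) (b - a) = g2" "cross3 (b - a) (c - a) = g3"
    by (simp_all add: g1_def g2_def g3_def w1_def w2_def w3_def)
  have sg: "g1 \<bullet> (b - a) = D" "g2 \<bullet> (c - a) = D" "g3 \<bullet> (d - a) = D" "(g1 + g2 + g3) \<bullet> (a - b) = - D"
    using D' s0 unfolding g1_def g2_def g3_def N0 by (simp_all add: w1_def w2_def w3_def D_def)
  show ?thesis
    unfolding * tri_cross_face_integral[OF tt(1) cu, symmetric] tri_cross_face_integral[OF tt(2) cu, symmetric]
      tri_cross_face_integral[OF tt(3) cu, symmetric] tri_cross_face_integral[OF tt(4) cu, symmetric] N0 N sg
    by (simp only: sgn_minus minus_minus right_diff_distrib mult_minus_left diff_conv_add_uminus distrib_left mult_minus_right)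
qed

section \<open>Test functions\<close>

text \<open>All derivatives of \<open>exp (- (1 / t))\<close>, extended by zero, are combinations of
  this family; the power \<open>n\<close> makes it closed under differentiation.\<close>

definition flat_exp :: "nat \<Rightarrow> real \<Rightarrow> real" where
  "flat_exp n t = (if 0 < t then (1 / t) ^ n * exp (- (1 / t)) else 0)"

lemma flat_exp_tendsto_0: "(flat_exp n \<longlongrightarrow> 0) (at_right 0)"
proof -
  have "((\<lambda>x::real. x ^ n / exp x) \<longlongrightarrow> 0) at_top" by (rule tendsto_power_div_exp_0)
  from filterlim_compose[OF this filterlim_inverse_at_top_right]
  have "((\<lambda>t::real. inverse t ^ n / exp (inverse t)) \<longlongrightarrow> 0) (at_right 0)" .
  moreover have "\<forall>\<^sub>F t in at_right 0. inverse t ^ n / exp (inverse t) = flat_exp n t"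
    by (auto simp: eventually_at_right_less flat_exp_def exp_minus field_simps eventually_at_filter)
  ultimately show ?thesis using tendsto_cong by fast
qed

lemma flat_exp_deriv:
  "(flat_exp n has_real_derivative (flat_exp (n + 2) t - real n * flat_exp (n + 1) t)) (at t)"
proof -
  consider "t < 0" | "t = 0" | "0 < t" by linarith
  then show ?thesis
  proof cases
    case 1
    have "((\<lambda>_. 0) has_real_derivative 0) (at t)" by simp
    moreover have "\<forall>\<^sub>F s in nhds t. 0 = flat_exp n s"
      using eventually_nhds_in_open[of "{..<0}" t] 1 by (auto elim!: eventually_mono simp: flat_exp_def)
    ultimately have "(flat_exp n has_real_derivative 0) (at t)"
      by (subst (asm) DERIV_cong_ev[OF refl _ refl])
    then show ?thesis using 1 by (simp add: flat_exp_def)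
  next
    case 2
    \<comment> \<open>For \<open>h > 0\<close> the difference quotient at 0 is
      \<open>flat_exp (Suc n) h\<close>.\<close>
    have "((\<lambda>h. flat_exp n h / h) \<longlongrightarrow> 0) (at 0)"
    proof (rule filterlim_split_at)
      show "((\<lambda>h. flat_exp n h / h) \<longlongrightarrow> 0) (at_left 0)"
        by (rule Lim_transform_eventually[of "\<lambda>_. 0"]) (auto simp: eventually_at_filter flat_exp_def)
      show "((\<lambda>h. flat_exp n h / h) \<longlongrightarrow> 0) (at_right 0)"
        by (rule Lim_transform_eventually[OF flat_exp_tendsto_0[of "Suc n"]])
          (auto simp: eventually_at_filter flat_exp_def)
    qed
    then show ?thesis using 2 by (simp add: DERIV_def flat_exp_def)
  next
    case 3
    have i: "((\<lambda>s. 1 / s) has_real_derivative - (1 / t\<^sup>2)) (at t)"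
      using 3 by (auto intro!: derivative_eq_intros simp: power2_eq_square)
    have e: "((\<lambda>s. exp (- (1 / s))) has_real_derivative exp (- (1 / t)) * (1 / t\<^sup>2)) (at t)"
      using DERIV_fun_exp[OF DERIV_minus[OF i]] by simp
    have "((\<lambda>s. (1 / s) ^ n * exp (- (1 / s))) has_real_derivative
      (flat_exp (n + 2) t - real n * flat_exp (n + 1) t)) (at t)"
    proof (cases n)
      case 0
      then show ?thesis using e 3 by (simp add: flat_exp_def power2_eq_square field_simps)
    next
      case (Suc m)
      show ?thesis
        unfolding Suc
        by (rule DERIV_cong[OF DERIV_mult[OF DERIV_power_Suc[OF i, of m] e]])
          (use 3 in \<open>simp add: flat_exp_def power2_eq_square field_simps\<close>)
    qed
    moreover have "\<forall>\<^sub>F s in nhds t. (1 / s) ^ n * exp (- (1 / s)) = flat_exp n s"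
      using eventually_nhds_in_open[of "{0<..}" t] 3 by (auto elim!: eventually_mono simp: flat_exp_def)
    ultimately show ?thesis
      by (subst (asm) DERIV_cong_ev[OF refl _ refl])
  qed
qed

text \<open>An algebra generated by constants and flat functions of affine arguments. It is closed
  under differentiation, so smoothness of all orders follows by one induction on the order.\<close>

inductive smooth_gen :: "(real^3 \<Rightarrow> real) \<Rightarrow> bool" where
  flat: "smooth_gen (\<lambda>x. flat_exp n (c + g \<bullet> x))"
| const: "smooth_gen (\<lambda>_. c)"
| add: "smooth_gen f \<Longrightarrow> smooth_gen h \<Longrightarrow> smooth_gen (\<lambda>x. f x + h x)"
| mult: "smooth_gen f \<Longrightarrow> smooth_gen h \<Longrightarrow> smooth_gen (\<lambda>x. f x * h x)"

lemma smooth_gen_deriv: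
  "smooth_gen f \<Longrightarrow> \<exists>f'. (\<forall>x. (f has_derivative f' x) (at x)) \<and> (\<forall>v. smooth_gen (\<lambda>x. f' x v))"
proof (induction rule: smooth_gen.induct)
  case (flat n c g)
  have "((\<lambda>x. flat_exp n (c + g \<bullet> x)) has_derivative
      (\<lambda>v. (flat_exp (n + 2) (c + g \<bullet> x) - real n * flat_exp (n + 1) (c + g \<bullet> x)) * (g \<bullet> v))) (at x)" for x
  proof -
    have "((\<lambda>x. c + g \<bullet> x) has_derivative (\<lambda>v. g \<bullet> v)) (at x)" by (auto intro!: derivative_eq_intros)
    from has_derivative_compose[OF this flat_exp_deriv[unfolded has_field_derivative_def]]
    show ?thesis by simp
  qed
  moreover have "smooth_gen (\<lambda>x. (flat_exp (n + 2) (c + g \<bullet> x) - real n * flat_exp (n + 1) (c + g \<bullet> x)) * (g \<bullet> v))" for v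
  proof -
    have "smooth_gen (\<lambda>x. (flat_exp (n + 2) (c + g \<bullet> x) + (- real n) * flat_exp (n + 1) (c + g \<bullet> x)) * (g \<bullet> v))"
      by (intro smooth_gen.intros)
    then show ?thesis by simp
  qed
  ultimately show ?case
    by (intro exI[of _ "\<lambda>x v. (flat_exp (n + 2) (c + g \<bullet> x) - real n * flat_exp (n + 1) (c + g \<bullet> x)) * (g \<bullet> v)"]) simp
next
  case (const c)
  then show ?case by (intro exI[of _ "\<lambda>_ _. 0"]) (auto intro: smooth_gen.const)
next
  case (add f h)
  then obtain f' h' where "\<forall>x. (f has_derivative f' x) (at x)" "\<forall>v. smooth_gen (\<lambda>x. f' x v)"
    "\<forall>x. (h has_derivative h' x) (at x)" "\<forall>v. smooth_gen (\<lambda>x. h' x v)" by blast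
  then show ?case
    by (intro exI[of _ "\<lambda>x v. f' x v + h' x v"]) (auto intro!: has_derivative_add smooth_gen.add)
next
  case (mult f h)
  then obtain f' h' where "\<forall>x. (f has_derivative f' x) (at x)" "\<forall>v. smooth_gen (\<lambda>x. f' x v)"
    "\<forall>x. (h has_derivative h' x) (at x)" "\<forall>v. smooth_gen (\<lambda>x. h' x v)" by blast
  with mult show ?case
    by (intro exI[of _ "\<lambda>x v. f x * h' x v + f' x v * h x"])
      (auto intro!: has_derivative_mult smooth_gen.add smooth_gen.mult)
qed

lemma smooth_gen_C_k: "smooth_gen f \<Longrightarrow> C_k k f"
proof (induction k arbitrary: f)
  case 0
  then obtain f' where "\<forall>x. (f has_derivative f' x) (at x)" using smooth_gen_deriv by blast
  then have "continuous_on UNIV f" by (intro has_derivative_continuous_on) auto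
  then show ?case by simp
next
  case (Suc k)
  then obtain f' where f': "\<forall>x. (f has_derivative f' x) (at x)" "\<forall>v. smooth_gen (\<lambda>x. f' x v)"
    using smooth_gen_deriv[of f] by blast
  then show ?case unfolding C_k.simps using Suc.IH by blast
qed

lemma test_function_C1: "test_function \<Omega> \<phi> \<Longrightarrow> C1_map \<phi>"
proof -
  assume "test_function \<Omega> \<phi>"
  then have "C_k (Suc 0) \<phi>" unfolding test_function_def by blast
  then show ?thesis unfolding C_k.simps C1_map_def .
qed

lemma flat_exp_0_bounds: "0 \<le> flat_exp 0 t" "flat_exp 0 t \<le> 1" "0 < t \<Longrightarrow> 0 < flat_exp 0 t" "flat_exp 0 t \<noteq> 0 \<Longrightarrow> 0 < t"
  by (auto simp: flat_exp_def split: if_splits)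

text \<open>A bump in \<open>g \<bullet> (x - x0)\<close>, supported in a layer around the plane
  through \<open>x0\<close>. Its value on the plane itself does not depend on the thickness
  \<open>r\<close>, which later keeps a face integral fixed while the support shrinks.\<close>

definition slab :: "real^3 \<Rightarrow> real^3 \<Rightarrow> real \<Rightarrow> real^3 \<Rightarrow> real" where
  "slab x0 g r x = flat_exp 0 (1 + (g \<bullet> (x - x0)) / r) * flat_exp 0 (1 - (g \<bullet> (x - x0)) / r)"

lemma slab_bounds: "0 \<le> slab x0 g r x" "slab x0 g r x \<le> 1"
  using flat_exp_0_bounds(1,2) by (auto simp: slab_def mult_le_one)

lemma slab_nz: "0 < r \<Longrightarrow> slab x0 g r x \<noteq> 0 \<longleftrightarrow> \<bar>g \<bullet> (x - x0)\<bar> < r"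
proof -
  assume r: "0 < r"
  have "slab x0 g r x \<noteq> 0 \<longleftrightarrow> 0 < 1 + (g \<bullet> (x - x0)) / r \<and> 0 < 1 - (g \<bullet> (x - x0)) / r"
    by (simp add: slab_def flat_exp_def)
  also have "\<dots> \<longleftrightarrow> \<bar>g \<bullet> (x - x0)\<bar> < r" using r by (auto simp: field_simps)
  finally show ?thesis .
qed

lemma slab_plane: "g \<bullet> (x - x0) = 0 \<Longrightarrow> slab x0 g r x = flat_exp 0 1 * flat_exp 0 1"
  by (simp add: slab_def)

lemma slab_smooth: "smooth_gen (slab x0 g r)"
proof -
  have "smooth_gen (\<lambda>x. flat_exp 0 ((1 - (g \<bullet> x0) / r) + ((1 / r) *\<^sub>R g) \<bullet> x) *
     flat_exp 0 ((1 + (g \<bullet> x0) / r) + ((- 1 / r) *\<^sub>R g) \<bullet> x))"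
    by (intro smooth_gen.intros)
  moreover have "(\<lambda>x. flat_exp 0 ((1 - (g \<bullet> x0) / r) + ((1 / r) *\<^sub>R g) \<bullet> x) *
     flat_exp 0 ((1 + (g \<bullet> x0) / r) + ((- 1 / r) *\<^sub>R g) \<bullet> x)) = slab x0 g r"
    by (rule ext) (simp add: slab_def inner_diff_right diff_divide_distrib add_divide_distrib algebra_simps)
  ultimately show ?thesis by simp
qed

definition box_bump :: "real^3 \<Rightarrow> real \<Rightarrow> real^3 \<Rightarrow> real" where
  "box_bump x0 r x = slab x0 (axis 1 1) r x * slab x0 (axis 2 1) r x * slab x0 (axis 3 1) r x"

lemma box_bump_smooth: "smooth_gen (box_bump x0 r)"
  unfolding box_bump_def[abs_def] by (intro smooth_gen.mult slab_smooth)

lemma box_bump_bounds: "0 \<le> box_bump x0 r x" "box_bump x0 r x \<le> 1"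
  unfolding box_bump_def by (auto intro!: mult_nonneg_nonneg mult_le_one slab_bounds)

lemma box_bump_pos: "0 < r \<Longrightarrow> 0 < box_bump x0 r x0"
  using flat_exp_0_bounds(3)[of 1] by (simp add: box_bump_def slab_plane)

text \<open>Each coordinate differs by at most \<open>r\<close>, and the Euclidean norm is bounded
  by the sum of the three.\<close>

lemma box_bump_support: "0 < r \<Longrightarrow> box_bump x0 r x \<noteq> 0 \<Longrightarrow> dist x0 x \<le> 3 * r"
proof -
  assume r: "0 < r" and nz: "box_bump x0 r x \<noteq> 0"
  have "\<bar>(x - x0) $ i\<bar> \<le> r" for i
  proof -
    have "slab x0 (axis i 1) r x \<noteq> 0" using exhaust_3[of i] nz by (auto simp: box_bump_def)
    then show ?thesis using slab_nz[OF r, of x0 "axis i 1" x] by (simp add: inner_axis')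
  qed
  then have "(\<Sum>i\<in>UNIV. \<bar>(x - x0) $ i\<bar>) \<le> (\<Sum>i\<in>(UNIV::3 set). r)" by (intro sum_mono) auto
  then show ?thesis using norm_le_l1_cart[of "x - x0"] by (simp add: dist_norm norm_minus_commute)
qed

lemma smooth_gen_test_function:
  assumes f: "smooth_gen f" and s: "\<And>x. f x \<noteq> 0 \<Longrightarrow> dist x0 x \<le> \<rho>" and b: "cball x0 \<rho> \<subseteq> \<Omega>"
  shows "test_function \<Omega> f"
proof -
  have "closure {x. f x \<noteq> 0} \<subseteq> cball x0 \<rho>" using s by (intro closure_minimal) auto
  then have "compact (closure {x. f x \<noteq> 0})" "closure {x. f x \<noteq> 0} \<subseteq> \<Omega>"
    using b by (auto simp: compact_eq_bounded_closed intro: bounded_subset bounded_cball)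
  then show ?thesis using f smooth_gen_C_k by (auto simp: test_function_def)
qed

section \<open>Facets of a tetrahedron\<close>

lemma simplex_3_iff_tet: "3 simplex K \<longleftrightarrow> (\<exists>a b c d. tet a b c d \<and> K = convex hull {a, b, c, d})"
proof
  assume "3 simplex K"
  then obtain C where C: "\<not> affine_dependent C" "card C = 4" "K = convex hull C"
    by (auto simp: simplex_def)
  then obtain a b c d where "C = {a, b, c, d}"
    by (auto simp: card_Suc_eq eval_nat_numeral)
  then show "\<exists>a b c d. tet a b c d \<and> K = convex hull {a, b, c, d}" using C tet_iff by blast
next
  assume "\<exists>a b c d. tet a b c d \<and> K = convex hull {a, b, c, d}"
  then obtain a b c d where "tet a b c d" "K = convex hull {a, b, c, d}" by blast
  moreover from this have "\<not> affine_dependent {a, b, c, d} \<and> int (card {a, b, c, d}) = 3 + 1" unfolding tet_iff by linarith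
  ultimately show "3 simplex K" unfolding simplex_def by metis
qed

definition facets :: "(real^3) set \<Rightarrow> (real^3) set set" where
  "facets K = {F. F face_of K \<and> aff_dim F = 2}"

lemma convex_hull_subset_affine_independent:
  assumes C: "\<not> affine_dependent C" and sub: "A \<subseteq> C" "B \<subseteq> C" "convex hull A \<subseteq> convex hull B"
  shows "A \<subseteq> B"
proof
  fix v assume v: "v \<in> A"
  show "v \<in> B"
  proof (rule ccontr)
    assume "v \<notin> B"
    have "v \<in> convex hull B" using v sub(3) hull_inc[of v A convex] by auto
    moreover have "B \<subseteq> C - {v}" using \<open>v \<notin> B\<close> sub(2) by blast
    then have "convex hull B \<subseteq> affine hull (C - {v})"
      by (meson order_trans hull_mono convex_hull_subset_affine_hull)
    ultimately have "v \<in> affine hull (C - {v})" "v \<in> C" using v sub(1) by auto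
    then show False using C unfolding affine_dependent_def by auto
  qed
qed

lemma face_of_tet:
  assumes t: "tet a b c d"
  shows "F face_of convex hull {a, b, c, d} \<longleftrightarrow> (\<exists>S\<subseteq>{a, b, c, d}. F = convex hull S)"
  using t face_of_convex_hull_affine_independent unfolding tet_iff by blast

lemma aff_dim_hull_card:
  assumes "\<not> affine_dependent C" "S \<subseteq> C"
  shows "aff_dim (convex hull S) = int (card S) - 1"
  using aff_dim_affine_independent[OF affine_independent_subset[OF assms]] by (simp add: aff_dim_convex_hull)

lemma facetE:
  assumes t: "tet a b c d" and F: "F face_of convex hull {a, b, c, d}" "aff_dim F = 2"
  obtains p q r s where "tet p q r s" "{p, q, r, s} = {a, b, c, d}" "F = convex hull {p, q, r}"
proof -
  let ?C = "{a, b, c, d}"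
  have C: "\<not> affine_dependent ?C" "card ?C = 4" using t tet_iff by auto
  obtain A where A: "A \<subseteq> ?C" "F = convex hull A" using F(1) face_of_tet[OF t] by blast
  have fin: "finite A" using A(1) finite_subset by (metis finite.emptyI finite_insert)
  have cA: "card A = 3" using aff_dim_hull_card[OF C(1) A(1)] F(2) A(2) by simp
  then obtain p q r where A': "A = {p, q, r}" by (auto simp: card_3_iff)
  have "card (?C - A) = 1" using C(2) cA fin A(1) by (simp add: card_Diff_subset)
  then obtain s where s: "?C - A = {s}" by (auto simp: card_1_singleton_iff)
  have "?C = A \<union> {s}" using s A(1) by blast
  then have eq: "{p, q, r, s} = ?C" using A' by blast
  show ?thesis using that[OF tet_set_cong[OF t eq] eq] A(2) A' by simp
qed

lemma edgeE:
  assumes t: "tet a b c d" and e: "e face_of convex hull {a, b, c, d}" "aff_dim e = 1"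
  obtains p q r s where "tet p q r s" "{p, q, r, s} = {a, b, c, d}" "e = convex hull {p, q}"
proof -
  let ?C = "{a, b, c, d}"
  have C: "\<not> affine_dependent ?C" "card ?C = 4" using t tet_iff by auto
  obtain A where A: "A \<subseteq> ?C" "e = convex hull A" using e(1) face_of_tet[OF t] by blast
  have fin: "finite A" using A(1) finite_subset by (metis finite.emptyI finite_insert)
  have cA: "card A = 2" using aff_dim_hull_card[OF C(1) A(1)] e(2) A(2) by simp
  then obtain p q where A': "A = {p, q}" by (auto simp: card_2_iff)
  have "card (?C - A) = 2" using C(2) cA fin A(1) by (simp add: card_Diff_subset)
  then obtain r s where s: "?C - A = {r, s}" by (auto simp: card_2_iff)
  have "?C = A \<union> {r, s}" using s A(1) by blast
  then have eq: "{p, q, r, s} = ?C" using A' by blast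
  show ?thesis using that[OF tet_set_cong[OF t eq] eq] A(2) A' by simp
qed

lemma aff_dim_tet_faces:
  assumes "tet a b c d"
  shows "aff_dim (convex hull {a, b}) = 1" "aff_dim (convex hull {a, b, c}) = 2" "aff_dim (convex hull {a, b, c, d}) = 3"
proof -
  have C: "\<not> affine_dependent {a, b, c, d}" and ne: "a \<noteq> b" "a \<noteq> c" "b \<noteq> c" "card {a, b, c, d} = 4"
    using assms by (auto simp: tet_iff card_insert_if split: if_splits)
  show "aff_dim (convex hull {a, b}) = 1" "aff_dim (convex hull {a, b, c}) = 2" "aff_dim (convex hull {a, b, c, d}) = 3"
    using aff_dim_hull_card[OF C, of "{a, b}"] aff_dim_hull_card[OF C, of "{a, b, c}"] aff_dim_hull_card[OF C, of "{a, b, c, d}"] ne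
    by auto
qed

lemma tet_face_hull: "tet a b c d \<Longrightarrow> S \<subseteq> {a, b, c, d} \<Longrightarrow> convex hull S face_of convex hull {a, b, c, d}"
  using face_of_tet by blast

lemma tet_hull_inj:
  assumes "tet a b c d" "A \<subseteq> {a, b, c, d}" "B \<subseteq> {a, b, c, d}" "convex hull A = convex hull B"
  shows "A = B"
  using convex_hull_subset_affine_independent[of "{a, b, c, d}" A B] convex_hull_subset_affine_independent[of "{a, b, c, d}" B A]
    assms tet_iff by blast

lemma tet_distinct: "tet a b c d \<Longrightarrow> a \<noteq> b \<and> a \<noteq> c \<and> a \<noteq> d \<and> b \<noteq> c \<and> b \<noteq> d \<and> c \<noteq> d"
  by (auto simp: tet_iff card_insert_if split: if_splits)

lemma facets_tet:
  assumes t: "tet a b c d"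
  shows "facets (convex hull {a, b, c, d}) = {convex hull {b, c, d}, convex hull {a, c, d}, convex hull {a, d, b}, convex hull {a, b, c}}"
    (is "_ = ?R")
proof
  show "facets (convex hull {a, b, c, d}) \<subseteq> ?R"
  proof
    fix F assume "F \<in> facets (convex hull {a, b, c, d})"
    then obtain p q r s where *: "tet p q r s" "{p, q, r, s} = {a, b, c, d}" "F = convex hull {p, q, r}"
      using facetE[OF t] unfolding facets_def by blast
    then have "{p, q, r} = {a, b, c, d} - {s}" using tet_distinct[OF *(1)] by blast
    moreover have "s \<in> {a, b, c, d}" using * by blast
    ultimately have "{p, q, r} \<in> {{b, c, d}, {a, c, d}, {a, d, b}, {a, b, c}}"
      using tet_distinct[OF t] by auto
    then show "F \<in> ?R" using *(3) by auto
  qed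
  have "aff_dim (convex hull {b, c, d}) = 2" "aff_dim (convex hull {a, c, d}) = 2" "aff_dim (convex hull {a, d, b}) = 2" "aff_dim (convex hull {a, b, c}) = 2"
    using aff_dim_tet_faces(2) tet_perms[OF t] t by blast+
  then show "?R \<subseteq> facets (convex hull {a, b, c, d})"
    unfolding facets_def using tet_face_hull[OF t] by auto
qed

lemma facets_tet_sum:
  assumes t: "tet a b c d"
  shows "(\<Sum>F\<in>facets (convex hull {a, b, c, d}). f F) =
    f (convex hull {b, c, d}) + f (convex hull {a, c, d}) + f (convex hull {a, d, b}) + (f (convex hull {a, b, c}) :: real)"
proof -
  note i = tet_hull_inj[OF t] and n = tet_distinct[OF t]
  have ne: "convex hull A \<noteq> convex hull B" if "x \<in> A" "x \<notin> B" "A \<subseteq> {a, b, c, d}" "B \<subseteq> {a, b, c, d}" for x A B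
    using i[of A B] that by auto
  have "convex hull {b, c, d} \<noteq> convex hull {a, c, d}" by (rule ne[of b]) (use n in auto)
  moreover have "convex hull {b, c, d} \<noteq> convex hull {a, d, b}" by (rule ne[of c]) (use n in auto)
  moreover have "convex hull {b, c, d} \<noteq> convex hull {a, b, c}" by (rule ne[of d]) (use n in auto)
  moreover have "convex hull {a, c, d} \<noteq> convex hull {a, d, b}" by (rule ne[of c]) (use n in auto)
  moreover have "convex hull {a, c, d} \<noteq> convex hull {a, b, c}" by (rule ne[of d]) (use n in auto)
  moreover have "convex hull {a, d, b} \<noteq> convex hull {a, b, c}" by (rule ne[of d]) (use n in auto)
  ultimately show ?thesis unfolding facets_tet[OF t] by simp
qed

lemma unit_normal_hull:
  "unit_normal (convex hull {a, b, c}) n \<longleftrightarrow> norm n = 1 \<and> n \<bullet> (b - a) = 0 \<and> n \<bullet> (c - a) = 0"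
proof
  assume "unit_normal (convex hull {a, b, c}) n"
  then show "norm n = 1 \<and> n \<bullet> (b - a) = 0 \<and> n \<bullet> (c - a) = 0"
    unfolding unit_normal_def using hull_inc[of a "{a,b,c}" convex] hull_inc[of b "{a,b,c}" convex] hull_inc[of c "{a,b,c}" convex] by auto
next
  assume *: "norm n = 1 \<and> n \<bullet> (b - a) = 0 \<and> n \<bullet> (c - a) = 0"
  have "n \<bullet> (x - a) = 0" if "x \<in> convex hull {a, b, c}" for x
    using that * by (auto simp: convex_hull_3_image inner_add_right)
  then have "n \<bullet> (y - x) = 0" if "x \<in> convex hull {a, b, c}" "y \<in> convex hull {a, b, c}" for x y
    using that by (metis (no_types, lifting) diff_add_cancel diff_diff_eq2 inner_diff_right right_minus_eq)
  then show "unit_normal (convex hull {a, b, c}) n" unfolding unit_normal_def using * by blast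
qed

text \<open>The expansion of \<open>cross3 n (cross3 u v)\<close> vanishes, so \<open>n\<close> is
  parallel to \<open>cross3 u v\<close>; the coefficient is that of the orthogonal
  projection.\<close>

lemma parallel_cross:
  assumes "n \<bullet> u = 0" "n \<bullet> v = 0" "cross3 u v \<noteq> 0"
  shows "n = ((cross3 u v \<bullet> n) / (cross3 u v \<bullet> cross3 u v)) *\<^sub>R cross3 u v"
proof -
  let ?N = "cross3 u v"
  have "cross3 n ?N = 0" using assms Lagrange[of n u v] by simp
  then have "(?N \<bullet> ?N) *\<^sub>R n - (?N \<bullet> n) *\<^sub>R ?N = 0" using Lagrange[of ?N n ?N] by simp
  then have "(?N \<bullet> ?N) *\<^sub>R n = (?N \<bullet> n) *\<^sub>R ?N" by simp
  then have "(1 / (?N \<bullet> ?N)) *\<^sub>R ((?N \<bullet> ?N) *\<^sub>R n) = (1 / (?N \<bullet> ?N)) *\<^sub>R ((?N \<bullet> n) *\<^sub>R ?N)" by simp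
  then show ?thesis using assms(3) by simp
qed

lemma unit_normal_cases:
  assumes N: "cross3 (b - a) (c - a) \<noteq> 0" and n: "unit_normal (convex hull {a, b, c}) n"
  shows "n = (1 / norm (cross3 (b - a) (c - a))) *\<^sub>R cross3 (b - a) (c - a) \<or>
    n = (- 1 / norm (cross3 (b - a) (c - a))) *\<^sub>R cross3 (b - a) (c - a)"
proof -
  let ?N = "cross3 (b - a) (c - a)"
  define k where "k = (?N \<bullet> n) / (?N \<bullet> ?N)"
  have n': "norm n = 1" "n \<bullet> (b - a) = 0" "n \<bullet> (c - a) = 0" using n unfolding unit_normal_hull by auto
  have nk: "n = k *\<^sub>R ?N" unfolding k_def by (rule parallel_cross[OF n'(2,3) N])
  then have "\<bar>k\<bar> * norm ?N = 1" using n'(1) by (metis norm_scaleR)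
  then have "\<bar>k\<bar> = 1 / norm ?N" using N by (simp add: field_simps)
  then have "k = 1 / norm ?N \<or> k = - 1 / norm ?N" by (auto simp: abs_if split: if_splits)
  then show ?thesis using nk by blast
qed

section \<open>Outward normals of the facets\<close>

text \<open>Defined from the sets alone, since the elements of a mesh carry no order of their
  vertices; \<open>outn_tet\<close> evaluates it in any order.\<close>

definition outn :: "(real^3) set \<Rightarrow> (real^3) set \<Rightarrow> real^3" where
  "outn K F = (SOME \<nu>. unit_normal F \<nu> \<and> (\<forall>x\<in>K. \<forall>y\<in>F. \<nu> \<bullet> (x - y) \<le> 0))"

lemma out_normal_props:
  assumes t: "tet a b c d"
  shows "unit_normal (convex hull {a, b, c}) (out_normal a b c d)" "out_normal a b c d \<bullet> (d - a) < 0"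
proof -
  let ?N = "cross3 (b - a) (c - a)"
  have N: "?N \<noteq> 0" "?N \<bullet> (d - a) \<noteq> 0" using t tet_cross_nz by (auto simp: tet_def)
  show "unit_normal (convex hull {a, b, c}) (out_normal a b c d)"
    unfolding unit_normal_hull using N by (simp add: out_normal_def dot_cross_self sgn_if)
  have "out_normal a b c d \<bullet> (d - a) = - (\<bar>?N \<bullet> (d - a)\<bar> / norm ?N)"
    by (simp add: out_normal_def abs_sgn mult.commute)
  then show "out_normal a b c d \<bullet> (d - a) < 0" using N by simp
qed

text \<open>A unit normal of a triangle is determined up to sign, and the fourth vertex decides the
  sign.\<close>

lemma outn_tet:
  assumes t: "tet a b c d"
  shows "outn (convex hull {a, b, c, d}) (convex hull {a, b, c}) = out_normal a b c d"
proof -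
  let ?P = "\<lambda>\<nu>. unit_normal (convex hull {a, b, c}) \<nu> \<and> (\<forall>x\<in>convex hull {a, b, c, d}. \<forall>y\<in>convex hull {a, b, c}. \<nu> \<bullet> (x - y) \<le> 0)"
  note o = out_normal_props[OF t]
  have o': "out_normal a b c d \<bullet> (b - a) = 0" "out_normal a b c d \<bullet> (c - a) = 0" using o(1) unfolding unit_normal_hull by auto
  have ex: "?P (out_normal a b c d)"
  proof (intro conjI ballI o(1))
    fix x y assume x: "x \<in> convex hull {a, b, c, d}" and y: "y \<in> convex hull {a, b, c}"
    obtain u where u: "x = a + u$1 *\<^sub>R (b - a) + u$2 *\<^sub>R (c - a) + u$3 *\<^sub>R (d - a)" "u \<in> simplex3"
      using x unfolding convex_hull_4_image by blast
    have "out_normal a b c d \<bullet> (x - a) = u$3 * (out_normal a b c d \<bullet> (d - a))"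
      using o' unfolding u(1) by (simp add: inner_add_right)
    then have "out_normal a b c d \<bullet> (x - a) \<le> 0" using o(2) u(2) by (auto simp: simplex3_def mult_le_0_iff)
    moreover have "out_normal a b c d \<bullet> (y - a) = 0"
      using o(1) y hull_inc[of a "{a,b,c}" convex] unfolding unit_normal_def by auto
    ultimately show "out_normal a b c d \<bullet> (x - y) \<le> 0" by (simp add: inner_diff_right)
  qed
  have uniq: "\<nu> = out_normal a b c d" if "?P \<nu>" for \<nu>
  proof -
    let ?N = "cross3 (b - a) (c - a)"
    have N: "?N \<noteq> 0" "?N \<bullet> (d - a) \<noteq> 0" using t tet_cross_nz by (auto simp: tet_def)
    have le: "\<nu> \<bullet> (d - a) \<le> 0" using that hull_inc[of d "{a,b,c,d}" convex] hull_inc[of a "{a,b,c}" convex] by blast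
    from unit_normal_cases[OF N(1)] that consider "\<nu> = (1 / norm ?N) *\<^sub>R ?N" | "\<nu> = (- 1 / norm ?N) *\<^sub>R ?N" by blast
    then show ?thesis
    proof cases
      case 1
      then have "?N \<bullet> (d - a) < 0" using le N by (auto simp: divide_le_0_iff)
      then show ?thesis using 1 by (simp add: out_normal_def)
    next
      case 2
      then have "?N \<bullet> (d - a) > 0" using le N by (auto simp: zero_le_divide_iff)
      then show ?thesis using 2 by (simp add: out_normal_def)
    qed
  qed
  show ?thesis unfolding outn_def by (rule some_equality[of ?P, OF ex uniq])
qed

lemma gauss_facets:
  fixes u :: "real^3 \<Rightarrow> real^3"
  assumes K: "3 simplex K" and u: "\<And>x. (u has_derivative u' x) (at x)"
    and u': "\<And>v. continuous_on UNIV (\<lambda>x. u' x v)"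
  shows "(LINT x:K|lebesgue. (\<Sum>i\<in>Basis. u' x i \<bullet> i)) = (\<Sum>F\<in>facets K. face_integral F (\<lambda>x. outn K F \<bullet> u x))"
proof -
  obtain a b c d where t: "tet a b c d" and K': "K = convex hull {a, b, c, d}" using simplex_3_iff_tet[THEN iffD1, OF K] by blast
  have e: "K = convex hull {b, c, d, a}" "K = convex hull {a, c, d, b}" "K = convex hull {a, d, b, c}"
    unfolding K' by (simp_all add: insert_commute)
  have "outn K (convex hull {b, c, d}) = out_normal b c d a" "outn K (convex hull {a, c, d}) = out_normal a c d b"
    "outn K (convex hull {a, d, b}) = out_normal a d b c" "outn K (convex hull {a, b, c}) = out_normal a b c d"
    using outn_tet[OF tet_perms(4)[OF t]] outn_tet[OF tet_perms(5)[OF t]] outn_tet[OF tet_perms(6)[OF t]] outn_tet[OF t]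
    unfolding e[symmetric] K'[symmetric] by simp_all
  then show ?thesis
    using gauss_tet[OF t u u'] facets_tet_sum[OF t, of "\<lambda>F. face_integral F (\<lambda>x. outn K F \<bullet> u x)"]
    unfolding K'[symmetric] by simp
qed

section \<open>Barycentric coordinates\<close>

text \<open>The barycentric coordinate of the last vertex \<open>d\<close>, as a ratio of signed
  volumes; it vanishes on the plane of \<open>a\<close>, \<open>b\<close>, \<open>c\<close>.\<close>

definition bary :: "real^3 \<Rightarrow> real^3 \<Rightarrow> real^3 \<Rightarrow> real^3 \<Rightarrow> real^3 \<Rightarrow> real" where
  "bary a b c d y = (cross3 (b - a) (c - a) \<bullet> (y - a)) / (cross3 (b - a) (c - a) \<bullet> (d - a))"

lemma bary_repr:
  assumes t: "tet a b c d"
  shows "y = a + bary a c d b y *\<^sub>R (b - a) + bary a d b c y *\<^sub>R (c - a) + bary a b c d y *\<^sub>R (d - a)"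
proof -
  let ?D = "cross3 (b - a) (c - a) \<bullet> (d - a)"
  have D: "?D \<noteq> 0" "cross3 (c - a) (d - a) \<bullet> (b - a) = ?D" "cross3 (d - a) (b - a) \<bullet> (c - a) = ?D"
    using t by (auto simp: tet_def) (metis cross_triple)+
  have "?D *\<^sub>R (y - a) = ?D *\<^sub>R (bary a c d b y *\<^sub>R (b - a) + bary a d b c y *\<^sub>R (c - a) + bary a b c d y *\<^sub>R (d - a))"
    unfolding bary_def D(2,3) using D(1) by (simp add: scaleR_add_right cramer3[of "b - a" "c - a" "d - a" "y - a"])
  then have "y - a = bary a c d b y *\<^sub>R (b - a) + bary a d b c y *\<^sub>R (c - a) + bary a b c d y *\<^sub>R (d - a)"
    using D(1) by (metis real_vector.scale_left_imp_eq)
  then show ?thesis by (simp add: algebra_simps)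
qed

lemma bary_affine:
  assumes "tet a b c d"
  shows "bary a b c d (a + s *\<^sub>R (b - a) + r *\<^sub>R (c - a) + z *\<^sub>R (d - a)) = z"
  using assms by (simp add: bary_def tet_def inner_add_right dot_cross_self)

lemma bary_opposite:
  assumes t: "tet a b c d"
  shows "bary b c d a (a + s *\<^sub>R (b - a) + r *\<^sub>R (c - a) + z *\<^sub>R (d - a)) = 1 - s - r - z"
proof -
  have "a + s *\<^sub>R (b - a) + r *\<^sub>R (c - a) + z *\<^sub>R (d - a) = b + r *\<^sub>R (c - b) + z *\<^sub>R (d - b) + (1 - s - r - z) *\<^sub>R (a - b)"
    by (simp add: algebra_simps)
  then show ?thesis using bary_affine[OF tet_perms(4)[OF t]] by simp
qed

lemma tet_mem_iff:
  assumes t: "tet a b c d"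
  shows "y \<in> convex hull {a, b, c, d} \<longleftrightarrow> 0 \<le> bary a c d b y \<and> 0 \<le> bary a d b c y \<and> 0 \<le> bary a b c d y \<and> 0 \<le> bary b c d a y"
proof
  assume "y \<in> convex hull {a, b, c, d}"
  then obtain u where u: "y = a + u$1 *\<^sub>R (b - a) + u$2 *\<^sub>R (c - a) + u$3 *\<^sub>R (d - a)" "u \<in> simplex3"
    unfolding convex_hull_4_image by blast
  have "bary a c d b y = u$1" "bary a d b c y = u$2" "bary a b c d y = u$3" "bary b c d a y = 1 - u$1 - u$2 - u$3"
    using bary_affine[OF tet_perms(5)[OF t], of "u$2" "u$3" "u$1"] bary_affine[OF tet_perms(6)[OF t], of "u$3" "u$1" "u$2"]
      bary_affine[OF t, of "u$1" "u$2" "u$3"] bary_opposite[OF t, of "u$1" "u$2" "u$3"] unfolding u(1)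
    by (simp_all add: add_ac)
  then show "0 \<le> bary a c d b y \<and> 0 \<le> bary a d b c y \<and> 0 \<le> bary a b c d y \<and> 0 \<le> bary b c d a y"
    using u(2) by (auto simp: simplex3_def)
next
  assume *: "0 \<le> bary a c d b y \<and> 0 \<le> bary a d b c y \<and> 0 \<le> bary a b c d y \<and> 0 \<le> bary b c d a y"
  have "bary b c d a y = 1 - bary a c d b y - bary a d b c y - bary a b c d y"
    using bary_opposite[OF t] bary_repr[OF t, of y] by metis
  then have "vector [bary a c d b y, bary a d b c y, bary a b c d y] \<in> simplex3"
    using * by (auto simp: simplex3_def vector_3)
  then show "y \<in> convex hull {a, b, c, d}"
    unfolding convex_hull_4_image
    by (rule image_eqI[rotated]) (subst bary_repr[OF t, of y], simp add: vector_3)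
qed

lemma bary_continuous: "continuous_on S (bary a b c d)"
  unfolding bary_def divide_inverse by (intro continuous_intros)

text \<open>At a relatively interior point of the face the other three barycentric coordinates are
  positive and stay so nearby; membership is then decided by the sign of the fourth, hence by the
  outward normal.\<close>

lemma tet_half_space:
  assumes t: "tet a b c d" and x: "x \<in> rel_interior (convex hull {a, b, c})"
  shows "\<exists>\<epsilon>>0. \<forall>y. dist x y < \<epsilon> \<longrightarrow> (y \<in> convex hull {a, b, c, d} \<longleftrightarrow> out_normal a b c d \<bullet> (y - x) \<le> 0)"
proof -
  have n: "a \<noteq> b" "a \<noteq> c" "b \<noteq> c" using tet_distinct[OF t] by auto
  have "\<not> affine_dependent {a, b, c}"
    using t tet_iff affine_independent_subset[of "{a,b,c,d}" "{a,b,c}"] by blast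
  then obtain u where u: "0 < u a" "0 < u b" "0 < u c" "u a + u b + u c = 1" "x = u a *\<^sub>R a + u b *\<^sub>R b + u c *\<^sub>R c"
    using x rel_interior_convex_hull_explicit[of "{a, b, c}"] n by (auto simp: add.assoc)
  have xr: "x = a + u b *\<^sub>R (b - a) + u c *\<^sub>R (c - a) + 0 *\<^sub>R (d - a)"
  proof -
    have ua: "u a = 1 - u b - u c" using u(4) by simp
    show ?thesis unfolding u(5) ua by (simp add: algebra_simps)
  qed
  have pos: "0 < bary a c d b x" "0 < bary a d b c x" "0 < bary b c d a x"
    using bary_affine[OF tet_perms(5)[OF t], of "u c" 0 "u b"] bary_affine[OF tet_perms(6)[OF t], of 0 "u b" "u c"]
      bary_opposite[OF t, of "u b" "u c" 0] u xr by (auto simp: add_ac)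
  have op: "open {y. 0 < bary a c d b y}" "open {y. 0 < bary a d b c y}" "open {y. 0 < bary b c d a y}"
    by (intro open_Collect_less continuous_intros bary_continuous)+
  have "open ({y. 0 < bary a c d b y} \<inter> {y. 0 < bary a d b c y} \<inter> {y. 0 < bary b c d a y})" using op by blast
  moreover have "x \<in> {y. 0 < bary a c d b y} \<inter> {y. 0 < bary a d b c y} \<inter> {y. 0 < bary b c d a y}" using pos by blast
  ultimately obtain \<epsilon> where \<epsilon>: "\<epsilon> > 0" "ball x \<epsilon> \<subseteq> {y. 0 < bary a c d b y} \<inter> {y. 0 < bary a d b c y} \<inter> {y. 0 < bary b c d a y}"
    using open_contains_ball by blast
  have "0 \<le> bary a b c d y \<longleftrightarrow> out_normal a b c d \<bullet> (y - x) \<le> 0" for y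
  proof -
    let ?N = "cross3 (b - a) (c - a)"
    have N: "norm ?N > 0" "?N \<bullet> (d - a) \<noteq> 0" using t tet_cross_nz by (auto simp: tet_def)
    have "?N \<bullet> (x - a) = 0" unfolding xr by (simp add: inner_add_right dot_cross_self)
    then have "?N \<bullet> (y - x) = ?N \<bullet> (y - a)" by (simp add: inner_diff_right)
    then have "out_normal a b c d \<bullet> (y - x) = - (sgn (?N \<bullet> (d - a)) * (?N \<bullet> (y - a)) / norm ?N)"
      by (simp add: out_normal_def)
    moreover have "0 \<le> bary a b c d y \<longleftrightarrow> 0 \<le> sgn (?N \<bullet> (d - a)) * (?N \<bullet> (y - a))"
      using N(2) by (auto simp: bary_def sgn_if zero_le_divide_iff)
    ultimately show ?thesis using N(1) by (simp add: zero_le_divide_iff)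
  qed
  then have "y \<in> convex hull {a, b, c, d} \<longleftrightarrow> out_normal a b c d \<bullet> (y - x) \<le> 0" if "dist x y < \<epsilon>" for y
    using \<epsilon>(2) that unfolding tet_mem_iff[OF t] by (force simp: subset_iff less_imp_le)
  then show ?thesis using \<epsilon>(1) by blast
qed

lemma facet_vertices:
  assumes "3 simplex K" "F \<in> facets K"
  obtains a b c d where "tet a b c d" "K = convex hull {a, b, c, d}" "F = convex hull {a, b, c}"
proof -
  obtain a b c d where t: "tet a b c d" and K: "K = convex hull {a, b, c, d}"
    using simplex_3_iff_tet[THEN iffD1, OF assms(1)] by blast
  have F: "F face_of convex hull {a, b, c, d}" "aff_dim F = 2" using assms(2) by (auto simp: facets_def K)
  obtain p q r s where "tet p q r s" "{p, q, r, s} = {a, b, c, d}" "F = convex hull {p, q, r}"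
    by (rule facetE[OF t F])
  then show ?thesis using that K by metis
qed

lemma facet_half_space:
  assumes K: "3 simplex K" "F \<in> facets K" and x: "x \<in> rel_interior F"
  shows "\<exists>\<epsilon>>0. \<forall>y. dist x y < \<epsilon> \<longrightarrow> (y \<in> K \<longleftrightarrow> outn K F \<bullet> (y - x) \<le> 0)"
proof -
  obtain a b c d where t: "tet a b c d" and K: "K = convex hull {a, b, c, d}" and F: "F = convex hull {a, b, c}"
    by (rule facet_vertices[OF K])
  show ?thesis using tet_half_space[OF t x[unfolded F]] unfolding K F outn_tet[OF t] .
qed

lemma facet_outn_unit: "3 simplex K \<Longrightarrow> F \<in> facets K \<Longrightarrow> unit_normal F (outn K F)"
proof -
  assume KF: "3 simplex K" "F \<in> facets K"
  obtain a b c d where t: "tet a b c d" and K: "K = convex hull {a, b, c, d}" and F: "F = convex hull {a, b, c}"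
    by (rule facet_vertices[OF KF])
  show ?thesis using out_normal_props(1)[OF t] unfolding K F outn_tet[OF t] .
qed

lemma facet_unit_normal_cases:
  assumes "3 simplex K" "F \<in> facets K" "unit_normal F n"
  shows "n = outn K F \<or> n = - outn K F"
proof -
  obtain a b c d where t: "tet a b c d" and K: "K = convex hull {a, b, c, d}" and F: "F = convex hull {a, b, c}"
    by (rule facet_vertices[OF assms(1,2)])
  have "out_normal a b c d = (1 / norm (cross3 (b - a) (c - a))) *\<^sub>R cross3 (b - a) (c - a) \<or>
    out_normal a b c d = (- 1 / norm (cross3 (b - a) (c - a))) *\<^sub>R cross3 (b - a) (c - a)"
    by (rule unit_normal_cases[OF tet_cross_nz[OF t] out_normal_props(1)[OF t]])
  moreover have "n = (1 / norm (cross3 (b - a) (c - a))) *\<^sub>R cross3 (b - a) (c - a) \<or>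
    n = (- 1 / norm (cross3 (b - a) (c - a))) *\<^sub>R cross3 (b - a) (c - a)"
    by (rule unit_normal_cases[OF tet_cross_nz[OF t]]) (use assms F in simp)
  ultimately show ?thesis unfolding K F outn_tet[OF t] by auto
qed

section \<open>Piecewise polynomials on a triangulation\<close>

abbreviation fderiv :: "('a::real_normed_vector \<Rightarrow> 'b::real_normed_vector) \<Rightarrow> 'a \<Rightarrow> 'a \<Rightarrow> 'b" where
  "fderiv f x \<equiv> frechet_derivative f (at x)"

lemma C1_map_fderiv:
  assumes "C1_map f"
  shows "(f has_derivative fderiv f x) (at x)" "continuous_on S (\<lambda>x. fderiv f x v)"
proof -
  obtain f' where f': "\<And>x. (f has_derivative f' x) (at x)" "\<And>v. continuous_on UNIV (\<lambda>x. f' x v)"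
    using assms unfolding C1_map_def by blast
  have "f' x = fderiv f x" for x by (rule frechet_derivative_at[OF f'(1)])
  then show "(f has_derivative fderiv f x) (at x)" "continuous_on S (\<lambda>x. fderiv f x v)"
    using f' continuous_on_subset[OF f'(2) subset_UNIV] by auto
qed

definition dvg :: "(real^3 \<Rightarrow> real^3) \<Rightarrow> real^3 \<Rightarrow> real" where
  "dvg \<sigma> x = (\<Sum>b\<in>Basis. fderiv \<sigma> x b \<bullet> b)"

lemma dvg_continuous: "C1_map \<sigma> \<Longrightarrow> continuous_on S (dvg \<sigma>)"
  unfolding dvg_def[abs_def] by (intro continuous_intros C1_map_fderiv)

lemma facet_props:
  assumes "F \<in> facets K" "3 simplex K"
  shows "compact F" "convex F" "aff_dim F = 2" "F \<subseteq> K" "closed F" "F \<noteq> {}"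
proof -
  obtain a b c d where t: "tet a b c d" and K: "K = convex hull {a, b, c, d}" and F: "F = convex hull {a, b, c}"
    by (rule facet_vertices[OF assms(2,1)])
  show "compact F" "convex F" unfolding F by (auto simp: finite_imp_compact_convex_hull)
  then show "closed F" using compact_imp_closed by blast
  show "aff_dim F = 2" "F \<subseteq> K" using assms(1) face_of_imp_subset by (auto simp: facets_def)
  then show "F \<noteq> {}" by auto
qed

lemma finite_facets: "3 simplex K \<Longrightarrow> finite (facets K)"
proof -
  assume "3 simplex K"
  then obtain a b c d where t: "tet a b c d" and K: "K = convex hull {a, b, c, d}"
    using simplex_3_iff_tet[THEN iffD1] by blast
  show ?thesis unfolding K facets_tet[OF t] by simp
qed

text \<open>Gauss' theorem for the product \<open>\<phi> x *\<^sub>R \<sigma> x\<close>.\<close>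

lemma integration_by_parts:
  assumes K: "3 simplex K" and \<phi>: "C1_map \<phi>" and \<sigma>: "C1_map (\<sigma> :: real^3 \<Rightarrow> real^3)"
  shows "(LINT x:K|lebesgue. fderiv \<phi> x (\<sigma> x)) + (LINT x:K|lebesgue. \<phi> x * dvg \<sigma> x) =
    (\<Sum>F\<in>facets K. face_integral F (\<lambda>x. \<phi> x * (outn K F \<bullet> \<sigma> x)))"
    and "continuous_on S (\<lambda>x. fderiv \<phi> x (\<sigma> x))"
proof -
  note d\<phi> = C1_map_fderiv(1)[OF \<phi>] and d\<sigma> = C1_map_fderiv(1)[OF \<sigma>]
  note c\<phi> = C1_map_continuous[OF \<phi>] and c\<sigma> = C1_map_continuous[OF \<sigma>]
  define u' where "u' x v = \<phi> x *\<^sub>R fderiv \<sigma> x v + fderiv \<phi> x v *\<^sub>R \<sigma> x" for x v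
  have u: "((\<lambda>x. \<phi> x *\<^sub>R \<sigma> x) has_derivative u' x) (at x)" for x
    unfolding u'_def using has_derivative_scaleR[OF d\<phi> d\<sigma>] by simp
  have u'c: "continuous_on UNIV (\<lambda>x. u' x v)" for v
    unfolding u'_def by (intro continuous_intros c\<phi> c\<sigma> C1_map_fderiv(2) \<phi> \<sigma>)
  have e: "fderiv \<phi> x (\<sigma> x) = (\<Sum>b\<in>Basis. fderiv \<phi> x b * (\<sigma> x \<bullet> b))" for x
  proof -
    have lin: "linear (fderiv \<phi> x)" by (rule has_derivative_linear[OF d\<phi>])
    have "fderiv \<phi> x (\<sigma> x) = fderiv \<phi> x (\<Sum>b\<in>Basis. (\<sigma> x \<bullet> b) *\<^sub>R b)" by (simp add: euclidean_representation)
    then show ?thesis by (simp add: linear_sum[OF lin] linear_scale[OF lin] mult.commute)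
  qed
  show c: "continuous_on S (\<lambda>x. fderiv \<phi> x (\<sigma> x))" for S
    unfolding e by (intro continuous_intros c\<sigma> C1_map_fderiv(2) \<phi>)
  have tr: "(\<Sum>i\<in>Basis. u' x i \<bullet> i) = fderiv \<phi> x (\<sigma> x) + \<phi> x * dvg \<sigma> x" for x
    unfolding u'_def dvg_def e by (simp add: inner_add_left sum.distrib sum_distrib_left)
  have K': "compact K" using K compact_simplex by blast
  have "(LINT x:K|lebesgue. fderiv \<phi> x (\<sigma> x)) + (LINT x:K|lebesgue. \<phi> x * dvg \<sigma> x) =
      (LINT x:K|lebesgue. (\<Sum>i\<in>Basis. u' x i \<bullet> i))"
    unfolding tr by (intro set_integral_add(2)[symmetric] set_integrable_compact(2) K' c continuous_intros c\<phi> dvg_continuous \<sigma>)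
  also have "\<dots> = (\<Sum>F\<in>facets K. face_integral F (\<lambda>x. outn K F \<bullet> (\<phi> x *\<^sub>R \<sigma> x)))"
    by (rule gauss_facets[OF K u u'c])
  finally show "(LINT x:K|lebesgue. fderiv \<phi> x (\<sigma> x)) + (LINT x:K|lebesgue. \<phi> x * dvg \<sigma> x) =
    (\<Sum>F\<in>facets K. face_integral F (\<lambda>x. \<phi> x * (outn K F \<bullet> \<sigma> x)))" by simp
qed

lemma lint_interior:
  fixes f :: "real^3 \<Rightarrow> 'b::{banach, second_countable_topology}"
  assumes K: "compact K" "convex K" and f: "continuous_on K f"
  shows "set_integrable lebesgue (interior K) f" "(LINT x:interior K|lebesgue. f x) = (LINT x:K|lebesgue. f x)"
proof -
  have i: "set_integrable lebesgue K f" by (rule set_integrable_compact(2)[OF K(1) f])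
  then show ii: "set_integrable lebesgue (interior K) f"
    by (rule set_integrable_subset) (auto dest: subsetD[OF interior_subset])
  have "AE x in lebesgue. x \<notin> frontier K"
    using negligible_convex_frontier[OF K(2)] by (intro AE_not_in) (simp add: negligible_iff_null_sets)
  then have "AE x in lebesgue. indicator (interior K) x *\<^sub>R f x = indicator K x *\<^sub>R f x"
  proof (rule AE_mp, intro AE_I2 impI)
    fix x assume "x \<notin> frontier K"
    then have "x \<in> interior K \<longleftrightarrow> x \<in> K"
      using interior_subset[of K] closure_subset[of K] by (auto simp: frontier_def)
    then show "indicator (interior K) x *\<^sub>R f x = indicator K x *\<^sub>R f x" by (simp add: indicator_def)
  qed
  then show "(LINT x:interior K|lebesgue. f x) = (LINT x:K|lebesgue. f x)"
    using i ii unfolding set_lebesgue_integral_def set_integrable_def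
    by (intro integral_cong_AE borel_measurable_integrable)
qed

text \<open>Interiors of distinct elements of a mesh are disjoint, so at most one summand is
  nonzero; outside all interiors the value is 0, as \<open>Sigma_h\<close> requires of its
  representatives.\<close>

definition glue :: "(real^3) set set \<Rightarrow> ((real^3) set \<Rightarrow> real^3 \<Rightarrow> 'b::real_vector) \<Rightarrow> real^3 \<Rightarrow> 'b" where
  "glue \<T> P x = (\<Sum>K\<in>\<T>. indicat_real (interior K) x *\<^sub>R P K x)"

locale mesh =
  fixes \<Omega> :: "(real^3) set" and \<T> :: "(real^3) set set"
  assumes dom: "polyhedral_domain \<Omega>" and bnd: "bounded \<Omega>" and tri: "tet_triangulation \<Omega> \<T>"
begin

lemma finite_T: "finite \<T>" and simplex_T: "K \<in> \<T> \<Longrightarrow> 3 simplex K"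
  and face_Int: "K \<in> \<T> \<Longrightarrow> K' \<in> \<T> \<Longrightarrow> (K \<inter> K') face_of K" and Union_T: "\<Union>\<T> = closure \<Omega>"
  using tri unfolding tet_triangulation_def triangulation_def by auto

lemma open_dom: "open \<Omega>" and interior_closure_dom: "interior (closure \<Omega>) = \<Omega>"
  using dom by (auto simp: polyhedral_domain_def)

lemma compact_T: "K \<in> \<T> \<Longrightarrow> compact K" and convex_T: "K \<in> \<T> \<Longrightarrow> convex K" and closed_T: "K \<in> \<T> \<Longrightarrow> closed K"
  using simplex_T compact_simplex convex_simplex closed_simplex by blast+

lemma interior_T_subset: "K \<in> \<T> \<Longrightarrow> interior K \<subseteq> \<Omega>"
proof -
  assume "K \<in> \<T>"
  then have "K \<subseteq> closure \<Omega>" using Union_T by blast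
  then have "interior K \<subseteq> interior (closure \<Omega>)" by (rule interior_mono)
  then show ?thesis unfolding interior_closure_dom .
qed

lemma interior_T_nonempty: "K \<in> \<T> \<Longrightarrow> interior K \<noteq> {}"
proof -
  assume K: "K \<in> \<T>"
  have "aff_dim K = 3" using simplex_T[OF K] aff_dim_simplex by blast
  then have "affine hull K = UNIV" using aff_dim_eq_full[of K] by simp
  then have "rel_interior K = interior K" by (rule rel_interior_interior)
  then show ?thesis
    using rel_interior_eq_empty[OF convex_T[OF K]] \<open>aff_dim K = 3\<close> by auto
qed

lemma closure_interior_T: "K \<in> \<T> \<Longrightarrow> closure (interior K) = K"
  using convex_closure_interior[OF convex_T interior_T_nonempty] closed_T closure_closed by metis

lemma interior_T_disjoint:
  assumes K: "K \<in> \<T>" "K' \<in> \<T>" "K \<noteq> K'"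
  shows "interior K \<inter> interior K' = {}"
proof -
  have "K \<inter> K' \<noteq> K \<or> K \<inter> K' \<noteq> K'" using K(3) by blast
  moreover have "(K \<inter> K') face_of K" "(K \<inter> K') face_of K'" using face_Int[OF K(1,2)] face_Int[OF K(2,1)] by (auto simp: Int_commute)
  ultimately have "(K \<inter> K') \<inter> interior K = {} \<or> (K \<inter> K') \<inter> interior K' = {}"
    using face_of_disjoint_interior by blast
  then show ?thesis using interior_subset[of K] interior_subset[of K'] by blast
qed

lemma glue_interior: "K \<in> \<T> \<Longrightarrow> x \<in> interior K \<Longrightarrow> glue \<T> P x = P K x"
proof -
  assume K: "K \<in> \<T>" and x: "x \<in> interior K"
  have "(\<Sum>K'\<in>\<T> - {K}. indicat_real (interior K') x *\<^sub>R P K' x) = 0"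
    by (rule sum.neutral) (use interior_T_disjoint[OF K] x in \<open>auto simp: indicator_def\<close>)
  then show ?thesis
    unfolding glue_def sum.remove[OF finite_T K] using x by simp
qed

lemma glue_outside: "(\<And>K. K \<in> \<T> \<Longrightarrow> x \<notin> interior K) \<Longrightarrow> glue \<T> P x = 0"
  by (auto simp: glue_def intro!: sum.neutral)

text \<open>Here \<open>h\<close> stands for any expression built pointwise from a glued function,
  so that one lemma serves the function, its piecewise divergence and its squared norm.\<close>

lemma lint_glue:
  fixes h :: "real^3 \<Rightarrow> 'b::{banach, second_countable_topology}"
  assumes c: "\<And>K. K \<in> \<T> \<Longrightarrow> continuous_on UNIV (H K)"
    and i: "\<And>K x. K \<in> \<T> \<Longrightarrow> x \<in> interior K \<Longrightarrow> h x = H K x"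
    and o: "\<And>x. (\<And>K. K \<in> \<T> \<Longrightarrow> x \<notin> interior K) \<Longrightarrow> h x = 0"
  shows "set_integrable lebesgue \<Omega> h" "(LINT x:\<Omega>|lebesgue. h x) = (\<Sum>K\<in>\<T>. LINT x:K|lebesgue. H K x)"
proof -
  have ck: "continuous_on K (H K)" if "K \<in> \<T>" for K using c[OF that] continuous_on_subset by blast
  have e: "indicator \<Omega> x *\<^sub>R h x = (\<Sum>K\<in>\<T>. indicat_real (interior K) x *\<^sub>R H K x)" for x
  proof (cases "\<exists>K\<in>\<T>. x \<in> interior K")
    case True
    then obtain K where K: "K \<in> \<T>" "x \<in> interior K" by blast
    then have "(\<Sum>K\<in>\<T>. indicat_real (interior K) x *\<^sub>R H K x) = H K x"
      using glue_interior[of K x H] by (simp add: glue_def)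
    then show ?thesis using K i[OF K] interior_T_subset[OF K(1)] by (auto simp: indicator_def)
  next
    case False
    then show ?thesis using o[of x] glue_outside[of x H] by (simp add: glue_def)
  qed
  have int: "integrable lebesgue (\<lambda>x. indicat_real (interior K) x *\<^sub>R H K x)" if "K \<in> \<T>" for K
    using lint_interior(1)[OF compact_T[OF that] convex_T[OF that] ck[OF that]] unfolding set_integrable_def .
  show "set_integrable lebesgue \<Omega> h"
    unfolding set_integrable_def e by (intro Bochner_Integration.integrable_sum int)
  have "(LINT x:\<Omega>|lebesgue. h x) = (\<Sum>K\<in>\<T>. LINT x:interior K|lebesgue. H K x)"
    unfolding set_lebesgue_integral_def e by (intro Bochner_Integration.integral_sum int)
  also have "\<dots> = (\<Sum>K\<in>\<T>. LINT x:K|lebesgue. H K x)"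
    by (intro sum.cong refl lint_interior(2) compact_T convex_T ck)
  finally show "(LINT x:\<Omega>|lebesgue. h x) = (\<Sum>K\<in>\<T>. LINT x:K|lebesgue. H K x)" .
qed

text \<open>If the outward normals agreed, both elements would contain the same half ball at a
  relatively interior point of the facet, and their interiors would meet.\<close>

lemma shared_outn:
  assumes K: "K \<in> \<T>" "K' \<in> \<T>" "K \<noteq> K'" and F: "F \<in> facets K" "F \<in> facets K'"
  shows "outn K' F = - outn K F"
proof (rule ccontr)
  assume "outn K' F \<noteq> - outn K F"
  moreover have "outn K' F = outn K F \<or> outn K' F = - outn K F"
    by (rule facet_unit_normal_cases[OF simplex_T[OF K(1)] F(1) facet_outn_unit[OF simplex_T[OF K(2)] F(2)]])
  ultimately have eq: "outn K' F = outn K F" by blast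
  define \<nu> where "\<nu> = outn K F"
  have n1: "norm \<nu> = 1" using facet_outn_unit[OF simplex_T[OF K(1)] F(1)] by (simp add: unit_normal_def \<nu>_def)
  obtain x where x: "x \<in> rel_interior F"
    using rel_interior_eq_empty facet_props[OF F(1) simplex_T[OF K(1)]] by blast
  obtain e1 where e1: "e1 > 0" "\<And>y. dist x y < e1 \<Longrightarrow> y \<in> K \<longleftrightarrow> \<nu> \<bullet> (y - x) \<le> 0"
    using facet_half_space[OF simplex_T[OF K(1)] F(1) x] \<nu>_def by blast
  obtain e2 where e2: "e2 > 0" "\<And>y. dist x y < e2 \<Longrightarrow> y \<in> K' \<longleftrightarrow> \<nu> \<bullet> (y - x) \<le> 0"
    using facet_half_space[OF simplex_T[OF K(2)] F(2) x] \<nu>_def eq by metis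
  define \<delta> where "\<delta> = min e1 e2 / 2"
  have \<delta>: "\<delta> > 0" "\<delta> < e1" "\<delta> < e2" using e1(1) e2(1) by (auto simp: \<delta>_def min_def)
  let ?U = "ball x (min e1 e2) \<inter> {y. \<nu> \<bullet> (y - x) < 0}"
  have "open ?U" by (intro open_Int open_ball open_Collect_less continuous_intros)
  moreover have "?U \<subseteq> K" "?U \<subseteq> K'" using e1(2) e2(2) by auto
  ultimately have "?U \<subseteq> interior K \<inter> interior K'" by (simp add: interior_maximal)
  moreover have "x - \<delta> *\<^sub>R \<nu> \<in> ?U"
    using \<delta> n1 by (auto simp: dist_norm inner_diff_right power2_norm_eq_inner[symmetric])
  ultimately show False using interior_T_disjoint[OF K] by blast
qed

lemma facet_outn_nz: "K \<in> \<T> \<Longrightarrow> F \<in> facets K \<Longrightarrow> outn K F \<noteq> 0"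
  using facet_outn_unit[OF simplex_T, of K F] unfolding unit_normal_def by (metis norm_zero zero_neq_one)

text \<open>Three elements at one facet would have pairwise opposite outward normals there, making a
  normal its own negative.\<close>

lemma adj_unique:
  assumes "K \<in> \<T>" "K' \<in> \<T>" "K'' \<in> \<T>" "F \<in> facets K" "F \<in> facets K'" "F \<in> facets K''" "K \<noteq> K'" "K \<noteq> K''"
  shows "K' = K''"
proof (rule ccontr)
  assume "K' \<noteq> K''"
  then have "outn K'' F = - outn K' F" "outn K' F = - outn K F" "outn K'' F = - outn K F"
    using shared_outn assms by blast+
  then have "outn K F = - outn K F" by simp
  then have "outn K F = 0" by (simp add: vec_eq_iff)
  then show False using facet_outn_nz[OF assms(1,4)] by simp
qed

text \<open>By conformity \<open>K \<inter> K'\<close> is a face of \<open>K\<close>. It meets the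
  relative interior of \<open>F\<close>, so it contains \<open>F\<close>; being a proper face it has
  dimension at most 2, so it equals \<open>F\<close>.\<close>

lemma facet_local:
  assumes K: "K \<in> \<T>" "F \<in> facets K" and x: "x \<in> rel_interior F" and K': "K' \<in> \<T>" "x \<in> K'"
  shows "F \<in> facets K'"
proof (cases "K' = K")
  case False
  note fp = facet_props[OF K(2) simplex_T[OF K(1)]]
  have g: "(K \<inter> K') face_of K" by (rule face_Int[OF K(1) K'(1)])
  have xK: "x \<in> K \<inter> K'" using x rel_interior_subset[of F] fp(4) K'(2) by blast
  have sub: "F \<subseteq> K \<inter> K'"
    by (rule subset_of_face_of[OF g fp(4)]) (use x xK in blast)
  have ne: "K \<inter> K' \<noteq> K"
  proof
    assume "K \<inter> K' = K"
    then have "interior K \<subseteq> interior K'" by (metis Int_lower2 interior_mono)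
    then show False using interior_T_disjoint[OF K(1) K'(1)] False interior_T_nonempty[OF K(1)] by blast
  qed
  have "F face_of (K \<inter> K')"
    using K(2) sub face_of_subset[of F K "K \<inter> K'"] unfolding facets_def by blast
  moreover have "aff_dim (K \<inter> K') \<le> 2"
    using face_of_aff_dim_lt[OF convex_T[OF K(1)] g ne] aff_dim_simplex[OF simplex_T[OF K(1)]] by simp
  moreover have "convex (K \<inter> K')" using convex_T K(1) K'(1) convex_Int by blast
  ultimately have "F = K \<inter> K'"
    using face_of_aff_dim_lt[of "K \<inter> K'" F] fp(3) by (cases "F = K \<inter> K'") auto
  then have "F face_of K'" using face_Int[OF K'(1) K(1)] by (simp add: Int_commute)
  then show ?thesis using fp(3) by (simp add: facets_def)
qed (use K in simp)

lemma others_away: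
  assumes "finite \<A>" "\<And>A. A \<in> \<A> \<Longrightarrow> closed A" "\<And>A. A \<in> \<A> \<Longrightarrow> x \<notin> A"
  shows "\<exists>\<epsilon>>0. \<forall>A\<in>\<A>. ball (x::real^3) \<epsilon> \<inter> A = {}"
proof -
  have "open (- \<Union>\<A>)" using assms by (simp add: closed_Union open_Compl)
  moreover have "x \<in> - \<Union>\<A>" using assms by blast
  ultimately obtain \<epsilon> where "\<epsilon> > 0" "ball x \<epsilon> \<subseteq> - \<Union>\<A>" using open_contains_ball by blast
  then show ?thesis by (intro exI[of _ \<epsilon>]) auto
qed

text \<open>From a relatively interior point of \<open>F\<close> lying in the open set \<Omega> a
  short outward step stays in \<Omega> but leaves \<open>K\<close>. It would have to end in another
  element, yet by \<open>facet_local\<close> all other elements keep a distance from the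
  point.\<close>

lemma unshared_facet:
  assumes K: "K \<in> \<T>" "F \<in> facets K" and only: "\<And>K'. K' \<in> \<T> \<Longrightarrow> F \<in> facets K' \<Longrightarrow> K' = K"
  shows "F \<inter> \<Omega> = {}"
proof -
  note fp = facet_props[OF K(2) simplex_T[OF K(1)]]
  have ri: "x \<notin> \<Omega>" if x: "x \<in> rel_interior F" for x
  proof
    assume "x \<in> \<Omega>"
    then obtain e0 where e0: "e0 > 0" "ball x e0 \<subseteq> \<Omega>" using open_dom open_contains_ball by blast
    have "\<exists>\<epsilon>>0. \<forall>A\<in>\<T> - {K}. ball x \<epsilon> \<inter> A = {}"
    proof (rule others_away)
      show "x \<notin> K'" if "K' \<in> \<T> - {K}" for K' using facet_local[OF K x, of K'] only[of K'] that by auto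
    qed (use finite_T closed_T in auto)
    then obtain e1 where e1: "e1 > 0" "\<forall>A\<in>\<T> - {K}. ball x e1 \<inter> A = {}" by blast
    obtain e2 where e2: "e2 > 0" "\<And>y. dist x y < e2 \<Longrightarrow> y \<in> K \<longleftrightarrow> outn K F \<bullet> (y - x) \<le> 0"
      using facet_half_space[OF simplex_T[OF K(1)] K(2) x] by blast
    define \<delta> where "\<delta> = min (min e0 e1) e2 / 2"
    have \<delta>: "\<delta> > 0" "\<delta> < e0" "\<delta> < e1" "\<delta> < e2" using e0 e1 e2 by (auto simp: \<delta>_def min_def)
    define y where "y = x + \<delta> *\<^sub>R outn K F"
    have n1: "norm (outn K F) = 1" using facet_outn_unit[OF simplex_T[OF K(1)] K(2)] by (simp add: unit_normal_def)
    then have dy: "dist x y = \<delta>" using \<delta> by (simp add: y_def dist_norm)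
    have "y \<in> closure \<Omega>" using e0(2) dy \<delta> closure_subset by fastforce
    then obtain K' where K': "K' \<in> \<T>" "y \<in> K'" using Union_T by blast
    have "y \<in> ball x e1" using dy \<delta> by simp
    then have "K' = K" using K' e1(2) by blast
    then have "outn K F \<bullet> (y - x) \<le> 0" using e2(2)[of y] dy \<delta> K' by simp
    then show False using \<delta> n1 by (simp add: y_def power2_norm_eq_inner[symmetric])
  qed
  have "closure (rel_interior F) \<subseteq> - \<Omega>"
    using ri open_dom by (intro closure_minimal) auto
  then show ?thesis using convex_closure_rel_interior[OF fp(2)] fp(5) by (auto simp: closure_closed)
qed

text \<open>The two half balls fill a ball inside \<open>closure \<Omega>\<close>, and \<Omega> is
  the interior of its closure.\<close>

lemma shared_facet_interior:
  assumes K: "K \<in> \<T>" "K' \<in> \<T>" "K \<noteq> K'" and F: "F \<in> facets K" "F \<in> facets K'" and x: "x \<in> rel_interior F"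
  shows "x \<in> \<Omega>"
proof -
  obtain e1 where e1: "e1 > 0" "\<And>y. dist x y < e1 \<Longrightarrow> y \<in> K \<longleftrightarrow> outn K F \<bullet> (y - x) \<le> 0"
    using facet_half_space[OF simplex_T[OF K(1)] F(1) x] by blast
  obtain e2 where e2: "e2 > 0" "\<And>y. dist x y < e2 \<Longrightarrow> y \<in> K' \<longleftrightarrow> - outn K F \<bullet> (y - x) \<le> 0"
    using facet_half_space[OF simplex_T[OF K(2)] F(2) x] shared_outn[OF K F] by metis
  have "ball x (min e1 e2) \<subseteq> K \<union> K'"
  proof
    fix y assume "y \<in> ball x (min e1 e2)"
    then show "y \<in> K \<union> K'" using e1(2)[of y] e2(2)[of y] by (cases "outn K F \<bullet> (y - x) \<le> 0") auto
  qed
  also have "\<dots> \<subseteq> closure \<Omega>" using Union_T K by blast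
  finally have "x \<in> interior (closure \<Omega>)" using e1(1) e2(1) by (meson centre_in_ball interiorI min_less_iff_conj open_ball)
  then show ?thesis unfolding interior_closure_dom .
qed

end

section \<open>Normal continuity and the space H(div)\<close>

definition pdiv :: "(real^3 \<Rightarrow> real^3^3) \<Rightarrow> real^3 \<Rightarrow> real^3" where
  "pdiv p x = (\<chi> i. dvg (\<lambda>x. p x $ i) x)"

lemma C1_map_row: "C1_map (p :: real^3 \<Rightarrow> real^3^3) \<Longrightarrow> C1_map (\<lambda>x. p x $ i)"
  by (rule C1_map_linear_comp[OF _ bounded_linear_vec_nth])

lemma pdiv_continuous: "C1_map p \<Longrightarrow> continuous_on S (pdiv p)"
  unfolding pdiv_def[abs_def] by (intro continuous_on_vec_lambda dvg_continuous C1_map_row)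

context mesh begin

definition normal_continuous :: "((real^3) set \<Rightarrow> real^3 \<Rightarrow> real^3^3) \<Rightarrow> bool" where
  "normal_continuous P \<longleftrightarrow> (\<forall>K\<in>\<T>. \<forall>K'\<in>\<T>. \<forall>F. F \<in> facets K \<and> F \<in> facets K' \<longrightarrow>
     (\<forall>x\<in>F. P K x *v outn K F = P K' x *v outn K F))"

text \<open>Integration by parts on each element; the sum of all facet fluxes is what separates the
  piecewise divergence from a weak one.\<close>

lemma glue_weak:
  assumes \<phi>: "C1_map \<phi>" and P: "\<forall>K\<in>\<T>. C1_map (P K)"
  shows "set_integrable lebesgue \<Omega> (\<lambda>x. \<phi> x * glue \<T> (\<lambda>K. pdiv (P K)) x $ i)"
    and "(LINT x:\<Omega>|lebesgue. fderiv \<phi> x (glue \<T> P x $ i)) + (LINT x:\<Omega>|lebesgue. \<phi> x * glue \<T> (\<lambda>K. pdiv (P K)) x $ i) =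
      (\<Sum>K\<in>\<T>. \<Sum>F\<in>facets K. face_integral F (\<lambda>x. \<phi> x * (outn K F \<bullet> P K x $ i)))"
proof -
  note row = C1_map_row[OF bspec[OF P]]
  have lin: "linear (fderiv \<phi> x)" for x by (rule has_derivative_linear[OF C1_map_fderiv(1)[OF \<phi>]])
  have 1: "(LINT x:\<Omega>|lebesgue. fderiv \<phi> x (glue \<T> P x $ i)) = (\<Sum>K\<in>\<T>. LINT x:K|lebesgue. fderiv \<phi> x (P K x $ i))"
    by (rule lint_glue(2)) (auto simp: glue_interior glue_outside linear_0[OF lin] integration_by_parts(2)[OF simplex_T \<phi> row])
  have c2: "continuous_on UNIV (\<lambda>x. \<phi> x * dvg (\<lambda>x. P K x $ i) x)" if "K \<in> \<T>" for K
    by (intro continuous_intros C1_map_continuous[OF \<phi>] dvg_continuous row that)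
  have 2: "set_integrable lebesgue \<Omega> (\<lambda>x. \<phi> x * glue \<T> (\<lambda>K. pdiv (P K)) x $ i) \<and>
    (LINT x:\<Omega>|lebesgue. \<phi> x * glue \<T> (\<lambda>K. pdiv (P K)) x $ i) = (\<Sum>K\<in>\<T>. LINT x:K|lebesgue. \<phi> x * dvg (\<lambda>x. P K x $ i) x)"
    by (intro conjI lint_glue[where H = "\<lambda>K x. \<phi> x * dvg (\<lambda>x. P K x $ i) x"] c2)
      (auto simp: glue_interior glue_outside pdiv_def)
  then show "set_integrable lebesgue \<Omega> (\<lambda>x. \<phi> x * glue \<T> (\<lambda>K. pdiv (P K)) x $ i)" by blast
  show "(LINT x:\<Omega>|lebesgue. fderiv \<phi> x (glue \<T> P x $ i)) + (LINT x:\<Omega>|lebesgue. \<phi> x * glue \<T> (\<lambda>K. pdiv (P K)) x $ i) =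
      (\<Sum>K\<in>\<T>. \<Sum>F\<in>facets K. face_integral F (\<lambda>x. \<phi> x * (outn K F \<bullet> P K x $ i)))"
    unfolding 1 conjunct2[OF 2] sum.distrib[symmetric]
    by (intro sum.cong refl integration_by_parts(1) simplex_T \<phi> row)
qed

lemma fluxes_by_face:
  fixes f :: "(real^3) set \<Rightarrow> (real^3) set \<Rightarrow> real"
  shows "(\<Sum>K\<in>\<T>. \<Sum>F\<in>facets K. f K F) = (\<Sum>F\<in>(\<Union>K\<in>\<T>. facets K). \<Sum>K | K \<in> \<T> \<and> F \<in> facets K. f K F)"
proof -
  let ?A = "\<Union>K\<in>\<T>. facets K"
  have fin: "finite ?A" using finite_T finite_facets simplex_T by blast
  have "(\<Sum>K\<in>\<T>. \<Sum>F\<in>facets K. f K F) = (\<Sum>K\<in>\<T>. \<Sum>F | F \<in> ?A \<and> F \<in> facets K. f K F)"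
    by (intro sum.cong refl) auto
  also have "\<dots> = (\<Sum>F\<in>?A. \<Sum>K | K \<in> \<T> \<and> F \<in> facets K. f K F)"
    by (rule sum.swap_restrict[OF finite_T fin])
  finally show ?thesis .
qed

lemma adjacent_cases:
  assumes "K \<in> \<T>" "F \<in> facets K"
  obtains "{K \<in> \<T>. F \<in> facets K} = {K}" | K' where "K' \<in> \<T>" "K' \<noteq> K" "F \<in> facets K'" "{K \<in> \<T>. F \<in> facets K} = {K, K'}"
proof (cases "\<exists>K'\<in>\<T>. K' \<noteq> K \<and> F \<in> facets K'")
  case True
  then obtain K' where K': "K' \<in> \<T>" "K' \<noteq> K" "F \<in> facets K'" by blast
  have "{K \<in> \<T>. F \<in> facets K} = {K, K'}"
    using adj_unique[OF assms(1) K'(1) _ assms(2) K'(3)] K' assms by blast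
  then show ?thesis using that(2) K' by blast
next
  case False
  then show ?thesis using that(1) assms by blast
qed

text \<open>On an unshared facet \<phi> vanishes because its support lies in the open set \<Omega>;
  on a shared facet the two outward normals are opposite and the fluxes cancel.\<close>

lemma normal_continuous_fluxes_0:
  assumes P: "\<forall>K\<in>\<T>. C1_map (P K)" and nc: "normal_continuous P" and \<phi>: "test_function \<Omega> \<phi>"
  shows "(\<Sum>K\<in>\<T>. \<Sum>F\<in>facets K. face_integral F (\<lambda>x. \<phi> x * (outn K F \<bullet> P K x $ i))) = 0"
  unfolding fluxes_by_face
proof (rule sum.neutral, rule ballI)
  fix F assume "F \<in> (\<Union>K\<in>\<T>. facets K)"
  then obtain K where K: "K \<in> \<T>" "F \<in> facets K" by blast
  note fp = facet_props[OF K(2) simplex_T[OF K(1)]]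
  show "(\<Sum>K | K \<in> \<T> \<and> F \<in> facets K. face_integral F (\<lambda>x. \<phi> x * (outn K F \<bullet> P K x $ i))) = 0"
  proof (rule adjacent_cases[OF K])
    assume eq: "{K \<in> \<T>. F \<in> facets K} = {K}"
    have d: "F \<inter> \<Omega> = {}"
    proof (rule unshared_facet[OF K])
      fix K' assume "K' \<in> \<T>" "F \<in> facets K'"
      then have "K' \<in> {K \<in> \<T>. F \<in> facets K}" by simp
      then show "K' = K" unfolding eq by simp
    qed
    have "\<phi> x = 0" if "x \<in> F" for x
    proof (rule ccontr)
      assume "\<phi> x \<noteq> 0"
      then have "x \<in> closure {x. \<phi> x \<noteq> 0}" using closure_subset[of "{x. \<phi> x \<noteq> 0}"] by auto
      moreover have "closure {x. \<phi> x \<noteq> 0} \<subseteq> \<Omega>" using \<phi> by (simp add: test_function_def)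
      ultimately show False using d that by blast
    qed
    then have "face_integral F (\<lambda>x. \<phi> x * (outn K F \<bullet> P K x $ i)) = face_integral F (\<lambda>x. 0 * 0)"
      by (intro face_integral_cong fp) auto
    also have "\<dots> = 0" unfolding face_integral_scale by simp
    finally show ?thesis unfolding eq by simp
  next
    fix K' assume K': "K' \<in> \<T>" "K' \<noteq> K" "F \<in> facets K'" and eq: "{K \<in> \<T>. F \<in> facets K} = {K, K'}"
    have o: "outn K' F = - outn K F" by (rule shared_outn[OF K(1) K'(1) K'(2)[symmetric] K(2) K'(3)])
    have "outn K F \<bullet> P K x $ i = outn K F \<bullet> P K' x $ i" if "x \<in> F" for x
    proof -
      have "(P K x *v outn K F) $ i = (P K' x *v outn K F) $ i"
        using nc K K' that unfolding normal_continuous_def by metis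
      then show ?thesis by (simp add: matrix_vector_mul_component inner_commute)
    qed
    then have "face_integral F (\<lambda>x. \<phi> x * (outn K' F \<bullet> P K' x $ i)) = face_integral F (\<lambda>x. (- 1) * (\<phi> x * (outn K F \<bullet> P K x $ i)))"
      by (intro face_integral_cong fp) (simp add: o)
    then show ?thesis unfolding eq face_integral_scale using K'(2) by simp
  qed
qed

lemma square_integrable_glue:
  fixes P :: "(real^3) set \<Rightarrow> real^3 \<Rightarrow> 'b::euclidean_space"
  assumes c: "\<And>K. K \<in> \<T> \<Longrightarrow> continuous_on UNIV (P K)"
  shows "square_integrable \<Omega> (glue \<T> P)"
proof -
  have "set_integrable lebesgue \<Omega> (glue \<T> P)"
    by (rule lint_glue(1)[where H = P]) (auto simp: c glue_interior glue_outside)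
  then have "set_borel_measurable lebesgue \<Omega> (glue \<T> P)"
    unfolding set_integrable_def set_borel_measurable_def by (rule borel_measurable_integrable)
  moreover have "set_integrable lebesgue \<Omega> (\<lambda>x. (norm (glue \<T> P x))\<^sup>2)"
    by (rule lint_glue(1)[where H = "\<lambda>K x. (norm (P K x))\<^sup>2"])
      (auto simp: glue_interior glue_outside intro!: continuous_intros c)
  ultimately show ?thesis unfolding square_integrable_def by blast
qed

lemma normal_continuous_Hdiv:
  assumes P: "\<forall>K\<in>\<T>. C1_map (P K)" and sym: "\<forall>K\<in>\<T>. \<forall>x. P K x \<in> sym_mats"
    and nc: "normal_continuous P"
  shows "glue \<T> P \<in> Hdiv_sym \<Omega>"
proof -
  have "glue \<T> P x \<in> sym_mats" for x
  proof (cases "\<exists>K\<in>\<T>. x \<in> interior K")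
    case True
    then obtain K where K: "K \<in> \<T>" "x \<in> interior K" by blast
    then show ?thesis using sym K(1) by (simp add: glue_interior[OF K])
  next
    case False
    then have "glue \<T> P x = 0" by (intro glue_outside) blast
    then show ?thesis by (simp add: sym_mats_def transpose_def vec_eq_iff)
  qed
  moreover have "square_integrable \<Omega> (glue \<T> P)" using P by (intro square_integrable_glue C1_map_continuous) auto
  moreover have "square_integrable \<Omega> (glue \<T> (\<lambda>K. pdiv (P K)))" using P by (intro square_integrable_glue pdiv_continuous) auto
  moreover have "weak_div \<Omega> (glue \<T> P) (glue \<T> (\<lambda>K. pdiv (P K)))"
    unfolding weak_div_def
  proof (intro allI impI)
    fix \<phi> i assume \<phi>: "test_function \<Omega> \<phi>"
    show "(LINT x:\<Omega>|lebesgue. fderiv \<phi> x (glue \<T> P x $ i)) = - (LINT x:\<Omega>|lebesgue. glue \<T> (\<lambda>K. pdiv (P K)) x $ i * \<phi> x)"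
      using glue_weak(2)[OF test_function_C1[OF \<phi>] P, of i] normal_continuous_fluxes_0[OF P nc \<phi>, of i]
      by (simp add: mult.commute)
  qed
  ultimately show ?thesis unfolding Hdiv_sym_def by auto
qed

text \<open>On a set of finite measure square integrability gives integrability, through the bound
  \<open>1 + (norm (g x))\<^sup>2\<close>.\<close>

lemma square_integrable_component:
  assumes g: "square_integrable \<Omega> (g :: real^3 \<Rightarrow> real^3)"
  shows "set_integrable lebesgue \<Omega> (\<lambda>x. g x $ i)"
proof -
  have m: "(\<lambda>x. indicator \<Omega> x *\<^sub>R g x) \<in> borel_measurable lebesgue"
    and s: "integrable lebesgue (\<lambda>x. indicator \<Omega> x *\<^sub>R (norm (g x))\<^sup>2)"
    using g unfolding square_integrable_def set_borel_measurable_def set_integrable_def by auto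
  have "integrable lebesgue (indicat_real \<Omega>)"
    using bnd open_dom by (intro integrable_real_indicator)
      (auto simp: emeasure_bounded_finite[unfolded infinity_ennreal_def] intro: sets_completionI_sets)
  then have b: "integrable lebesgue (\<lambda>x. indicat_real \<Omega> x + indicator \<Omega> x *\<^sub>R (norm (g x))\<^sup>2)"
    by (rule Bochner_Integration.integrable_add[OF _ s])
  show ?thesis
    unfolding set_integrable_def
  proof (rule Bochner_Integration.integrable_bound[OF b])
    have "(\<lambda>x. (indicator \<Omega> x *\<^sub>R g x) $ i) \<in> borel_measurable lebesgue"
      by (rule borel_measurable_continuous_on[OF _ m]) (intro continuous_intros)
    then show "(\<lambda>x. indicat_real \<Omega> x *\<^sub>R g x $ i) \<in> borel_measurable lebesgue" by simp
    have "\<bar>g x $ i\<bar> \<le> 1 + (norm (g x))\<^sup>2" for x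
    proof -
      have "\<bar>g x $ i\<bar> \<le> norm (g x)" by (rule component_le_norm_cart)
      moreover have "2 * norm (g x) \<le> 1 + (norm (g x))\<^sup>2"
        using sum_squares_bound[of 1 "norm (g x)"] by simp
      ultimately have "\<bar>g x $ i\<bar> \<le> 1 + (norm (g x))\<^sup>2" using norm_ge_zero[of "g x"] by linarith
      then show ?thesis .
    qed
    then show "AE x in lebesgue. norm (indicat_real \<Omega> x *\<^sub>R g x $ i) \<le> norm (indicat_real \<Omega> x + indicator \<Omega> x *\<^sub>R (norm (g x))\<^sup>2)"
      by (intro AE_I2) (auto simp: indicator_def)
  qed
qed

text \<open>Dominated convergence: off the hyperplane, which is a null set, the slabs eventually
  vanish.\<close>

lemma slab_integrals_tendsto_0:
  assumes h: "set_integrable lebesgue \<Omega> h" and g: "g \<noteq> 0" and b: "\<And>x. 0 \<le> b x" "\<And>x. b x \<le> 1" and bm: "continuous_on UNIV b"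
  shows "(\<lambda>k. LINT x:\<Omega>|lebesgue. b x * slab x0 g (1 / real (Suc k)) x * h x) \<longlonglongrightarrow> 0"
proof -
  let ?s = "\<lambda>k x. indicator \<Omega> x *\<^sub>R (b x * slab x0 g (1 / real (Suc k)) x * h x)"
  have i: "integrable lebesgue (\<lambda>x. indicator \<Omega> x *\<^sub>R h x)" using h unfolding set_integrable_def .
  have sm: "continuous_on UNIV (slab x0 g r)" for r
    using smooth_gen_C_k[OF slab_smooth, of 0] by simp
  have "(\<lambda>k. integral\<^sup>L lebesgue (?s k)) \<longlonglongrightarrow> integral\<^sup>L lebesgue (\<lambda>x :: real^3. 0 :: real)"
  proof (rule integral_dominated_convergence[where w = "\<lambda>x. norm (indicator \<Omega> x *\<^sub>R h x)"])
    show "integrable lebesgue (\<lambda>x. norm (indicator \<Omega> x *\<^sub>R h x))" using i by (rule integrable_norm)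
    show "?s k \<in> borel_measurable lebesgue" for k
    proof -
      have "(\<lambda>x. (b x * slab x0 g (1 / real (Suc k)) x) *\<^sub>R (indicator \<Omega> x *\<^sub>R h x)) \<in> borel_measurable lebesgue"
        by (intro borel_measurable_scaleR borel_measurable_integrable[OF i] measurable_completion)
          (simp add: borel_measurable_continuous_onI continuous_on_mult bm sm)
      then show ?thesis by (simp add: mult_ac)
    qed
    have "negligible {x. g \<bullet> x = g \<bullet> x0}" using g by (intro negligible_hyperplane) auto
    then have "AE x in lebesgue. x \<notin> {x. g \<bullet> x = g \<bullet> x0}" by (intro AE_not_in) (simp add: negligible_iff_null_sets)
    then show "AE x in lebesgue. (\<lambda>k. ?s k x) \<longlonglongrightarrow> 0"
    proof (rule AE_mp, intro AE_I2 impI)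
      fix x assume "x \<notin> {x. g \<bullet> x = g \<bullet> x0}"
      then have pos: "0 < \<bar>g \<bullet> (x - x0)\<bar>" by (simp add: inner_diff_right)
      then obtain n where n: "inverse (real (Suc n)) < \<bar>g \<bullet> (x - x0)\<bar>" using reals_Archimedean by blast
      have "?s k x = 0" if "k \<ge> n" for k
      proof -
        have "1 / real (Suc k) \<le> 1 / real (Suc n)" using that by (simp add: frac_le)
        then have "\<not> \<bar>g \<bullet> (x - x0)\<bar> < 1 / real (Suc k)" using n by (simp add: inverse_eq_divide)
        then have "slab x0 g (1 / real (Suc k)) x = 0" using slab_nz[of "1 / real (Suc k)" x0 g x] by simp
        then show ?thesis by simp
      qed
      then have "\<forall>\<^sub>F k in sequentially. ?s k x = 0" by (auto simp: eventually_sequentially)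
      then show "(\<lambda>k. ?s k x) \<longlonglongrightarrow> 0" by (rule tendsto_eventually)
    qed
    show "AE x in lebesgue. norm (?s k x) \<le> norm (indicator \<Omega> x *\<^sub>R h x)" for k
    proof (intro AE_I2)
      fix x
      have "\<bar>b x * slab x0 g (1 / real (Suc k)) x\<bar> \<le> 1"
        using b[of x] slab_bounds[of x0 g "1 / real (Suc k)" x] by (simp add: abs_mult mult_le_one)
      then have "\<bar>b x * slab x0 g (1 / real (Suc k)) x\<bar> * \<bar>h x\<bar> \<le> 1 * \<bar>h x\<bar>" by (intro mult_right_mono) auto
      then show "norm (?s k x) \<le> norm (indicator \<Omega> x *\<^sub>R h x)" by (auto simp: indicator_def abs_mult)
    qed
  qed auto
  then show ?thesis by (simp add: set_lebesgue_integral_def)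
qed

text \<open>Suppose a normal component jumps across a shared facet. A fixed bump near a point of the
  facet, cut off by ever thinner slabs around its plane, gives the same facet flux \<open>I\<close>
  each time, while the volume integrals tend to 0. So \<open>I = 0\<close>, although the jump has
  constant sign on the bump.\<close>

lemma Hdiv_normal_continuous:
  assumes P: "\<forall>K\<in>\<T>. C1_map (P K)" and H: "glue \<T> P \<in> Hdiv_sym \<Omega>"
  shows "normal_continuous P"
proof (rule ccontr)
  assume "\<not> normal_continuous P"
  then obtain K K' F x1 where K: "K \<in> \<T>" "K' \<in> \<T>" and F: "F \<in> facets K" "F \<in> facets K'"
    and x1: "x1 \<in> F" "P K x1 *v outn K F \<noteq> P K' x1 *v outn K F"
    unfolding normal_continuous_def by blast
  have KK': "K \<noteq> K'" using x1 by auto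
  define n where "n = outn K F"
  note fp = facet_props[OF F(1) simplex_T[OF K(1)]]
  have o: "outn K' F = - n" unfolding n_def by (rule shared_outn[OF K KK' F])
  have nz: "n \<noteq> 0" unfolding n_def by (rule facet_outn_nz[OF K(1) F(1)])
  from x1(2) obtain i where i: "(P K x1 *v n) $ i \<noteq> (P K' x1 *v n) $ i"
    unfolding n_def by (auto simp: vec_eq_iff)
  define j where "j x = n \<bullet> P K x $ i - n \<bullet> P K' x $ i" for x
  have jx1: "j x1 \<noteq> 0" using i by (simp add: j_def matrix_vector_mul_component inner_commute)
  have cj: "continuous_on S j" for S
    unfolding j_def by (intro continuous_intros C1_map_continuous bspec[OF P] K)
  \<comment> \<open>The jump may have been found on the relative boundary of \<open>F\<close>; by
    continuity it also occurs in the relative interior, where no other facet is near.\<close>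
  have "\<exists>x\<in>rel_interior F. j x \<noteq> 0"
  proof (rule ccontr)
    assume "\<not> ?thesis"
    then have "j x1 = 0"
      using continuous_constant_on_closure[of "rel_interior F" j 0 x1, OF cj] convex_closure_rel_interior[OF fp(2)] x1(1) fp(5)
      by (auto simp: closure_closed)
    then show False using jx1 by simp
  qed
  then obtain x0 where x0: "x0 \<in> rel_interior F" "j x0 \<noteq> 0" by blast
  have x0F: "x0 \<in> F" using x0(1) rel_interior_subset by blast
  have x0\<Omega>: "x0 \<in> \<Omega>" by (rule shared_facet_interior[OF K KK' F x0(1)])
  let ?A = "\<Union>K\<in>\<T>. facets K"
  have finA: "finite ?A" using finite_T finite_facets simplex_T by blast
  have "\<exists>\<epsilon>>0. \<forall>A\<in>?A - {F}. ball x0 \<epsilon> \<inter> A = {}"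
  proof (rule others_away)
    show "finite (?A - {F})" using finA by blast
    fix A assume A: "A \<in> ?A - {F}"
    then obtain L where L: "L \<in> \<T>" "A \<in> facets L" by blast
    note ap = facet_props[OF L(2) simplex_T[OF L(1)]]
    show "closed A" by (rule ap(5))
    show "x0 \<notin> A"
    proof
      assume "x0 \<in> A"
      then have "F \<in> facets L" using facet_local[OF K(1) F(1) x0(1) L(1)] ap(4) by blast
      then have fL: "F face_of L" "A face_of L" "aff_dim F = 2" "aff_dim A = 2" using L(2) by (auto simp: facets_def)
      have "F \<subseteq> A"
        by (rule subset_of_face_of[OF fL(2) face_of_imp_subset[OF fL(1)]]) (use \<open>x0 \<in> A\<close> x0(1) in blast)
      then have "F face_of A" using fL face_of_subset face_of_imp_subset by metis
      then have "F = A" using face_of_aff_dim_lt[OF ap(2), of F] fL by (cases "F = A") auto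
      then show False using A by blast
    qed
  qed
  then obtain e1 where e1: "e1 > 0" "\<And>A. A \<in> ?A \<Longrightarrow> A \<noteq> F \<Longrightarrow> ball x0 e1 \<inter> A = {}" by blast
  obtain e2 where e2: "e2 > 0" "ball x0 e2 \<subseteq> \<Omega>" using open_dom open_contains_ball x0\<Omega> by blast
  have "open {x. 0 < j x * j x0}" by (intro open_Collect_less continuous_intros cj)
  moreover have "x0 \<in> {x. 0 < j x * j x0}" using x0(2) by (simp add: zero_less_mult_iff) linarith
  ultimately obtain e3 where e3: "e3 > 0" "ball x0 e3 \<subseteq> {x. 0 < j x * j x0}" using open_contains_ball by blast
  \<comment> \<open>The bump reaches as far as \<open>3 * r\<close>, so dividing by 4 keeps its
    support inside all three balls.\<close>
  define r where "r = min e1 (min e2 e3) / 4"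
  have r: "r > 0" "3 * r < e1" "3 * r < e2" "3 * r < e3" using e1(1) e2(1) e3(1) by (auto simp: r_def min_def)
  define b where "b = box_bump x0 r"
  have bs: "dist x0 x \<le> 3 * r" if "b x \<noteq> 0" for x using box_bump_support[OF r(1)] that by (simp add: b_def)
  define \<phi> where "\<phi> k x = b x * slab x0 n (1 / real (Suc k)) x" for k x
  have \<phi>t: "test_function \<Omega> (\<phi> k)" for k
    unfolding \<phi>_def
    by (rule smooth_gen_test_function[of _ x0 "3 * r"])
      (use bs e2 r in \<open>auto simp: b_def intro!: smooth_gen.mult box_bump_smooth slab_smooth\<close>)
  define f0 where "f0 = flat_exp 0 1 * flat_exp 0 1"
  have f0: "f0 > 0" using flat_exp_0_bounds(3)[of 1] by (simp add: f0_def)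
  define I where "I = face_integral F (\<lambda>x. b x * f0 * j x)"
  have cb: "continuous_on S b" for S
    using smooth_gen_C_k[OF box_bump_smooth[of x0 r], of 0] continuous_on_subset by (simp add: b_def) blast
  have csl: "continuous_on S (slab x0 n t)" for S t
    using smooth_gen_C_k[OF slab_smooth[of x0 n t], of 0] continuous_on_subset by simp blast
  \<comment> \<open>Only \<open>F\<close> meets the support, and on the plane of \<open>F\<close>
    the slab is constant, so the flux does not depend on \<open>k\<close>.\<close>
  have flux: "(\<Sum>L\<in>\<T>. \<Sum>G\<in>facets L. face_integral G (\<lambda>x. \<phi> k x * (outn L G \<bullet> P L x $ i))) = I" for k
  proof -
    have z: "face_integral G (\<lambda>x. \<phi> k x * (outn L G \<bullet> P L x $ i)) = 0" if "L \<in> \<T>" "G \<in> facets L" "G \<noteq> F" for L G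
    proof -
      have "\<phi> k x = 0" if x: "x \<in> G" for x
      proof (rule ccontr)
        assume "\<phi> k x \<noteq> 0"
        then have "x \<in> ball x0 e1" using bs[of x] r by (auto simp: \<phi>_def)
        then show False using e1(2)[of G] \<open>L \<in> \<T>\<close> \<open>G \<in> facets L\<close> \<open>G \<noteq> F\<close> x by blast
      qed
      then have "face_integral G (\<lambda>x. \<phi> k x * (outn L G \<bullet> P L x $ i)) = face_integral G (\<lambda>x. 0 * 0)"
        by (intro face_integral_cong facet_props(3)[OF that(2) simplex_T[OF that(1)]]) auto
      then show ?thesis unfolding face_integral_scale by simp
    qed
    have set: "{L \<in> \<T>. F \<in> facets L} = {K, K'}"
      using adj_unique[OF K(1) K(2) _ F(1) F(2) _ KK'] K F by blast
    have "(\<Sum>L\<in>\<T>. \<Sum>G\<in>facets L. face_integral G (\<lambda>x. \<phi> k x * (outn L G \<bullet> P L x $ i))) =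
        (\<Sum>G\<in>{F}. \<Sum>L | L \<in> \<T> \<and> G \<in> facets L. face_integral G (\<lambda>x. \<phi> k x * (outn L G \<bullet> P L x $ i)))"
      unfolding fluxes_by_face by (rule sum.mono_neutral_right) (use finA K F z in \<open>auto intro!: sum.neutral\<close>)
    also have "\<dots> = face_integral F (\<lambda>x. \<phi> k x * (n \<bullet> P K x $ i)) + face_integral F (\<lambda>x. \<phi> k x * (- n \<bullet> P K' x $ i))"
      using KK' by (simp add: set o n_def[symmetric])
    also have "\<dots> = face_integral F (\<lambda>x. \<phi> k x * (n \<bullet> P K x $ i) + \<phi> k x * (- n \<bullet> P K' x $ i))"
      unfolding \<phi>_def by (intro face_integral_add[symmetric] fp continuous_intros cb csl C1_map_continuous bspec[OF P] K)
    also have "\<dots> = I"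
      unfolding I_def
    proof (intro face_integral_cong fp)
      fix x assume x: "x \<in> F"
      have "n \<bullet> (x - x0) = 0"
        using facet_outn_unit[OF simplex_T[OF K(1)] F(1)] x x0F by (simp add: unit_normal_def n_def)
      then have "\<phi> k x = b x * f0" unfolding \<phi>_def f0_def by (simp add: slab_plane)
      then show "\<phi> k x * (n \<bullet> P K x $ i) + \<phi> k x * (- n \<bullet> P K' x $ i) = b x * f0 * j x"
        by (simp add: j_def right_diff_distrib)
    qed
    finally show ?thesis .
  qed
  obtain g where g: "square_integrable \<Omega> g" "weak_div \<Omega> (glue \<T> P) g"
    using H unfolding Hdiv_sym_def by blast
  \<comment> \<open>The difference between the piecewise divergence and the weak one; its
    integrability is all that the limit requires.\<close>
  define h where "h x = glue \<T> (\<lambda>K. pdiv (P K)) x $ i - g x $ i" for x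
  have gi: "set_integrable lebesgue \<Omega> (\<lambda>x. g x $ i)" by (rule square_integrable_component[OF g(1)])
  have di: "set_integrable lebesgue \<Omega> (\<lambda>x. glue \<T> (\<lambda>K. pdiv (P K)) x $ i)"
    using glue_weak(1)[OF C1_map_const[of 1] P, of i] by simp
  have hi: "set_integrable lebesgue \<Omega> h" unfolding h_def[abs_def] by (rule set_integral_diff(1)[OF di gi])
  have Ik: "I = (LINT x:\<Omega>|lebesgue. b x * slab x0 n (1 / real (Suc k)) x * h x)" for k
  proof -
    have C1: "C1_map (\<phi> k)" by (rule test_function_C1[OF \<phi>t])
    have "set_integrable lebesgue \<Omega> (\<lambda>x. g x $ i * \<phi> k x)"
      unfolding set_integrable_def
    proof (rule Bochner_Integration.integrable_bound[OF integrable_norm[OF gi[unfolded set_integrable_def]]])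
      have "(\<lambda>x. \<phi> k x *\<^sub>R (indicator \<Omega> x *\<^sub>R g x $ i)) \<in> borel_measurable lebesgue"
        by (intro borel_measurable_scaleR borel_measurable_integrable[OF gi[unfolded set_integrable_def]] measurable_completion)
          (simp add: borel_measurable_continuous_onI C1_map_continuous[OF C1])
      then show "(\<lambda>x. indicat_real \<Omega> x *\<^sub>R (g x $ i * \<phi> k x)) \<in> borel_measurable lebesgue" by (simp add: mult_ac)
      have "\<bar>\<phi> k x\<bar> \<le> 1" for x
        using box_bump_bounds[of x0 r x] slab_bounds[of x0 n "1 / real (Suc k)" x]
        by (simp add: \<phi>_def b_def abs_mult mult_le_one)
      then have "\<bar>g x $ i\<bar> * \<bar>\<phi> k x\<bar> \<le> \<bar>g x $ i\<bar> * 1" for x by (intro mult_left_mono) auto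
      then show "AE x in lebesgue. norm (indicat_real \<Omega> x *\<^sub>R (g x $ i * \<phi> k x)) \<le> norm (norm (indicat_real \<Omega> x *\<^sub>R g x $ i))"
        by (intro AE_I2) (auto simp: indicator_def abs_mult)
    qed
    note gp = this
    have "I = (LINT x:\<Omega>|lebesgue. \<phi> k x * glue \<T> (\<lambda>K. pdiv (P K)) x $ i) - (LINT x:\<Omega>|lebesgue. g x $ i * \<phi> k x)"
      using glue_weak(2)[OF C1 P, of i] g(2)[unfolded weak_div_def, rule_format, OF \<phi>t[of k], of i] flux[of k] by simp
    also have "\<dots> = (LINT x:\<Omega>|lebesgue. \<phi> k x * glue \<T> (\<lambda>K. pdiv (P K)) x $ i - g x $ i * \<phi> k x)"
      by (rule set_integral_diff(2)[OF glue_weak(1)[OF C1 P] gp, symmetric])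
    also have "\<dots> = (LINT x:\<Omega>|lebesgue. b x * slab x0 n (1 / real (Suc k)) x * h x)"
      by (simp add: \<phi>_def h_def right_diff_distrib mult_ac)
    finally show ?thesis .
  qed
  have "(\<lambda>k. LINT x:\<Omega>|lebesgue. b x * slab x0 n (1 / real (Suc k)) x * h x) \<longlonglongrightarrow> 0"
    by (rule slab_integrals_tendsto_0[OF hi nz _ _ cb]) (auto simp: b_def box_bump_bounds)
  then have "(\<lambda>k::nat. I) \<longlonglongrightarrow> 0" unfolding Ik[symmetric] .
  then have "I = 0" using LIMSEQ_const_iff by blast
  \<comment> \<open>The factor \<open>j x0\<close> makes the integrand nonnegative on the support of
    the bump.\<close>
  then have "face_integral F (\<lambda>x. j x0 * (b x * f0 * j x)) = 0" unfolding face_integral_scale I_def by simp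
  then have "j x0 * (b x0 * f0 * j x0) = 0"
  proof (rule face_integral_eq_0[OF fp(3,1,2), rotated 2])
    show "continuous_on F (\<lambda>x. j x0 * (b x * f0 * j x))" by (intro continuous_intros cb cj)
    fix x assume "x \<in> F"
    show "0 \<le> j x0 * (b x * f0 * j x)"
    proof (cases "b x = 0")
      case False
      then have "x \<in> ball x0 e3" using bs[of x] r by auto
      then have "0 < j x * j x0" using e3(2) by blast
      then have "0 \<le> (b x * f0) * (j x * j x0)" using f0 box_bump_bounds(1)[of x0 r x] by (simp add: b_def)
      then show ?thesis by (simp add: mult_ac)
    qed simp
  qed (rule x0F)
  then show False using x0(2) f0 box_bump_pos[OF r(1), of x0] by (simp add: b_def)
qed

end

section \<open>Traces on one face\<close>

lemma convex_hull_2_image: "convex hull {a, b} = (\<lambda>s. a + s *\<^sub>R (b - a)) ` {0..1::real}"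
proof -
  have "(1 - s) *\<^sub>R a + s *\<^sub>R b = a + s *\<^sub>R (b - a)" for s by (simp add: algebra_simps)
  then show ?thesis unfolding segment_convex_hull[symmetric] closed_segment_def by auto
qed

text \<open>The general cubic with its 20 coefficients written out, so that setting a variable to 0
  is a simplification step.\<close>

definition cubic3 :: "(nat \<Rightarrow> nat \<Rightarrow> nat \<Rightarrow> real) \<Rightarrow> real \<Rightarrow> real \<Rightarrow> real \<Rightarrow> real" where
  "cubic3 c s r z =
    c 0 0 0 + c 1 0 0 * s + c 0 1 0 * r + c 0 0 1 * z + c 2 0 0 * s^2 + c 1 1 0 * (s * r) + c 1 0 1 * (s * z) +
    c 0 2 0 * r^2 + c 0 1 1 * (r * z) + c 0 0 2 * z^2 + c 3 0 0 * s^3 + c 2 1 0 * (s^2 * r) + c 2 0 1 * (s^2 * z) +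
    c 1 2 0 * (s * r^2) + c 1 1 1 * (s * r * z) + c 1 0 2 * (s * z^2) + c 0 3 0 * r^3 + c 0 2 1 * (r^2 * z) +
    c 0 1 2 * (r * z^2) + c 0 0 3 * z^3"

lemma polys_cubic3_form:
  fixes f :: "real^3 \<Rightarrow> real"
  assumes "f \<in> polys 3"
  shows "\<exists>c. \<forall>s r z. f (x0 + s *\<^sub>R u + r *\<^sub>R v + z *\<^sub>R w) = cubic3 c s r z"
proof -
  obtain c where c: "\<And>x :: real^3. f (x0 + x$1 *\<^sub>R u + x$2 *\<^sub>R v + x$3 *\<^sub>R w) =
      (\<Sum>(i, j, l)\<in>triples 3. ((x$1) ^ i * (x$2) ^ j * (x$3) ^ l) *\<^sub>R c i j l)"
    using polys_compose_affine[OF assms, of x0 u v w] unfolding polys_iff by blast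
  have "f (x0 + s *\<^sub>R u + r *\<^sub>R v + z *\<^sub>R w) = cubic3 c s r z" for s r z
    using c[of "vector [s, r, z]"] unfolding sum_triples cubic3_def
    by (simp add: vector_3 numeral_3_eq_3 numeral_2_eq_2 add_ac mult_ac)
  then show ?thesis by blast
qed

lemma polys_cubic2:
  fixes f :: "real^3 \<Rightarrow> real"
  assumes "f \<in> polys 3"
  shows "\<exists>c00 c10 c01 c20 c11 c02 c30 c21 c12 c03. \<forall>s r. f (a + s *\<^sub>R u + r *\<^sub>R v) =
    c00 + c10 * s + c01 * r + c20 * s^2 + c11 * (s * r) + c02 * r^2 + c30 * s^3 + c21 * (s^2 * r) + c12 * (s * r^2) + c03 * r^3"
proof -
  obtain c where c: "\<And>s r z. f (a + s *\<^sub>R u + r *\<^sub>R v + z *\<^sub>R 0) = cubic3 c s r z"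
    using polys_cubic3_form[OF assms, of a u v 0] by blast
  have "f (a + s *\<^sub>R u + r *\<^sub>R v) = c 0 0 0 + c 1 0 0 * s + c 0 1 0 * r + c 2 0 0 * s^2 + c 1 1 0 * (s * r) + c 0 2 0 * r^2 +
      c 3 0 0 * s^3 + c 2 1 0 * (s^2 * r) + c 1 2 0 * (s * r^2) + c 0 3 0 * r^3" for s r
    using c[of s r 0] by (simp add: cubic3_def)
  then show ?thesis by metis
qed

text \<open>On the edge a cubic vanishing at both ends is \<open>s * (1 - s)\<close> times a linear
  factor. That factor is itself an admissible test function, and the moment against it integrates a
  nonnegative function.\<close>

lemma edge_cubic_zero:
  fixes f :: "real^3 \<Rightarrow> real"
  assumes f: "f \<in> polys 3" and ab: "a \<noteq> b" and z: "f a = 0" "f b = 0" and d: "aff_dim (convex hull {a, b}) = 1"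
    and m: "\<And>q. q \<in> polys 1 \<Longrightarrow> edge_integral (convex hull {a, b}) (\<lambda>x. f x * q x) = 0"
  shows "f (a + s *\<^sub>R (b - a)) = 0"
proof -
  let ?e = "convex hull {a, b}"
  obtain c0 c1 c01 c2 c11 c02 c3 c21 c12 c03 where c0: "\<And>s r. f (a + s *\<^sub>R (b - a) + r *\<^sub>R 0) =
    c0 + c1 * s + c01 * r + c2 * s^2 + c11 * (s * r) + c02 * r^2 + c3 * s^3 + c21 * (s^2 * r) + c12 * (s * r^2) + c03 * r^3"
    using polys_cubic2[OF f, of a "b - a" 0] by (elim exE) (rule that, (erule allE)+, assumption)
  have c: "f (a + s *\<^sub>R (b - a)) = c0 + s * c1 + s^2 * c2 + s^3 * c3" for s
    using c0[of s 0] by (simp add: mult.commute)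
  have cc: "c0 = 0" "c1 = - c2 - c3" using c[of 0] c[of 1] z by auto
  have fs: "f (a + s *\<^sub>R (b - a)) = s * (1 - s) * (- c2 - c3 - c3 * s)" for s
    unfolding c cc by (simp add: algebra_simps power2_eq_square power3_eq_cube)
  define S where "S x = ((b - a) \<bullet> (x - a)) / ((b - a) \<bullet> (b - a))" for x
  have S: "S (a + s *\<^sub>R (b - a)) = s" for s using ab by (simp add: S_def)
  have Sq: "(\<lambda>x. (- c2 - c3) + (- c3) * S x) \<in> polys 1"
  proof -
    have eq: "(- c2 - c3 + c3 * ((b - a) \<bullet> a) / ((b - a) \<bullet> (b - a))) + (- (c3 / ((b - a) \<bullet> (b - a))) *\<^sub>R (b - a)) \<bullet> x =
       (- c2 - c3) + (- c3) * S x" for x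
      by (simp add: S_def inner_diff_right[of "b - a" x a] diff_divide_distrib right_diff_distrib)
    show ?thesis
      using polys_affine[of "- c2 - c3 + c3 * ((b - a) \<bullet> a) / ((b - a) \<bullet> (b - a))" "- (c3 / ((b - a) \<bullet> (b - a))) *\<^sub>R (b - a)"]
      unfolding eq .
  qed
  define g where "g x = f x * ((- c2 - c3) + (- c3) * S x)" for x
  have cg: "continuous_on ?e g"
    unfolding g_def by (intro continuous_on_mult polys_continuous[OF f] polys_continuous[OF Sq])
  have gs: "g (a + s *\<^sub>R (b - a)) = s * (1 - s) * (- c2 - c3 - c3 * s)\<^sup>2" for s
    by (simp add: g_def fs S power2_eq_square)
  have g0: "g x = 0" if "x \<in> ?e" for x
  proof (rule edge_integral_eq_0[OF d _ _ cg _ _ that])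
    show "compact ?e" "convex ?e" by (auto simp: finite_imp_compact_convex_hull)
    show "edge_integral ?e g = 0" using m[OF Sq] by (simp add: g_def[abs_def])
    fix x assume "x \<in> ?e"
    then show "0 \<le> g x" by (auto simp: convex_hull_2_image gs)
  qed
  have l: "- c2 - c3 - c3 * s = 0" if "0 < s" "s < 1" for s
  proof -
    have "a + s *\<^sub>R (b - a) \<in> ?e" unfolding convex_hull_2_image using that by (intro image_eqI[of _ _ s]) auto
    then show ?thesis using g0 gs[of s] that by fastforce
  qed
  have "c3 = 0" "c2 = 0" using l[of "1/2"] l[of "1/4"] by auto
  then show ?thesis by (simp add: fs)
qed

lemma face_cubic_bubble:
  fixes f :: "real^3 \<Rightarrow> real"
  assumes f: "f \<in> polys 3"
    and e: "\<And>s. f (a + s *\<^sub>R (b - a)) = 0" "\<And>r. f (a + r *\<^sub>R (c - a)) = 0" "\<And>s. f (b + s *\<^sub>R (c - b)) = 0"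
  shows "\<exists>\<kappa>. \<forall>s r. f (a + s *\<^sub>R (b - a) + r *\<^sub>R (c - a)) = \<kappa> * (s * r * (1 - s - r))"
proof -
  obtain c00 c10 c01 c20 c11 c02 c30 c21 c12 c03 where F: "\<And>s r. f (a + s *\<^sub>R (b - a) + r *\<^sub>R (c - a)) =
    c00 + c10 * s + c01 * r + c20 * s^2 + c11 * (s * r) + c02 * r^2 + c30 * s^3 + c21 * (s^2 * r) + c12 * (s * r^2) + c03 * r^3"
    using polys_cubic2[OF f, of a "b - a" "c - a"] by (elim exE) (rule that, (erule allE)+, assumption)
  have e1: "c00 + c10 * s + c20 * s^2 + c30 * s^3 = 0" for s using F[of s 0] e(1)[of s] by simp
  have e2: "c00 + c01 * r + c02 * r^2 + c03 * r^3 = 0" for r using F[of 0 r] e(2)[of r] by simp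
  have e3: "f (a + (1 - r) *\<^sub>R (b - a) + r *\<^sub>R (c - a)) = 0" for r
    using e(3)[of r] by (simp add: algebra_simps)
  \<comment> \<open>The edge conditions hold on the whole lines, so four convenient parameter values
    determine each cubic.\<close>
  have "c00 = 0" "c10 = 0" "c20 = 0" "c30 = 0"
    using e1[of 0] e1[of 1] e1[of "-1"] e1[of 2] by (auto simp: power2_eq_square power3_eq_cube)
  moreover have "c01 = 0" "c02 = 0" "c03 = 0"
    using e2[of 0] e2[of 1] e2[of "-1"] e2[of 2] by (auto simp: power2_eq_square power3_eq_cube)
  ultimately have F': "f (a + s *\<^sub>R (b - a) + r *\<^sub>R (c - a)) = c11 * (s * r) + c21 * (s^2 * r) + c12 * (s * r^2)" for s r
    using F by simp
  have c: "c21 = - c11" "c12 = - c11"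
    using F'[of "1 - 2" 2] e3[of 2] F'[of "1 - (-1)" "-1"] e3[of "-1"] by (auto simp: power2_eq_square)
  show ?thesis
  proof (intro exI allI)
    fix s r show "f (a + s *\<^sub>R (b - a) + r *\<^sub>R (c - a)) = c11 * (s * r * (1 - s - r))"
      unfolding F' c by (simp add: algebra_simps power2_eq_square)
  qed
qed

text \<open>What the edge conditions leave is a multiple of the cubic bubble, which keeps its sign
  on the triangle; the barycentre then shows that the factor is 0.\<close>

lemma face_scalar_zero:
  fixes f :: "real^3 \<Rightarrow> real"
  assumes f: "f \<in> polys 3" and N: "cross3 (b - a) (c - a) \<noteq> 0"
    and e: "\<And>s. f (a + s *\<^sub>R (b - a)) = 0" "\<And>r. f (a + r *\<^sub>R (c - a)) = 0" "\<And>s. f (b + s *\<^sub>R (c - b)) = 0"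
    and m: "face_integral (convex hull {a, b, c}) f = 0"
  shows "f (a + s *\<^sub>R (b - a) + r *\<^sub>R (c - a)) = 0"
proof -
  let ?F = "convex hull {a, b, c}"
  obtain \<kappa> where \<kappa>: "\<And>s r. f (a + s *\<^sub>R (b - a) + r *\<^sub>R (c - a)) = \<kappa> * (s * r * (1 - s - r))"
    using face_cubic_bubble[OF f e] by blast
  have pt: "a + (1/3) *\<^sub>R (b - a) + (1/3) *\<^sub>R (c - a) \<in> ?F"
    unfolding convex_hull_3_image by (rule image_eqI[of _ _ "vector [1/3, 1/3]"]) (auto simp: simplex2_def vector_2)
  have "\<kappa> * f (a + (1/3) *\<^sub>R (b - a) + (1/3) *\<^sub>R (c - a)) = 0"
  proof (rule face_integral_eq_0[OF aff_dim_triangle[OF N] _ _ _ _ _ pt])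
    show "compact ?F" "convex ?F" by (auto simp: finite_imp_compact_convex_hull)
    show "continuous_on ?F (\<lambda>x. \<kappa> * f x)" by (intro continuous_intros polys_continuous[OF f])
    show "face_integral ?F (\<lambda>x. \<kappa> * f x) = 0" using m by (simp add: face_integral_scale)
    fix x assume "x \<in> ?F"
    then obtain u where u: "x = a + u$1 *\<^sub>R (b - a) + u$2 *\<^sub>R (c - a)" "u \<in> simplex2" unfolding convex_hull_3_image by blast
    have eq: "\<kappa> * f x = (\<kappa> * \<kappa>) * (u$1 * u$2 * (1 - u$1 - u$2))" unfolding u(1) \<kappa> by simp
    show "0 \<le> \<kappa> * f x" unfolding eq using u(2) zero_le_square[of \<kappa>]
      by (intro mult_nonneg_nonneg[of "\<kappa> * \<kappa>"] mult_nonneg_nonneg[of "u$1 * u$2"] mult_nonneg_nonneg[of "u$1"]) (auto simp: simplex2_def)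
  qed
  then have "\<kappa> * (\<kappa> * ((1/3) * (1/3) * (1 - 1/3 - 1/3))) = 0" by (simp only: \<kappa>)
  then have "\<kappa> = 0" by simp
  then show ?thesis by (simp add: \<kappa>)
qed

text \<open>The Dirichlet integrals of \<open>lint_simplex2_monomial\<close>, tabulated below for
  \<open>bdm_face_zero\<close>.\<close>

definition tri_moment :: "nat \<Rightarrow> nat \<Rightarrow> real" where
  "tri_moment i j = fact i * fact j / fact (i + j + 2)"

lemma tri_moment_values:
  "tri_moment 1 0 = 1 / 6" "tri_moment 0 1 = 1 / 6" "tri_moment 2 0 = 1 / 12" "tri_moment 1 1 = 1 / 24" "tri_moment 0 2 = 1 / 12"
  "tri_moment 3 0 = 1 / 20" "tri_moment 2 1 = 1 / 60" "tri_moment 1 2 = 1 / 60" "tri_moment 0 3 = 1 / 20"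
  "tri_moment 4 0 = 1 / 30" "tri_moment 3 1 = 1 / 120" "tri_moment 2 2 = 1 / 180" "tri_moment 1 3 = 1 / 120" "tri_moment 0 4 = 1 / 30"
  "tri_moment 4 1 = 1 / 210" "tri_moment 3 2 = 1 / 420" "tri_moment 2 3 = 1 / 420" "tri_moment 1 4 = 1 / 210"
  by (simp_all add: tri_moment_def fact_numeral)

lemma lint_simplex2_cubic:
  "(LINT u:simplex2|lborel. ((u$1) ^ p * (u$2) ^ q) * (c00 + c10 * (u$1) + c01 * (u$2) + c20 * (u$1)^2 + c11 * ((u$1) * (u$2)) + c02 * (u$2)^2 +
      c30 * (u$1)^3 + c21 * ((u$1)^2 * (u$2)) + c12 * ((u$1) * (u$2)^2) + c03 * (u$2)^3)) =
    c00 * tri_moment p q + c10 * tri_moment (p + 1) q + c01 * tri_moment p (q + 1) + c20 * tri_moment (p + 2) q +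
    c11 * tri_moment (p + 1) (q + 1) + c02 * tri_moment p (q + 2) + c30 * tri_moment (p + 3) q +
    c21 * tri_moment (p + 2) (q + 1) + c12 * tri_moment (p + 1) (q + 2) + c03 * tri_moment p (q + 3)"
proof -
  define M where "M h v \<longleftrightarrow> set_integrable lborel simplex2 h \<and> (LINT u:simplex2|lborel. h u) = v" for h :: "real^2 \<Rightarrow> real" and v
  have add: "M h v \<Longrightarrow> M h' v' \<Longrightarrow> M (\<lambda>u. h u + h' u) (v + v')" for h v h' v' unfolding M_def by auto
  have mono: "M (\<lambda>u. c * ((u$1) ^ i * (u$2) ^ j)) (c * tri_moment i j)" for c i j
    unfolding M_def tri_moment_def
    by (intro conjI set_integrable_compact(1) compact_simplex2 continuous_intros) (simp add: lint_simplex2_monomial)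
  have "M (\<lambda>u. c00 * ((u$1) ^ p * (u$2) ^ q) + c10 * ((u$1) ^ (p + 1) * (u$2) ^ q) + c01 * ((u$1) ^ p * (u$2) ^ (q + 1)) +
      c20 * ((u$1) ^ (p + 2) * (u$2) ^ q) + c11 * ((u$1) ^ (p + 1) * (u$2) ^ (q + 1)) + c02 * ((u$1) ^ p * (u$2) ^ (q + 2)) +
      c30 * ((u$1) ^ (p + 3) * (u$2) ^ q) + c21 * ((u$1) ^ (p + 2) * (u$2) ^ (q + 1)) + c12 * ((u$1) ^ (p + 1) * (u$2) ^ (q + 2)) +
      c03 * ((u$1) ^ p * (u$2) ^ (q + 3)))
    (c00 * tri_moment p q + c10 * tri_moment (p + 1) q + c01 * tri_moment p (q + 1) + c20 * tri_moment (p + 2) q +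
    c11 * tri_moment (p + 1) (q + 1) + c02 * tri_moment p (q + 2) + c30 * tri_moment (p + 3) q +
    c21 * tri_moment (p + 2) (q + 1) + c12 * tri_moment (p + 1) (q + 2) + c03 * tri_moment p (q + 3))"
    by (intro add mono)
  moreover have "(\<lambda>u::real^2. c00 * ((u$1) ^ p * (u$2) ^ q) + c10 * ((u$1) ^ (p + 1) * (u$2) ^ q) + c01 * ((u$1) ^ p * (u$2) ^ (q + 1)) +
      c20 * ((u$1) ^ (p + 2) * (u$2) ^ q) + c11 * ((u$1) ^ (p + 1) * (u$2) ^ (q + 1)) + c02 * ((u$1) ^ p * (u$2) ^ (q + 2)) +
      c30 * ((u$1) ^ (p + 3) * (u$2) ^ q) + c21 * ((u$1) ^ (p + 2) * (u$2) ^ (q + 1)) + c12 * ((u$1) ^ (p + 1) * (u$2) ^ (q + 2)) +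
      c03 * ((u$1) ^ p * (u$2) ^ (q + 3))) =
    (\<lambda>u. ((u$1) ^ p * (u$2) ^ q) * (c00 + c10 * (u$1) + c01 * (u$2) + c20 * (u$1)^2 + c11 * ((u$1) * (u$2)) + c02 * (u$2)^2 +
      c30 * (u$1)^3 + c21 * ((u$1)^2 * (u$2)) + c12 * ((u$1) * (u$2)^2) + c03 * (u$2)^3))"
    by (rule ext) (simp add: power_add power2_eq_square power3_eq_cube algebra_simps)
  ultimately show ?thesis unfolding M_def by simp
qed

text \<open>Unisolvence of the cubic Brezzi-Douglas-Marini element on a triangle. \<open>f\<close>
  and \<open>h\<close> are components of a tangential field; the three edge conditions say that its
  component normal to each edge vanishes there, and the eight moment conditions are those against
  \<open>nedelec1\<close>. The 20 coefficients are eliminated explicitly.\<close>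

lemma bdm_face_zero:
  fixes f h :: "real^3 \<Rightarrow> real"
  assumes f: "f \<in> polys 3" "h \<in> polys 3"
    and e: "\<And>r. f (a + r *\<^sub>R (c - a)) = 0" "\<And>s. h (a + s *\<^sub>R (b - a)) = 0"
      "\<And>r. f (b + r *\<^sub>R (c - b)) + h (b + r *\<^sub>R (c - b)) = 0"
    and s: "\<And>s r. S (a + s *\<^sub>R (b - a) + r *\<^sub>R (c - a)) = s" "\<And>s r. R (a + s *\<^sub>R (b - a) + r *\<^sub>R (c - a)) = r"
    and m: "tri a b c f = 0" "tri a b c (\<lambda>x. S x * f x) = 0" "tri a b c (\<lambda>x. R x * f x) = 0"
      "tri a b c h = 0" "tri a b c (\<lambda>x. S x * h x) = 0" "tri a b c (\<lambda>x. R x * h x) = 0"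
      "tri a b c (\<lambda>x. S x * R x * f x) = tri a b c (\<lambda>x. S x * S x * h x)"
      "tri a b c (\<lambda>x. R x * R x * f x) = tri a b c (\<lambda>x. S x * R x * h x)"
  shows "f (a + s *\<^sub>R (b - a) + r *\<^sub>R (c - a)) = 0" "h (a + s *\<^sub>R (b - a) + r *\<^sub>R (c - a)) = 0"
proof -
  obtain c00 c10 c01 c20 c11 c02 c30 c21 c12 c03 where F: "\<And>s r. f (a + s *\<^sub>R (b - a) + r *\<^sub>R (c - a)) =
    c00 + c10 * s + c01 * r + c20 * s^2 + c11 * (s * r) + c02 * r^2 + c30 * s^3 + c21 * (s^2 * r) + c12 * (s * r^2) + c03 * r^3"
    using polys_cubic2[OF f(1), of a "b - a" "c - a"] by (elim exE) (rule that, (erule allE)+, assumption)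
  obtain d00 d10 d01 d20 d11 d02 d30 d21 d12 d03 where H: "\<And>s r. h (a + s *\<^sub>R (b - a) + r *\<^sub>R (c - a)) =
    d00 + d10 * s + d01 * r + d20 * s^2 + d11 * (s * r) + d02 * r^2 + d30 * s^3 + d21 * (s^2 * r) + d12 * (s * r^2) + d03 * r^3"
    using polys_cubic2[OF f(2), of a "b - a" "c - a"] by (elim exE) (rule that, (erule allE)+, assumption)
  have e1: "c00 + c01 * r + c02 * r^2 + c03 * r^3 = 0" for r using F[of 0 r] e(1)[of r] by simp
  have e2: "d00 + d10 * s + d20 * s^2 + d30 * s^3 = 0" for s using H[of s 0] e(2)[of s] by simp
  have e3: "f (a + (1 - r) *\<^sub>R (b - a) + r *\<^sub>R (c - a)) + h (a + (1 - r) *\<^sub>R (b - a) + r *\<^sub>R (c - a)) = 0" for r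
    using e(3)[of r] by (simp add: algebra_simps)
  have c0: "c00 = 0" "c01 = 0" "c02 = 0" "c03 = 0"
    using e1[of 0] e1[of 1] e1[of "-1"] e1[of 2] by (auto simp: power2_eq_square power3_eq_cube)
  have d0: "d00 = 0" "d10 = 0" "d20 = 0" "d30 = 0"
    using e2[of 0] e2[of 1] e2[of "-1"] e2[of 2] by (auto simp: power2_eq_square power3_eq_cube)
  have TF: "tri a b c (\<lambda>x. S x ^ p * R x ^ q * f x) = c10 * tri_moment (p + 1) q + c20 * tri_moment (p + 2) q +
    c11 * tri_moment (p + 1) (q + 1) + c30 * tri_moment (p + 3) q + c21 * tri_moment (p + 2) (q + 1) + c12 * tri_moment (p + 1) (q + 2)" for p q
    unfolding tri_def s F lint_simplex2_cubic by (simp add: c0)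
  have TH: "tri a b c (\<lambda>x. S x ^ p * R x ^ q * h x) = d01 * tri_moment p (q + 1) +
    d11 * tri_moment (p + 1) (q + 1) + d02 * tri_moment p (q + 2) +
    d21 * tri_moment (p + 2) (q + 1) + d12 * tri_moment (p + 1) (q + 2) + d03 * tri_moment p (q + 3)" for p q
    unfolding tri_def s H lint_simplex2_cubic by (simp add: d0)
  have n: "0 + n = n" "1 + 1 = (2::nat)" "1 + 2 = (3::nat)" "1 + 3 = (4::nat)" "2 + 1 = (3::nat)" "2 + 2 = (4::nat)" for n :: nat by auto
  note TF = TF[of 0 0] TF[of 1 0] TF[of 0 1] TF[of 1 1] TF[of 0 2]
  note TH = TH[of 0 0] TH[of 1 0] TH[of 0 1] TH[of 2 0] TH[of 1 1]
  note mv = tri_moment_values power_0 power_one_right mult_1_left mult_1_right power2_eq_square times_divide_eq_right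
  have M: "c10 / 6 + c20 / 12 + c11 / 24 + c30 / 20 + c21 / 60 + c12 / 60 = 0"
    "c10 / 12 + c20 / 20 + c11 / 60 + c30 / 30 + c21 / 120 + c12 / 180 = 0"
    "c10 / 24 + c20 / 60 + c11 / 60 + c30 / 120 + c21 / 180 + c12 / 120 = 0"
    "d01 / 6 + d11 / 24 + d02 / 12 + d21 / 60 + d12 / 60 + d03 / 20 = 0"
    "d01 / 24 + d11 / 60 + d02 / 60 + d21 / 120 + d12 / 180 + d03 / 120 = 0"
    "d01 / 12 + d11 / 60 + d02 / 20 + d21 / 180 + d12 / 120 + d03 / 30 = 0"
    using m(1-6) TF(1-3)[unfolded n mv] TH(1-3)[unfolded n mv] by linarith+
  have M2: "c10 / 60 + c20 / 120 + c11 / 180 + c30 / 210 + c21 / 420 + c12 / 420 =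
      d01 / 60 + d11 / 120 + d02 / 180 + d21 / 210 + d12 / 420 + d03 / 420"
    using m(7) TF(4)[unfolded n mv] TH(4)[unfolded n mv] by linarith
  have M3: "c10 / 60 + c20 / 180 + c11 / 120 + c30 / 420 + c21 / 420 + c12 / 210 =
      d01 / 60 + d11 / 180 + d02 / 120 + d21 / 420 + d12 / 420 + d03 / 210"
    using m(8) TF(5)[unfolded n mv] TH(5)[unfolded n mv] by linarith
  have E: "c10 + c20 + c30 = 0" "d01 + d02 + d03 = 0"
    "2 * c10 - 2 * c11 - d01 + 4 * c20 + d02 - 2 * d11 + 8 * c30 - d03 - 4 * c21 + 2 * c12 - 4 * d21 + 2 * d12 = 0"
    "- c10 + 2 * d01 - 2 * c11 - 2 * d11 + c20 + 4 * d02 - c30 + 8 * d03 + 2 * c21 - 4 * c12 + 2 * d21 - 4 * d12 = 0"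
    using e3[of 0] e3[of 1] e3[of "-1"] e3[of 2] unfolding F H by (simp_all add: c0 d0 power2_eq_square power3_eq_cube)
  \<comment> \<open>The lowest moments and the condition at the vertex \<open>b\<close> express
    everything by the coefficients of \<open>s^2 * r\<close> and \<open>s * r^2\<close>. The
    quadratic test functions and the last edge then settle these four.\<close>
  have C: "c10 = c21 / 6" "c20 = c12 / 3 - 2 * c21 / 3" "c30 = c21 / 2 - c12 / 3" "c11 = - c21 / 3 - 2 * c12 / 3"
    using M(1-3) E(1) by argo+
  have D: "d01 = d12 / 6" "d02 = d21 / 3 - 2 * d12 / 3" "d03 = d12 / 2 - d21 / 3" "d11 = - d12 / 3 - 2 * d21 / 3"
    using M(4-6) E(2) by argo+
  have "c21 = 0 \<and> c12 = 0 \<and> d21 = 0 \<and> d12 = 0"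
    using M2 M3 E(3,4) unfolding C D by argo
  then have "c10 = 0 \<and> c20 = 0 \<and> c11 = 0 \<and> c30 = 0 \<and> c21 = 0 \<and> c12 = 0 \<and> d01 = 0 \<and> d11 = 0 \<and> d02 = 0 \<and> d21 = 0 \<and> d12 = 0 \<and> d03 = 0"
    by (simp add: C D)
  then show "f (a + s *\<^sub>R (b - a) + r *\<^sub>R (c - a)) = 0" "h (a + s *\<^sub>R (b - a) + r *\<^sub>R (c - a)) = 0"
    using c0 d0 by (simp_all add: F H)
qed

text \<open>The tangential part of \<open>y\<close>, turned by a right angle, is
  \<open>cross3 y n\<close>; it is orthogonal to \<open>u\<close>, \<open>v\<close> and
  \<open>n\<close>, which span the space.\<close>

lemma perp_triple_zero:
  assumes n: "norm n = 1" and N: "cross3 u v \<noteq> 0" "n \<bullet> cross3 u v \<noteq> 0"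
    and y: "n \<bullet> y = 0" "cross3 n u \<bullet> y = 0" "cross3 n v \<bullet> y = 0"
  shows "y = 0"
proof -
  let ?z = "cross3 y n"
  have z: "?z \<bullet> u = 0" "?z \<bullet> v = 0" "?z \<bullet> n = 0"
    using y(2,3) cross_triple[of y n u] cross_triple[of y n v] by (auto simp: inner_commute dot_cross_self)
  have "?z = ((cross3 u v \<bullet> ?z) / (cross3 u v \<bullet> cross3 u v)) *\<^sub>R cross3 u v" (is "_ = ?k *\<^sub>R _")
    by (rule parallel_cross[OF z(1,2) N(1)])
  then have "?k * (cross3 u v \<bullet> n) = 0" using z(3) by (metis inner_scaleR_left)
  then have "?k = 0" using N(2) by (simp add: inner_commute)
  then have "?z = 0" using \<open>?z = ?k *\<^sub>R cross3 u v\<close> by (metis scaleR_zero_left)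
  then have "(n \<bullet> n) *\<^sub>R y - (n \<bullet> y) *\<^sub>R n = 0" using Lagrange[of n y n] by simp
  then show ?thesis using y(1) n by (auto simp: norm_eq_1)
qed

lemma tangential_part_inner: "n \<bullet> w = 0 \<Longrightarrow> norm n = 1 \<Longrightarrow> tangential_part n v \<bullet> w = v \<bullet> w"
proof -
  assume n: "n \<bullet> w = 0" "norm n = 1"
  have "cross3 (cross3 n v) n = (n \<bullet> n) *\<^sub>R v - (n \<bullet> v) *\<^sub>R n"
    using Lagrange[of n n v] cross_skew[of "cross3 n v" n] by simp
  then show ?thesis using n by (simp add: tangential_part_def inner_diff_left norm_eq_1)
qed

text \<open>The quadratic part arises from choosing \<open>q\<close> as a multiple of
  \<open>n\<close>; a term of \<open>p\<close> moves its centre from the origin to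
  \<open>a\<close>.\<close>

lemma nedelec1_member:
  assumes A: "A1 \<in> polys 1" "A2 \<in> polys 1" "Q \<in> polys 1" and h: "h1 \<bullet> n = 0" "h2 \<bullet> n = 0"
  shows "restr F (\<lambda>x. A1 x *\<^sub>R h1 + A2 x *\<^sub>R h2 + Q x *\<^sub>R cross3 n (x - a)) \<in> nedelec1 F n"
proof -
  let ?p = "\<lambda>x. (A1 x *\<^sub>R h1 + A2 x *\<^sub>R h2) - Q x *\<^sub>R cross3 n a" and ?q = "\<lambda>x. Q x *\<^sub>R n"
  have l: "linear (\<lambda>c::real. c *\<^sub>R v)" for v :: "real^3" by (auto simp: linear_iff scaleR_add_left)
  have p: "?p \<in> polys 1" by (intro polys_diff polys_add polys_linear[OF A(1) l] polys_linear[OF A(2) l] polys_linear[OF A(3) l])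
  have q: "?q \<in> polys 1" by (rule polys_linear[OF A(3) l])
  have e: "A1 x *\<^sub>R h1 + A2 x *\<^sub>R h2 + Q x *\<^sub>R cross3 n (x - a) = ?p x + cross3 (?q x) x" for x
    by (simp add: cross_mult_left Cross3.right_diff_distrib scaleR_diff_right)
  have z: "(?p x + cross3 (?q x) x) \<bullet> n = 0" for x
    unfolding e[symmetric] using h by (simp add: inner_add_left dot_cross_self)
  show ?thesis
    unfolding nedelec1_def mem_Collect_eq using p q z by (intro exI[of _ ?p] exI[of _ ?q]) (simp add: e)
qed

lemma tri_diff:
  assumes "continuous_on UNIV f" "continuous_on UNIV g"
  shows "tri a b c (\<lambda>x. f x - g x) = tri a b c f - tri a b c g"
proof -
  have "continuous_on simplex2 (\<lambda>u. h (a + u$1 *\<^sub>R (b - a) + u$2 *\<^sub>R (c - a)))" if "continuous_on UNIV h" for h :: "real^3 \<Rightarrow> real"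
    by (rule continuous_on_compose2[OF that]) (auto intro!: continuous_intros)
  then show ?thesis
    unfolding tri_def using assms by (intro set_integral_diff set_integrable_compact(1) compact_simplex2) auto
qed

lemma polys_inner: "u \<in> polys k \<Longrightarrow> (\<lambda>x. g \<bullet> u x) \<in> polys k" for u :: "real^3 \<Rightarrow> 'b::real_inner"
  by (rule polys_linear[where L = "\<lambda>y. g \<bullet> y"]) (auto simp: linear_iff inner_add_right)

text \<open>The normal component is a scalar cubic, settled by the edges and the mean value; the
  tangential part is the planar problem of \<open>bdm_face_zero\<close>.\<close>

lemma face_trace_zero:
  fixes u :: "real^3 \<Rightarrow> real^3"
  assumes u: "u \<in> polys 3" and N: "cross3 (b - a) (c - a) \<noteq> 0" and n: "unit_normal (convex hull {a, b, c}) n"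
    and v: "u a = 0" "u b = 0" "u c = 0"
    and e: "\<And>x y q. (x, y) \<in> {(a, b), (a, c), (b, c)} \<Longrightarrow> q \<in> polys 1 \<Longrightarrow>
       edge_integral (convex hull {x, y}) (\<lambda>z. (n \<bullet> u z) * q z) = 0 \<and>
       edge_integral (convex hull {x, y}) (\<lambda>z. (cross3 n (y - x) \<bullet> u z) * q z) = 0"
    and d: "aff_dim (convex hull {a, b}) = 1" "aff_dim (convex hull {a, c}) = 1" "aff_dim (convex hull {b, c}) = 1"
    and m0: "face_integral (convex hull {a, b, c}) (\<lambda>x. n \<bullet> u x) = 0"
    and m1: "\<And>w. w \<in> nedelec1 (convex hull {a, b, c}) n \<Longrightarrow>
      face_integral (convex hull {a, b, c}) (\<lambda>x. tangential_part n (u x) \<bullet> w x) = 0"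
    and x: "x \<in> convex hull {a, b, c}"
  shows "u x = 0"
proof -
  let ?F = "convex hull {a, b, c}"
  have n1: "norm n = 1" and ne: "n \<bullet> (b - a) = 0" "n \<bullet> (c - a) = 0" using n unfolding unit_normal_hull by auto
  have ab: "a \<noteq> b" "a \<noteq> c" "b \<noteq> c" using N by auto
  have nN: "n \<bullet> cross3 (b - a) (c - a) \<noteq> 0"
    using unit_normal_cases[OF N n] N by auto
  have cu: "continuous_on S u" for S by (rule polys_continuous[OF u])
  define f0 f1 f2 where "f0 x = n \<bullet> u x" and "f1 x = cross3 n (c - a) \<bullet> u x" and "f2 x = - (cross3 n (b - a) \<bullet> u x)" for x
  have fp: "f0 \<in> polys 3" "f1 \<in> polys 3" "f2 \<in> polys 3"
    unfolding f0_def[abs_def] f1_def[abs_def] f2_def[abs_def] by (intro polys_minus polys_inner u)+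
  have edge: "(g \<bullet> u (x + s *\<^sub>R (y - x))) = 0"
    if xy: "(x, y) \<in> {(a, b), (a, c), (b, c)}" and g: "g = n \<or> g = cross3 n (y - x)" for x y g s
  proof (rule edge_cubic_zero[OF polys_inner[OF u]])
    show "x \<noteq> y" using xy ab by auto
    show "g \<bullet> u x = 0" "g \<bullet> u y = 0" using xy v by auto
    show "aff_dim (convex hull {x, y}) = 1" using xy d by auto
    show "edge_integral (convex hull {x, y}) (\<lambda>z. g \<bullet> u z * q z) = 0" if "q \<in> polys 1" for q
      using e[OF xy that] g by auto
  qed
  have f0e: "f0 (a + s *\<^sub>R (b - a)) = 0" "f0 (a + s *\<^sub>R (c - a)) = 0" "f0 (b + s *\<^sub>R (c - b)) = 0" for s
    unfolding f0_def by (rule edge; simp)+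
  have f0z: "f0 (a + s *\<^sub>R (b - a) + r *\<^sub>R (c - a)) = 0" for s r
    by (rule face_scalar_zero[OF fp(1) N f0e]) (use m0 in \<open>simp add: f0_def[abs_def]\<close>)
  have f1e: "f1 (a + r *\<^sub>R (c - a)) = 0" for r unfolding f1_def by (rule edge) auto
  have f2e: "f2 (a + r *\<^sub>R (b - a)) = 0" for r unfolding f2_def using edge[of a b "cross3 n (b - a)" r] by simp
  have f3e: "f1 (b + r *\<^sub>R (c - b)) + f2 (b + r *\<^sub>R (c - b)) = 0" for r
  proof -
    have "cross3 n (c - b) = cross3 n (c - a) - cross3 n (b - a)"
      by (simp add: Cross3.right_diff_distrib)
    then show ?thesis unfolding f1_def f2_def using edge[of b c "cross3 n (c - b)" r] by (simp add: inner_diff_left)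
  qed
  define \<nu> where "\<nu> = n \<bullet> cross3 (b - a) (c - a)"
  have h: "cross3 n (c - a) \<bullet> (b - a) = - \<nu>" "cross3 n (b - a) \<bullet> (c - a) = \<nu>"
    unfolding \<nu>_def by (simp_all add: cross3_def inner_vec_def sum_3 vector_3 algebra_simps)
  \<comment> \<open>The affine coordinates of the triangle, expressed through the in-plane normals
    of its two edges at \<open>a\<close>.\<close>
  define S R where "S x = - (cross3 n (c - a) \<bullet> (x - a)) / \<nu>" and "R x = (cross3 n (b - a) \<bullet> (x - a)) / \<nu>" for x
  have SR: "S (a + s *\<^sub>R (b - a) + r *\<^sub>R (c - a)) = s" "R (a + s *\<^sub>R (b - a) + r *\<^sub>R (c - a)) = r" for s r
    using nN by (simp_all add: S_def R_def inner_add_right h dot_cross_self) (simp_all add: \<nu>_def)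
  have Sp: "S \<in> polys 1"
  proof -
    have "S = (\<lambda>x. (cross3 n (c - a) \<bullet> a) / \<nu> + (- (1 / \<nu>) *\<^sub>R cross3 n (c - a)) \<bullet> x)"
      by (rule ext) (simp add: S_def inner_diff_right diff_divide_distrib)
    then show ?thesis using polys_affine by metis
  qed
  have Rp: "R \<in> polys 1"
  proof -
    have "R = (\<lambda>x. - (cross3 n (b - a) \<bullet> a) / \<nu> + ((1 / \<nu>) *\<^sub>R cross3 n (b - a)) \<bullet> x)"
      by (rule ext) (simp add: R_def inner_diff_right diff_divide_distrib)
    then show ?thesis using polys_affine by metis
  qed
  have cS: "continuous_on X S" "continuous_on X R" for X using polys_continuous Sp Rp by auto
  have cf: "continuous_on X f1" "continuous_on X f2" for X using polys_continuous fp by auto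
  \<comment> \<open>In terms of these edge normals the rotated position vector has coefficients
    given by \<open>R\<close> and \<open>S\<close>; this produces the last two moment conditions of
    \<open>bdm_face_zero\<close>.\<close>
  have rot: "cross3 n (x - a) = R x *\<^sub>R cross3 n (c - a) - S x *\<^sub>R (- cross3 n (b - a))" if "x \<in> ?F" for x
  proof -
    obtain w :: "real^2" where "x = a + w$1 *\<^sub>R (b - a) + w$2 *\<^sub>R (c - a)" using \<open>x \<in> ?F\<close> unfolding convex_hull_3_image by blast
    then show ?thesis by (simp add: SR cross_add_right cross_mult_right add.commute)
  qed
  have test: "tri a b c (\<lambda>x. A1 x * f1 x + A2 x * f2 x + Q x * (R x * f1 x - S x * f2 x)) = 0"
    if A: "A1 \<in> polys 1" "A2 \<in> polys 1" "Q \<in> polys 1" for A1 A2 Q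
  proof -
    let ?w = "restr ?F (\<lambda>x. A1 x *\<^sub>R cross3 n (c - a) + A2 x *\<^sub>R (- cross3 n (b - a)) + Q x *\<^sub>R cross3 n (x - a))"
    have w: "?w \<in> nedelec1 ?F n" by (rule nedelec1_member[OF A]) (simp_all add: dot_cross_self)
    have wn: "n \<bullet> ?w x = 0" for x by (simp add: restr_def inner_add_right inner_diff_right dot_cross_self)
    have c: "continuous_on X (\<lambda>x. A1 x * f1 x + A2 x * f2 x + Q x * (R x * f1 x - S x * f2 x))" for X
      by (intro continuous_intros cS cf polys_continuous[OF A(1)] polys_continuous[OF A(2)] polys_continuous[OF A(3)])
    have "0 = face_integral ?F (\<lambda>x. tangential_part n (u x) \<bullet> ?w x)" using m1[OF w] by simp
    also have "\<dots> = face_integral ?F (\<lambda>x. A1 x * f1 x + A2 x * f2 x + Q x * (R x * f1 x - S x * f2 x))"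
    proof (rule face_integral_cong[OF aff_dim_triangle[OF N]])
      fix x assume x: "x \<in> ?F"
      have "tangential_part n (u x) \<bullet> ?w x = ?w x \<bullet> u x"
        unfolding tangential_part_inner[OF wn n1] by (rule inner_commute)
      also have "\<dots> = A1 x * f1 x + A2 x * f2 x + Q x * (R x * f1 x - S x * f2 x)"
        using x by (simp add: restr_def rot f1_def f2_def inner_add_left inner_diff_left)
      finally show "tangential_part n (u x) \<bullet> ?w x = A1 x * f1 x + A2 x * f2 x + Q x * (R x * f1 x - S x * f2 x)" .
    qed
    also have "\<dots> = norm (cross3 (b - a) (c - a)) * tri a b c (\<lambda>x. A1 x * f1 x + A2 x * f2 x + Q x * (R x * f1 x - S x * f2 x))"
      by (rule face_integral_tri[OF N c])
    finally show ?thesis using N by simp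
  qed
  have t: "tri a b c f1 = 0" "tri a b c (\<lambda>x. S x * f1 x) = 0" "tri a b c (\<lambda>x. R x * f1 x) = 0"
    "tri a b c f2 = 0" "tri a b c (\<lambda>x. S x * f2 x) = 0" "tri a b c (\<lambda>x. R x * f2 x) = 0"
    using test[of "\<lambda>_. 1" "\<lambda>_. 0" "\<lambda>_. 0"] test[of S "\<lambda>_. 0" "\<lambda>_. 0"] test[of R "\<lambda>_. 0" "\<lambda>_. 0"]
      test[of "\<lambda>_. 0" "\<lambda>_. 1" "\<lambda>_. 0"] test[of "\<lambda>_. 0" S "\<lambda>_. 0"] test[of "\<lambda>_. 0" R "\<lambda>_. 0"] Sp Rp by simp_all
  have t3: "tri a b c (\<lambda>x. S x * R x * f1 x - S x * S x * f2 x) = 0" "tri a b c (\<lambda>x. R x * R x * f1 x - S x * R x * f2 x) = 0"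
    using test[of "\<lambda>_. 0" "\<lambda>_. 0" S] test[of "\<lambda>_. 0" "\<lambda>_. 0" R] Sp Rp by (simp_all add: algebra_simps)
  have c3: "continuous_on UNIV (\<lambda>x. S x * R x * f1 x)" "continuous_on UNIV (\<lambda>x. S x * S x * f2 x)"
    "continuous_on UNIV (\<lambda>x. R x * R x * f1 x)" "continuous_on UNIV (\<lambda>x. S x * R x * f2 x)"
    by (intro continuous_on_mult cS cf)+
  have t2: "tri a b c (\<lambda>x. S x * R x * f1 x) = tri a b c (\<lambda>x. S x * S x * f2 x)"
    "tri a b c (\<lambda>x. R x * R x * f1 x) = tri a b c (\<lambda>x. S x * R x * f2 x)"
    using t3 tri_diff[OF c3(1,2), of a b c] tri_diff[OF c3(3,4), of a b c] by linarith+
  note z = bdm_face_zero[OF fp(2,3) f1e f2e f3e SR t t2]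
  obtain w :: "real^2" where w: "x = a + w$1 *\<^sub>R (b - a) + w$2 *\<^sub>R (c - a)" using x unfolding convex_hull_3_image by blast
  have "n \<bullet> u x = 0" "cross3 n (b - a) \<bullet> u x = 0" "cross3 n (c - a) \<bullet> u x = 0"
    using f0z[of "w$1" "w$2"] z[of "w$1" "w$2"] unfolding w[symmetric] f0_def f1_def f2_def by auto
  then show ?thesis by (rule perp_triple_zero[OF n1 N nN])
qed

section \<open>The relation between the traces at an edge\<close>

text \<open>Homogeneous of degree one in \<open>t\<close>, like the components along
  \<open>cross3 n t\<close>, because a tangential vector need not be normalised.\<close>

definition kappa :: "real^3 \<Rightarrow> real^3 \<Rightarrow> real^3 \<Rightarrow> real" where
  "kappa t n n' = (n \<bullet> n') * (t \<bullet> t) / (n' \<bullet> cross3 n t)"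

lemma sym_mats_inner: "A \<in> sym_mats \<Longrightarrow> x \<bullet> (A *v y) = y \<bullet> (A *v x)"
  by (metis (mono_tags, lifting) dot_lmul_matrix inner_commute mem_Collect_eq sym_mats_def transpose_matrix_vector)

text \<open>Both \<open>n \<bullet> A n\<close> and \<open>n \<bullet> A (n \<times> t)\<close> are invariant under \<open>n \<mapsto> - n\<close>, so the relation needs no
  orientation of the normals.\<close>

lemma edge_relation:
  assumes A: "A \<in> sym_mats" and n: "norm n = 1" "norm n' = 1" and t: "t \<noteq> 0" "n \<bullet> t = 0" "n' \<bullet> t = 0"
    and nn': "n' \<bullet> cross3 n t \<noteq> 0"
  shows "n \<bullet> (A *v cross3 n t) + n' \<bullet> (A *v cross3 n' t) = kappa t n n' * (n' \<bullet> (A *v n') - n \<bullet> (A *v n))"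
proof -
  define \<alpha> \<beta> T where "\<alpha> = n \<bullet> n'" and "\<beta> = n' \<bullet> cross3 n t" and "T = t \<bullet> t"
  have T: "T \<noteq> 0" using t by (simp add: T_def)
  \<comment> \<open>\<open>k\<close> and \<open>cross3 k t\<close> form an orthogonal basis of the
    plane orthogonal to \<open>t\<close>.\<close>
  have dec: "T *\<^sub>R m = (k \<bullet> m * T) *\<^sub>R k + (m \<bullet> cross3 k t) *\<^sub>R cross3 k t"
    if "norm k = 1" "k \<bullet> t = 0" "m \<bullet> t = 0" for k m
  proof -
    have kk: "k \<bullet> k = 1" using that(1) by (simp add: norm_eq_1)
    have "cross3 k t \<bullet> cross3 k t = T" using that kk by (simp add: dot_cross T_def inner_commute)
    define y where "y = T *\<^sub>R m - ((k \<bullet> m * T) *\<^sub>R k + (m \<bullet> cross3 k t) *\<^sub>R cross3 k t)"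
    have "y \<bullet> t = 0" "y \<bullet> k = 0" "y \<bullet> cross3 k t = 0"
      using that kk \<open>cross3 k t \<bullet> cross3 k t = T\<close>
      by (simp_all add: y_def inner_diff_left inner_add_left dot_cross_self inner_commute[of m k])
    moreover have "cross3 k t \<noteq> 0" using \<open>cross3 k t \<bullet> cross3 k t = T\<close> T by auto
    ultimately have "y = ((cross3 k t \<bullet> y) / (cross3 k t \<bullet> cross3 k t)) *\<^sub>R cross3 k t" by (intro parallel_cross)
    then have "y = 0" using \<open>y \<bullet> cross3 k t = 0\<close> by (simp add: inner_commute)
    then show ?thesis by (simp add: y_def)
  qed
  have \<beta>': "n \<bullet> cross3 n' t = - \<beta>"
    by (simp add: \<beta>_def cross3_def inner_vec_def sum_3 vector_3 algebra_simps)
  have d1: "T *\<^sub>R n' = (\<alpha> * T) *\<^sub>R n + \<beta> *\<^sub>R cross3 n t" using dec[OF n(1) t(2,3)] by (simp add: \<alpha>_def \<beta>_def)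
  have d2: "T *\<^sub>R n = (\<alpha> * T) *\<^sub>R n' - \<beta> *\<^sub>R cross3 n' t" using dec[OF n(2) t(3,2)] \<beta>' by (simp add: \<alpha>_def inner_commute)
  \<comment> \<open>The mixed entry between \<open>n\<close> and \<open>n'\<close> is computed
    twice, expanding \<open>n'\<close> in the frame of \<open>n\<close> and then \<open>n\<close> in
    that of \<open>n'\<close>; the symmetry of \<open>A\<close> equates the results.\<close>
  have "T * (n \<bullet> (A *v n')) = n \<bullet> (A *v (T *\<^sub>R n'))" by (simp add: matrix_vector_mult_scaleR)
  also have "\<dots> = \<alpha> * T * (n \<bullet> (A *v n)) + \<beta> * (n \<bullet> (A *v cross3 n t))"
    unfolding d1 by (simp add: matrix_vector_right_distrib matrix_vector_mult_scaleR inner_add_right)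
  finally have 1: "T * (n \<bullet> (A *v n')) = \<alpha> * T * (n \<bullet> (A *v n)) + \<beta> * (n \<bullet> (A *v cross3 n t))" .
  have "T * (n' \<bullet> (A *v n)) = n' \<bullet> (A *v (T *\<^sub>R n))" by (simp add: matrix_vector_mult_scaleR)
  also have "\<dots> = \<alpha> * T * (n' \<bullet> (A *v n')) - \<beta> * (n' \<bullet> (A *v cross3 n' t))"
    unfolding d2 by (simp add: matrix_vector_mult_diff_distrib matrix_vector_mult_scaleR inner_diff_right)
  finally have "\<beta> * (n \<bullet> (A *v cross3 n t) + n' \<bullet> (A *v cross3 n' t)) = \<alpha> * T * (n' \<bullet> (A *v n') - n \<bullet> (A *v n))"
    using 1 sym_mats_inner[OF A, of n n'] by (simp add: algebra_simps)
  then show ?thesis using nn' by (simp add: kappa_def \<alpha>_def[symmetric] \<beta>_def[symmetric] T_def[symmetric] field_simps)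
qed

section \<open>Bubbles on one element\<close>

lemma cubic1_coeffs_zero:
  fixes c0 :: real
  assumes "\<And>s. 0 \<le> s \<Longrightarrow> s \<le> 1 \<Longrightarrow> c0 + c1 * s + c2 * s^2 + c3 * s^3 = 0"
  shows "c0 = 0" "c1 = 0" "c2 = 0" "c3 = 0"
  using assms[of 0] assms[of 1] assms[of "1/2"] assms[of "1/4"] by (simp_all add: power2_eq_square power3_eq_cube; argo)+

lemma cubic2_coeffs_zero:
  fixes c00 :: real
  assumes *: "\<forall>s r. 0 \<le> s \<longrightarrow> 0 \<le> r \<longrightarrow> s + r \<le> 1 \<longrightarrow>
    c00 + c10 * s + c01 * r + c20 * s^2 + c11 * (s * r) + c02 * r^2 + c30 * s^3 + c21 * (s^2 * r) + c12 * (s * r^2) + c03 * r^3 = 0"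
  shows "c00 = 0" "c10 = 0" "c01 = 0" "c20 = 0" "c11 = 0" "c02 = 0" "c30 = 0" "c21 = 0" "c12 = 0" "c03 = 0"
proof -
  note z = *[rule_format]
  have "c00 + c10 * s + c20 * s^2 + c30 * s^3 = 0" if "0 \<le> s" "s \<le> 1" for s using z[of s 0] that by simp
  then show c1: "c00 = 0" "c10 = 0" "c20 = 0" "c30 = 0" using cubic1_coeffs_zero[of c00 c10 c20 c30] by auto
  have "c00 + c01 * s + c02 * s^2 + c03 * s^3 = 0" if "0 \<le> s" "s \<le> 1" for s using z[of 0 s] that by simp
  then show c2: "c01 = 0" "c02 = 0" "c03 = 0" using cubic1_coeffs_zero[of c00 c01 c02 c03] by auto
  show "c11 = 0" "c21 = 0" "c12 = 0"
    using z[of "1/4" "1/4"] z[of "1/2" "1/4"] z[of "1/4" "1/2"] by (simp_all add: c1 c2 power2_eq_square; argo)+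
qed

lemma cubic3_slices:
  "cubic3 c s r 0 = c 0 0 0 + c 1 0 0 * s + c 0 1 0 * r + c 2 0 0 * s^2 + c 1 1 0 * (s * r) + c 0 2 0 * r^2 +
     c 3 0 0 * s^3 + c 2 1 0 * (s^2 * r) + c 1 2 0 * (s * r^2) + c 0 3 0 * r^3"
  "cubic3 c s 0 z = c 0 0 0 + c 1 0 0 * s + c 0 0 1 * z + c 2 0 0 * s^2 + c 1 0 1 * (s * z) + c 0 0 2 * z^2 +
     c 3 0 0 * s^3 + c 2 0 1 * (s^2 * z) + c 1 0 2 * (s * z^2) + c 0 0 3 * z^3"
  "cubic3 c 0 r z = c 0 0 0 + c 0 1 0 * r + c 0 0 1 * z + c 0 2 0 * r^2 + c 0 1 1 * (r * z) + c 0 0 2 * z^2 +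
     c 0 3 0 * r^3 + c 0 2 1 * (r^2 * z) + c 0 1 2 * (r * z^2) + c 0 0 3 * z^3"
  by (simp_all add: cubic3_def)

text \<open>Vanishing for \<open>z = 0\<close> and for \<open>r = 0\<close> leaves only monomials
  containing both \<open>r\<close> and \<open>z\<close>, so the quotient by \<open>r * z\<close> has
  degree one.\<close>

lemma cubic3_two_faces:
  assumes "\<And>s r. 0 \<le> s \<Longrightarrow> 0 \<le> r \<Longrightarrow> s + r \<le> 1 \<Longrightarrow> cubic3 c s r 0 = 0"
    and "\<And>s z. 0 \<le> s \<Longrightarrow> 0 \<le> z \<Longrightarrow> s + z \<le> 1 \<Longrightarrow> cubic3 c s 0 z = 0"
  shows "cubic3 c s r z = r * z * (c 0 1 1 + c 1 1 1 * s + c 0 2 1 * r + c 0 1 2 * z)"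
proof -
  have a1: "\<forall>s r. 0 \<le> s \<longrightarrow> 0 \<le> r \<longrightarrow> s + r \<le> 1 \<longrightarrow> cubic3 c s r 0 = 0"
    and a2: "\<forall>s z. 0 \<le> s \<longrightarrow> 0 \<le> z \<longrightarrow> s + z \<le> 1 \<longrightarrow> cubic3 c s 0 z = 0" using assms by auto
  note z1 = cubic2_coeffs_zero[OF a1[unfolded cubic3_slices]]
  note z2 = cubic2_coeffs_zero[OF a2[unfolded cubic3_slices]]
  show ?thesis unfolding cubic3_def z1 z2 by (simp add: algebra_simps power2_eq_square)
qed

text \<open>Vanishing on three faces leaves only the coefficient of \<open>s * r * z\<close>, which
  one interior point detects.\<close>

lemma cubic3_coeffs_zero:
  assumes z: "\<And>s r z. 0 \<le> s \<Longrightarrow> 0 \<le> r \<Longrightarrow> 0 \<le> z \<Longrightarrow> s + r + z \<le> 1 \<Longrightarrow> cubic3 c s r z = 0"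
    and ijl: "i + j + l \<le> 3"
  shows "c i j l = 0"
proof -
  have a1: "\<forall>s r. 0 \<le> s \<longrightarrow> 0 \<le> r \<longrightarrow> s + r \<le> 1 \<longrightarrow> cubic3 c s r 0 = 0"
    and a2: "\<forall>s z. 0 \<le> s \<longrightarrow> 0 \<le> z \<longrightarrow> s + z \<le> 1 \<longrightarrow> cubic3 c s 0 z = 0"
    and a3: "\<forall>r z. 0 \<le> r \<longrightarrow> 0 \<le> z \<longrightarrow> r + z \<le> 1 \<longrightarrow> cubic3 c 0 r z = 0"
    using z by simp_all
  note z1 = cubic2_coeffs_zero[OF a1[unfolded cubic3_slices]]
  note z2 = cubic2_coeffs_zero[OF a2[unfolded cubic3_slices]]
  note z3 = cubic2_coeffs_zero[OF a3[unfolded cubic3_slices]]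
  have c111: "c 1 1 1 = 0"
    using z[of "1/4" "1/4" "1/4"] unfolding cubic3_def z1 z2 z3 by simp
  have r: "d i j = 0" if "i + j \<le> 3" "d 0 0 = 0" "d 1 0 = 0" "d 0 1 = 0" "d 2 0 = 0" "d 1 1 = 0" "d 0 2 = 0" "d 3 0 = 0" "d 2 1 = 0" "d 1 2 = 0" "d 0 3 = 0"
    for d :: "nat \<Rightarrow> nat \<Rightarrow> real" and i j :: nat
  proof -
    have "i = 0 \<or> i = 1 \<or> i = 2 \<or> i = 3" "j = 0 \<or> j = 1 \<or> j = 2 \<or> j = 3" using that(1) by linarith+
    then show ?thesis using that by (elim disjE) simp_all
  qed
  have "l = 0 \<or> j = 0 \<or> i = 0 \<or> l = 1 \<and> j = 1 \<and> i = 1" using ijl by linarith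
  then consider "l = 0" | "j = 0" | "i = 0" | "l = 1 \<and> j = 1 \<and> i = 1" by blast
  then show ?thesis
  proof cases
    case 1
    then show ?thesis using r[of i j "\<lambda>i j. c i j 0"] z1 ijl by simp
  next
    case 2
    then show ?thesis using r[of i l "\<lambda>i l. c i 0 l"] z2 ijl by simp
  next
    case 3
    then show ?thesis using r[of j l "\<lambda>j l. c 0 j l"] z3 ijl by simp
  next
    case 4
    then show ?thesis using c111 by simp
  qed
qed

lemma bary_polys: "bary a b c d \<in> polys 1"
proof -
  let ?N = "cross3 (b - a) (c - a)"
  have "bary a b c d = (\<lambda>y. - (?N \<bullet> a) / (?N \<bullet> (d - a)) + ((1 / (?N \<bullet> (d - a))) *\<^sub>R ?N) \<bullet> y)"
    by (rule ext) (simp add: bary_def inner_diff_right[of ?N _ a] diff_divide_distrib)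
  then show ?thesis using polys_affine by metis
qed

lemma bary_coords:
  assumes t: "tet a b c d"
  shows "bary a c d b (a + s *\<^sub>R (b - a) + r *\<^sub>R (c - a) + z *\<^sub>R (d - a)) = s"
    "bary a d b c (a + s *\<^sub>R (b - a) + r *\<^sub>R (c - a) + z *\<^sub>R (d - a)) = r"
    "bary a b c d (a + s *\<^sub>R (b - a) + r *\<^sub>R (c - a) + z *\<^sub>R (d - a)) = z"
  using bary_affine[OF tet_perms(5)[OF t], of r z s] bary_affine[OF tet_perms(6)[OF t], of z s r] bary_affine[OF t, of s r z]
  by (simp_all add: add_ac)

lemma interior_tet_nonempty:
  assumes "tet a b c d"
  shows "interior (convex hull {a, b, c, d}) \<noteq> {}"
proof -
  have "aff_dim (convex hull {a, b, c, d}) = 3" by (rule aff_dim_tet_faces(3)[OF assms])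
  then have "affine hull (convex hull {a, b, c, d}) = UNIV" using aff_dim_eq_full[of "convex hull {a, b, c, d}"] by simp
  then have "rel_interior (convex hull {a, b, c, d}) = interior (convex hull {a, b, c, d})" by (rule rel_interior_interior)
  then show ?thesis using rel_interior_eq_empty[of "convex hull {a, b, c, d}"] by auto
qed

text \<open>\<open>f\<close> is divisible by the barycentric coordinates of \<open>c\<close> and
  \<open>d\<close>. The linear quotient serves as its own test function, and the remaining weight is
  nonnegative on the tetrahedron.\<close>

lemma pair_zero:
  fixes f :: "real^3 \<Rightarrow> real"
  assumes t: "tet a b c d" and f: "f \<in> polys 3"
    and z1: "\<And>x. x \<in> convex hull {a, b, c} \<Longrightarrow> f x = 0" and z2: "\<And>x. x \<in> convex hull {a, b, d} \<Longrightarrow> f x = 0"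
    and m: "\<And>p. p \<in> polys 1 \<Longrightarrow> (LINT x:(convex hull {a, b, c, d})|lebesgue. f x * p x) = 0"
    and x: "x \<in> convex hull {a, b, c, d}"
  shows "f x = 0"
proof -
  let ?K = "convex hull {a, b, c, d}"
  obtain k where k: "\<And>s r z. f (a + s *\<^sub>R (b - a) + r *\<^sub>R (c - a) + z *\<^sub>R (d - a)) = cubic3 k s r z"
    using polys_cubic3_form[OF f] by blast
  have "cubic3 k s r 0 = 0" if "0 \<le> s" "0 \<le> r" "s + r \<le> 1" for s r
  proof -
    have "a + s *\<^sub>R (b - a) + r *\<^sub>R (c - a) \<in> convex hull {a, b, c}"
      unfolding convex_hull_3_image by (rule image_eqI[of _ _ "vector [s, r]"]) (use that in \<open>auto simp: simplex2_def vector_2\<close>)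
    then show ?thesis using z1 k[of s r 0] by simp
  qed
  moreover have "cubic3 k s 0 z = 0" if "0 \<le> s" "0 \<le> z" "s + z \<le> 1" for s z
  proof -
    have "a + s *\<^sub>R (b - a) + z *\<^sub>R (d - a) \<in> convex hull {a, b, d}"
      unfolding convex_hull_3_image by (rule image_eqI[of _ _ "vector [s, z]"]) (use that in \<open>auto simp: simplex2_def vector_2\<close>)
    then show ?thesis using z2 k[of s 0 z] by simp
  qed
  ultimately have fk: "f (a + s *\<^sub>R (b - a) + r *\<^sub>R (c - a) + z *\<^sub>R (d - a)) = r * z * (k 0 1 1 + k 1 1 1 * s + k 0 2 1 * r + k 0 1 2 * z)" for s r z
    unfolding k by (rule cubic3_two_faces)
  define p where "p y = k 0 1 1 + k 1 1 1 *\<^sub>R bary a c d b y + k 0 2 1 *\<^sub>R bary a d b c y + k 0 1 2 *\<^sub>R bary a b c d y" for y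
  have p: "p \<in> polys 1" unfolding p_def[abs_def] by (intro polys_add polys_const polys_scaleR bary_polys)
  have fp: "f y = bary a d b c y * bary a b c d y * p y" for y
    using fk[of "bary a c d b y" "bary a d b c y" "bary a b c d y"] bary_repr[OF t, of y] by (simp add: p_def)
  have "f x * p x = 0"
  proof (rule integral_zero_imp_zero[OF _ _ interior_tet_nonempty[OF t] _ _ m[OF p] x])
    show "compact ?K" "convex ?K" by (auto simp: finite_imp_compact_convex_hull)
    show "continuous_on ?K (\<lambda>x. f x * p x)" by (intro continuous_intros polys_continuous[OF f] polys_continuous[OF p])
    fix y assume y: "y \<in> ?K"
    have eq: "f y * p y = (bary a d b c y * bary a b c d y) * (p y * p y)" by (simp add: fp)
    show "0 \<le> f y * p y" unfolding eq using y unfolding tet_mem_iff[OF t] by simp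
  qed
  then show ?thesis using fp[of x] by auto
qed

text \<open>The symmetrised product: the matrix dual to the entry
  \<open>g \<bullet> (A *v h)\<close> of a symmetric \<open>A\<close>.\<close>

definition sym_tensor :: "real^3 \<Rightarrow> real^3 \<Rightarrow> real^3^3" where
  "sym_tensor g h = (\<chi> i j. (g$i * h$j + h$i * g$j) / 2)"

lemma sym_tensor_sym: "sym_tensor g h \<in> sym_mats"
  by (simp add: sym_tensor_def sym_mats_def transpose_def vec_eq_iff)

lemma sym_tensor_inner: "A \<in> sym_mats \<Longrightarrow> A \<bullet> sym_tensor g h = g \<bullet> (A *v h)"
proof -
  assume "A \<in> sym_mats"
  then have s: "A$1$2 = A$2$1" "A$1$3 = A$3$1" "A$2$3 = A$3$2"
    by (auto simp: sym_mats_def transpose_def vec_eq_iff)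
  show ?thesis
    by (simp add: inner_vec_def sum_3 matrix_vector_mult_def sym_tensor_def s) (simp add: field_simps)
qed

lemma sym_mats_scaleR: "A \<in> sym_mats \<Longrightarrow> c *\<^sub>R A \<in> sym_mats"
  and sym_mats_add: "A \<in> sym_mats \<Longrightarrow> B \<in> sym_mats \<Longrightarrow> A + B \<in> sym_mats"
  and sym_mats_zero: "0 \<in> sym_mats"
  and sym_mats_diff: "A \<in> sym_mats \<Longrightarrow> B \<in> sym_mats \<Longrightarrow> A - B \<in> sym_mats"
  by (auto simp: sym_mats_def transpose_def vec_eq_iff)

lemma linear_matrix_vector: "linear (\<lambda>A :: real^3^3. A *v h)"
  by (auto simp: linear_iff matrix_vector_mult_add_rdistrib scaleR_matrix_vector_assoc)

lemma polys_matrix_vector: "P \<in> polys k \<Longrightarrow> (\<lambda>x. P x *v h) \<in> polys k" for P :: "real^3 \<Rightarrow> real^3^3"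
  by (rule polys_linear[OF _ linear_matrix_vector])

text \<open>By symmetry of \<open>P x\<close> the entry between \<open>g\<close> and
  \<open>h\<close> vanishes on both faces at the edge \<open>a, b\<close>. It thus has the form
  treated in \<open>pair_zero\<close>, with test fields that are multiples of
  \<open>sym_tensor g h\<close>.\<close>

lemma element_pair:
  fixes P :: "real^3 \<Rightarrow> real^3^3"
  assumes t: "tet a b c d" and P: "P \<in> polys 3" and sym: "\<And>x. P x \<in> sym_mats"
    and z1: "\<And>x. x \<in> convex hull {a, b, c} \<Longrightarrow> P x *v g = 0" and z2: "\<And>x. x \<in> convex hull {a, b, d} \<Longrightarrow> P x *v h = 0"
    and m: "\<And>\<xi>. \<xi> \<in> polys_on 1 (convex hull {a, b, c, d}) sym_mats \<Longrightarrow> (LINT x:(convex hull {a, b, c, d})|lebesgue. P x \<bullet> \<xi> x) = 0"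
    and x: "x \<in> convex hull {a, b, c, d}"
  shows "g \<bullet> (P x *v h) = 0"
proof (rule pair_zero[OF t _ _ _ _ x])
  let ?K = "convex hull {a, b, c, d}"
  show "(\<lambda>x. g \<bullet> (P x *v h)) \<in> polys 3" by (intro polys_inner polys_matrix_vector P)
  show "g \<bullet> (P x *v h) = 0" if "x \<in> convex hull {a, b, d}" for x using z2[OF that] by simp
  show "g \<bullet> (P x *v h) = 0" if "x \<in> convex hull {a, b, c}" for x using z1[OF that] sym_mats_inner[OF sym, of g x h] by simp
  fix p :: "real^3 \<Rightarrow> real" assume p: "p \<in> polys 1"
  let ?\<xi> = "\<lambda>x. p x *\<^sub>R sym_tensor g h"
  have "restr ?K ?\<xi> \<in> polys_on 1 ?K sym_mats"
    unfolding polys_on_def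
  proof (intro CollectI exI[of _ ?\<xi>] conjI refl ballI)
    show "?\<xi> \<in> polys 1" by (rule polys_linear[OF p]) (auto simp: linear_iff scaleR_add_left)
    show "?\<xi> x \<in> sym_mats" for x by (intro sym_mats_scaleR sym_tensor_sym)
  qed
  then have "0 = (LINT x:?K|lebesgue. P x \<bullet> restr ?K ?\<xi> x)" using m by simp
  also have "\<dots> = (LINT x:?K|lebesgue. (g \<bullet> (P x *v h)) * p x)"
    unfolding set_lebesgue_integral_def
    by (intro Bochner_Integration.integral_cong refl)
      (auto simp: indicator_def restr_def sym_tensor_inner[OF sym] mult.commute)
  finally show "(LINT x:?K|lebesgue. (g \<bullet> (P x *v h)) * p x) = 0" by simp
qed

text \<open>Each of the six edges pairs two facets, which gives all mixed entries of
  \<open>P x\<close> between the four facet normals. The normals are dependent,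
  \<open>g0 = g1 + g2 + g3\<close>, so the entries with \<open>g0\<close> supply the diagonal ones
  in the basis \<open>g1\<close>, \<open>g2\<close>, \<open>g3\<close>.\<close>

lemma element_zero:
  fixes P :: "real^3 \<Rightarrow> real^3^3"
  assumes K: "3 simplex K" and P: "P \<in> polys 3" and sym: "\<And>x. P x \<in> sym_mats"
    and z: "\<And>F x. F \<in> facets K \<Longrightarrow> x \<in> F \<Longrightarrow> P x *v outn K F = 0"
    and m: "\<And>\<xi>. \<xi> \<in> polys_on 1 K sym_mats \<Longrightarrow> (LINT x:K|lebesgue. P x \<bullet> \<xi> x) = 0"
    and x: "x \<in> K"
  shows "P x = 0"
proof -
  obtain a b c d where t: "tet a b c d" and K': "K = convex hull {a, b, c, d}" using simplex_3_iff_tet[THEN iffD1, OF K] by blast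
  have face: "P y *v cross3 (q - p) (r - p) = 0" if "tet p q r s" "{p, q, r, s} = {a, b, c, d}" "y \<in> convex hull {p, q, r}" for p q r s y
  proof -
    have Kp: "K = convex hull {p, q, r, s}" unfolding K' that(2) ..
    have F: "convex hull {p, q, r} \<in> facets K"
      unfolding facets_def Kp using tet_face_hull[OF that(1)] aff_dim_tet_faces(2)[OF that(1)] by auto
    have "P y *v outn K (convex hull {p, q, r}) = 0" by (rule z[OF F that(3)])
    then have "P y *v out_normal p q r s = 0" unfolding Kp outn_tet[OF that(1)] .
    moreover have "- sgn (cross3 (q - p) (r - p) \<bullet> (s - p)) / norm (cross3 (q - p) (r - p)) \<noteq> 0"
      using that(1) tet_cross_nz[OF that(1)] by (auto simp: tet_def sgn_if)
    ultimately show ?thesis unfolding out_normal_def matrix_vector_mult_scaleR by (metis scaleR_eq_0_iff)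
  qed
  define g1 g2 g3 where "g1 = cross3 (c - a) (d - a)" and "g2 = cross3 (d - a) (b - a)" and "g3 = cross3 (b - a) (c - a)"
  define g0 where "g0 = g1 + g2 + g3"
  have g0: "g0 = cross3 (c - b) (d - b)"
    unfolding g0_def g1_def g2_def g3_def by (simp add: vec_eq_iff forall_3 cross3_def vector_3 algebra_simps)
  have sets: "{a, c, d, b} = {a, b, c, d}" "{a, d, b, c} = {a, b, c, d}" "{b, c, d, a} = {a, b, c, d}" by auto
  have f1: "P y *v g1 = 0" if "y \<in> convex hull {a, c, d}" for y
    unfolding g1_def by (rule face[OF tet_perms(5)[OF t] sets(1) that])
  have f2: "P y *v g2 = 0" if "y \<in> convex hull {a, d, b}" for y
    unfolding g2_def by (rule face[OF tet_perms(6)[OF t] sets(2) that])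
  have f3: "P y *v g3 = 0" if "y \<in> convex hull {a, b, c}" for y
    unfolding g3_def by (rule face[OF t refl that])
  have f0: "P y *v g0 = 0" if "y \<in> convex hull {b, c, d}" for y
    unfolding g0 by (rule face[OF tet_perms(4)[OF t] sets(3) that])
  have pair: "g \<bullet> (P x *v h) = 0"
    if "{p, q, r, s} = {a, b, c, d}" "\<And>y. y \<in> convex hull {p, q, r} \<Longrightarrow> P y *v g = 0" "\<And>y. y \<in> convex hull {p, q, s} \<Longrightarrow> P y *v h = 0" for p q r s g h
  proof -
    have Kp: "K = convex hull {p, q, r, s}" unfolding K' that(1) ..
    show ?thesis
      by (rule element_pair[OF tet_set_cong[OF t that(1)] P sym that(2,3) m[unfolded Kp] x[unfolded Kp]])
  qed
  have p32: "g3 \<bullet> (P x *v g2) = 0" by (rule pair[of a b c d]) (use f3 f2 in \<open>auto simp: insert_commute\<close>)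
  have p13: "g1 \<bullet> (P x *v g3) = 0" by (rule pair[of a c d b]) (use f1 f3 in \<open>auto simp: insert_commute\<close>)
  have p12: "g1 \<bullet> (P x *v g2) = 0" by (rule pair[of a d c b]) (use f1 f2 in \<open>auto simp: insert_commute\<close>)
  have p10: "g1 \<bullet> (P x *v g0) = 0" by (rule pair[of c d a b]) (use f1 f0 in \<open>auto simp: insert_commute\<close>)
  have p20: "g2 \<bullet> (P x *v g0) = 0" by (rule pair[of b d a c]) (use f2 f0 in \<open>auto simp: insert_commute\<close>)
  have p30: "g3 \<bullet> (P x *v g0) = 0" by (rule pair[of b c a d]) (use f3 f0 in \<open>auto simp: insert_commute\<close>)
  note si = sym_mats_inner[OF sym, of _ x]
  have p: "g1 \<bullet> (P x *v g1) = 0" "g2 \<bullet> (P x *v g2) = 0" "g3 \<bullet> (P x *v g3) = 0"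
    "g2 \<bullet> (P x *v g1) = 0" "g3 \<bullet> (P x *v g1) = 0" "g2 \<bullet> (P x *v g3) = 0"
    using p32 p13 p12 p10 p20 p30 si[of g2 g1] si[of g3 g1] si[of g2 g3]
    by (simp_all add: g0_def matrix_vector_right_distrib inner_add_right)
  have D: "cross3 (b - a) (c - a) \<bullet> (d - a) \<noteq> 0" using t by (simp add: tet_def)
  have basis: "y = 0" if "g1 \<bullet> y = 0" "g2 \<bullet> y = 0" "g3 \<bullet> y = 0" for y
    using cramer3[of "b - a" "c - a" "d - a" y] that D by (simp add: g1_def g2_def g3_def)
  have "P x *v g1 = 0" "P x *v g2 = 0" "P x *v g3 = 0" using basis p p32 p13 p12 by auto
  then have "P x *v y = 0" for y
    using basis[of "P x *v y"] si[of g1 y] si[of g2 y] si[of g3 y] by simp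
  then show ?thesis by (simp add: matrix_eq)
qed

section \<open>Spanning sets of the test spaces\<close>

lemma is_basis_card_le:
  assumes "is_basis B V" "finite S" "V \<subseteq> fn.span S"
  shows "finite B" "card B \<le> card S"
proof -
  have "fn.independent B" "B \<subseteq> fn.span S"
    using assms(1,3) fn.span_superset[of B] unfolding is_basis_def by auto
  then show "finite B" "card B \<le> card S" using fn.independent_span_bound[OF assms(2)] by auto
qed

text \<open>The moments are prescribed on a basis only. Linearity of \<phi> is asked on
  \<open>V\<close> alone, since integrals are additive only where integrability is known.\<close>

lemma is_basis_zero_ext:
  fixes \<phi> :: "('a \<Rightarrow> 'b::real_vector) \<Rightarrow> real"
  assumes B: "is_basis B V" and v: "v \<in> V" and z: "\<And>b. b \<in> B \<Longrightarrow> \<phi> b = 0"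
    and add: "\<And>x y. x \<in> V \<Longrightarrow> y \<in> V \<Longrightarrow> \<phi> (\<lambda>t. x t + y t) = \<phi> x + \<phi> y"
    and scale: "\<And>c x. x \<in> V \<Longrightarrow> \<phi> (\<lambda>t. c *\<^sub>R x t) = c * \<phi> x"
  shows "\<phi> v = 0"
proof -
  have V: "V = fn.span B" and BV: "B \<subseteq> V" using B fn.span_superset[of B] unfolding is_basis_def by auto
  have sub: "fn.subspace V" unfolding V by (rule fn.subspace_span)
  have sc: "\<phi> (scale_fun c x) = c * \<phi> x" if "x \<in> V" for c x using scale[OF that] by (simp add: scale_fun_def)
  have ad: "\<phi> (x + y) = \<phi> x + \<phi> y" if "x \<in> V" "y \<in> V" for x y using add[OF that] by (simp add: plus_fun_def)
  have "v \<in> V \<and> \<phi> v = 0"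
    using v unfolding V
  proof (induction rule: fn.span_induct_alt)
    case base
    have "\<phi> (scale_fun 0 0) = 0" using sc[OF fn.subspace_0[OF sub], of 0] by simp
    moreover have "scale_fun 0 (0 :: 'a \<Rightarrow> 'b) = 0" by (rule ext) (simp add: scale_fun_def)
    ultimately show ?case using fn.subspace_0[OF sub] V by metis
  next
    case (step c x y)
    have "x \<in> V" using step(1) BV by blast
    have cx: "scale_fun c x \<in> V" by (rule fn.subspace_scale[OF sub \<open>x \<in> V\<close>])
    have y: "y \<in> V" "\<phi> y = 0" using step(2) unfolding V by blast+
    have "\<phi> (scale_fun c x + y) = 0" unfolding ad[OF cx y(1)] sc[OF \<open>x \<in> V\<close>] z[OF step(1)] y(2) by simp
    moreover have "scale_fun c x + y \<in> V" by (rule fn.subspace_add[OF sub cx y(1)])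
    ultimately show ?case unfolding V by (rule conjI[rotated])
  qed
  then show ?thesis by blast
qed

lemma polys_0_form: "p \<in> polys 0 \<Longrightarrow> \<exists>c. \<forall>x. p x = c"
proof -
  assume "p \<in> polys 0"
  then obtain c where c: "\<forall>x. p x = (\<Sum>(i, j, l)\<in>triples 0. ((x$1) ^ i * (x$2) ^ j * (x$3) ^ l) *\<^sub>R c i j l)"
    unfolding polys_iff by blast
  have "\<forall>x. p x = c 0 0 0" using c unfolding sum_triples by simp
  then show ?thesis by blast
qed

lemma polys_1_affine:
  assumes "p \<in> polys 1"
  shows "p (a + s *\<^sub>R u + r *\<^sub>R v + z *\<^sub>R w) = p a + s *\<^sub>R (p (a + u) - p a) + r *\<^sub>R (p (a + v) - p a) + z *\<^sub>R (p (a + w) - p a)"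
proof -
  obtain c where "\<forall>x. p x = (\<Sum>(i, j, l)\<in>triples 1. ((x$1) ^ i * (x$2) ^ j * (x$3) ^ l) *\<^sub>R c i j l)"
    using assms unfolding polys_iff by blast
  then have p: "p x = c 0 0 0 + x$1 *\<^sub>R c 1 0 0 + x$2 *\<^sub>R c 0 1 0 + x$3 *\<^sub>R c 0 0 1" for x
    unfolding sum_triples by (simp add: add_ac)
  show ?thesis unfolding p by (simp add: algebra_simps)
qed

lemma polys_on_0_span: "polys_on 0 F (UNIV :: real set) \<subseteq> fn.span {restr F (\<lambda>_. 1)}"
proof
  fix q assume "q \<in> polys_on 0 F (UNIV :: real set)"
  then obtain p where p: "q = restr F p" "p \<in> polys 0" unfolding polys_on_def by blast
  obtain c where "\<forall>x. p x = c" using polys_0_form[OF p(2)] by blast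
  then have "q = scale_fun c (restr F (\<lambda>_. 1))" by (auto simp: p(1) restr_def scale_fun_def)
  then show "q \<in> fn.span {restr F (\<lambda>_. 1)}" by (simp add: fn.span_scale fn.span_base)
qed

lemma polys_on_1_edge_span:
  assumes ab: "a \<noteq> b"
  shows "polys_on 1 (convex hull {a, b}) (UNIV :: real set) \<subseteq>
    fn.span {restr (convex hull {a, b}) (\<lambda>_. 1), restr (convex hull {a, b}) (\<lambda>x. ((b - a) \<bullet> (x - a)) / ((b - a) \<bullet> (b - a)))}"
    (is "_ \<subseteq> fn.span {?f, ?g}")
proof
  let ?e = "convex hull {a, b}"
  fix q assume "q \<in> polys_on 1 ?e (UNIV :: real set)"
  then obtain p where p: "q = restr ?e p" "p \<in> polys 1" unfolding polys_on_def by blast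
  have "q = scale_fun (p a) ?f + scale_fun (p b - p a) ?g"
  proof
    fix x
    show "q x = (scale_fun (p a) ?f + scale_fun (p b - p a) ?g) x"
    proof (cases "x \<in> ?e")
      case True
      then obtain s where s: "x = a + s *\<^sub>R (b - a)" unfolding convex_hull_2_image by blast
      have "p x = p a + s * (p b - p a)" using polys_1_affine[OF p(2), of a s "b - a" 0 0 0 0] by (simp add: s)
      then show ?thesis using True ab by (simp add: p(1) restr_def scale_fun_def) (simp add: s)
    qed (simp add: p(1) restr_def scale_fun_def)
  qed
  then show "q \<in> fn.span {?f, ?g}" using fn.span_add[OF fn.span_scale[OF fn.span_base[of ?f "{?f, ?g}"]] fn.span_scale[OF fn.span_base[of ?g "{?f, ?g}"]], of "p a" "p b - p a"] by (metis insertI1 insertI2)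
qed

definition sym_unit :: "3 \<Rightarrow> 3 \<Rightarrow> real^3^3" where
  "sym_unit i j = (\<chi> k l. if (k = i \<and> l = j) \<or> (k = j \<and> l = i) then 1 else 0)"

definition upper_pairs :: "(3 \<times> 3) set" where
  "upper_pairs = {(i, j). i \<le> j}"

lemma finite_upper_pairs [simp]: "finite upper_pairs" by (rule finite_subset[OF subset_UNIV]) simp

text \<open>The set and its mirror image cover the 9 pairs and share the 3 diagonal ones.\<close>

lemma card_upper_pairs: "card upper_pairs = 6"
proof -
  let ?A = "upper_pairs" and ?B = "prod.swap ` upper_pairs"
  have "(i, j) \<in> ?A \<union> ?B" for i j :: 3
  proof (cases "i \<le> j")
    case False
    then have "(j, i) \<in> ?A" by (simp add: upper_pairs_def)
    then have "prod.swap (j, i) \<in> ?B" by (rule imageI)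
    then show ?thesis by simp
  qed (simp add: upper_pairs_def)
  then have "?A \<union> ?B = UNIV" by (simp only: set_eq_iff split_paired_All UNIV_I simp_thms)
  moreover have "?A \<inter> ?B = (\<lambda>i. (i, i)) ` UNIV"
  proof (rule set_eqI, clarify)
    fix i j :: 3
    have "(i, j) \<in> ?B \<longleftrightarrow> j \<le> i" by (auto simp: upper_pairs_def image_iff)
    moreover have "(i, j) \<in> (\<lambda>i. (i, i)) ` UNIV \<longleftrightarrow> i = j" by blast
    ultimately show "(i, j) \<in> ?A \<inter> ?B \<longleftrightarrow> (i, j) \<in> (\<lambda>i. (i, i)) ` UNIV"
      unfolding Int_iff by (simp add: upper_pairs_def) (meson order_antisym order_refl)
  qed
  moreover have "card ((\<lambda>i::3. (i, i)) ` UNIV) = 3" by (subst card_image) (auto simp: inj_on_def)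
  moreover have "card ?B = card ?A" by (rule card_image) (auto simp: inj_on_def)
  moreover have "card (UNIV :: (3 \<times> 3) set) = 9" by simp
  ultimately show ?thesis using card_Un_Int[of ?A ?B] by simp
qed

lemma sym_unit_sym: "sym_unit i j \<in> sym_mats"
proof -
  have "((l = i \<and> k = j) \<or> (l = j \<and> k = i)) = ((k = i \<and> l = j) \<or> (k = j \<and> l = i))" for k l by blast
  then show ?thesis by (simp only: sym_unit_def sym_mats_def transpose_def vec_lambda_beta mem_Collect_eq)
qed

lemma sym_unit_comb: "(\<Sum>(i, j)\<in>upper_pairs. c i j *\<^sub>R sym_unit i j) $ k $ l = c (min k l) (max k l)"
proof -
  have "(\<Sum>(i, j)\<in>upper_pairs. c i j *\<^sub>R sym_unit i j) $ k $ l =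
      (\<Sum>t\<in>upper_pairs. if t = (min k l, max k l) then c (fst t) (snd t) else 0)"
    unfolding sum_component
  proof (rule sum.cong[OF refl])
    fix t :: "3 \<times> 3" assume t: "t \<in> upper_pairs"
    obtain i j where ij: "t = (i, j)" "i \<le> j" using t by (cases t) (auto simp: upper_pairs_def)
    have "((k = i \<and> l = j) \<or> (k = j \<and> l = i)) = (i = min k l \<and> j = max k l)"
      using ij(2) by (cases k l rule: linorder_cases) (auto simp: min_def max_def)
    then show "((case t of (i, j) \<Rightarrow> c i j *\<^sub>R sym_unit i j) $ k) $ l = (if t = (min k l, max k l) then c (fst t) (snd t) else 0)"
      by (simp add: ij(1) sym_unit_def)
  qed
  also have "\<dots> = c (min k l) (max k l)"
    using order_trans[OF min.cobounded1 max.cobounded1, of k l l] by (simp add: upper_pairs_def)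
  finally show ?thesis .
qed

lemma sym_mats_component: "A \<in> sym_mats \<Longrightarrow> A$k$l = A$l$k"
proof -
  assume "A \<in> sym_mats"
  then have "transpose A $ l $ k = A $ l $ k" by (simp add: sym_mats_def)
  then show ?thesis by (simp add: transpose_def)
qed

lemma sym_mats_expand:
  assumes "A \<in> sym_mats"
  shows "A = (\<Sum>(i, j)\<in>upper_pairs. A$i$j *\<^sub>R sym_unit i j)"
proof -
  have "A$k$l = A$l$k" for k l using assms by (metis sym_mats_component)
  then have "A$k$l = A $ (min k l) $ (max k l)" for k l by (auto simp: min_def max_def)
  then show ?thesis by (simp only: vec_eq_iff sym_unit_comb simp_thms)
qed

lemma polys_on_1_sym_span:
  assumes t: "tet a b c d"
  defines "K \<equiv> convex hull {a, b, c, d}"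
  defines "\<Lambda> \<equiv> {\<lambda>_. 1, bary a c d b, bary a d b c, bary a b c d}"
  shows "polys_on 1 K sym_mats \<subseteq> fn.span ((\<lambda>(\<l>, i, j). restr K (\<lambda>x. \<l> x *\<^sub>R sym_unit i j)) ` (\<Lambda> \<times> upper_pairs))"
    (is "_ \<subseteq> fn.span ?S")
proof
  fix q assume "q \<in> polys_on 1 K sym_mats"
  then obtain p where p: "q = restr K p" "p \<in> polys 1" "\<And>x. x \<in> K \<Longrightarrow> p x \<in> sym_mats" unfolding polys_on_def by blast
  have v: "a \<in> K" "b \<in> K" "c \<in> K" "d \<in> K" unfolding K_def by (auto intro: hull_inc)
  have sp: "restr K (\<lambda>x. \<l> x *\<^sub>R A) \<in> fn.span ?S" if "\<l> \<in> \<Lambda>" "A \<in> sym_mats" for \<l> A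
  proof -
    have "restr K (\<lambda>x. \<l> x *\<^sub>R A) = (\<Sum>t\<in>upper_pairs. scale_fun (A $ fst t $ snd t) (restr K (\<lambda>x. \<l> x *\<^sub>R sym_unit (fst t) (snd t))))"
    proof
      fix x
      have "\<l> x *\<^sub>R A = (\<Sum>t\<in>upper_pairs. (A $ fst t $ snd t) *\<^sub>R (\<l> x *\<^sub>R sym_unit (fst t) (snd t)))"
        using arg_cong[OF sym_mats_expand[OF that(2)], of "\<lambda>A. \<l> x *\<^sub>R A"]
        by (simp add: scaleR_sum_right case_prod_beta mult.commute)
      then show "restr K (\<lambda>x. \<l> x *\<^sub>R A) x = (\<Sum>t\<in>upper_pairs. scale_fun (A $ fst t $ snd t) (restr K (\<lambda>x. \<l> x *\<^sub>R sym_unit (fst t) (snd t)))) x"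
        by (simp add: sum_fun_apply scale_fun_def restr_def)
    qed
    also have "\<dots> \<in> fn.span ?S"
      by (intro fn.span_sum fn.span_scale fn.span_base) (use that(1) in \<open>force simp: image_iff\<close>)
    finally show ?thesis .
  qed
  have "q = restr K (\<lambda>x. 1 *\<^sub>R p a) + (restr K (\<lambda>x. bary a c d b x *\<^sub>R (p b - p a)) +
    (restr K (\<lambda>x. bary a d b c x *\<^sub>R (p c - p a)) + restr K (\<lambda>x. bary a b c d x *\<^sub>R (p d - p a))))"
  proof
    fix x
    have "p x = p a + bary a c d b x *\<^sub>R (p b - p a) + bary a d b c x *\<^sub>R (p c - p a) + bary a b c d x *\<^sub>R (p d - p a)"
      using polys_1_affine[OF p(2), of a "bary a c d b x" "b - a" "bary a d b c x" "c - a" "bary a b c d x" "d - a"]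
      unfolding bary_repr[OF t, of x, symmetric] by simp
    then show "q x = (restr K (\<lambda>x. 1 *\<^sub>R p a) + (restr K (\<lambda>x. bary a c d b x *\<^sub>R (p b - p a)) +
      (restr K (\<lambda>x. bary a d b c x *\<^sub>R (p c - p a)) + restr K (\<lambda>x. bary a b c d x *\<^sub>R (p d - p a))))) x"
      by (simp add: p(1) restr_def)
  qed
  also have "\<dots> \<in> fn.span ?S"
    by (intro fn.span_add sp sym_mats_diff p(3) v) (auto simp: \<Lambda>_def)
  finally show "q \<in> fn.span ?S" .
qed

text \<open>On the face the field is quadratic only through the normal component of
  \<open>q\<close>, which is an affine function. The two affine components contribute six spanning
  functions, the quadratic part two more.\<close>

lemma nedelec1_span:
  assumes N: "cross3 (b - a) (c - a) \<noteq> 0" and n: "unit_normal (convex hull {a, b, c}) n"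
  shows "\<exists>S. finite S \<and> card S \<le> 8 \<and> nedelec1 (convex hull {a, b, c}) n \<subseteq> fn.span S"
proof -
  let ?F = "convex hull {a, b, c}" and ?N = "cross3 (b - a) (c - a)"
  have ne: "n \<bullet> (b - a) = 0" "n \<bullet> (c - a) = 0" using n unfolding unit_normal_hull by auto
  have nN: "n \<bullet> ?N \<noteq> 0" using unit_normal_cases[OF N n] N by auto
  define \<nu> where "\<nu> = n \<bullet> ?N"
  define h1 h2 where "h1 = (- 1 / \<nu>) *\<^sub>R cross3 n (c - a)" and "h2 = (1 / \<nu>) *\<^sub>R cross3 n (b - a)"
  have dual: "h1 \<bullet> (b - a) = 1" "h1 \<bullet> (c - a) = 0" "h2 \<bullet> (b - a) = 0" "h2 \<bullet> (c - a) = 1" "h1 \<bullet> n = 0" "h2 \<bullet> n = 0"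
  proof -
    have "cross3 n (c - a) \<bullet> (b - a) = - \<nu>" "cross3 n (b - a) \<bullet> (c - a) = \<nu>"
      unfolding \<nu>_def by (simp_all add: cross3_def inner_vec_def sum_3 vector_3 algebra_simps)
    then show "h1 \<bullet> (b - a) = 1" "h1 \<bullet> (c - a) = 0" "h2 \<bullet> (b - a) = 0" "h2 \<bullet> (c - a) = 1" "h1 \<bullet> n = 0" "h2 \<bullet> n = 0"
      using nN by (simp_all add: h1_def h2_def dot_cross_self \<nu>_def)
  qed
  have dec: "y = (y \<bullet> (b - a)) *\<^sub>R h1 + (y \<bullet> (c - a)) *\<^sub>R h2" if "y \<bullet> n = 0" for y
  proof -
    define z where "z = y - ((y \<bullet> (b - a)) *\<^sub>R h1 + (y \<bullet> (c - a)) *\<^sub>R h2)"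
    have z: "z \<bullet> (b - a) = 0" "z \<bullet> (c - a) = 0" "z \<bullet> n = 0"
      using dual that by (simp_all only: z_def inner_diff_left inner_add_left inner_scaleR_left)
    have zz: "z = ((?N \<bullet> z) / (?N \<bullet> ?N)) *\<^sub>R ?N" by (rule parallel_cross[OF z(1,2) N])
    then have "((?N \<bullet> z) / (?N \<bullet> ?N)) * (?N \<bullet> n) = 0" using z(3) by (metis inner_scaleR_left)
    then have "(?N \<bullet> z) / (?N \<bullet> ?N) = 0" using nN by (simp add: inner_commute)
    then have "z = 0" using zz by (metis scaleR_zero_left)
    then show ?thesis by (simp add: z_def)
  qed
  define S R where "S x = h1 \<bullet> (x - a)" and "R x = h2 \<bullet> (x - a)" for x
  have SR: "S (a + s *\<^sub>R (b - a) + r *\<^sub>R (c - a)) = s" "R (a + s *\<^sub>R (b - a) + r *\<^sub>R (c - a)) = r" for s r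
    using dual by (simp_all add: S_def R_def inner_add_right)
  define f where "f = (\<lambda>k::nat. restr ?F (\<lambda>x. if k = 0 then h1 else if k = 1 then S x *\<^sub>R h1 else if k = 2 then R x *\<^sub>R h1 else
    if k = 3 then h2 else if k = 4 then S x *\<^sub>R h2 else if k = 5 then R x *\<^sub>R h2 else
    if k = 6 then S x *\<^sub>R (S x *\<^sub>R h2 - R x *\<^sub>R h1) else R x *\<^sub>R (S x *\<^sub>R h2 - R x *\<^sub>R h1)))"
  have "nedelec1 ?F n \<subseteq> fn.span (f ` {..<8})"
  proof
    fix w assume "w \<in> nedelec1 ?F n"
    then obtain p q where w: "w = restr ?F (\<lambda>x. p x + cross3 (q x) x)" and pq: "p \<in> polys 1" "q \<in> polys 1"
      and z: "\<And>x. x \<in> ?F \<Longrightarrow> (p x + cross3 (q x) x) \<bullet> n = 0" unfolding nedelec1_def by blast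
    \<comment> \<open>\<open>P1\<close> and \<open>P2\<close> are the components of
      \<open>p x + cross3 (q x) a\<close> along the edges at \<open>a\<close>; \<open>Q\<close> is
      the normal component of \<open>q\<close> up to a factor.\<close>
    define P1 where "P1 x = p x \<bullet> (b - a) + q x \<bullet> cross3 a (b - a)" for x
    define P2 where "P2 x = p x \<bullet> (c - a) + q x \<bullet> cross3 a (c - a)" for x
    define Q where "Q x = q x \<bullet> ?N" for x
    have P12: "P1 \<in> polys 1" "P2 \<in> polys 1" "Q \<in> polys 1"
      unfolding P1_def[abs_def] P2_def[abs_def] Q_def[abs_def] using polys_inner[OF pq(1)] polys_inner[OF pq(2)]
      by (auto simp: inner_commute[of "p _"] inner_commute[of "q _"])
    have aff: "g (a + s *\<^sub>R (b - a) + r *\<^sub>R (c - a)) = g a + s * (g b - g a) + r * (g c - g a)" if "g \<in> polys 1" for g :: "real^3 \<Rightarrow> real" and s r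
      using polys_1_affine[OF that, of a s "b - a" r "c - a" 0 0] by simp
    have key: "p x + cross3 (q x) x = (P1 x - R x * Q x) *\<^sub>R h1 + (P2 x + S x * Q x) *\<^sub>R h2" if x: "x \<in> ?F" for x
    proof -
      obtain u :: "real^2" where u: "x = a + u$1 *\<^sub>R (b - a) + u$2 *\<^sub>R (c - a)" using x unfolding convex_hull_3_image by blast
      have sr: "S x = u$1" "R x = u$2" unfolding u by (rule SR)+
      have "cross3 (q x) x \<bullet> (b - a) = q x \<bullet> cross3 x (b - a)" "cross3 (q x) x \<bullet> (c - a) = q x \<bullet> cross3 x (c - a)"
        by (simp_all add: cross3_def inner_vec_def sum_3 vector_3 algebra_simps)
      moreover have "cross3 x (b - a) = cross3 a (b - a) - R x *\<^sub>R ?N" "cross3 x (c - a) = cross3 a (c - a) + S x *\<^sub>R ?N"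
        unfolding sr by (subst u; simp add: cross_add_left cross_mult_left cross_skew[of "c - a" "b - a"])+
      ultimately have e: "(p x + cross3 (q x) x) \<bullet> (b - a) = P1 x - R x * Q x" "(p x + cross3 (q x) x) \<bullet> (c - a) = P2 x + S x * Q x"
        by (simp_all add: P1_def P2_def Q_def inner_add_left inner_diff_right inner_add_right)
      show ?thesis by (subst dec[OF z[OF x]]) (simp only: e)
    qed
    have "w = scale_fun (P1 a) (f 0) + (scale_fun (P1 b - P1 a) (f 1) + (scale_fun (P1 c - P1 a - Q a) (f 2) + (scale_fun (P2 a) (f 3) +
      (scale_fun (P2 b - P2 a + Q a) (f 4) + (scale_fun (P2 c - P2 a) (f 5) + (scale_fun (Q b - Q a) (f 6) + scale_fun (Q c - Q a) (f 7)))))))"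
    proof
      fix x
      show "w x = (scale_fun (P1 a) (f 0) + (scale_fun (P1 b - P1 a) (f 1) + (scale_fun (P1 c - P1 a - Q a) (f 2) + (scale_fun (P2 a) (f 3) +
      (scale_fun (P2 b - P2 a + Q a) (f 4) + (scale_fun (P2 c - P2 a) (f 5) + (scale_fun (Q b - Q a) (f 6) + scale_fun (Q c - Q a) (f 7)))))))) x"
      proof (cases "x \<in> ?F")
        case True
        then obtain u :: "real^2" where u: "x = a + u$1 *\<^sub>R (b - a) + u$2 *\<^sub>R (c - a)" unfolding convex_hull_3_image by blast
        have e: "P1 x = P1 a + S x * (P1 b - P1 a) + R x * (P1 c - P1 a)" "P2 x = P2 a + S x * (P2 b - P2 a) + R x * (P2 c - P2 a)"
          "Q x = Q a + S x * (Q b - Q a) + R x * (Q c - Q a)"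
          using aff[OF P12(1), of "u$1" "u$2"] aff[OF P12(2), of "u$1" "u$2"] aff[OF P12(3), of "u$1" "u$2"] SR[of "u$1" "u$2"]
          unfolding u[symmetric] by auto
        have "w x = (P1 x - R x * Q x) *\<^sub>R h1 + (P2 x + S x * Q x) *\<^sub>R h2" using True key[OF True] by (simp add: w restr_def)
        then show ?thesis
          unfolding e using True by (simp add: f_def restr_def scale_fun_def algebra_simps)
      next
        case False
        then show ?thesis by (simp add: w f_def restr_def scale_fun_def)
      qed
    qed
    also have "\<dots> \<in> fn.span (f ` {..<8})"
      by (intro fn.span_add fn.span_scale fn.span_base imageI) auto
    finally show "w \<in> fn.span (f ` {..<8})" .
  qed
  moreover have "card (f ` {..<8}) \<le> 8" using card_image_le[of "{..<8::nat}" f] by simp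
  ultimately show ?thesis by blast
qed

section \<open>Edges of a tetrahedron\<close>

definition tedges :: "(real^3) set \<Rightarrow> (real^3) set set" where
  "tedges K = {e. e face_of K \<and> aff_dim e = 1}"

lemma two_facets:
  assumes t: "tet p q r s"
  shows "{f \<in> facets (convex hull {p, q, r, s}). convex hull {p, q} face_of f} = {convex hull {p, q, r}, convex hull {p, q, s}}"
proof (rule set_eqI)
  fix f
  let ?K = "convex hull {p, q, r, s}"
  have C: "\<not> affine_dependent {p, q, r, s}" using t unfolding tet_iff by blast
  note d = tet_distinct[OF t]
  have fc: "f \<in> facets ?K \<longleftrightarrow> f = convex hull {q, r, s} \<or> f = convex hull {p, r, s} \<or> f = convex hull {p, s, q} \<or> f = convex hull {p, q, r}"
    unfolding facets_tet[OF t] by simp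
  have ps: "convex hull {p, s, q} = convex hull {p, q, s}" by (simp add: insert_commute)
  have n1: "\<not> convex hull {p, q} face_of convex hull {q, r, s}"
  proof
    assume "convex hull {p, q} face_of convex hull {q, r, s}"
    from convex_hull_subset_affine_independent[OF C _ _ face_of_imp_subset[OF this]] d show False by auto
  qed
  have n2: "\<not> convex hull {p, q} face_of convex hull {p, r, s}"
  proof
    assume "convex hull {p, q} face_of convex hull {p, r, s}"
    from convex_hull_subset_affine_independent[OF C _ _ face_of_imp_subset[OF this]] d show False by auto
  qed
  have e: "convex hull {p, q} face_of ?K" by (rule tet_face_hull[OF t]) auto
  have y: "convex hull {p, q} face_of convex hull {p, q, r}" "convex hull {p, q} face_of convex hull {p, q, s}"
    by (rule face_of_subset[OF e]; rule hull_mono; simp; fail | rule face_of_subset[OF e]; rule hull_mono; blast)+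
  show "f \<in> {f \<in> facets ?K. convex hull {p, q} face_of f} \<longleftrightarrow> f \<in> {convex hull {p, q, r}, convex hull {p, q, s}}"
    unfolding mem_Collect_eq fc ps insert_iff empty_iff using n1 n2 y by metis
qed

lemma facets_at_edge:
  assumes K: "3 simplex K" and e: "e \<in> tedges K"
  obtains p q r s where "tet p q r s" "K = convex hull {p, q, r, s}" "e = convex hull {p, q}"
    "{f \<in> facets K. e face_of f} = {convex hull {p, q, r}, convex hull {p, q, s}}"
    "convex hull {p, q, r} \<noteq> convex hull {p, q, s}"
proof -
  obtain a b c d where t: "tet a b c d" "K = convex hull {a, b, c, d}" using K unfolding simplex_3_iff_tet by blast
  obtain p q r s where p: "tet p q r s" "{p, q, r, s} = {a, b, c, d}" "e = convex hull {p, q}"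
    using edgeE[OF t(1)] e unfolding tedges_def t(2) by blast
  have K': "K = convex hull {p, q, r, s}" using t(2) p(2) by simp
  have "convex hull {p, q, r} \<noteq> convex hull {p, q, s}"
    using tet_hull_inj[OF p(1), of "{p, q, r}" "{p, q, s}"] tet_distinct[OF p(1)] by auto
  then show ?thesis using that[OF p(1) K' p(3)] two_facets[OF p(1)] unfolding K' p(3) by blast
qed

lemma card_facets_at_edge: "3 simplex K \<Longrightarrow> e \<in> tedges K \<Longrightarrow> card {f \<in> facets K. e face_of f} = 2"
proof -
  assume "3 simplex K" "e \<in> tedges K"
  then obtain p q r s where "{f \<in> facets K. e face_of f} = {convex hull {p, q, r}, convex hull {p, q, s}}"
    "convex hull {p, q, r} \<noteq> convex hull {p, q, s :: real^3}" by (rule facets_at_edge)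
  then show ?thesis by simp
qed

lemma tedges_finite_card:
  assumes K: "3 simplex K"
  shows "finite (tedges K)" "card (tedges K) \<le> 6"
proof -
  obtain a b c d where t: "tet a b c d" "K = convex hull {a, b, c, d}" using K unfolding simplex_3_iff_tet by blast
  let ?S = "(\<lambda>S. convex hull S) ` {{a, b}, {a, c}, {a, d}, {b, c}, {b, d}, {c, d}}"
  have sub: "tedges K \<subseteq> ?S"
  proof
    fix e assume "e \<in> tedges K"
    then obtain p q r s where p: "tet p q r s" "{p, q, r, s} = {a, b, c, d}" "e = convex hull {p, q}"
      using edgeE[OF t(1)] unfolding tedges_def t(2) by blast
    have "p \<in> {a, b, c, d}" "q \<in> {a, b, c, d}" using p(2) by blast+
    moreover have "p \<noteq> q" using tet_distinct[OF p(1)] by blast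
    ultimately have "{p, q} \<in> {{a, b}, {a, c}, {a, d}, {b, c}, {b, d}, {c, d}}" by (auto simp: doubleton_eq_iff)
    then show "e \<in> ?S" unfolding p(3) by (rule imageI)
  qed
  show "finite (tedges K)" by (rule finite_subset[OF sub]) simp
  have "card (tedges K) \<le> card ?S" by (rule card_mono[OF _ sub]) simp
  also have "\<dots> \<le> card {{a, b}, {a, c}, {a, d}, {b, c}, {b, d}, {c, d}}" by (rule card_image_le) simp
  also have "\<dots> \<le> 6" by (simp add: card_insert_if)
  finally show "card (tedges K) \<le> 6" .
qed

lemma card_facets: "3 simplex K \<Longrightarrow> card (facets K) \<le> 4"
proof -
  assume "3 simplex K"
  then obtain a b c d where t: "tet a b c d" "K = convex hull {a, b, c, d}" unfolding simplex_3_iff_tet by blast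
  show ?thesis unfolding t(2) facets_tet[OF t(1)] by (simp add: card_insert_if)
qed

lemma tedge_props:
  assumes "e \<in> tedges K" "3 simplex K"
  shows "compact e" "convex e" "aff_dim e = 1" "e \<subseteq> K"
proof -
  have f: "e face_of K" "aff_dim e = 1" using assms(1) by (auto simp: tedges_def)
  have K: "compact K" "convex K" using assms(2) by (auto simp: compact_simplex convex_simplex)
  show "compact e" "convex e" "aff_dim e = 1" "e \<subseteq> K"
    using face_of_imp_compact[OF K(2,1) f(1)] face_of_imp_convex[OF f(1)] face_of_imp_subset[OF f(1)] f(2) by auto
qed

lemma tangential_hull:
  assumes "tangential (convex hull {p, q}) t"
  obtains c where "c \<noteq> 0" "t = c *\<^sub>R (q - p)"
proof -
  obtain x y c where t: "t \<noteq> 0" "x \<in> convex hull {p, q}" "y \<in> convex hull {p, q}" "t = c *\<^sub>R (y - x)"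
    using assms unfolding tangential_def by blast
  obtain s r where s: "x = p + s *\<^sub>R (q - p)" "y = p + r *\<^sub>R (q - p)" using t(2,3) unfolding convex_hull_2_image by blast
  have "t = (c * (r - s)) *\<^sub>R (q - p)" unfolding t(4) s by (simp add: algebra_simps)
  then show ?thesis using that[of "c * (r - s)"] t(1) by force
qed

text \<open>If the triple product vanished, \<open>n'\<close> would be parallel to \<open>n\<close>
  and the four vertices would lie in one plane.\<close>

lemma facet_pair_nondegenerate:
  assumes t: "tet p q r s" and n: "unit_normal (convex hull {p, q, r}) n" and n': "unit_normal (convex hull {p, q, s}) n'"
    and c: "c \<noteq> 0"
  shows "n' \<bullet> cross3 n (c *\<^sub>R (q - p)) \<noteq> 0"
proof
  assume z: "n' \<bullet> cross3 n (c *\<^sub>R (q - p)) = 0"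
  let ?t = "q - p"
  have z': "cross3 n ?t \<bullet> n' = 0" using z c by (simp add: cross_mult_right inner_commute)
  have e: "norm n = 1" "n \<bullet> ?t = 0" "n \<bullet> (r - p) = 0" "norm n' = 1" "n' \<bullet> ?t = 0" "n' \<bullet> (s - p) = 0"
    using n n' unfolding unit_normal_hull by auto
  have nn: "n \<bullet> n = 1" using e(1) by (simp add: dot_square_norm)
  have c1: "cross3 ?t (cross3 n ?t) = (?t \<bullet> ?t) *\<^sub>R n" using e(2) by (simp add: Lagrange inner_commute)
  have c2: "cross3 (cross3 n ?t) n = ?t" using e(2) nn by (subst cross_skew) (simp add: Lagrange)
  have c3: "cross3 n ?t \<bullet> cross3 n ?t = ?t \<bullet> ?t" using e(2) nn by (simp add: dot_cross inner_commute)
  have tt: "?t \<bullet> ?t \<noteq> 0" using tet_distinct[OF t] by auto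
  have "(cross3 n ?t \<bullet> cross3 n ?t) *\<^sub>R n' = (cross3 ?t (cross3 n ?t) \<bullet> n') *\<^sub>R n + (cross3 (cross3 n ?t) n \<bullet> n') *\<^sub>R ?t + (cross3 n ?t \<bullet> n') *\<^sub>R cross3 n ?t"
    by (rule cramer3)
  then have "(?t \<bullet> ?t) *\<^sub>R n' = (?t \<bullet> ?t) *\<^sub>R ((n \<bullet> n') *\<^sub>R n)"
    unfolding c1 c2 c3 z' using e(5) by (simp add: inner_commute)
  then have "n' = (n \<bullet> n') *\<^sub>R n" using tt by (metis scaleR_left_imp_eq)
  then have r: "n' \<bullet> (r - p) = 0" using e(3) by (metis inner_scaleR_left mult_zero_right)
  have N: "cross3 ?t (r - p) \<noteq> 0" by (rule tet_cross_nz[OF t])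
  define k where "k = (cross3 ?t (r - p) \<bullet> n') / (cross3 ?t (r - p) \<bullet> cross3 ?t (r - p))"
  have k: "n' = k *\<^sub>R cross3 ?t (r - p)" unfolding k_def by (rule parallel_cross[OF e(5) r N])
  have "k * (cross3 ?t (r - p) \<bullet> (s - p)) = 0" using e(6) unfolding k by simp
  then have "k = 0" using t by (simp add: tet_def)
  then show False using k e(4) by simp
qed

lemma kappa_swap: "kappa t n' n = - kappa t n n'"
proof -
  have "n \<bullet> cross3 n' t = - (n' \<bullet> cross3 n t)" by (simp add: cross3_def inner_vec_def sum_3 vector_3 algebra_simps)
  then show ?thesis by (simp add: kappa_def inner_commute[of n'])
qed

lemma extreme_point_tet: "tet a b c d \<Longrightarrow> x extreme_point_of convex hull {a, b, c, d} \<longleftrightarrow> x \<in> {a, b, c, d}"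
proof -
  assume t: "tet a b c d"
  then have "\<not> affine_dependent {a, b, c, d}" unfolding tet_iff by blast
  then show ?thesis by (rule extreme_point_of_convex_hull_affine_independent)
qed

lemma card_triples_3: "card (triples 3) = 20"
proof -
  have "real (card (triples 3)) = (\<Sum>(i, j, l)\<in>triples 3. 1)" by (simp add: case_prod_beta)
  also have "\<dots> = 20" unfolding sum_triples by (simp add: eval_nat_numeral)
  finally show ?thesis by simp
qed

lemma polys_power: "f \<in> polys 1 \<Longrightarrow> (\<lambda>x. f x ^ n :: real) \<in> polys n"
proof (induction n)
  case (Suc n)
  then show ?case using polys_mult[OF Suc(2) Suc(1)[OF Suc(2)]] by simp
qed simp

section \<open>Coordinates for symmetric cubic matrix fields\<close>

context
  fixes a b c d :: "real^3"
  assumes t: "tet a b c d"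
begin

text \<open>Parametrises the fields by 20 * 6 = 120 coefficients: monomials in three barycentric
  coordinates times the units of the symmetric matrices.\<close>

definition cubic_comb :: "((nat \<times> nat \<times> nat) \<times> 3 \<times> 3 \<Rightarrow> real) \<Rightarrow> real^3 \<Rightarrow> real^3^3" where
  "cubic_comb k x = (\<Sum>(i, j, l)\<in>triples 3. (bary a c d b x ^ i * bary a d b c x ^ j * bary a b c d x ^ l) *\<^sub>R
     (\<Sum>(m, n)\<in>upper_pairs. k ((i, j, l), (m, n)) *\<^sub>R sym_unit m n))"

lemma cubic_comb_polys: "cubic_comb k \<in> polys 3"
proof -
  have "(\<lambda>x. (bary a c d b x ^ i * bary a d b c x ^ j * bary a b c d x ^ l) *\<^sub>R A) \<in> polys 3" if "i + j + l \<le> 3" for i j l and A :: "real^3^3"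
  proof -
    have "(\<lambda>x. (bary a c d b x ^ i) *\<^sub>R ((bary a d b c x ^ j) *\<^sub>R ((bary a b c d x ^ l) *\<^sub>R A))) \<in> polys (i + (j + (l + 0)))"
      by (intro polys_mult polys_power bary_polys polys_const)
    from polys_mono[OF this, of 3] that show ?thesis by (simp add: mult.assoc)
  qed
  then show ?thesis unfolding cubic_comb_def[abs_def] by (intro polys_sum) (auto simp: mem_triples)
qed

lemma cubic_comb_sym: "cubic_comb k x \<in> sym_mats"
proof -
  have *: "(\<Sum>i\<in>I. f i) \<in> sym_mats" if "\<And>i. i \<in> I \<Longrightarrow> f i \<in> sym_mats" for f :: "'i \<Rightarrow> real^3^3" and I
    using that by (induction I rule: infinite_finite_induct) (auto simp: sym_mats_zero intro: sym_mats_add)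
  show ?thesis unfolding cubic_comb_def by (auto intro!: * sym_mats_scaleR sym_unit_sym)
qed

lemma cubic_comb_add: "cubic_comb (k + k') x = cubic_comb k x + cubic_comb k' x"
  and cubic_comb_scale: "cubic_comb (scale_fun h k) x = h *\<^sub>R cubic_comb k x"
  by (simp_all add: cubic_comb_def case_prod_beta scaleR_add_right scaleR_add_left sum.distrib scale_fun_def scaleR_sum_right mult_ac)

lemma cubic_comb_zero:
  assumes z: "\<And>x. x \<in> convex hull {a, b, c, d} \<Longrightarrow> cubic_comb k x = 0"
    and s: "\<And>i. i \<notin> triples 3 \<times> upper_pairs \<Longrightarrow> k i = 0"
  shows "k = 0"
proof -
  have "k ((i, j, l), (m, n)) = 0" if ijl: "i + j + l \<le> 3" and mn: "m \<le> n" for i j l m n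
  proof -
    define C where "C i j l = k ((i, j, l), (m, n))" for i j l
    have mm: "min m n = m" "max m n = n" using mn by (simp_all add: min_def max_def)
    have "cubic3 C s r z = 0" if "0 \<le> s" "0 \<le> r" "0 \<le> z" "s + r + z \<le> 1" for s r z
    proof -
      let ?x = "a + s *\<^sub>R (b - a) + r *\<^sub>R (c - a) + z *\<^sub>R (d - a)"
      have "?x \<in> convex hull {a, b, c, d}"
        unfolding convex_hull_4_image
        by (rule image_eqI[of _ _ "vector [s, r, z]"]) (use that in \<open>simp_all add: simplex3_def\<close>)
      then have "cubic_comb k ?x $ m $ n = 0" using z by simp
      moreover have inner: "(\<Sum>(m, n)\<in>upper_pairs. k (T, (m, n)) *\<^sub>R sym_unit m n) $ m $ n = k (T, (m, n))" for T
        using sym_unit_comb[of "\<lambda>m n. k (T, (m, n))" m n] unfolding mm .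
      have "cubic_comb k ?x $ m $ n = (\<Sum>(i, j, l)\<in>triples 3. (s ^ i * r ^ j * z ^ l) * C i j l)"
        unfolding cubic_comb_def bary_coords[OF t] sum_component
      proof (rule sum.cong[OF refl], clarify)
        fix i j l
        show "(((s ^ i * r ^ j * z ^ l) *\<^sub>R (\<Sum>(m, n)\<in>upper_pairs. k ((i, j, l), (m, n)) *\<^sub>R sym_unit m n)) $ m) $ n = (s ^ i * r ^ j * z ^ l) * C i j l"
          unfolding vector_scaleR_component inner C_def by simp
      qed
      ultimately have "(\<Sum>(i, j, l)\<in>triples 3. (s ^ i * r ^ j * z ^ l) * C i j l) = 0" by simp
      then show ?thesis unfolding sum_triples cubic3_def by (simp add: eval_nat_numeral algebra_simps)
    qed
    then have "C i j l = 0" by (rule cubic3_coeffs_zero[OF _ ijl])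
    then show ?thesis by (simp add: C_def)
  qed
  then have "k i = 0" for i
    using s[of i] by (cases "i \<in> triples 3 \<times> upper_pairs") (auto simp: mem_triples upper_pairs_def)
  then show ?thesis by (simp add: fun_eq_iff)
qed

end

section \<open>Unisolvence on one element\<close>

lemma polys_on_continuous: "q \<in> polys_on k S X \<Longrightarrow> continuous_on S q"
  for q :: "real^3 \<Rightarrow> 'b::real_normed_vector"
proof -
  assume "q \<in> polys_on k S X"
  then obtain p where p: "q = restr S p" "p \<in> polys k" unfolding polys_on_def by blast
  show ?thesis unfolding p(1)
    by (rule continuous_on_eq[OF polys_continuous[OF p(2)]]) (simp add: restr_def)
qed

lemma nedelec1_continuous: "v \<in> nedelec1 S n \<Longrightarrow> continuous_on S v"
proof -
  assume "v \<in> nedelec1 S n"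
  then obtain p q where v: "v = restr S (\<lambda>x. p x + cross3 (q x) x)" "p \<in> polys 1" "q \<in> polys 1" unfolding nedelec1_def by blast
  have "continuous_on S (\<lambda>x. p x + cross3 (q x) x)"
    using polys_continuous[OF v(2)] polys_continuous[OF v(3)] by (intro continuous_on_add continuous_on_cross continuous_on_id)
  then show ?thesis unfolding v(1) by (rule continuous_on_eq) (simp add: restr_def)
qed

lemma is_basis_subset: "is_basis B V \<Longrightarrow> b \<in> B \<Longrightarrow> b \<in> V"
  unfolding is_basis_def using fn.span_base by blast

lemma restr_polys_on: "p \<in> polys k \<Longrightarrow> restr S p \<in> polys_on k S UNIV"
  unfolding polys_on_def by blast

text \<open>Moments on one element name the facet at an edge directly instead of by a label, and
  both kinds of edge moments are taken on each facet. The family is therefore redundant by one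
  relation per edge and test function.\<close>

datatype local_dof =
    Vertex_loc "real^3" 3 3
  | Face_nn_loc "(real^3) set" "real^3 \<Rightarrow> real"
  | Face_tangential_loc "(real^3) set" "real^3 \<Rightarrow> real^3"
  | Element_loc "real^3 \<Rightarrow> real^3^3"
  | Edge_nn_loc "(real^3) set" "(real^3) set" "real^3 \<Rightarrow> real"
  | Edge_nt_loc "(real^3) set" "(real^3) set" "real^3 \<Rightarrow> real"

locale elasticity_mesh = mesh +
  fixes K F :: "(real^3) set \<Rightarrow> nat \<Rightarrow> (real^3) set"
    and nrm tng :: "(real^3) set \<Rightarrow> real^3"
    and B0 BE :: "(real^3) set \<Rightarrow> (real^3 \<Rightarrow> real) set"
    and BN :: "(real^3) set \<Rightarrow> (real^3 \<Rightarrow> real^3) set"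
    and BK :: "(real^3) set \<Rightarrow> (real^3 \<Rightarrow> real^3^3) set"
  assumes normals: "\<forall>f\<in>faces \<T>. unit_normal f (nrm f)"
    and tangents: "\<forall>e\<in>edges \<T>. tangential e (tng e)"
    and labels: "\<forall>e\<in>edges \<T>. edge_labelling \<Omega> \<T> e (K e) (F e)"
    and even_labels: "\<forall>e\<in>edges \<T>. \<not> boundary_edge \<Omega> e \<and> even (patch_size \<T> e) \<and>
           \<not> singular_edge \<Omega> \<T> e (F e) \<longrightarrow>
           theta e (F e) 1 + theta e (F e) (patch_size \<T> e) \<noteq> pi"
    and basis_B0: "\<forall>f\<in>faces \<T>. is_basis (B0 f) (polys_on 0 f UNIV)"
    and basis_BN: "\<forall>f\<in>faces \<T>. is_basis (BN f) (nedelec1 f (nrm f))"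
    and basis_BK: "\<forall>T\<in>\<T>. is_basis (BK T) (polys_on 1 T sym_mats)"
    and basis_BE: "\<forall>e\<in>edges \<T>. is_basis (BE e) (polys_on 1 e UNIV)"
begin

lemma facets_faces: "T \<in> \<T> \<Longrightarrow> f \<in> facets T \<Longrightarrow> f \<in> faces \<T>"
  and tedges_edges: "T \<in> \<T> \<Longrightarrow> e \<in> tedges T \<Longrightarrow> e \<in> edges \<T>"
  by (auto simp: facets_def faces_def tedges_def edges_def)

lemma normal_facet: "T \<in> \<T> \<Longrightarrow> f \<in> facets T \<Longrightarrow> unit_normal f (nrm f)"
  using normals facets_faces by blast

lemma edge_moment_ext:
  assumes T: "T \<in> \<T>" "e \<in> tedges T" and g: "continuous_on e g"
    and z: "\<And>q. q \<in> BE e \<Longrightarrow> edge_integral e (\<lambda>x. g x * q x) = 0" and q: "q \<in> polys 1"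
  shows "edge_integral e (\<lambda>x. g x * q x) = 0"
proof -
  note e = tedge_props[OF T(2) simplex_T[OF T(1)]]
  have B: "is_basis (BE e) (polys_on 1 e UNIV)" using basis_BE tedges_edges[OF T] by blast
  have "edge_integral e (\<lambda>x. g x * restr e q x) = 0"
  proof (rule is_basis_zero_ext[OF B restr_polys_on[OF q], of "\<lambda>q. edge_integral e (\<lambda>x. g x * q x)"])
    fix x y :: "real^3 \<Rightarrow> real" assume xy: "x \<in> polys_on 1 e UNIV" "y \<in> polys_on 1 e UNIV"
    show "edge_integral e (\<lambda>t. g t * (x t + y t)) = edge_integral e (\<lambda>t. g t * x t) + edge_integral e (\<lambda>t. g t * y t)"
      unfolding distrib_left by (rule edge_integral_add[OF e(3,1,2)]) (intro continuous_on_mult g polys_on_continuous[OF xy(1)] polys_on_continuous[OF xy(2)])+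
  next
    fix c and x :: "real^3 \<Rightarrow> real"
    show "edge_integral e (\<lambda>t. g t * (c *\<^sub>R x t)) = c * edge_integral e (\<lambda>t. g t * x t)"
      unfolding edge_integral_scale[symmetric] by (simp add: mult_ac)
  qed (rule z)
  then show ?thesis using edge_integral_cong[OF e(3), of "\<lambda>x. g x * restr e q x" "\<lambda>x. g x * q x"] by (simp add: restr_def)
qed

lemma face_moment_ext:
  assumes T: "T \<in> \<T>" "f \<in> facets T" and g: "continuous_on f g"
    and z: "\<And>q. q \<in> B0 f \<Longrightarrow> face_integral f (\<lambda>x. g x * q x) = 0"
  shows "face_integral f g = 0"
proof -
  note f = facet_props[OF T(2) simplex_T[OF T(1)]]
  have B: "is_basis (B0 f) (polys_on 0 f UNIV)" using basis_B0 facets_faces[OF T] by blast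
  have "face_integral f (\<lambda>x. g x * restr f (\<lambda>_. 1) x) = 0"
  proof (rule is_basis_zero_ext[OF B restr_polys_on[OF polys_const], of "\<lambda>q. face_integral f (\<lambda>x. g x * q x)"])
    fix x y :: "real^3 \<Rightarrow> real" assume xy: "x \<in> polys_on 0 f UNIV" "y \<in> polys_on 0 f UNIV"
    show "face_integral f (\<lambda>t. g t * (x t + y t)) = face_integral f (\<lambda>t. g t * x t) + face_integral f (\<lambda>t. g t * y t)"
      unfolding distrib_left by (rule face_integral_add[OF f(3,1,2)]) (intro continuous_on_mult g polys_on_continuous[OF xy(1)] polys_on_continuous[OF xy(2)])+
  next
    fix c and x :: "real^3 \<Rightarrow> real"
    show "face_integral f (\<lambda>t. g t * (c *\<^sub>R x t)) = c * face_integral f (\<lambda>t. g t * x t)"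
      unfolding face_integral_scale[symmetric] by (simp add: mult_ac)
  qed (rule z)
  then show ?thesis using face_integral_cong[OF f(3), of "\<lambda>x. g x * restr f (\<lambda>_. 1) x" g] by (simp add: restr_def)
qed

lemma face_tangential_ext:
  assumes T: "T \<in> \<T>" "f \<in> facets T" and g: "continuous_on f g"
    and z: "\<And>v. v \<in> BN f \<Longrightarrow> face_integral f (\<lambda>x. g x \<bullet> v x) = 0" and v: "v \<in> nedelec1 f (nrm f)"
  shows "face_integral f (\<lambda>x. g x \<bullet> v x) = 0"
proof -
  note f = facet_props[OF T(2) simplex_T[OF T(1)]]
  have B: "is_basis (BN f) (nedelec1 f (nrm f))" using basis_BN facets_faces[OF T] by blast
  show ?thesis
  proof (rule is_basis_zero_ext[OF B v, of "\<lambda>q. face_integral f (\<lambda>x. g x \<bullet> q x)"])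
    fix x y assume xy: "x \<in> nedelec1 f (nrm f)" "y \<in> nedelec1 f (nrm f)"
    show "face_integral f (\<lambda>t. g t \<bullet> (x t + y t)) = face_integral f (\<lambda>t. g t \<bullet> x t) + face_integral f (\<lambda>t. g t \<bullet> y t)"
      unfolding inner_add_right by (rule face_integral_add[OF f(3,1,2)]) (intro continuous_on_inner g nedelec1_continuous[OF xy(1)] nedelec1_continuous[OF xy(2)])+
  next
    fix c and x :: "real^3 \<Rightarrow> real^3"
    show "face_integral f (\<lambda>t. g t \<bullet> (c *\<^sub>R x t)) = c * face_integral f (\<lambda>t. g t \<bullet> x t)"
      unfolding face_integral_scale[symmetric] by simp
  qed (rule z)
qed

lemma element_moment_ext:
  assumes T: "T \<in> \<T>" and g: "continuous_on T g"
    and z: "\<And>\<xi>. \<xi> \<in> BK T \<Longrightarrow> (LINT x:T|lebesgue. g x \<bullet> \<xi> x) = 0" and v: "\<xi> \<in> polys_on 1 T sym_mats"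
  shows "(LINT x:T|lebesgue. g x \<bullet> \<xi> x) = 0"
proof -
  have B: "is_basis (BK T) (polys_on 1 T sym_mats)" using basis_BK T by blast
  show ?thesis
  proof (rule is_basis_zero_ext[OF B v, of "\<lambda>\<xi>. LINT x:T|lebesgue. g x \<bullet> \<xi> x"])
    fix x y :: "real^3 \<Rightarrow> real^3^3" assume xy: "x \<in> polys_on 1 T sym_mats" "y \<in> polys_on 1 T sym_mats"
    show "(LINT t:T|lebesgue. g t \<bullet> (x t + y t)) = (LINT t:T|lebesgue. g t \<bullet> x t) + (LINT t:T|lebesgue. g t \<bullet> y t)"
      unfolding inner_add_right
      by (intro set_integral_add(2) set_integrable_compact(2) compact_T T continuous_on_inner g polys_on_continuous[OF xy(1)] polys_on_continuous[OF xy(2)])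
  qed (use z in simp_all)
qed

text \<open>Stated for an arbitrary vector field \<open>u\<close>, because it is applied both to the
  normal trace of one field and to the difference of the traces from two neighbouring
  elements.\<close>

lemma face_zero:
  assumes T: "T \<in> \<T>" "f \<in> facets T" and u: "u \<in> polys 3"
    and v: "\<And>x. x extreme_point_of T \<Longrightarrow> x \<in> f \<Longrightarrow> u x = 0"
    and m0: "\<And>q. q \<in> B0 f \<Longrightarrow> face_integral f (\<lambda>x. (nrm f \<bullet> u x) * q x) = 0"
    and m1: "\<And>w. w \<in> BN f \<Longrightarrow> face_integral f (\<lambda>x. tangential_part (nrm f) (u x) \<bullet> w x) = 0"
    and e1: "\<And>e q. e \<in> tedges T \<Longrightarrow> e face_of f \<Longrightarrow> q \<in> BE e \<Longrightarrow> edge_integral e (\<lambda>x. (nrm f \<bullet> u x) * q x) = 0"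
    and e2: "\<And>e q. e \<in> tedges T \<Longrightarrow> e face_of f \<Longrightarrow> q \<in> BE e \<Longrightarrow> edge_integral e (\<lambda>x. (cross3 (nrm f) (tng e) \<bullet> u x) * q x) = 0"
    and x: "x \<in> f"
  shows "u x = 0"
proof -
  obtain a b c d where t: "tet a b c d" "T = convex hull {a, b, c, d}" "f = convex hull {a, b, c}"
    by (rule facet_vertices[OF simplex_T[OF T(1)] T(2)])
  have cu: "continuous_on S u" for S by (rule polys_continuous[OF u])
  have ext: "y extreme_point_of T" "y \<in> f" if "y \<in> {a, b, c}" for y
    using that extreme_point_tet[OF t(1)] hull_subset[of "{a, b, c}" convex] unfolding t(2,3) by blast+
  have ed: "convex hull {y, z} \<in> tedges T" "convex hull {y, z} face_of f" if "(y, z) \<in> {(a, b), (a, c), (b, c)}" for y z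
  proof -
    have s: "{y, z} \<subseteq> {a, b, c, d}" "{y, z} \<subseteq> {a, b, c}" "card {y, z} = 2" using that tet_distinct[OF t(1)] by auto
    have C: "\<not> affine_dependent {a, b, c, d}" using t(1) unfolding tet_iff by blast
    have fT: "convex hull {y, z} face_of T" unfolding t(2) by (rule tet_face_hull[OF t(1) s(1)])
    then show "convex hull {y, z} \<in> tedges T" unfolding tedges_def using aff_dim_hull_card[OF C s(1)] s(3) by simp
    show "convex hull {y, z} face_of f"
      by (rule face_of_subset[OF fT]) (use s(2) facet_props(4)[OF T(2) simplex_T[OF T(1)]] in \<open>auto simp: t(3) intro!: hull_mono\<close>)
  qed
  show ?thesis
  proof (rule face_trace_zero[OF u tet_cross_nz[OF t(1)] normal_facet[OF T, unfolded t(3)]])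
    show "u a = 0" "u b = 0" "u c = 0" using v ext by auto
    show "aff_dim (convex hull {a, b}) = 1" "aff_dim (convex hull {a, c}) = 1" "aff_dim (convex hull {b, c}) = 1"
      using ed(1)[of a b] ed(1)[of a c] ed(1)[of b c] by (auto simp: tedges_def)
    show "x \<in> convex hull {a, b, c}" using x t(3) by simp
    have "face_integral f (\<lambda>x. nrm f \<bullet> u x) = 0"
      by (rule face_moment_ext[OF T _ m0]) (intro continuous_on_inner continuous_on_const cu)
    then show "face_integral (convex hull {a, b, c}) (\<lambda>x. nrm (convex hull {a, b, c}) \<bullet> u x) = 0" unfolding t(3) .
    fix w assume "w \<in> nedelec1 (convex hull {a, b, c}) (nrm (convex hull {a, b, c}))"
    then have w: "w \<in> nedelec1 f (nrm f)" unfolding t(3) .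
    have "face_integral f (\<lambda>x. tangential_part (nrm f) (u x) \<bullet> w x) = 0"
      by (rule face_tangential_ext[OF T _ m1 w]) (unfold tangential_part_def, intro continuous_on_cross continuous_on_const cu)
    then show "face_integral (convex hull {a, b, c}) (\<lambda>x. tangential_part (nrm (convex hull {a, b, c})) (u x) \<bullet> w x) = 0" unfolding t(3) .
  next
    fix y z and q :: "real^3 \<Rightarrow> real" assume yz: "(y, z) \<in> {(a, b), (a, c), (b, c)}" and q: "q \<in> polys 1"
    let ?e = "convex hull {y, z}" and ?n = "nrm f"
    note E = ed[OF yz]
    have "tangential ?e (tng ?e)" using tangents tedges_edges[OF T(1) E(1)] by blast
    then obtain k where k: "k \<noteq> 0" "tng ?e = k *\<^sub>R (z - y)" by (rule tangential_hull)
    have 1: "edge_integral ?e (\<lambda>x. (?n \<bullet> u x) * q x) = 0"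
      by (rule edge_moment_ext[OF T(1) E(1) _ e1[OF E] q]) (intro continuous_on_inner continuous_on_const cu)
    have 2: "edge_integral ?e (\<lambda>x. (cross3 ?n (tng ?e) \<bullet> u x) * q x) = 0"
      by (rule edge_moment_ext[OF T(1) E(1) _ e2[OF E] q]) (intro continuous_on_inner continuous_on_const cu)
    have "k * edge_integral ?e (\<lambda>x. (cross3 ?n (z - y) \<bullet> u x) * q x) = 0"
      using 2 unfolding edge_integral_scale[symmetric] k(2) by (simp add: cross_mult_right mult_ac)
    then show "edge_integral ?e (\<lambda>x. (nrm (convex hull {a, b, c}) \<bullet> u x) * q x) = 0 \<and>
        edge_integral ?e (\<lambda>x. (cross3 (nrm (convex hull {a, b, c})) (z - y) \<bullet> u x) * q x) = 0"
      using 1 k(1) unfolding t(3) by simp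
  qed
qed

fun loc :: "(real^3) set \<Rightarrow> (real^3 \<Rightarrow> real^3^3) \<Rightarrow> local_dof \<Rightarrow> real" where
  "loc T p (Vertex_loc x i j) = p x $ i $ j"
| "loc T p (Face_nn_loc f q) = face_integral f (\<lambda>x. (nrm f \<bullet> (p x *v nrm f)) * q x)"
| "loc T p (Face_tangential_loc f v) = face_integral f (\<lambda>x. tangential_part (nrm f) (p x *v nrm f) \<bullet> v x)"
| "loc T p (Element_loc \<xi>) = (LINT x:T|lebesgue. p x \<bullet> \<xi> x)"
| "loc T p (Edge_nn_loc e f q) = edge_integral e (\<lambda>x. (nrm f \<bullet> (p x *v nrm f)) * q x)"
| "loc T p (Edge_nt_loc e f q) = edge_integral e (\<lambda>x. (nrm f \<bullet> (p x *v cross3 (nrm f) (tng e))) * q x)"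

fun is_loc :: "(real^3) set \<Rightarrow> local_dof \<Rightarrow> bool" where
  "is_loc T (Vertex_loc x i j) \<longleftrightarrow> x extreme_point_of T \<and> i \<le> j"
| "is_loc T (Face_nn_loc f q) \<longleftrightarrow> f \<in> facets T \<and> q \<in> B0 f"
| "is_loc T (Face_tangential_loc f v) \<longleftrightarrow> f \<in> facets T \<and> v \<in> BN f"
| "is_loc T (Element_loc \<xi>) \<longleftrightarrow> \<xi> \<in> BK T"
| "is_loc T (Edge_nn_loc e f q) \<longleftrightarrow> e \<in> tedges T \<and> f \<in> facets T \<and> e face_of f \<and> q \<in> BE e"
| "is_loc T (Edge_nt_loc e f q) \<longleftrightarrow> e \<in> tedges T \<and> f \<in> facets T \<and> e face_of f \<and> q \<in> BE e"

lemma basis_continuous: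
  "f \<in> faces \<T> \<Longrightarrow> q \<in> B0 f \<Longrightarrow> continuous_on f q" "f \<in> faces \<T> \<Longrightarrow> v \<in> BN f \<Longrightarrow> continuous_on f v"
  "T \<in> \<T> \<Longrightarrow> \<xi> \<in> BK T \<Longrightarrow> continuous_on T \<xi>" "e \<in> edges \<T> \<Longrightarrow> q \<in> BE e \<Longrightarrow> continuous_on e q"
  using basis_B0 basis_BN basis_BK basis_BE is_basis_subset polys_on_continuous nedelec1_continuous by metis+

lemma continuous_on_matrix_vector: "p \<in> polys k \<Longrightarrow> continuous_on S (\<lambda>x. p x *v h)" for p :: "real^3 \<Rightarrow> real^3^3"
  by (rule polys_continuous[OF polys_matrix_vector])

lemma tangential_part_add: "tangential_part n (u + v) = tangential_part n u + tangential_part n v"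
  and tangential_part_scaleR: "tangential_part n (c *\<^sub>R u) = c *\<^sub>R tangential_part n u"
  by (simp_all add: tangential_part_def cross_add_right cross_add_left cross_mult_right cross_mult_left)

lemma loc_add:
  assumes T: "T \<in> \<T>" and p: "p \<in> polys 3" "p' \<in> polys 3" and d: "is_loc T d"
  shows "loc T (\<lambda>x. p x + p' x) d = loc T p d + loc T p' d"
proof (cases d)
  case (Face_nn_loc f q)
  then have f: "f \<in> facets T" "q \<in> B0 f" using d by auto
  note fp = facet_props[OF f(1) simplex_T[OF T]]
  show ?thesis
    unfolding Face_nn_loc loc.simps matrix_vector_mult_add_rdistrib inner_add_right distrib_right
    by (rule face_integral_add[OF fp(3,1,2)]) (intro continuous_on_mult continuous_on_inner continuous_on_const
      continuous_on_matrix_vector[OF p(1)] continuous_on_matrix_vector[OF p(2)] basis_continuous(1)[OF facets_faces[OF T f(1)] f(2)])+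
next
  case (Face_tangential_loc f v)
  then have f: "f \<in> facets T" "v \<in> BN f" using d by auto
  note fp = facet_props[OF f(1) simplex_T[OF T]]
  show ?thesis
    unfolding Face_tangential_loc loc.simps matrix_vector_mult_add_rdistrib tangential_part_add inner_add_left
    unfolding tangential_part_def
    by (rule face_integral_add[OF fp(3,1,2)]) (intro continuous_on_cross continuous_on_inner continuous_on_const
      continuous_on_matrix_vector[OF p(1)] continuous_on_matrix_vector[OF p(2)] basis_continuous(2)[OF facets_faces[OF T f(1)] f(2)])+
next
  case (Element_loc \<xi>)
  then have f: "\<xi> \<in> BK T" using d by auto
  show ?thesis unfolding Element_loc loc.simps inner_add_left
    by (intro set_integral_add(2) set_integrable_compact(2) compact_T T continuous_on_inner polys_continuous[OF p(1)] polys_continuous[OF p(2)]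
        basis_continuous(3)[OF T f])
next
  case (Edge_nn_loc e f q)
  then have f: "e \<in> tedges T" "q \<in> BE e" using d by auto
  note fp = tedge_props[OF f(1) simplex_T[OF T]]
  show ?thesis
    unfolding Edge_nn_loc loc.simps matrix_vector_mult_add_rdistrib inner_add_right distrib_right
    by (rule edge_integral_add[OF fp(3,1,2)]) (intro continuous_on_mult continuous_on_inner continuous_on_const
      continuous_on_matrix_vector[OF p(1)] continuous_on_matrix_vector[OF p(2)] basis_continuous(4)[OF tedges_edges[OF T f(1)] f(2)])+
next
  case (Edge_nt_loc e f q)
  then have f: "e \<in> tedges T" "q \<in> BE e" using d by auto
  note fp = tedge_props[OF f(1) simplex_T[OF T]]
  show ?thesis
    unfolding Edge_nt_loc loc.simps matrix_vector_mult_add_rdistrib inner_add_right distrib_right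
    by (rule edge_integral_add[OF fp(3,1,2)]) (intro continuous_on_mult continuous_on_inner continuous_on_const
      continuous_on_matrix_vector[OF p(1)] continuous_on_matrix_vector[OF p(2)] basis_continuous(4)[OF tedges_edges[OF T f(1)] f(2)])+
qed simp

lemma loc_scale: "loc T (\<lambda>x. c *\<^sub>R p x) d = c * loc T p d"
proof -
  have mv: "(c *\<^sub>R A) *v x = c *\<^sub>R (A *v x)" for A :: "real^3^3" and x by (rule scaleR_matrix_vector_assoc[symmetric])
  show ?thesis
    by (cases d; simp only: loc.simps mv tangential_part_scaleR inner_scaleR_left inner_scaleR_right mult.assoc face_integral_scale
      edge_integral_scale set_integral_mult_right vector_scaleR_component real_scaleR_def)
qed

text \<open>\<open>edge_relation\<close> multiplied by \<open>q\<close> and integrated over the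
  edge.\<close>

lemma edge_moment_relation:
  assumes T: "T \<in> \<T>" and e: "e \<in> tedges T" and f: "f \<in> facets T" "f' \<in> facets T" "e face_of f" "e face_of f'" "f \<noteq> f'"
    and p: "p \<in> polys 3" "\<And>x. p x \<in> sym_mats" and q: "q \<in> BE e"
  shows "loc T p (Edge_nt_loc e f q) + loc T p (Edge_nt_loc e f' q) =
    kappa (tng e) (nrm f) (nrm f') * (loc T p (Edge_nn_loc e f' q) - loc T p (Edge_nn_loc e f q))"
proof -
  note S = simplex_T[OF T] and ep = tedge_props[OF e simplex_T[OF T]]
  obtain p1 p2 p3 p4 where t: "tet p1 p2 p3 p4" "T = convex hull {p1, p2, p3, p4}" "e = convex hull {p1, p2}"
      "{f \<in> facets T. e face_of f} = {convex hull {p1, p2, p3}, convex hull {p1, p2, p4}}"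
      "convex hull {p1, p2, p3} \<noteq> convex hull {p1, p2, p4}"
    by (rule facets_at_edge[OF S e])
  have "f \<in> {f \<in> facets T. e face_of f}" "f' \<in> {f \<in> facets T. e face_of f}" using f by simp_all
  then have "f = convex hull {p1, p2, p3} \<and> f' = convex hull {p1, p2, p4} \<or> f = convex hull {p1, p2, p4} \<and> f' = convex hull {p1, p2, p3}"
    unfolding t(4) insert_iff empty_iff using f(5) by argo
  then obtain r s where rs: "tet p1 p2 r s" "f = convex hull {p1, p2, r}" "f' = convex hull {p1, p2, s}"
    using t(1) tet_perms(3)[OF t(1)] by (elim disjE conjE)
  have "tangential e (tng e)" using tangents tedges_edges[OF T e] by blast
  then obtain c where c: "c \<noteq> 0" "tng e = c *\<^sub>R (p2 - p1)" unfolding t(3) by (rule tangential_hull)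
  note n = normal_facet[OF T f(1)] normal_facet[OF T f(2)]
  have nd: "nrm f' \<bullet> cross3 (nrm f) (tng e) \<noteq> 0"
    using facet_pair_nondegenerate[OF rs(1) n[unfolded rs(2,3)] c(1)] unfolding c(2) rs(2,3) .
  have n1: "norm (nrm f) = 1" "norm (nrm f') = 1" "tng e \<noteq> 0" "nrm f \<bullet> tng e = 0" "nrm f' \<bullet> tng e = 0"
    using n tet_distinct[OF rs(1)] c unfolding rs(2,3) unit_normal_hull by auto
  let ?k = "kappa (tng e) (nrm f) (nrm f')"
  have rel: "(nrm f \<bullet> (p x *v cross3 (nrm f) (tng e))) * q x + (nrm f' \<bullet> (p x *v cross3 (nrm f') (tng e))) * q x =
    ?k * ((nrm f' \<bullet> (p x *v nrm f')) * q x + (- 1) * ((nrm f \<bullet> (p x *v nrm f)) * q x))" for x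
    unfolding distrib_right[symmetric] edge_relation[OF p(2) n1 nd] by (simp add: algebra_simps)
  note ci = continuous_on_mult continuous_on_inner continuous_on_const continuous_on_matrix_vector[OF p(1)] basis_continuous(4)[OF tedges_edges[OF T e] q]
  show ?thesis
    unfolding loc.simps
    apply (subst edge_integral_add[OF ep(3,1,2), symmetric]) apply (intro ci; fail)+
    unfolding rel edge_integral_scale
    apply (subst edge_integral_add[OF ep(3,1,2)]) apply (intro ci; fail)+
    unfolding edge_integral_scale by simp
qed

lemma local_injective:
  assumes T: "T \<in> \<T>" and p: "p \<in> polys 3" "\<And>x. p x \<in> sym_mats" and z: "\<And>d. is_loc T d \<Longrightarrow> loc T p d = 0" and x: "x \<in> T"
  shows "p x = 0"
proof (rule element_zero[OF simplex_T[OF T] p _ _ x])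
  fix \<xi> :: "real^3 \<Rightarrow> real^3^3" assume "\<xi> \<in> polys_on 1 T sym_mats"
  then show "(LINT x:T|lebesgue. p x \<bullet> \<xi> x) = 0"
    by (rule element_moment_ext[OF T polys_continuous[OF p(1)], rotated]) (use z[of "Element_loc _"] in simp)
next
  fix f x assume f: "f \<in> facets T" and x: "x \<in> f"
  \<comment> \<open>The edge moments pair \<open>n\<close> with \<open>P (n \<times> t)\<close>,
    while \<open>face_zero\<close> only sees the trace \<open>P n\<close>; symmetry exchanges the
    two sides.\<close>
  have ss: "cross3 (nrm f) (tng e) \<bullet> (p x *v nrm f) = nrm f \<bullet> (p x *v cross3 (nrm f) (tng e))" for e x by (rule sym_mats_inner[OF p(2)])
  have "p x *v nrm f = 0"
  proof (rule face_zero[OF T f polys_matrix_vector[OF p(1)] _ _ _ _ _ x])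
    fix y assume y: "y extreme_point_of T"
    have "p y $ i $ j = 0" for i j
    proof (cases "i \<le> j")
      case True
      then show ?thesis using z[of "Vertex_loc y i j"] y by simp
    next
      case False
      then have "p y $ j $ i = 0" using z[of "Vertex_loc y j i"] y by simp
      then show ?thesis using sym_mats_component[OF p(2)] by metis
    qed
    then have "p y = 0" by (simp add: vec_eq_iff)
    then show "p y *v nrm f = 0" by simp
  next
    fix q assume "q \<in> B0 f"
    then show "face_integral f (\<lambda>x. (nrm f \<bullet> (p x *v nrm f)) * q x) = 0" using z[of "Face_nn_loc f q"] f by simp
  next
    fix w assume "w \<in> BN f"
    then show "face_integral f (\<lambda>x. tangential_part (nrm f) (p x *v nrm f) \<bullet> w x) = 0" using z[of "Face_tangential_loc f w"] f by simp
  next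
    fix e q assume e: "e \<in> tedges T" "e face_of f" "q \<in> BE e"
    then show "edge_integral e (\<lambda>x. (nrm f \<bullet> (p x *v nrm f)) * q x) = 0" using z[of "Edge_nn_loc e f q"] f by simp
    show "edge_integral e (\<lambda>x. (cross3 (nrm f) (tng e) \<bullet> (p x *v nrm f)) * q x) = 0"
      unfolding ss using e z[of "Edge_nt_loc e f q"] f by simp
  qed
  moreover have "nrm f = outn T f \<or> nrm f = - outn T f"
    by (rule facet_unit_normal_cases[OF simplex_T[OF T] f normal_facet[OF T f]])
  ultimately show "p x *v outn T f = 0"
    using linear_neg[OF matrix_vector_mul_linear, of "p x" "outn T f"] by auto
qed

end

lemma card_UN_bound:
  assumes "finite I" "\<And>i. i \<in> I \<Longrightarrow> finite (A i) \<and> card (A i) \<le> k" "card I \<le> n"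
  shows "finite (\<Union>i\<in>I. A i)" "card (\<Union>i\<in>I. A i) \<le> n * k"
proof -
  show "finite (\<Union>i\<in>I. A i)" using assms by blast
  have "card (\<Union>i\<in>I. A i) \<le> (\<Sum>i\<in>I. card (A i))" by (rule card_UN_le[OF assms(1)])
  also have "\<dots> \<le> card I * k" using sum_bounded_above[of I "\<lambda>i. card (A i)" k] assms(2) by simp
  also have "\<dots> \<le> n * k" using assms(3) by (rule mult_le_mono1)
  finally show "card (\<Union>i\<in>I. A i) \<le> n * k" .
qed

lemma card_UN_image_bound:
  assumes "finite I" "card I \<le> n" "\<And>i. i \<in> I \<Longrightarrow> finite (B i) \<and> card (B i) \<le> k"
  shows "finite (\<Union>i\<in>I. g i ` B i)" "card (\<Union>i\<in>I. g i ` B i) \<le> n * k"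
proof -
  have im: "finite (g i ` B i) \<and> card (g i ` B i) \<le> k" if "i \<in> I" for i
    using assms(3)[OF that] card_image_le[of "B i" "g i"] by simp
  show "finite (\<Union>i\<in>I. g i ` B i)" "card (\<Union>i\<in>I. g i ` B i) \<le> n * k"
    by (rule card_UN_bound[OF assms(1) im assms(2)]; assumption)+
qed

context elasticity_mesh begin

lemma basis_cards:
  "T \<in> \<T> \<Longrightarrow> f \<in> facets T \<Longrightarrow> finite (B0 f) \<and> card (B0 f) \<le> 1"
  "T \<in> \<T> \<Longrightarrow> f \<in> facets T \<Longrightarrow> finite (BN f) \<and> card (BN f) \<le> 8"
  "T \<in> \<T> \<Longrightarrow> finite (BK T) \<and> card (BK T) \<le> 24"
  "T \<in> \<T> \<Longrightarrow> e \<in> tedges T \<Longrightarrow> finite (BE e) \<and> card (BE e) \<le> 2"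
proof -
  assume T: "T \<in> \<T>" and f: "f \<in> facets T"
  have B: "is_basis (B0 f) (polys_on 0 f UNIV)" using basis_B0 facets_faces[OF T f] by blast
  show "finite (B0 f) \<and> card (B0 f) \<le> 1"
    using is_basis_card_le[OF B _ polys_on_0_span] by simp
  have BN: "is_basis (BN f) (nedelec1 f (nrm f))" using basis_BN facets_faces[OF T f] by blast
  obtain a b c d where t: "tet a b c d" "T = convex hull {a, b, c, d}" "f = convex hull {a, b, c}"
    by (rule facet_vertices[OF simplex_T[OF T] f])
  obtain S where S: "finite S" "card S \<le> 8" "nedelec1 f (nrm f) \<subseteq> fn.span S"
    using nedelec1_span[OF tet_cross_nz[OF t(1)] normal_facet[OF T f, unfolded t(3)]] unfolding t(3) by blast
  show "finite (BN f) \<and> card (BN f) \<le> 8"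
    using is_basis_card_le[OF BN S(1,3)] S(2) by simp
next
  assume T: "T \<in> \<T>"
  obtain a b c d where t: "tet a b c d" "T = convex hull {a, b, c, d}" using simplex_T[OF T] unfolding simplex_3_iff_tet by blast
  have BK: "is_basis (BK T) (polys_on 1 T sym_mats)" using basis_BK T by blast
  let ?L = "{\<lambda>_. 1, bary a c d b, bary a d b c, bary a b c d}"
  let ?S = "(\<lambda>(\<l>, i, j). restr T (\<lambda>x. \<l> x *\<^sub>R sym_unit i j)) ` (?L \<times> upper_pairs)"
  have fin: "finite (?L \<times> upper_pairs)" by simp
  have "card ?S \<le> card (?L \<times> upper_pairs)" by (rule card_image_le[OF fin])
  also have "\<dots> = card ?L * 6" unfolding card_cartesian_product card_upper_pairs ..
  also have "\<dots> \<le> 4 * 6" by (rule mult_le_mono1) (simp add: card_insert_if)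
  finally have "card ?S \<le> 24" by simp
  then show "finite (BK T) \<and> card (BK T) \<le> 24"
    using is_basis_card_le[OF BK finite_imageI[OF fin] polys_on_1_sym_span[OF t(1), folded t(2)]] by simp
next
  assume T: "T \<in> \<T>" and e: "e \<in> tedges T"
  have BE: "is_basis (BE e) (polys_on 1 e UNIV)" using basis_BE tedges_edges[OF T e] by blast
  obtain p q r s where t: "tet p q r s" "T = convex hull {p, q, r, s}" "e = convex hull {p, q}"
    "{f \<in> facets T. e face_of f} = {convex hull {p, q, r}, convex hull {p, q, s}}"
    "convex hull {p, q, r} \<noteq> convex hull {p, q, s}"
    by (rule facets_at_edge[OF simplex_T[OF T] e])
  have pq: "p \<noteq> q" using tet_distinct[OF t(1)] by blast
  let ?S = "{restr e (\<lambda>_. 1), restr e (\<lambda>x. ((q - p) \<bullet> (x - p)) / ((q - p) \<bullet> (q - p)))}"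
  have "card ?S \<le> 2" by (simp add: card_insert_if)
  then show "finite (BE e) \<and> card (BE e) \<le> 2"
    using is_basis_card_le[OF BE _ polys_on_1_edge_span[OF pq, folded t(3)]] by simp
qed

text \<open>The facet whose mixed moment is kept at the edge; any of the two would do.\<close>

definition sel :: "(real^3) set \<Rightarrow> (real^3) set \<Rightarrow> (real^3) set" where
  "sel T e = (SOME f. f \<in> facets T \<and> e face_of f)"

lemma sel_props:
  assumes "T \<in> \<T>" "e \<in> tedges T"
  shows "sel T e \<in> facets T" "e face_of sel T e"
proof -
  have "{f \<in> facets T. e face_of f} \<noteq> {}" using card_facets_at_edge[OF simplex_T[OF assms(1)] assms(2)] by force
  then have "\<exists>f. f \<in> facets T \<and> e face_of f" by blast
  from someI_ex[OF this] show "sel T e \<in> facets T" "e face_of sel T e" unfolding sel_def by blast+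
qed

text \<open>Of the two \<open>n \<tau> (n \<times> t)\<close> moments at an edge one is redundant by the edge relation. The bound below counts
  \<open>24 + 4 + 32 + 24 + 24 + 12 = 120\<close>.\<close>

definition reduced_locs :: "(real^3) set \<Rightarrow> local_dof set" where
  "reduced_locs T = {d. is_loc T d \<and> (case d of Edge_nt_loc e f q \<Rightarrow> f = sel T e | _ \<Rightarrow> True)}"

lemma reduced_locs_card:
  assumes T: "T \<in> \<T>"
  shows "finite (reduced_locs T)" "card (reduced_locs T) \<le> 120"
proof -
  note S = simplex_T[OF T] and bc = basis_cards[OF T]
  let ?V = "{x. x extreme_point_of T}" and ?E = "tedges T" and ?Fe = "\<lambda>e. {f \<in> facets T. e face_of f}"
  let ?D1 = "(\<lambda>(x, i, j). Vertex_loc x i j) ` (?V \<times> upper_pairs)"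
  let ?D2 = "\<Union>f\<in>facets T. Face_nn_loc f ` B0 f"
  let ?D3 = "\<Union>f\<in>facets T. Face_tangential_loc f ` BN f"
  let ?D4 = "Element_loc ` BK T"
  let ?D5 = "\<Union>e\<in>?E. \<Union>f\<in>?Fe e. Edge_nn_loc e f ` BE e"
  let ?D6 = "\<Union>e\<in>?E. Edge_nt_loc e (sel T e) ` BE e"
  obtain a b c d where t: "tet a b c d" "T = convex hull {a, b, c, d}" using S unfolding simplex_3_iff_tet by blast
  have V: "?V = {a, b, c, d}" unfolding t(2) extreme_point_tet[OF t(1)] by auto
  have "card (?V \<times> upper_pairs) = card ?V * 6" unfolding card_cartesian_product card_upper_pairs ..
  also have "\<dots> \<le> 4 * 6" unfolding V by (rule mult_le_mono1) (simp add: card_insert_if)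
  finally have "finite (?V \<times> upper_pairs) \<and> card (?V \<times> upper_pairs) \<le> 24" unfolding V by simp
  then have 1: "finite ?D1" "card ?D1 \<le> 24" using card_image_le[of "?V \<times> upper_pairs" "\<lambda>(x, i, j). Vertex_loc x i j"] by simp_all
  have ff: "finite (facets T)" "card (facets T) \<le> 4" using finite_facets[OF S] card_facets[OF S] by blast+
  have 2: "finite ?D2" "card ?D2 \<le> 4 * 1" by (rule card_UN_image_bound[OF ff bc(1)]; assumption)+
  have 3: "finite ?D3" "card ?D3 \<le> 4 * 8" by (rule card_UN_image_bound[OF ff bc(2)]; assumption)+
  have 4: "finite ?D4" "card ?D4 \<le> 24" using bc(3) card_image_le[of "BK T" Element_loc] by auto
  note te = tedges_finite_card[OF S]
  have fe: "finite (?Fe e)" "card (?Fe e) \<le> 2" if "e \<in> ?E" for e using ff(1) card_facets_at_edge[OF S that] by auto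
  have x5: "finite (\<Union>f\<in>?Fe e. Edge_nn_loc e f ` BE e) \<and> card (\<Union>f\<in>?Fe e. Edge_nn_loc e f ` BE e) \<le> 2 * 2" if "e \<in> ?E" for e
    using card_UN_image_bound[OF fe[OF that], of "\<lambda>_. BE e" 2 "Edge_nn_loc e"] bc(4)[OF that] by simp
  have 5: "finite ?D5" "card ?D5 \<le> 6 * (2 * 2)" by (rule card_UN_bound[OF te(1) x5 te(2)]; assumption)+
  have 6: "finite ?D6" "card ?D6 \<le> 6 * 2" by (rule card_UN_image_bound[OF te bc(4)]; assumption)+
  have sub: "reduced_locs T \<subseteq> ?D1 \<union> (?D2 \<union> (?D3 \<union> (?D4 \<union> (?D5 \<union> ?D6))))"
  proof
    fix d assume "d \<in> reduced_locs T"
    then have d: "is_loc T d" "case d of Edge_nt_loc e f q \<Rightarrow> f = sel T e | _ \<Rightarrow> True" by (auto simp: reduced_locs_def)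
    show "d \<in> ?D1 \<union> (?D2 \<union> (?D3 \<union> (?D4 \<union> (?D5 \<union> ?D6))))"
    proof (cases d)
      case (Vertex_loc x i j)
      then have "(x, i, j) \<in> ?V \<times> upper_pairs" using d by (simp add: upper_pairs_def)
      from imageI[OF this, of "\<lambda>(x, i, j). Vertex_loc x i j"] show ?thesis unfolding Vertex_loc by simp
    qed (use d in auto)
  qed
  show "finite (reduced_locs T)" by (rule finite_subset[OF sub]) (use 1 2 3 4 5 6 in simp)
  have "card (reduced_locs T) \<le> card (?D1 \<union> (?D2 \<union> (?D3 \<union> (?D4 \<union> (?D5 \<union> ?D6)))))"
    by (rule card_mono[OF _ sub]) (use 1 2 3 4 5 6 in simp)
  also have "\<dots> \<le> card ?D1 + (card ?D2 + (card ?D3 + (card ?D4 + (card ?D5 + card ?D6))))"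
    using card_Un_le[of ?D1 "?D2 \<union> (?D3 \<union> (?D4 \<union> (?D5 \<union> ?D6)))"] card_Un_le[of ?D2 "?D3 \<union> (?D4 \<union> (?D5 \<union> ?D6))"]
      card_Un_le[of ?D3 "?D4 \<union> (?D5 \<union> ?D6)"] card_Un_le[of ?D4 "?D5 \<union> ?D6"] card_Un_le[of ?D5 ?D6] by linarith
  also have "\<dots> \<le> 120" using 1(2) 2(2) 3(2) 4(2) 5(2) 6(2) by linarith
  finally show "card (reduced_locs T) \<le> 120" .
qed

text \<open>The omitted mixed moment is determined by the kept ones through the edge relation, which
  the field and the data both satisfy.\<close>

lemma local_from_reduced:
  assumes T: "T \<in> \<T>" and p: "p \<in> polys 3" "\<And>x. p x \<in> sym_mats"
    and h: "\<forall>e\<in>tedges T. \<forall>f\<in>facets T. \<forall>f'\<in>facets T. \<forall>q\<in>BE e. e face_of f \<and> e face_of f' \<and> f \<noteq> f' \<longrightarrow>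
      h (Edge_nt_loc e f q) + h (Edge_nt_loc e f' q) = kappa (tng e) (nrm f) (nrm f') * (h (Edge_nn_loc e f' q) - h (Edge_nn_loc e f q))"
    and r: "\<forall>d\<in>reduced_locs T. loc T p d = h d" and d: "is_loc T d"
  shows "loc T p d = h d"
proof (cases "\<exists>e f q. d = Edge_nt_loc e f q \<and> f \<noteq> sel T e")
  case True
  then obtain e f q where D: "d = Edge_nt_loc e f q" "f \<noteq> sel T e" by blast
  then have e: "e \<in> tedges T" "f \<in> facets T" "e face_of f" "q \<in> BE e" using d by auto
  note s = sel_props[OF T e(1)]
  have "loc T p (Edge_nn_loc e f q) = h (Edge_nn_loc e f q)" "loc T p (Edge_nn_loc e (sel T e) q) = h (Edge_nn_loc e (sel T e) q)"
      "loc T p (Edge_nt_loc e (sel T e) q) = h (Edge_nt_loc e (sel T e) q)"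
    using r e s by (simp_all add: reduced_locs_def del: loc.simps)
  moreover have "loc T p (Edge_nt_loc e f q) + loc T p (Edge_nt_loc e (sel T e) q) =
      kappa (tng e) (nrm f) (nrm (sel T e)) * (loc T p (Edge_nn_loc e (sel T e) q) - loc T p (Edge_nn_loc e f q))"
    by (rule edge_moment_relation[OF T e(1,2) s(1) e(3) s(2) D(2) p e(4)])
  moreover have "h (Edge_nt_loc e f q) + h (Edge_nt_loc e (sel T e) q) =
      kappa (tng e) (nrm f) (nrm (sel T e)) * (h (Edge_nn_loc e (sel T e) q) - h (Edge_nn_loc e f q))"
    using h e s D(2) by blast
  ultimately show ?thesis unfolding D(1) by (simp del: loc.simps)
next
  case False
  then have "d \<in> reduced_locs T" using d unfolding reduced_locs_def by (cases d) auto
  then show ?thesis using r by blast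
qed

text \<open>There are at most 120 reduced conditions on 120 coefficients, and only zero coefficients
  satisfy the homogeneous ones, so \<open>exists_functional_values\<close> solves them for any data.
  Compatibility of \<open>h\<close> recovers the omitted moments.\<close>

lemma local_surjective:
  assumes T: "T \<in> \<T>"
    and h: "\<forall>e\<in>tedges T. \<forall>f\<in>facets T. \<forall>f'\<in>facets T. \<forall>q\<in>BE e. e face_of f \<and> e face_of f' \<and> f \<noteq> f' \<longrightarrow>
      h (Edge_nt_loc e f q) + h (Edge_nt_loc e f' q) = kappa (tng e) (nrm f) (nrm f') * (h (Edge_nn_loc e f' q) - h (Edge_nn_loc e f q))"
  shows "\<exists>p. p \<in> polys 3 \<and> (\<forall>x. p x \<in> sym_mats) \<and> (\<forall>d. is_loc T d \<longrightarrow> loc T p d = h d)"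
proof -
  obtain a b c d where t: "tet a b c d" "T = convex hull {a, b, c, d}" using simplex_T[OF T] unfolding simplex_3_iff_tet by blast
  let ?P = "cubic_comb a b c d"
  note P = cubic_comb_polys[OF t(1)] cubic_comb_sym[OF t(1)]
  have lin1: "loc T (?P (k + k')) d = loc T (?P k) d + loc T (?P k') d" if "d \<in> reduced_locs T" for k k' d
  proof -
    have e: "?P (k + k') = (\<lambda>x. ?P k x + ?P k' x)" by (rule ext) (rule cubic_comb_add[OF t(1)])
    have "is_loc T d" using that by (simp add: reduced_locs_def)
    then show ?thesis unfolding e by (rule loc_add[OF T P(1) P(1)])
  qed
  have lin2: "loc T (?P (scale_fun s k)) d = s * loc T (?P k) d" for s k d
  proof -
    have e: "?P (scale_fun s k) = (\<lambda>x. s *\<^sub>R ?P k x)" by (rule ext) (rule cubic_comb_scale[OF t(1)])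
    show ?thesis unfolding e by (rule loc_scale)
  qed
  have inj: "k = 0" if k: "\<And>i. i \<notin> triples 3 \<times> upper_pairs \<Longrightarrow> k i = 0" and z: "\<And>d. d \<in> reduced_locs T \<Longrightarrow> loc T (?P k) d = 0" for k
  proof (rule cubic_comb_zero[OF t(1) _ k])
    fix x assume x: "x \<in> convex hull {a, b, c, d}"
    have "loc T (?P k) d = 0" if "is_loc T d" for d
      using local_from_reduced[OF T P, of "\<lambda>_. 0" k d] z that by simp
    then show "?P k x = 0" using local_injective[OF T P, of k x] x unfolding t(2) by blast
  qed
  have card: "card (reduced_locs T) \<le> card (triples 3 \<times> upper_pairs)"
    using reduced_locs_card(2)[OF T] by (simp add: card_cartesian_product card_upper_pairs card_triples_3)
  have "\<exists>k. (\<forall>i. i \<notin> triples 3 \<times> upper_pairs \<longrightarrow> k i = 0) \<and> (\<forall>d\<in>reduced_locs T. loc T (?P k) d = h d)"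
    by (rule exists_functional_values[OF _ reduced_locs_card(1)[OF T] card lin1 lin2 inj]) simp_all
  then obtain k where k: "\<forall>d\<in>reduced_locs T. loc T (?P k) d = h d" by blast
  then have "\<forall>d. is_loc T d \<longrightarrow> loc T (?P k) d = h d" using local_from_reduced[OF T P h] by blast
  then show ?thesis using P by blast
qed

end

section \<open>Conormals and dihedral angles\<close>

text \<open>The description in \<open>conormal\<close> singles out the normalised component of
  \<open>r - p\<close> orthogonal to the edge; its positive coefficient at \<open>r - p\<close>
  records that it points into the triangle.\<close>

lemma conormal_props:
  assumes N: "cross3 (q - p) (r - p) \<noteq> 0"
  defines "\<nu> \<equiv> conormal (convex hull {p, q}) (convex hull {p, q, r})"
  shows "norm \<nu> = 1" "\<nu> \<bullet> (q - p) = 0" "\<exists>k l. k > 0 \<and> \<nu> = k *\<^sub>R (r - p) + l *\<^sub>R (q - p)"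
proof -
  let ?u = "q - p" and ?v = "r - p"
  let ?e = "convex hull {p, q}" and ?F = "convex hull {p, q, r}"
  have u0: "?u \<noteq> 0" using N by auto
  then have uu: "?u \<bullet> ?u > 0" by simp
  define \<mu> where "\<mu> = (?v \<bullet> ?u) / (?u \<bullet> ?u)"
  define w where "w = ?v - \<mu> *\<^sub>R ?u"
  have wu: "w \<bullet> ?u = 0" using uu by (simp add: w_def \<mu>_def inner_diff_left)
  have w0: "w \<noteq> 0"
  proof
    assume "w = 0"
    then have "?v = \<mu> *\<^sub>R ?u" by (simp add: w_def)
    then show False using N by (simp add: cross_mult_right cross_refl)
  qed
  have nw: "norm w > 0" using w0 by simp
  define \<nu>' where "\<nu>' = (1 / norm w) *\<^sub>R w"
  let ?P = "\<lambda>\<nu>. norm \<nu> = 1 \<and> (\<forall>x\<in>?e. \<forall>y\<in>?e. \<nu> \<bullet> (y - x) = 0) \<and> (\<exists>x\<in>?e. \<exists>s>0. x + s *\<^sub>R \<nu> \<in> ?F)"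
  have perp: "(\<forall>x\<in>?e. \<forall>y\<in>?e. \<nu> \<bullet> (y - x) = 0) \<longleftrightarrow> \<nu> \<bullet> ?u = 0" for \<nu>
  proof
    assume "\<forall>x\<in>?e. \<forall>y\<in>?e. \<nu> \<bullet> (y - x) = 0"
    moreover have "p \<in> ?e" "q \<in> ?e" by (simp_all add: hull_inc)
    ultimately show "\<nu> \<bullet> ?u = 0" by blast
  next
    assume z: "\<nu> \<bullet> ?u = 0"
    have "\<nu> \<bullet> ((p + s *\<^sub>R ?u) - (p + s' *\<^sub>R ?u)) = 0" for s s'
    proof -
      have "(p + s *\<^sub>R ?u) - (p + s' *\<^sub>R ?u) = (s - s') *\<^sub>R ?u" by (simp add: algebra_simps)
      then show ?thesis using z by simp
    qed
    then show "\<forall>x\<in>?e. \<forall>y\<in>?e. \<nu> \<bullet> (y - x) = 0" unfolding convex_hull_2_image by blast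
  qed
  have P: "?P \<nu>'"
  proof -
    \<comment> \<open>The point at height \<open>b * norm w\<close> over the midpoint of the edge
      has triangle coordinates \<open>1 / 2 - b * \<mu>\<close> and \<open>b\<close>; this
      \<open>b\<close> puts the first one between \<open>b\<close> and \<open>1 - b\<close>.\<close>
    define b where "b = 1 / (2 * (1 + \<bar>\<mu>\<bar>))"
    have b: "0 < b" "b * (1 + \<bar>\<mu>\<bar>) = 1 / 2" by (simp_all add: b_def field_simps add_pos_nonneg)
    then have "\<bar>b * \<mu>\<bar> = 1 / 2 - b" by (simp add: abs_mult algebra_simps)
    then have bm: "b * \<mu> \<le> 1 / 2 - b" "- (b * \<mu>) \<le> 1 / 2 - b" by linarith+
    let ?x = "p + (1 / 2) *\<^sub>R ?u"
    have "?x \<in> ?e" unfolding convex_hull_2_image by (rule image_eqI[of _ _ "1 / 2"]) auto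
    moreover have "b * norm w > 0" using b nw by simp
    moreover have "?x + (b * norm w) *\<^sub>R \<nu>' \<in> ?F"
    proof -
      have "?x + (b * norm w) *\<^sub>R \<nu>' = p + (1 / 2 - b * \<mu>) *\<^sub>R ?u + b *\<^sub>R ?v"
        using nw by (simp add: \<nu>'_def w_def scaleR_diff_right scaleR_diff_left)
      then show ?thesis unfolding convex_hull_3_image
        by (intro image_eqI[of _ _ "vector [1 / 2 - b * \<mu>, b] :: real^2"]) (use b bm in \<open>simp_all add: simplex2_def\<close>)
    qed
    moreover have "norm \<nu>' = 1" using nw by (simp add: \<nu>'_def)
    moreover have "\<nu>' \<bullet> ?u = 0" using wu by (simp add: \<nu>'_def)
    ultimately show ?thesis unfolding perp by blast
  qed
  have uniq: "\<nu> = \<nu>'" if Q: "?P \<nu>" for \<nu>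
  proof -
    have q: "norm \<nu> = 1" "\<nu> \<bullet> ?u = 0" using Q unfolding perp by blast+
    obtain x s where xs: "x \<in> ?e" "s > 0" "x + s *\<^sub>R \<nu> \<in> ?F" using Q by blast
    obtain l where l: "x = p + l *\<^sub>R ?u" using xs(1) unfolding convex_hull_2_image by blast
    obtain g :: "real^2" where g: "g \<in> simplex2" "x + s *\<^sub>R \<nu> = p + g$1 *\<^sub>R ?u + g$2 *\<^sub>R ?v" using xs(3) unfolding convex_hull_3_image by blast
    define m where "m = g$1 + g$2 * \<mu> - l"
    have "s *\<^sub>R \<nu> = g$1 *\<^sub>R ?u + g$2 *\<^sub>R ?v - l *\<^sub>R ?u" using g(2) unfolding l by (simp add: algebra_simps)
    then have e: "s *\<^sub>R \<nu> = m *\<^sub>R ?u + g$2 *\<^sub>R w" by (simp add: m_def w_def algebra_simps)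
    have "(s *\<^sub>R \<nu>) \<bullet> ?u = 0" using q(2) by simp
    then have "m * (?u \<bullet> ?u) = 0" unfolding e using wu by (simp add: inner_add_left)
    then have "m = 0" using uu by simp
    then have e': "s *\<^sub>R \<nu> = g$2 *\<^sub>R w" using e by simp
    have g2: "g$2 \<ge> 0" using g(1) by (simp add: simplex2_def)
    have "s = g$2 * norm w" using arg_cong[OF e', of norm] q(1) xs(2) g2 by simp
    then have "s *\<^sub>R \<nu> = s *\<^sub>R \<nu>'" unfolding e' \<nu>'_def using nw by simp
    then show ?thesis using xs(2) by simp
  qed
  have \<nu>: "\<nu> = \<nu>'" unfolding \<nu>_def conormal_def by (rule the_equality[where P = "?P", OF P uniq])
  show "norm \<nu> = 1" "\<nu> \<bullet> ?u = 0" using P unfolding perp \<nu> by blast+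
  have "\<nu>' = (1 / norm w) *\<^sub>R ?v + (- \<mu> / norm w) *\<^sub>R ?u" by (simp add: \<nu>'_def w_def scaleR_diff_right)
  then show "\<exists>k l. k > 0 \<and> \<nu> = k *\<^sub>R ?v + l *\<^sub>R ?u" unfolding \<nu> using nw by (intro exI[of _ "1 / norm w"] exI[of _ "- \<mu> / norm w"]) simp
qed

text \<open>For unit vectors orthogonal to \<open>t\<close> this is, up to the length of
  \<open>t\<close>, a signed sine of the angle between them; the sign tells the sense of rotation
  about \<open>t\<close>.\<close>

definition turn :: "real^3 \<Rightarrow> real^3 \<Rightarrow> real^3 \<Rightarrow> real" where
  "turn t \<nu> \<nu>' = \<nu> \<bullet> cross3 t \<nu>'"

lemma cross3_unit: "norm \<nu> = 1 \<Longrightarrow> \<nu> \<bullet> t = 0 \<Longrightarrow> cross3 t \<nu> \<bullet> cross3 t \<nu> = t \<bullet> t"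
  unfolding dot_cross by (simp add: dot_square_norm inner_commute)

lemma unit_perp_pair:
  assumes "norm n = 1" "n \<bullet> t = 0" "n \<bullet> \<nu> = 0" "norm \<nu> = 1" "\<nu> \<bullet> t = 0" "t \<noteq> 0"
  shows "\<exists>\<epsilon>. \<epsilon> * \<epsilon> * (t \<bullet> t) = 1 \<and> n = \<epsilon> *\<^sub>R cross3 t \<nu>"
proof -
  have c: "cross3 t \<nu> \<bullet> cross3 t \<nu> = t \<bullet> t" by (rule cross3_unit[OF assms(4,5)])
  then have nz: "cross3 t \<nu> \<noteq> 0" using assms(6) by (metis inner_eq_zero_iff)
  define \<epsilon> where "\<epsilon> = (cross3 t \<nu> \<bullet> n) / (cross3 t \<nu> \<bullet> cross3 t \<nu>)"
  have n: "n = \<epsilon> *\<^sub>R cross3 t \<nu>" unfolding \<epsilon>_def by (rule parallel_cross[OF assms(2,3) nz])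
  have "n \<bullet> n = \<epsilon> * \<epsilon> * (t \<bullet> t)" unfolding n using c by simp
  then have "\<epsilon> * \<epsilon> * (t \<bullet> t) = 1" using assms(1) by (simp add: dot_square_norm)
  then show ?thesis using n by blast
qed

text \<open>Each normal is its conormal turned by a right angle about \<open>t\<close>, up to a
  factor of either sign; both factors cancel in the quotient.\<close>

lemma kappa_conormal:
  assumes t: "t \<noteq> 0" and n: "norm n = 1" "n \<bullet> t = 0" "n \<bullet> \<nu> = 0" "norm \<nu> = 1" "\<nu> \<bullet> t = 0"
    and n': "norm n' = 1" "n' \<bullet> t = 0" "n' \<bullet> \<nu>' = 0" "norm \<nu>' = 1" "\<nu>' \<bullet> t = 0"
  shows "kappa t n n' = (t \<bullet> t) * (\<nu> \<bullet> \<nu>') / turn t \<nu> \<nu>'"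
proof -
  obtain \<epsilon> where e: "\<epsilon> * \<epsilon> * (t \<bullet> t) = 1" "n = \<epsilon> *\<^sub>R cross3 t \<nu>" using unit_perp_pair[OF n t] by blast
  obtain \<epsilon>' where e': "\<epsilon>' * \<epsilon>' * (t \<bullet> t) = 1" "n' = \<epsilon>' *\<^sub>R cross3 t \<nu>'" using unit_perp_pair[OF n' t] by blast
  have 1: "n \<bullet> n' = \<epsilon> * \<epsilon>' * ((t \<bullet> t) * (\<nu> \<bullet> \<nu>'))"
    unfolding e(2) e'(2) using n n' by (simp add: dot_cross inner_commute)
  have "cross3 (cross3 t \<nu>) t = (t \<bullet> t) *\<^sub>R \<nu>"
    using n(5) by (subst cross_skew) (simp add: Lagrange inner_commute)
  then have 2: "n' \<bullet> cross3 n t = \<epsilon> * \<epsilon>' * ((t \<bullet> t) * turn t \<nu> \<nu>')"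
    unfolding e(2) e'(2) turn_def by (simp add: cross_mult_left inner_commute)
  have nz: "\<epsilon> \<noteq> 0" "\<epsilon>' \<noteq> 0" "t \<bullet> t \<noteq> 0" using e(1) e'(1) by auto
  show ?thesis unfolding kappa_def 1 2 using nz by (simp add: field_simps)
qed

text \<open>Pythagoras' theorem, read off from the expansion of \<nu> in the orthogonal frame
  \<open>\<nu>'\<close>, \<open>cross3 t \<nu>'\<close>.\<close>

lemma turn_square:
  assumes "norm \<nu> = 1" "norm \<nu>' = 1" "\<nu> \<bullet> t = 0" "\<nu>' \<bullet> t = 0"
  shows "(turn t \<nu> \<nu>')\<^sup>2 = (t \<bullet> t) * (1 - (\<nu> \<bullet> \<nu>')\<^sup>2)"
proof -
  have c: "cross3 t \<nu>' \<bullet> cross3 t \<nu>' = t \<bullet> t" by (rule cross3_unit[OF assms(2,4)])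
  have t1: "cross3 \<nu>' (cross3 t \<nu>') = t" using assms by (simp add: Lagrange inner_commute dot_square_norm)
  have t2: "cross3 (cross3 t \<nu>') t = (t \<bullet> t) *\<^sub>R \<nu>'" using assms by (subst cross_skew) (simp add: Lagrange inner_commute)
  let ?w = "cross3 t \<nu>'"
  have "(?w \<bullet> ?w) *\<^sub>R \<nu> = (cross3 \<nu>' ?w \<bullet> \<nu>) *\<^sub>R t + (cross3 ?w t \<bullet> \<nu>) *\<^sub>R \<nu>' + (cross3 t \<nu>' \<bullet> \<nu>) *\<^sub>R ?w" by (rule cramer3)
  then have "(t \<bullet> t) *\<^sub>R \<nu> = ((t \<bullet> t) * (\<nu> \<bullet> \<nu>')) *\<^sub>R \<nu>' + turn t \<nu> \<nu>' *\<^sub>R ?w"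
    unfolding c t1 t2 using assms by (simp add: turn_def inner_commute)
  then have "((t \<bullet> t) *\<^sub>R \<nu>) \<bullet> \<nu> = (((t \<bullet> t) * (\<nu> \<bullet> \<nu>')) *\<^sub>R \<nu>' + turn t \<nu> \<nu>' *\<^sub>R ?w) \<bullet> \<nu>" by (rule arg_cong)
  moreover have "\<nu> \<bullet> \<nu> = 1" "?w \<bullet> \<nu> = turn t \<nu> \<nu>'" "\<nu>' \<bullet> \<nu> = \<nu> \<bullet> \<nu>'" using assms(1) by (simp_all add: dot_square_norm turn_def inner_commute)
  ultimately have "t \<bullet> t = (t \<bullet> t) * (\<nu> \<bullet> \<nu>') * (\<nu> \<bullet> \<nu>') + turn t \<nu> \<nu>' * turn t \<nu> \<nu>'"
    unfolding inner_add_left inner_scaleR_left by (simp only: mult_1_right)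
  then show ?thesis by (simp only: power2_eq_square right_diff_distrib mult_1_right mult.assoc)
qed

lemma turn_swap: "turn t \<nu>' \<nu> = - turn t \<nu> \<nu>'"
  by (simp add: turn_def cross3_def inner_vec_def sum_3 vector_3 algebra_simps)

lemma turn_eq:
  assumes "(s1::real)\<^sup>2 = A * (1 - c1\<^sup>2)" "s2\<^sup>2 = A * (1 - c2\<^sup>2)" "c2\<^sup>2 = c1\<^sup>2" "s1 * s2 > 0"
  shows "s2 = s1"
proof -
  have "s2\<^sup>2 = s1\<^sup>2" using assms by simp
  then have "s2 = s1 \<or> s2 = - s1" by (simp add: power2_eq_iff)
  then show ?thesis
  proof
    assume "s2 = - s1"
    then have "s1 * s2 \<le> 0" by simp
    then show ?thesis using assms(4) by linarith
  qed
qed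

text \<open>Opposite cotangents have equal squared cosines, hence equal squared sines. The sines
  have the same sign, so they agree, and the cosines are opposite.\<close>

lemma cot_sum_zero:
  fixes c1 c2 s1 s2 A :: real
  assumes s: "s1\<^sup>2 = A * (1 - c1\<^sup>2)" "s2\<^sup>2 = A * (1 - c2\<^sup>2)" "s1 * s2 > 0" and z: "c1 / s1 + c2 / s2 = 0" and A: "A > 0"
  shows "c2 = - c1"
proof -
  have nz: "s1 \<noteq> 0" "s2 \<noteq> 0" using s(3) by auto
  have e: "c1 * s2 = - (c2 * s1)" using z nz by (simp add: field_simps)
  then have "c1\<^sup>2 * s2\<^sup>2 = c2\<^sup>2 * s1\<^sup>2" by (metis power_mult_distrib power2_minus)
  then have "A * c1\<^sup>2 = A * c2\<^sup>2" unfolding s by (simp add: algebra_simps)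
  then have cc: "c2\<^sup>2 = c1\<^sup>2" using A by simp
  have "s2 = s1" by (rule turn_eq[OF s(1,2) cc s(3)])
  then have "(c1 + c2) * s1 = 0" using e by (simp add: algebra_simps)
  then show ?thesis using nz by simp
qed

text \<open>Two consecutive dihedral angles that add up to \<open>\<pi>\<close>, on opposite sides of the common face.\<close>

lemma opposite_conormal:
  assumes t: "t \<noteq> 0" and u: "norm \<nu>1 = 1" "norm \<nu>2 = 1" "norm \<nu>3 = 1" "\<nu>1 \<bullet> t = 0" "\<nu>2 \<bullet> t = 0" "\<nu>3 \<bullet> t = 0"
    and c: "\<nu>2 \<bullet> \<nu>3 = - (\<nu>1 \<bullet> \<nu>2)" and s: "turn t \<nu>1 \<nu>2 = turn t \<nu>2 \<nu>3"
  shows "\<nu>3 = - \<nu>1"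
proof -
  let ?y = "\<nu>3 + \<nu>1" and ?w = "cross3 t \<nu>2"
  have "?w \<bullet> ?w = t \<bullet> t" by (rule cross3_unit[OF u(2,5)])
  moreover have "\<nu>2 \<bullet> ?y = 0" using c by (simp add: inner_add_right inner_commute)
  moreover have "?w \<bullet> ?y = 0"
    using s turn_swap[of t \<nu>2 \<nu>3] by (simp add: turn_def inner_add_right inner_commute)
  moreover have "t \<bullet> ?y = 0" using u by (simp add: inner_add_right inner_commute)
  moreover have "cross3 \<nu>2 ?w = t" using u by (simp add: Lagrange inner_commute dot_square_norm)
  moreover have "cross3 ?w t = (t \<bullet> t) *\<^sub>R \<nu>2" using u by (subst cross_skew) (simp add: Lagrange inner_commute)
  ultimately have "(t \<bullet> t) *\<^sub>R ?y = 0" using cramer3[of t \<nu>2 ?w ?y] by simp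
  then have "?y = 0" using t by simp
  then show ?thesis by (simp add: eq_neg_iff_add_eq_0)
qed

section \<open>Edge patches\<close>

lemma abs_inner_unit: "norm x = 1 \<Longrightarrow> norm y = 1 \<Longrightarrow> \<bar>x \<bullet> y\<bar> \<le> 1" for x y :: "real^3"
  using Cauchy_Schwarz_ineq2[of x y] by simp

lemma arccos_supplement:
  assumes "\<bar>x\<bar> \<le> 1" "\<bar>y\<bar> \<le> 1" "arccos x + arccos y = pi"
  shows "y = - x"
proof -
  have "arccos y = pi - arccos x" using assms(3) by simp
  then have "cos (arccos y) = - cos (arccos x)" by simp
  then show ?thesis using assms(1,2) by simp
qed

context elasticity_mesh begin

abbreviation m :: "(real^3) set \<Rightarrow> nat" where "m e \<equiv> patch_size \<T> e"

lemma label_props: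
  assumes e: "e \<in> edges \<T>" and i: "i \<in> {1..m e}"
  shows "K e i \<in> \<T>" "e \<in> tedges (K e i)" "F e i \<in> facets (K e i)" "F e (i + 1) \<in> facets (K e i)"
    "e face_of F e i" "e face_of F e (i + 1)"
proof -
  have L: "edge_labelling \<Omega> \<T> e (K e) (F e)" using labels e by blast
  have bK: "bij_betw (K e) {1..m e} {K\<in>\<T>. e face_of K}" and fK: "\<forall>i\<in>{1..m e}. F e i face_of K e i \<and> F e (i + 1) face_of K e i"
    using L unfolding edge_labelling_def Let_def by blast+
  have "aff_dim e = 1" using e by (auto simp: edges_def)
  then show T: "K e i \<in> \<T>" "e \<in> tedges (K e i)" using bij_betw_apply[OF bK i] by (auto simp: tedges_def)
  have F: "F e j \<in> {F\<in>faces \<T>. e face_of F}" if j: "j \<in> {1..m e + 1}" for j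
  proof (cases "boundary_edge \<Omega> e")
    case True
    then have "bij_betw (F e) {1..m e + 1} {F\<in>faces \<T>. e face_of F}" using L unfolding edge_labelling_def Let_def by presburger
    from bij_betw_apply[OF this j] show ?thesis .
  next
    case False
    then have b: "bij_betw (F e) {1..m e} {F\<in>faces \<T>. e face_of F}" and c: "F e (m e + 1) = F e 1" using L unfolding edge_labelling_def Let_def by presburger+
    show ?thesis
    proof (cases "j = m e + 1")
      case True
      then show ?thesis using bij_betw_apply[OF b, of 1] i c by simp
    next
      case False
      then show ?thesis using bij_betw_apply[OF b, of j] j by simp
    qed
  qed
  have d: "aff_dim f = 2" if "f \<in> faces \<T>" for f using that by (auto simp: faces_def)
  have "F e i \<in> {F\<in>faces \<T>. e face_of F}" "F e (i + 1) \<in> {F\<in>faces \<T>. e face_of F}" using F[of i] F[of "i + 1"] i by auto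
  then show "F e i \<in> facets (K e i)" "F e (i + 1) \<in> facets (K e i)" "e face_of F e i" "e face_of F e (i + 1)"
    using fK i d by (auto simp: facets_def)
qed

lemma patch_size_pos: "e \<in> edges \<T> \<Longrightarrow> 1 \<le> m e"
proof -
  assume "e \<in> edges \<T>"
  then obtain T where "T \<in> {K \<in> \<T>. e face_of K}" by (auto simp: edges_def)
  moreover have "finite {K \<in> \<T>. e face_of K}" using finite_T by simp
  ultimately have "card {K \<in> \<T>. e face_of K} \<noteq> 0" by (metis card_0_eq empty_iff)
  then show ?thesis by (simp add: patch_size_def)
qed

lemma boundary_labels:
  assumes "e \<in> edges \<T>" "boundary_edge \<Omega> e"
  shows "bij_betw (F e) {1..m e + 1} {F\<in>faces \<T>. e face_of F}"
  using labels assms unfolding edge_labelling_def Let_def by presburger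

lemma interior_labels:
  assumes "e \<in> edges \<T>" "\<not> boundary_edge \<Omega> e"
  shows "bij_betw (F e) {1..m e} {F\<in>faces \<T>. e face_of F}" "F e (m e + 1) = F e 1"
  using labels assms unfolding edge_labelling_def Let_def by presburger+

lemma element_labels: "e \<in> edges \<T> \<Longrightarrow> bij_betw (K e) {1..m e} {K\<in>\<T>. e face_of K}"
  using labels unfolding edge_labelling_def Let_def by blast

lemma face_label:
  assumes e: "e \<in> edges \<T>" and f: "f \<in> faces \<T>" "e face_of f"
  obtains i where "i \<in> {1..m e + 1}" "F e i = f"
proof (cases "boundary_edge \<Omega> e")
  case True
  have "f \<in> F e ` {1..m e + 1}" using bij_betw_imp_surj_on[OF boundary_labels[OF e True]] f by simp
  then show ?thesis using that by blast
next
  case False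
  have "f \<in> F e ` {1..m e}" using bij_betw_imp_surj_on[OF interior_labels(1)[OF e False]] f by simp
  then obtain i where "i \<in> {1..m e}" "F e i = f" by blast
  then show ?thesis using that[of i] by simp
qed

lemma element_label:
  assumes T: "T \<in> \<T>" "e \<in> tedges T"
  obtains i where "i \<in> {1..m e}" "K e i = T"
proof -
  have "T \<in> {K\<in>\<T>. e face_of K}" using T by (simp add: tedges_def)
  then have "T \<in> K e ` {1..m e}" using bij_betw_imp_surj_on[OF element_labels[OF tedges_edges[OF T]]] by simp
  then show ?thesis using that by blast
qed

text \<open>A single element would bring two facets at the edge, but an interior edge has only as
  many labelled faces as elements.\<close>

lemma interior_patch_size:
  assumes e: "e \<in> edges \<T>" "\<not> boundary_edge \<Omega> e"
  shows "2 \<le> m e"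
proof (rule ccontr)
  assume "\<not> 2 \<le> m e"
  then have m1: "m e = 1" using patch_size_pos[OF e(1)] by simp
  note l = label_props[OF e(1), of 1, unfolded m1]
  have "{f \<in> facets (K e 1). e face_of f} \<subseteq> F e ` {1..m e}"
    using bij_betw_imp_surj_on[OF interior_labels(1)[OF e]] facets_faces l(1) by auto
  then have "card {f \<in> facets (K e 1). e face_of f} \<le> card (F e ` {1..1})" unfolding m1 by (intro card_mono) auto
  then show False using card_facets_at_edge[OF simplex_T] l(1,2) by simp
qed

text \<open>The delicate index is \<open>i = m e\<close> at an interior edge: there the next face is
  \<open>F e 1\<close>, which differs because such an edge has at least two elements.\<close>

lemma labels_distinct:
  assumes e: "e \<in> edges \<T>" and i: "i \<in> {1..m e}"
  shows "F e i \<noteq> F e (i + 1)"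
proof (cases "boundary_edge \<Omega> e")
  case True
  then show ?thesis using bij_betw_imp_inj_on[OF boundary_labels[OF e True]] i by (auto simp: inj_on_eq_iff)
next
  case False
  note b = bij_betw_imp_inj_on[OF interior_labels(1)[OF e False]] and c = interior_labels(2)[OF e False]
  show ?thesis
  proof (cases "i = m e")
    case True
    have "F e i \<noteq> F e 1" using inj_on_eq_iff[OF b, of i 1] i True interior_patch_size[OF e False] by simp
    then show ?thesis using c True by simp
  next
    case False
    then show ?thesis using inj_on_eq_iff[OF b, of i "i + 1"] i by simp
  qed
qed

lemma facets_at_label:
  assumes e: "e \<in> edges \<T>" and i: "i \<in> {1..m e}"
  shows "{f \<in> facets (K e i). e face_of f} = {F e i, F e (i + 1)}"
proof -
  note l = label_props[OF e i]
  have "finite {f \<in> facets (K e i). e face_of f}" using finite_facets[OF simplex_T[OF l(1)]] by simp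
  moreover have "{F e i, F e (i + 1)} \<subseteq> {f \<in> facets (K e i). e face_of f}" using l by simp
  moreover have "card {F e i, F e (i + 1)} = card {f \<in> facets (K e i). e face_of f}"
    using labels_distinct[OF e i] card_facets_at_edge[OF simplex_T[OF l(1)] l(2)] by simp
  ultimately show ?thesis by (rule card_subset_eq[symmetric])
qed

lemma conormal_facet:
  assumes T: "T \<in> \<T>" and e: "e \<in> tedges T" and f: "f \<in> facets T" "f' \<in> facets T" "e face_of f" "e face_of f'" "f \<noteq> f'"
  shows "norm (conormal e f) = 1" "conormal e f \<bullet> tng e = 0" "nrm f \<bullet> conormal e f = 0" "outn T f' \<bullet> conormal e f < 0"
    "norm (nrm f) = 1" "nrm f \<bullet> tng e = 0" "tng e \<noteq> 0" "outn T f = nrm f \<or> outn T f = - nrm f"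
proof -
  note S = simplex_T[OF T]
  obtain p1 p2 p3 p4 where t: "tet p1 p2 p3 p4" "T = convex hull {p1, p2, p3, p4}" "e = convex hull {p1, p2}"
      "{f \<in> facets T. e face_of f} = {convex hull {p1, p2, p3}, convex hull {p1, p2, p4}}"
      "convex hull {p1, p2, p3} \<noteq> convex hull {p1, p2, p4}"
    by (rule facets_at_edge[OF S e])
  have "f \<in> {f \<in> facets T. e face_of f}" "f' \<in> {f \<in> facets T. e face_of f}" using f by simp_all
  then have "f = convex hull {p1, p2, p3} \<and> f' = convex hull {p1, p2, p4} \<or> f = convex hull {p1, p2, p4} \<and> f' = convex hull {p1, p2, p3}"
    unfolding t(4) insert_iff empty_iff using f(5) by argo
  moreover have "tet p1 p2 p4 p3" "T = convex hull {p1, p2, p4, p3}" using tet_perms(3)[OF t(1)] t(2) by (simp_all add: insert_commute)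
  ultimately obtain r s where rs: "tet p1 p2 s r" "T = convex hull {p1, p2, s, r}" "f = convex hull {p1, p2, r}" "f' = convex hull {p1, p2, s}"
    using t(1,2) by (elim disjE conjE)
  note rt = tet_perms(3)[OF rs(1)]
  have "tangential e (tng e)" using tangents tedges_edges[OF T e] by blast
  then obtain c where c: "c \<noteq> 0" "tng e = c *\<^sub>R (p2 - p1)" unfolding t(3) by (rule tangential_hull)
  note cn = conormal_props[OF tet_cross_nz[OF rt], folded t(3) rs(3)]
  note n = normal_facet[OF T f(1)]
  have n1: "norm (nrm f) = 1" "nrm f \<bullet> (p2 - p1) = 0" "nrm f \<bullet> (r - p1) = 0" using n unfolding rs(3) unit_normal_hull by auto
  obtain k l where kl: "k > 0" "conormal e f = k *\<^sub>R (r - p1) + l *\<^sub>R (p2 - p1)" using cn(3) by blast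
  show "norm (conormal e f) = 1" "conormal e f \<bullet> tng e = 0" using cn(1,2) unfolding c(2) by simp_all
  show "nrm f \<bullet> conormal e f = 0" unfolding kl(2) using n1 by (simp add: inner_add_right)
  have o: "outn T f' = out_normal p1 p2 s r" unfolding rs(2,4) by (rule outn_tet[OF rs(1)])
  have "out_normal p1 p2 s r \<bullet> (r - p1) < 0" "out_normal p1 p2 s r \<bullet> (p2 - p1) = 0"
    using out_normal_props[OF rs(1)] unfolding unit_normal_hull by blast+
  then show "outn T f' \<bullet> conormal e f < 0" unfolding o kl(2) using kl(1) by (simp add: inner_add_right mult_pos_neg)
  show "norm (nrm f) = 1" "nrm f \<bullet> tng e = 0" using n1 unfolding c(2) by simp_all
  show "tng e \<noteq> 0" using c tet_distinct[OF t(1)] by auto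
  show "outn T f = nrm f \<or> outn T f = - nrm f" using facet_unit_normal_cases[OF S f(1) n] by auto
qed

text \<open>The conormals of \<open>f1\<close> and \<open>f2\<close> point to opposite sides of the
  common facet \<open>f\<close>, since the outward normals of \<open>T\<close> and \<open>T'\<close>
  there are opposite; so both steps rotate in the same sense about the edge.\<close>

lemma turn_same_sign:
  assumes T: "T \<in> \<T>" "T' \<in> \<T>" "T \<noteq> T'" and e: "e \<in> tedges T" "e \<in> tedges T'" and f: "f \<in> facets T" "f \<in> facets T'" "e face_of f"
    and f1: "f1 \<in> facets T" "e face_of f1" "f1 \<noteq> f" and f2: "f2 \<in> facets T'" "e face_of f2" "f2 \<noteq> f"
  shows "turn (tng e) (conormal e f1) (conormal e f) * turn (tng e) (conormal e f) (conormal e f2) > 0"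
proof -
  let ?t = "tng e" and ?\<nu> = "conormal e f" and ?\<nu>1 = "conormal e f1" and ?\<nu>2 = "conormal e f2"
  note c = conormal_facet[OF T(1) e(1) f(1) f1(1) f(3) f1(2) f1(3)[symmetric]]
  obtain \<epsilon> where n: "nrm f = \<epsilon> *\<^sub>R cross3 ?t ?\<nu>" using unit_perp_pair[OF c(5,6,3,1,2,7)] by blast
  have "\<exists>\<delta>. outn T f = \<delta> *\<^sub>R cross3 ?t ?\<nu>"
    using c(8) unfolding n by (metis scaleR_minus_left)
  then obtain \<delta> where \<delta>: "outn T f = \<delta> *\<^sub>R cross3 ?t ?\<nu>" by blast
  have o: "outn T' f = - outn T f" by (rule shared_outn[OF T f(1,2)])
  have 1: "outn T f \<bullet> ?\<nu>1 < 0" by (rule conormal_facet(4)[OF T(1) e(1) f1(1) f(1) f1(2) f(3) f1(3)])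
  have 2: "outn T' f \<bullet> ?\<nu>2 < 0" by (rule conormal_facet(4)[OF T(2) e(2) f2(1) f(2) f2(2) f(3) f2(3)])
  have t1: "turn ?t ?\<nu>1 ?\<nu> = cross3 ?t ?\<nu> \<bullet> ?\<nu>1" by (simp add: turn_def inner_commute)
  have t2: "turn ?t ?\<nu> ?\<nu>2 = - (cross3 ?t ?\<nu> \<bullet> ?\<nu>2)" using turn_swap[of ?t ?\<nu> ?\<nu>2] by (simp add: turn_def inner_commute)
  have a: "\<delta> * turn ?t ?\<nu>1 ?\<nu> < 0" using 1 unfolding \<delta> t1 by simp
  have b: "\<delta> * turn ?t ?\<nu> ?\<nu>2 < 0" using 2 unfolding o \<delta> t2 by simp
  show ?thesis using a b by (auto simp: mult_less_0_iff zero_less_mult_iff)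
qed

section \<open>Cotangents around an edge patch\<close>

definition \<kappa> :: "(real^3) set \<Rightarrow> nat \<Rightarrow> real" where
  "\<kappa> e i = kappa (tng e) (nrm (F e i)) (nrm (F e (i + 1)))"

text \<open>The cosine of the dihedral angle. Correspondingly \<sigma> below is its sine up to the
  length of the edge vector and a sign that is constant around the patch.\<close>

definition \<gamma> :: "(real^3) set \<Rightarrow> nat \<Rightarrow> real" where
  "\<gamma> e i = conormal e (F e i) \<bullet> conormal e (F e (i + 1))"

definition \<sigma> :: "(real^3) set \<Rightarrow> nat \<Rightarrow> real" where
  "\<sigma> e i = turn (tng e) (conormal e (F e i)) (conormal e (F e (i + 1)))"

lemma theta_arccos: "theta e (F e) i = arccos (\<gamma> e i)"
  by (simp add: theta_def dihedral_angle_def \<gamma>_def)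

lemma conormal_label:
  assumes e: "e \<in> edges \<T>" and i: "i \<in> {1..m e}"
  shows "\<kappa> e i = (tng e \<bullet> tng e) * (\<gamma> e i / \<sigma> e i)" "(\<sigma> e i)\<^sup>2 = (tng e \<bullet> tng e) * (1 - (\<gamma> e i)\<^sup>2)" "\<bar>\<gamma> e i\<bar> \<le> 1"
    "norm (conormal e (F e i)) = 1" "conormal e (F e i) \<bullet> tng e = 0" "tng e \<noteq> 0"
    "norm (conormal e (F e (i + 1))) = 1" "conormal e (F e (i + 1)) \<bullet> tng e = 0"
proof -
  note l = label_props[OF e i] and d = labels_distinct[OF e i]
  note c = conormal_facet[OF l(1,2,3,4,5,6) d] and c' = conormal_facet[OF l(1,2,4,3,6,5) d[symmetric]]
  show "\<kappa> e i = (tng e \<bullet> tng e) * (\<gamma> e i / \<sigma> e i)"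
    unfolding \<kappa>_def \<gamma>_def \<sigma>_def by (subst kappa_conormal[OF c(7,5,6,3,1,2) c'(5,6,3,1,2)]) simp
  show "(\<sigma> e i)\<^sup>2 = (tng e \<bullet> tng e) * (1 - (\<gamma> e i)\<^sup>2)" unfolding \<gamma>_def \<sigma>_def by (rule turn_square[OF c(1) c'(1) c(2) c'(2)])
  show "\<bar>\<gamma> e i\<bar> \<le> 1" unfolding \<gamma>_def by (rule abs_inner_unit[OF c(1) c'(1)])
  show "norm (conormal e (F e i)) = 1" "conormal e (F e i) \<bullet> tng e = 0" "tng e \<noteq> 0" by (rule c(1,2,7))+
  show "norm (conormal e (F e (i + 1))) = 1" "conormal e (F e (i + 1)) \<bullet> tng e = 0" by (rule c'(1,2))+
qed

lemma elements_distinct: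
  assumes e: "e \<in> edges \<T>" and ij: "i \<in> {1..m e}" "j \<in> {1..m e}" "i \<noteq> j"
  shows "K e i \<noteq> K e j"
  using inj_on_eq_iff[OF bij_betw_imp_inj_on[OF element_labels[OF e]]] ij by simp

lemma sigma_step:
  assumes e: "e \<in> edges \<T>" and i: "i \<in> {1..m e}" "i + 1 \<in> {1..m e}"
  shows "\<sigma> e i * \<sigma> e (i + 1) > 0"
proof -
  note l = label_props[OF e i(1)] and l' = label_props[OF e i(2)]
  have n: "K e i \<noteq> K e (i + 1)" using elements_distinct[OF e i] by simp
  show ?thesis unfolding \<sigma>_def
    by (rule turn_same_sign[OF l(1) l'(1) n l(2) l'(2) l(4) l'(3) l(6) l(3,5) labels_distinct[OF e i(1)] l'(4,6) labels_distinct[OF e i(2), symmetric]])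
qed

lemma sigma_cycle:
  assumes e: "e \<in> edges \<T>" "\<not> boundary_edge \<Omega> e"
  shows "\<sigma> e (m e) * \<sigma> e 1 > 0"
proof -
  have i: "m e \<in> {1..m e}" "1 \<in> {1..m e}" "m e \<noteq> 1" using interior_patch_size[OF e] by auto
  note c = interior_labels(2)[OF e]
  note l = label_props[OF e(1) i(1), unfolded c] and l' = label_props[OF e(1) i(2)]
  show ?thesis unfolding \<sigma>_def c
    by (rule turn_same_sign[OF l(1) l'(1) elements_distinct[OF e(1) i] l(2) l'(2) l(4) l'(3) l(6) l(3,5)
          labels_distinct[OF e(1) i(1), unfolded c] l'(4,6) labels_distinct[OF e(1) i(2), symmetric]])
qed

text \<open>The sum vanishes only if the first and the last dihedral angle add up to \<pi>, which
  the choice of the labelling excludes.\<close>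

lemma kappa_even:
  assumes e: "e \<in> edges \<T>" "\<not> boundary_edge \<Omega> e" "even (m e)" "\<not> singular_edge \<Omega> \<T> e (F e)"
  shows "\<kappa> e 1 + \<kappa> e (m e) \<noteq> 0"
proof
  assume z: "\<kappa> e 1 + \<kappa> e (m e) = 0"
  have i: "m e \<in> {1..m e}" "1 \<in> {1..m e}" using interior_patch_size[OF e(1,2)] by auto
  note c = conormal_label[OF e(1) i(1)] and c' = conormal_label[OF e(1) i(2)]
  have t: "tng e \<bullet> tng e > 0" using c(6) by simp
  have "(tng e \<bullet> tng e) * (\<gamma> e (m e) / \<sigma> e (m e) + \<gamma> e 1 / \<sigma> e 1) = 0" using z unfolding c(1) c'(1) distrib_left by linarith
  then have s: "\<gamma> e (m e) / \<sigma> e (m e) + \<gamma> e 1 / \<sigma> e 1 = 0" using t by simp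
  have "\<gamma> e 1 = - \<gamma> e (m e)" by (rule cot_sum_zero[OF c(2) c'(2) sigma_cycle[OF e(1,2)] s t])
  then have "theta e (F e) 1 + theta e (F e) (m e) = pi"
    unfolding theta_arccos using c(3) by (simp add: arccos_minus abs_le_iff)
  then show False using even_labels e by blast
qed

text \<open>Two overlapping pairs of supplementary angles make faces 1 and 3, and faces 2 and 4,
  continue each other, so the edge is the crossing of two planes. The fourth angle is then
  supplementary too, and the cotangents alternate.\<close>

lemma kappa_singular:
  assumes e: "e \<in> edges \<T>" "singular_edge \<Omega> \<T> e (F e)"
  shows "\<kappa> e 2 = - \<kappa> e 1" "\<kappa> e 3 = \<kappa> e 1" "\<kappa> e 4 = - \<kappa> e 1"
proof -
  have s: "\<not> boundary_edge \<Omega> e" "m e = 4" "theta e (F e) 1 + theta e (F e) 2 = pi" "theta e (F e) 2 + theta e (F e) 3 = pi"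
    using e(2) unfolding singular_edge_def by auto
  have i: "1 \<in> {1..m e}" "2 \<in> {1..m e}" "3 \<in> {1..m e}" "4 \<in> {1..m e}" unfolding s(2) by auto
  note c1 = conormal_label[OF e(1) i(1)] and c2 = conormal_label[OF e(1) i(2)] and c3 = conormal_label[OF e(1) i(3)] and c4 = conormal_label[OF e(1) i(4)]
  have g2: "\<gamma> e 2 = - \<gamma> e 1" by (rule arccos_supplement[OF c1(3) c2(3)]) (use s(3) in \<open>simp add: theta_arccos\<close>)
  have g3: "\<gamma> e 3 = - \<gamma> e 2" by (rule arccos_supplement[OF c2(3) c3(3)]) (use s(4) in \<open>simp add: theta_arccos\<close>)
  have n: "1 + 1 = (2::nat)" "2 + 1 = (3::nat)" "3 + 1 = (4::nat)" by simp_all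
  note st = sigma_step[OF e(1) i(1), unfolded n, OF i(2)] sigma_step[OF e(1) i(2), unfolded n, OF i(3)] sigma_step[OF e(1) i(3), unfolded n, OF i(4)]
  have s2: "\<sigma> e 2 = \<sigma> e 1" by (rule turn_eq[OF c1(2) c2(2) _ st(1)]) (simp add: g2)
  have s3: "\<sigma> e 3 = \<sigma> e 2" by (rule turn_eq[OF c2(2) c3(2) _ st(2)]) (simp add: g3)
  \<comment> \<open>Two rotations in the same sense by supplementary angles add up to a half
    turn.\<close>
  have o3: "conormal e (F e 3) = - conormal e (F e 1)"
    by (rule opposite_conormal[OF c1(6) c1(4) c2(4) c3(4) c1(5) c2(5) c3(5)]) (use g2 s2 in \<open>simp_all add: \<gamma>_def \<sigma>_def eval_nat_numeral\<close>)
  have o4: "conormal e (F e 4) = - conormal e (F e 2)"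
    by (rule opposite_conormal[OF c1(6) c2(4) c3(4) c4(4) c2(5) c3(5) c4(5)]) (use g3 s3 in \<open>simp_all add: \<gamma>_def \<sigma>_def eval_nat_numeral\<close>)
  have F5: "F e (4 + 1) = F e 1" using interior_labels(2)[OF e(1) s(1)] unfolding s(2) .
  have g4: "\<gamma> e 4 = - \<gamma> e 1" unfolding \<gamma>_def F5 o4 n by (simp add: inner_commute)
  have s4: "\<sigma> e 4 = \<sigma> e 3" by (rule turn_eq[OF c3(2) c4(2) _ st(3)]) (simp add: g4 g3 g2)
  show "\<kappa> e 2 = - \<kappa> e 1" "\<kappa> e 3 = \<kappa> e 1" "\<kappa> e 4 = - \<kappa> e 1"
    unfolding c1(1) c2(1) c3(1) c4(1) s4 s3 s2 g4 g3 g2 by simp_all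
qed

end

section \<open>Global unisolvence\<close>

lemma common_value_eq: "T \<in> \<K> \<Longrightarrow> (\<And>T'. T' \<in> \<K> \<Longrightarrow> g T' = g T) \<Longrightarrow> common_value \<K> g = g T"
  unfolding common_value_def by (rule the_equality) (blast, metis)

context mesh begin

lemma elem_value_glue:
  assumes T: "T \<in> \<T>" and c: "continuous_on UNIV (P T)" and x: "x \<in> T"
  shows "elem_value (glue \<T> P) T x = P T x"
proof -
  have "x \<in> closure (interior T)" using closure_interior_T[OF T] x by simp
  then have "x islimpt interior T"
    using interior_limit_point[of x "interior T"] by (auto simp: closure_def)
  then have nt: "\<not> trivial_limit (at x within interior T)" by (simp add: trivial_limit_within)
  have "(P T \<longlongrightarrow> P T x) (at x)" using c by (simp add: continuous_on_eq_continuous_at isCont_def)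
  then have "(P T \<longlongrightarrow> P T x) (at x within interior T)" by (rule tendsto_within_subset) simp
  moreover have "\<forall>\<^sub>F y in at x within interior T. P T y = glue \<T> P y"
    unfolding eventually_at_filter by (rule always_eventually) (simp add: glue_interior[OF T])
  ultimately have "(glue \<T> P \<longlongrightarrow> P T x) (at x within interior T)" by (rule Lim_transform_eventually)
  then show ?thesis unfolding elem_value_def by (rule tendsto_Lim[OF nt])
qed

text \<open>By conformity \<open>{x}\<close> is a face of the intersection of \<open>T\<close> with
  an element that has \<open>x\<close> as a vertex, hence a face of \<open>T\<close>.\<close>

lemma vertex_extreme:
  assumes x: "x \<in> vertices \<T>" and T: "T \<in> \<T>" "x \<in> T"
  shows "x extreme_point_of T"
proof -
  obtain K where K: "K \<in> \<T>" "x extreme_point_of K" using x by (auto simp: vertices_def)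
  have sx: "{x} face_of K" using K(2) by (simp add: face_of_singleton)
  have xK: "x \<in> K" using K(2) by (simp add: extreme_point_of_def)
  have "{x} face_of (K \<inter> T)" by (rule face_of_subset[OF sx]) (use xK T in auto)
  moreover have "(K \<inter> T) face_of T" using face_Int[OF T(1) K(1)] by (simp add: Int_commute)
  ultimately have "{x} face_of T" by (rule face_of_trans)
  then show ?thesis by (simp add: face_of_singleton)
qed

lemma lint_glue_element:
  fixes \<xi> :: "real^3 \<Rightarrow> real^3^3"
  assumes T: "T \<in> \<T>" and c: "continuous_on T (P T)" "continuous_on T \<xi>"
  shows "(LINT x:T|lebesgue. glue \<T> P x \<bullet> \<xi> x) = (LINT x:T|lebesgue. P T x \<bullet> \<xi> x)"
proof -
  have "glue \<T> P x = 0" if "x \<in> T" "x \<notin> interior T" for x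
  proof (rule glue_outside)
    fix K assume K: "K \<in> \<T>"
    show "x \<notin> interior K"
    proof (cases "K = T")
      case False
      then have "interior K \<inter> interior T = {}" by (rule interior_T_disjoint[OF K T])
      then have "interior K \<inter> closure (interior T) = {}" using open_Int_closure_eq_empty[OF open_interior] by blast
      then show ?thesis using closure_interior_T[OF T] that(1) by blast
    qed (use that in simp)
  qed
  then have "indicator T x *\<^sub>R (glue \<T> P x \<bullet> \<xi> x) = indicator (interior T) x *\<^sub>R (P T x \<bullet> \<xi> x)" for x
    using glue_interior[OF T, of x P] interior_subset[of T] by (cases "x \<in> interior T"; cases "x \<in> T") (auto simp: indicator_def)
  then have "(LINT x:T|lebesgue. glue \<T> P x \<bullet> \<xi> x) = (LINT x:interior T|lebesgue. P T x \<bullet> \<xi> x)"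
    unfolding set_lebesgue_integral_def by presburger
  also have "\<dots> = (LINT x:T|lebesgue. P T x \<bullet> \<xi> x)"
    by (rule lint_interior(2)[OF compact_T[OF T] convex_T[OF T]]) (intro continuous_on_inner c)
  finally show ?thesis .
qed

section \<open>The finite element space through its polynomial pieces\<close>

text \<open>One polynomial per element. Symmetry is asked at every point of space, so that it may be
  used on facets and edges as well.\<close>

definition admissible :: "((real^3) set \<Rightarrow> real^3 \<Rightarrow> real^3^3) \<Rightarrow> bool" where
  "admissible P \<longleftrightarrow> (\<forall>T\<in>\<T>. P T \<in> polys 3) \<and> (\<forall>T\<in>\<T>. \<forall>x. P T x \<in> sym_mats) \<and> normal_continuous P \<and>
     (\<forall>x\<in>vertices \<T>. \<forall>T\<in>\<T>. \<forall>T'\<in>\<T>. x \<in> T \<and> x \<in> T' \<longrightarrow> P T x = P T' x)"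

lemma admissibleD:
  assumes "admissible P"
  shows "T \<in> \<T> \<Longrightarrow> P T \<in> polys 3" "T \<in> \<T> \<Longrightarrow> P T x \<in> sym_mats" "normal_continuous P"
    "x \<in> vertices \<T> \<Longrightarrow> T \<in> \<T> \<Longrightarrow> T' \<in> \<T> \<Longrightarrow> x \<in> T \<Longrightarrow> x \<in> T' \<Longrightarrow> P T x = P T' x"
  using assms unfolding admissible_def by blast+

lemma admissible_elem_value: "admissible P \<Longrightarrow> T \<in> \<T> \<Longrightarrow> x \<in> T \<Longrightarrow> elem_value (glue \<T> P) T x = P T x"
  by (rule elem_value_glue[OF _ polys_continuous[OF admissibleD(1)]])

lemma Sigma_h_glue:
  assumes P: "admissible P"
  shows "glue \<T> P \<in> Sigma_h \<Omega> \<T>"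
proof -
  have "\<forall>K\<in>\<T>. C1_map (P K)" using polys_C1[OF admissibleD(1)[OF P]] by blast
  then have "glue \<T> P \<in> Hdiv_sym \<Omega>"
    using normal_continuous_Hdiv[of P] admissibleD(2,3)[OF P] by blast
  moreover have "restr (interior K) (glue \<T> P) \<in> polys_on 3 (interior K) sym_mats" if K: "K \<in> \<T>" for K
  proof -
    have "restr (interior K) (glue \<T> P) = restr (interior K) (P K)" by (rule ext) (simp add: restr_def glue_interior[OF K] split: if_split)
    then show ?thesis unfolding polys_on_def mem_Collect_eq by (intro exI[of _ "P K"] conjI ballI admissibleD(1,2)[OF P K])
  qed
  moreover have "glue \<T> P x = 0" if "x \<notin> (\<Union>K\<in>\<T>. interior K)" for x using that by (intro glue_outside) blast
  moreover have "elem_value (glue \<T> P) K x = elem_value (glue \<T> P) K' x"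
    if "x \<in> vertices \<T>" "K \<in> \<T>" "K' \<in> \<T>" "x \<in> K" "x \<in> K'" for x K K'
    unfolding admissible_elem_value[OF P that(2,4)] admissible_elem_value[OF P that(3,5)] by (rule admissibleD(4)[OF P that])
  ultimately show ?thesis unfolding Sigma_h_def by blast
qed

lemma Sigma_hE:
  assumes \<tau>: "\<tau> \<in> Sigma_h \<Omega> \<T>"
  obtains P where "admissible P" "\<tau> = glue \<T> P"
proof -
  have r: "\<forall>T\<in>\<T>. restr (interior T) \<tau> \<in> polys_on 3 (interior T) sym_mats" and H: "\<tau> \<in> Hdiv_sym \<Omega>"
    and o: "\<forall>x. x \<notin> (\<Union>K\<in>\<T>. interior K) \<longrightarrow> \<tau> x = 0"
    and v: "\<forall>x\<in>vertices \<T>. \<forall>K\<in>\<T>. \<forall>K'\<in>\<T>. x \<in> K \<and> x \<in> K' \<longrightarrow> elem_value \<tau> K x = elem_value \<tau> K' x"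
    using \<tau> unfolding Sigma_h_def by blast+
  have "\<exists>p. p \<in> polys 3 \<and> (\<forall>x. p x \<in> sym_mats) \<and> (\<forall>x\<in>interior T. p x = \<tau> x)" if "T \<in> \<T>" for T
  proof -
    have "restr (interior T) \<tau> \<in> polys_on 3 (interior T) sym_mats" using r that by (rule bspec)
    then obtain p where p': "restr (interior T) \<tau> = restr (interior T) p \<and> p \<in> polys 3 \<and> (\<forall>x\<in>interior T. p x \<in> sym_mats)"
      unfolding polys_on_def mem_Collect_eq by (rule exE)
    note p = p'[THEN conjunct1] p'[THEN conjunct2, THEN conjunct1] p'[THEN conjunct2, THEN conjunct2]
    \<comment> \<open>\<open>p\<close> is known to be symmetric only on the interior of
      \<open>T\<close>; its symmetric part is so everywhere and agrees with \<open>p\<close>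
      there.\<close>
    define p' where "p' x = (1 / 2) *\<^sub>R (p x + transpose (p x))" for x
    have lin: "linear (transpose :: real^3^3 \<Rightarrow> _)" by (rule linearI) (simp_all add: transpose_def vec_eq_iff)
    have "p' \<in> polys 3" unfolding p'_def[abs_def] by (rule polys_scaleR[OF polys_add[OF p(2) polys_linear[OF p(2) lin]]])
    moreover have "p' x \<in> sym_mats" for x by (simp add: p'_def sym_mats_def transpose_def vec_eq_iff)
    moreover have "p' x = \<tau> x" if x: "x \<in> interior T" for x
    proof -
      have "transpose (p x) = p x" using p(3) x by (simp add: sym_mats_def)
      then have "p' x = p x" unfolding p'_def by (simp add: scaleR_2[symmetric])
      then show ?thesis using fun_cong[OF p(1), of x] x by (simp add: restr_def)
    qed
    ultimately show ?thesis by (intro exI[of _ p'] conjI allI ballI)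
  qed
  then have "\<forall>T\<in>\<T>. \<exists>p. p \<in> polys 3 \<and> (\<forall>x. p x \<in> sym_mats) \<and> (\<forall>x\<in>interior T. p x = \<tau> x)" by (intro ballI)
  from bchoice[OF this] obtain P where P: "\<forall>T\<in>\<T>. P T \<in> polys 3 \<and> (\<forall>x. P T x \<in> sym_mats) \<and> (\<forall>x\<in>interior T. P T x = \<tau> x)" by (rule exE)
  have g: "\<tau> = glue \<T> P"
  proof
    fix x
    show "\<tau> x = glue \<T> P x"
    proof (cases "\<exists>T\<in>\<T>. x \<in> interior T")
      case True
      then obtain T where "T \<in> \<T>" "x \<in> interior T" by blast
      then show ?thesis using glue_interior[of T x P] P by simp
    next
      case False
      then show ?thesis using o glue_outside[of x P] by simp
    qed
  qed
  have "\<forall>K\<in>\<T>. C1_map (P K)" using P polys_C1 by blast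
  then have nc: "normal_continuous P" using Hdiv_normal_continuous[of P] H unfolding g by blast
  have "P T x = P T' x" if "x \<in> vertices \<T>" "T \<in> \<T>" "T' \<in> \<T>" "x \<in> T" "x \<in> T'" for x T T'
  proof -
    have e: "elem_value (glue \<T> P) T x = P T x" if "T \<in> \<T>" "x \<in> T" for T
      using elem_value_glue[OF that(1) polys_continuous that(2)] P that(1) by blast
    show ?thesis using v that unfolding g e[OF that(2,4), symmetric] e[OF that(3,5), symmetric] by blast
  qed
  then have "admissible P" unfolding admissible_def using P nc by blast
  then show ?thesis using that g by blast
qed

lemma admissible_add:
  assumes P: "admissible P" and Q: "admissible Q"
  shows "admissible (\<lambda>T x. P T x + Q T x)"
  unfolding admissible_def
proof (intro conjI ballI allI impI)
  show "(\<lambda>x. P T x + Q T x) \<in> polys 3" if "T \<in> \<T>" for T by (rule polys_add[OF admissibleD(1)[OF P that] admissibleD(1)[OF Q that]])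
  show "P T x + Q T x \<in> sym_mats" if "T \<in> \<T>" for T x by (rule sym_mats_add[OF admissibleD(2)[OF P that] admissibleD(2)[OF Q that]])
  show "normal_continuous (\<lambda>T x. P T x + Q T x)"
    using admissibleD(3)[OF P] admissibleD(3)[OF Q] unfolding normal_continuous_def matrix_vector_mult_add_rdistrib by presburger
  fix x T T' assume "x \<in> vertices \<T>" "T \<in> \<T>" "T' \<in> \<T>" "x \<in> T \<and> x \<in> T'"
  then show "P T x + Q T x = P T' x + Q T' x" using admissibleD(4)[OF P, of x T T'] admissibleD(4)[OF Q, of x T T'] by simp
qed

lemma admissible_scale:
  assumes P: "admissible P"
  shows "admissible (\<lambda>T x. c *\<^sub>R P T x)"
  unfolding admissible_def
proof (intro conjI ballI allI impI)
  show "(\<lambda>x. c *\<^sub>R P T x) \<in> polys 3" if "T \<in> \<T>" for T by (rule polys_scaleR[OF admissibleD(1)[OF P that]])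
  show "c *\<^sub>R P T x \<in> sym_mats" if "T \<in> \<T>" for T x by (rule sym_mats_scaleR[OF admissibleD(2)[OF P that]])
  show "normal_continuous (\<lambda>T x. c *\<^sub>R P T x)"
    using admissibleD(3)[OF P] unfolding normal_continuous_def scaleR_matrix_vector_assoc[symmetric] by presburger
  fix x T T' assume "x \<in> vertices \<T>" "T \<in> \<T>" "T' \<in> \<T>" "x \<in> T \<and> x \<in> T'"
  then show "c *\<^sub>R P T x = c *\<^sub>R P T' x" using admissibleD(4)[OF P, of x T T'] by simp
qed

lemma glue_add: "glue \<T> P + glue \<T> Q = glue \<T> (\<lambda>T x. P T x + Q T x)"
  by (rule ext) (simp add: glue_def scaleR_add_right sum.distrib)

lemma glue_scale: "scale_fun c (glue \<T> P) = glue \<T> (\<lambda>T x. c *\<^sub>R P T x)"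
  by (rule ext) (simp add: glue_def scale_fun_def scaleR_sum_right mult.commute)

lemma Sigma_h_subspace: "fn.subspace (Sigma_h \<Omega> \<T>)"
proof (rule fn.subspaceI)
  have "admissible (\<lambda>T x. 0)"
    unfolding admissible_def normal_continuous_def by (simp add: sym_mats_zero)
  moreover have "glue \<T> (\<lambda>T x. 0) = 0" by (rule ext) (simp add: glue_def)
  ultimately show "0 \<in> Sigma_h \<Omega> \<T>" using Sigma_h_glue by metis
next
  fix u v assume "u \<in> Sigma_h \<Omega> \<T>" "v \<in> Sigma_h \<Omega> \<T>"
  then obtain P Q where PQ: "admissible P" "u = glue \<T> P" "admissible Q" "v = glue \<T> Q" by (elim Sigma_hE)
  show "u + v \<in> Sigma_h \<Omega> \<T>" unfolding PQ(2,4) glue_add by (rule Sigma_h_glue[OF admissible_add[OF PQ(1,3)]])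
next
  fix c u assume "u \<in> Sigma_h \<Omega> \<T>"
  then obtain P where P: "admissible P" "u = glue \<T> P" by (rule Sigma_hE)
  show "scale_fun c u \<in> Sigma_h \<Omega> \<T>" unfolding P(2) glue_scale by (rule Sigma_h_glue[OF admissible_scale[OF P(1)]])
qed

end

section \<open>Global degrees of freedom as local moments\<close>

context elasticity_mesh begin

abbreviation D :: "dof set" where "D \<equiv> dofs \<Omega> \<T> F B0 BN BK BE"

abbreviation val :: "(real^3 \<Rightarrow> real^3^3) \<Rightarrow> dof \<Rightarrow> real" where "val \<equiv> dof_value \<T> F nrm tng"

lemma normal_common:
  assumes P: "normal_continuous P" and T: "T \<in> \<T>" "T' \<in> \<T>" and f: "f \<in> facets T" "f \<in> facets T'" and x: "x \<in> f"
  shows "P T x *v nrm f = P T' x *v nrm f"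
proof -
  have e: "P T x *v outn T f = P T' x *v outn T f" using P T f x unfolding normal_continuous_def by blast
  have "nrm f = outn T f \<or> nrm f = - outn T f" by (rule facet_unit_normal_cases[OF simplex_T[OF T(1)] f(1) normal_facet[OF T(1) f(1)]])
  then show ?thesis
    using e linear_neg[OF matrix_vector_mul_linear, of "P T x" "outn T f"] linear_neg[OF matrix_vector_mul_linear, of "P T' x" "outn T f"] by auto
qed

text \<open>Neighbours share only the product of the matrix with the normal, so \<open>L\<close> has
  to factor through it. Asking this on symmetric matrices alone admits the component
  \<open>n \<bullet> (A *v t)\<close>, which equals \<open>t \<bullet> (A *v n)\<close>.\<close>

lemma face_value_glue:
  assumes P: "admissible P" and T: "T \<in> \<T>" "f \<in> facets T" and x: "x \<in> f"
    and L: "\<And>A B. A \<in> sym_mats \<Longrightarrow> B \<in> sym_mats \<Longrightarrow> A *v nrm f = B *v nrm f \<Longrightarrow> L A = L B"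
  shows "face_value \<T> (glue \<T> P) f L x = L (P T x)"
proof -
  have ev: "elem_value (glue \<T> P) T' x = P T' x" if "T' \<in> \<T>" "f \<in> facets T'" for T'
    using admissible_elem_value[OF P that(1)] facet_props(4)[OF that(2) simplex_T[OF that(1)]] x by blast
  have d: "aff_dim f = 2" using T(2) by (simp add: facets_def)
  have "face_value \<T> (glue \<T> P) f L x = L (elem_value (glue \<T> P) T x)"
    unfolding face_value_def
  proof (rule common_value_eq)
    show "T \<in> {K \<in> \<T>. f face_of K}" using T by (simp add: facets_def)
    fix T' assume "T' \<in> {K \<in> \<T>. f face_of K}"
    then have T': "T' \<in> \<T>" "f \<in> facets T'" using d by (auto simp: facets_def)
    show "L (elem_value (glue \<T> P) T' x) = L (elem_value (glue \<T> P) T x)"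
      unfolding ev[OF T'] ev[OF T]
      by (rule L[OF admissibleD(2)[OF P T'(1)] admissibleD(2)[OF P T(1)] normal_common[OF admissibleD(3)[OF P] T'(1) T(1) T'(2) T(2) x]])
  qed
  then show ?thesis unfolding ev[OF T] .
qed

lemma val_vertex:
  assumes P: "admissible P" and T: "T \<in> \<T>" "x extreme_point_of T"
  shows "val (glue \<T> P) (Vertex_dof x i j) = loc T (P T) (Vertex_loc x i j)"
proof -
  have x: "x \<in> vertices \<T>" "x \<in> T" using T by (auto simp: vertices_def extreme_point_of_def)
  have "vertex_value \<T> (glue \<T> P) x = elem_value (glue \<T> P) T x"
    unfolding vertex_value_def
  proof (rule common_value_eq)
    show "T \<in> {K \<in> \<T>. x \<in> K}" using T x by simp
    fix T' assume "T' \<in> {K \<in> \<T>. x \<in> K}"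
    then have T': "T' \<in> \<T>" "x \<in> T'" by simp_all
    show "elem_value (glue \<T> P) T' x = elem_value (glue \<T> P) T x"
      unfolding admissible_elem_value[OF P T'] admissible_elem_value[OF P T(1) x(2)]
      by (rule admissibleD(4)[OF P x(1) T'(1) T(1) T'(2) x(2)])
  qed
  then show ?thesis using admissible_elem_value[OF P T(1) x(2)] by simp
qed

lemma val_face:
  assumes P: "admissible P" and T: "T \<in> \<T>" "f \<in> facets T"
  shows "val (glue \<T> P) (Face_nn_dof f q) = loc T (P T) (Face_nn_loc f q)"
    "val (glue \<T> P) (Face_tangential_dof f v) = loc T (P T) (Face_tangential_loc f v)"
proof -
  note d = facet_props(3)[OF T(2) simplex_T[OF T(1)]]
  show "val (glue \<T> P) (Face_nn_dof f q) = loc T (P T) (Face_nn_loc f q)"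
    unfolding dof_value.simps loc.simps
    by (rule face_integral_cong[OF d], subst face_value_glue[OF P T]) auto
  show "val (glue \<T> P) (Face_tangential_dof f v) = loc T (P T) (Face_tangential_loc f v)"
    unfolding dof_value.simps loc.simps
    by (rule face_integral_cong[OF d], subst face_value_glue[OF P T]) auto
qed

lemma val_element:
  assumes P: "admissible P" and T: "T \<in> \<T>" and \<xi>: "\<xi> \<in> BK T"
  shows "val (glue \<T> P) (Element_dof T \<xi>) = loc T (P T) (Element_loc \<xi>)"
  unfolding dof_value.simps loc.simps
  by (rule lint_glue_element[of T P \<xi>, OF T polys_continuous[OF admissibleD(1)[OF P T]] basis_continuous(3)[OF T \<xi>]])

lemma val_edge:
  assumes P: "admissible P" and T: "T \<in> \<T>" "e \<in> tedges T" and f: "F e i \<in> facets T" "e face_of F e i"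
  shows "val (glue \<T> P) (Edge_nn_dof e i q) = loc T (P T) (Edge_nn_loc e (F e i) q)"
    "i = 1 \<Longrightarrow> val (glue \<T> P) (Edge_nt_dof e q) = loc T (P T) (Edge_nt_loc e (F e i) q)"
proof -
  note d = tedge_props(3)[OF T(2) simplex_T[OF T(1)]] and sub = subsetD[OF face_of_imp_subset[OF f(2)]]
  show "val (glue \<T> P) (Edge_nn_dof e i q) = loc T (P T) (Edge_nn_loc e (F e i) q)"
    unfolding dof_value.simps loc.simps Let_def
    by (rule edge_integral_cong[OF d], subst face_value_glue[OF P T(1) f(1) sub]) auto
  assume i: "i = 1"
  show "val (glue \<T> P) (Edge_nt_dof e q) = loc T (P T) (Edge_nt_loc e (F e i) q)"
    unfolding dof_value.simps loc.simps Let_def i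
    by (rule edge_integral_cong[OF d], subst face_value_glue[OF P T(1) f(1)[unfolded i] sub[unfolded i]]) (auto simp: sym_mats_inner[of _ "nrm _"])
qed

text \<open>An element that has the \<open>i\<close>-th face as a facet. The index
  \<open>m e + 1\<close> has no element of its own; its face is the second facet of
  \<open>K e (m e)\<close>.\<close>

definition elt :: "(real^3) set \<Rightarrow> nat \<Rightarrow> (real^3) set" where
  "elt e i = K e (if i \<le> m e then i else m e)"

lemma elt_props:
  assumes e: "e \<in> edges \<T>" and i: "i \<in> {1..m e + 1}"
  shows "elt e i \<in> \<T>" "e \<in> tedges (elt e i)" "F e i \<in> facets (elt e i)" "e face_of F e i"
proof -
  have m1: "m e \<in> {1..m e}" using patch_size_pos[OF e] by simp
  have "elt e i \<in> \<T> \<and> e \<in> tedges (elt e i) \<and> F e i \<in> facets (elt e i) \<and> e face_of F e i"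
  proof (cases "i \<le> m e")
    case True
    then show ?thesis using label_props[OF e, of i] i by (simp add: elt_def)
  next
    case False
    then have "i = m e + 1" using i by simp
    then show ?thesis using label_props[OF e m1] by (simp add: elt_def)
  qed
  then show "elt e i \<in> \<T>" "e \<in> tedges (elt e i)" "F e i \<in> facets (elt e i)" "e face_of F e i" by blast+
qed

lemma edge_nn_dof_iff: "Edge_nn_dof e i q \<in> D \<longleftrightarrow> e \<in> edges \<T> \<and> q \<in> BE e \<and>
    (boundary_edge \<Omega> e \<and> i \<in> {1..m e + 1} \<or> \<not> boundary_edge \<Omega> e \<and> odd (m e) \<and> i \<in> {1..m e} \<or>
     \<not> boundary_edge \<Omega> e \<and> even (m e) \<and> \<not> singular_edge \<Omega> \<T> e (F e) \<and> i \<in> {2..m e} \<or> singular_edge \<Omega> \<T> e (F e) \<and> i \<in> {1..4})"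
  unfolding dofs_def by auto

lemma edge_nt_dof_iff: "Edge_nt_dof e q \<in> D \<longleftrightarrow> e \<in> edges \<T> \<and> q \<in> BE e \<and>
    (boundary_edge \<Omega> e \<or> \<not> boundary_edge \<Omega> e \<and> even (m e) \<and> \<not> singular_edge \<Omega> \<T> e (F e) \<or> singular_edge \<Omega> \<T> e (F e))"
  unfolding dofs_def by auto

lemma singularD: "singular_edge \<Omega> \<T> e (F e) \<Longrightarrow> \<not> boundary_edge \<Omega> e \<and> m e = 4"
  by (simp add: singular_edge_def)

lemma edge_dof_index: "Edge_nn_dof e i q \<in> D \<Longrightarrow> i \<in> {1..m e + 1}"
  unfolding edge_nn_dof_iff using singularD[of e] by auto

lemma faces_facets: "f \<in> faces \<T> \<Longrightarrow> \<exists>T\<in>\<T>. f \<in> facets T"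
  by (auto simp: faces_def facets_def)

text \<open>Every degree of freedom is a moment of a single polynomial piece. This gives its
  linearity on \<open>Sigma_h\<close>, although \<open>val\<close> is defined through limits and
  common values.\<close>

lemma dof_local:
  assumes d: "d \<in> D"
  shows "\<exists>T\<in>\<T>. \<exists>d'. is_loc T d' \<and> (\<forall>P. admissible P \<longrightarrow> val (glue \<T> P) d = loc T (P T) d')"
proof (cases d)
  case (Vertex_dof x i j)
  then have x: "x \<in> vertices \<T>" "i \<le> j" using d unfolding dofs_def by auto
  then obtain T where "T \<in> \<T>" "x extreme_point_of T" by (auto simp: vertices_def)
  then show ?thesis using val_vertex x unfolding Vertex_dof by (meson is_loc.simps(1))
next
  case (Face_nn_dof f q)
  then have f: "f \<in> faces \<T>" "q \<in> B0 f" using d unfolding dofs_def by auto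
  then obtain T where "T \<in> \<T>" "f \<in> facets T" using faces_facets by blast
  then show ?thesis using val_face(1) f unfolding Face_nn_dof by (meson is_loc.simps(2))
next
  case (Face_tangential_dof f v)
  then have f: "f \<in> faces \<T>" "v \<in> BN f" using d unfolding dofs_def by auto
  then obtain T where "T \<in> \<T>" "f \<in> facets T" using faces_facets by blast
  then show ?thesis using val_face(2) f unfolding Face_tangential_dof by (meson is_loc.simps(3))
next
  case (Element_dof T \<xi>)
  then have "T \<in> \<T>" "\<xi> \<in> BK T" using d unfolding dofs_def by auto
  then show ?thesis using val_element unfolding Element_dof by (meson is_loc.simps(4))
next
  case (Edge_nt_dof e q)
  then have e: "e \<in> edges \<T>" "q \<in> BE e" using d unfolding Edge_nt_dof edge_nt_dof_iff by auto
  note E = elt_props[OF e(1), of 1, simplified]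
  have "is_loc (elt e 1) (Edge_nt_loc e (F e 1) q)" using E e by simp
  then show ?thesis using val_edge(2)[OF _ E(1,2,3,4)[unfolded One_nat_def[symmetric]]] E(1) unfolding Edge_nt_dof by (metis One_nat_def)
next
  case (Edge_nn_dof e i q)
  then have e: "e \<in> edges \<T>" "q \<in> BE e" "i \<in> {1..m e + 1}" using d edge_dof_index unfolding Edge_nn_dof edge_nn_dof_iff by auto
  note E = elt_props[OF e(1,3)]
  have "is_loc (elt e i) (Edge_nn_loc e (F e i) q)" using E e by simp
  then show ?thesis using val_edge(1)[OF _ E] E(1) unfolding Edge_nn_dof by blast
qed

lemma finite_dofs: "finite D"
proof -
  have fT: "finite {f. f face_of T}" if "T \<in> \<T>" for T
    using finite_polytope_faces[OF simplex_imp_polytope[OF simplex_T[OF that]]] .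
  have fF: "finite (faces \<T>)" and fE: "finite (edges \<T>)"
    by (rule finite_subset[of _ "\<Union>T\<in>\<T>. {f. f face_of T}"]; use fT finite_T in \<open>auto simp: faces_def edges_def\<close>)+
  have "vertices \<T> \<subseteq> (\<Union>T\<in>\<T>. (\<lambda>x. {x}) -` {f. f face_of T})" by (auto simp: vertices_def face_of_singleton)
  then have fV: "finite (vertices \<T>)"
    by (rule finite_subset) (intro finite_UN_I finite_T finite_vimageI fT; simp add: inj_def)
  have b: "finite (B0 f)" "finite (BN f)" if "f \<in> faces \<T>" for f using faces_facets[OF that] basis_cards(1,2) by blast+
  have bE: "finite (BE e)" if "e \<in> edges \<T>" for e
  proof -
    obtain T where "T \<in> \<T>" "e \<in> tedges T" using \<open>e \<in> edges \<T>\<close> by (auto simp: edges_def tedges_def)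
    then show ?thesis using basis_cards(4) by blast
  qed
  let ?A = "(\<lambda>(x, i, j). Vertex_dof x i j) ` (vertices \<T> \<times> UNIV)"
  let ?B = "(\<Union>f\<in>faces \<T>. Face_nn_dof f ` B0 f) \<union> (\<Union>f\<in>faces \<T>. Face_tangential_dof f ` BN f) \<union> (\<Union>T\<in>\<T>. Element_dof T ` BK T)"
  let ?C = "(\<Union>e\<in>edges \<T>. Edge_nt_dof e ` BE e) \<union> (\<Union>e\<in>edges \<T>. (\<lambda>(i, q). Edge_nn_dof e i q) ` ({1..m e + 1} \<times> BE e))"
  have "finite ?A" using fV by simp
  moreover have "finite ?B"
    by (intro finite_UnI finite_UN_I finite_imageI fF finite_T b basis_cards(3)[THEN conjunct1]; assumption)
  moreover have "finite ?C"
    by (intro finite_UnI finite_UN_I finite_imageI finite_cartesian_product finite_atLeastAtMost fE bE; assumption)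
  moreover have "D \<subseteq> ?A \<union> ?B \<union> ?C"
  proof
    fix d assume d: "d \<in> D"
    show "d \<in> ?A \<union> ?B \<union> ?C"
    proof (cases d)
      case (Vertex_dof x i j)
      then have "(x, i, j) \<in> vertices \<T> \<times> UNIV" using d unfolding dofs_def by auto
      from imageI[OF this, of "\<lambda>(x, i, j). Vertex_dof x i j"] show ?thesis unfolding Vertex_dof prod.case by - (rule UnI1, rule UnI1)
    next
      case (Face_nn_dof f q)
      then have f: "f \<in> faces \<T>" "q \<in> B0 f" using d unfolding dofs_def by auto
      show ?thesis unfolding Face_nn_dof by (rule UnI1, rule UnI2, rule UnI1, rule UnI1, rule UN_I[OF f(1)], rule imageI[OF f(2)])
    next
      case (Face_tangential_dof f q)
      then have f: "f \<in> faces \<T>" "q \<in> BN f" using d unfolding dofs_def by auto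
      show ?thesis unfolding Face_tangential_dof by (rule UnI1, rule UnI2, rule UnI1, rule UnI2, rule UN_I[OF f(1)], rule imageI[OF f(2)])
    next
      case (Element_dof f q)
      then have f: "f \<in> \<T>" "q \<in> BK f" using d unfolding dofs_def by auto
      show ?thesis unfolding Element_dof by (rule UnI1, rule UnI2, rule UnI2, rule UN_I[OF f(1)], rule imageI[OF f(2)])
    next
      case (Edge_nt_dof e q)
      then have f: "e \<in> edges \<T>" "q \<in> BE e" using d unfolding Edge_nt_dof edge_nt_dof_iff by auto
      show ?thesis unfolding Edge_nt_dof by (rule UnI2, rule UnI1, rule UN_I[OF f(1)], rule imageI[OF f(2)])
    next
      case (Edge_nn_dof e i q)
      then have e: "e \<in> edges \<T>" "(i, q) \<in> {1..m e + 1} \<times> BE e" using d edge_dof_index unfolding Edge_nn_dof edge_nn_dof_iff by auto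
      have "Edge_nn_dof e i q \<in> (\<lambda>(i, q). Edge_nn_dof e i q) ` ({1..m e + 1} \<times> BE e)"
        using imageI[OF e(2), of "\<lambda>(i, q). Edge_nn_dof e i q"] unfolding prod.case .
      then show ?thesis unfolding Edge_nn_dof by - (rule UnI2, rule UnI2, rule UN_I[OF e(1)])
    qed
  qed
  ultimately show ?thesis by (meson finite_Un finite_subset)
qed

end

context elasticity_mesh begin

lemma dof_iff: "Vertex_dof x i j \<in> D \<longleftrightarrow> x \<in> vertices \<T> \<and> i \<le> j"
  "Face_nn_dof f q \<in> D \<longleftrightarrow> f \<in> faces \<T> \<and> q \<in> B0 f" "Face_tangential_dof f v \<in> D \<longleftrightarrow> f \<in> faces \<T> \<and> v \<in> BN f"
  "Element_dof T \<xi> \<in> D \<longleftrightarrow> T \<in> \<T> \<and> \<xi> \<in> BK T"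
  unfolding dofs_def by auto

text \<open>Both moments depend on the normal trace alone, once symmetry has moved the normal next
  to the matrix.\<close>

lemma loc_shared:
  assumes P: "normal_continuous P" and sym: "\<And>x. P T x \<in> sym_mats" "\<And>x. P T' x \<in> sym_mats"
    and T: "T \<in> \<T>" "T' \<in> \<T>" and e: "e \<in> tedges T" and f: "f \<in> facets T" "f \<in> facets T'" "e face_of f"
  shows "loc T (P T) (Edge_nn_loc e f q) = loc T' (P T') (Edge_nn_loc e f q)"
    "loc T (P T) (Edge_nt_loc e f q) = loc T' (P T') (Edge_nt_loc e f q)"
proof -
  note d = tedge_props(3)[OF e simplex_T[OF T(1)]] and n = normal_common[OF P T f(1,2)]
  have x: "x \<in> f" if "x \<in> e" for x using face_of_imp_subset[OF f(3)] that by blast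
  have s: "nrm f \<bullet> (P T x *v h) = h \<bullet> (P T x *v nrm f)" "nrm f \<bullet> (P T' x *v h) = h \<bullet> (P T' x *v nrm f)" for x h
    by (rule sym_mats_inner[OF sym(1)], rule sym_mats_inner[OF sym(2)])
  show "loc T (P T) (Edge_nn_loc e f q) = loc T' (P T') (Edge_nn_loc e f q)"
    unfolding loc.simps by (rule edge_integral_cong[OF d]) (simp only: n[OF x])
  show "loc T (P T) (Edge_nt_loc e f q) = loc T' (P T') (Edge_nt_loc e f q)"
    unfolding loc.simps by (rule edge_integral_cong[OF d], subst s, subst s) (simp only: n[OF x])
qed

lemma moments_loop:
  assumes P: "admissible P" and e: "e \<in> edges \<T>" and q: "q \<in> BE e"
  shows "loop_rel (m e) (\<kappa> e) (\<lambda>i. loc (elt e i) (P (elt e i)) (Edge_nn_loc e (F e i) q))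
    (\<lambda>i. loc (elt e i) (P (elt e i)) (Edge_nt_loc e (F e i) q))"
    (is "loop_rel _ _ ?a ?b")
  unfolding loop_rel_def
proof
  fix i assume i: "i \<in> {1..m e}"
  note l = label_props[OF e i]
  have i': "i \<in> {1..m e + 1}" "i + 1 \<in> {1..m e + 1}" using i by auto
  note E = elt_props[OF e i'(1)] and E' = elt_props[OF e i'(2)]
  note sh = loc_shared[OF admissibleD(3)[OF P] admissibleD(2)[OF P E(1)] admissibleD(2)[OF P l(1)] E(1) l(1) E(2,3) l(3) E(4)]
    and sh' = loc_shared[OF admissibleD(3)[OF P] admissibleD(2)[OF P E'(1)] admissibleD(2)[OF P l(1)] E'(1) l(1) E'(2,3) l(4) E'(4)]
  show "?b i + ?b (i + 1) = \<kappa> e i * (?a (i + 1) - ?a i)"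
    unfolding sh sh' \<kappa>_def
    by (rule edge_moment_relation[OF l(1,2,3,4,5,6) labels_distinct[OF e i] admissibleD(1)[OF P l(1)] admissibleD(2)[OF P l(1)] q])
qed

text \<open>\<open>F e (m e + 1)\<close> and \<open>F e 1\<close> are one face, seen from the last
  and from the first element; normal continuity equates the moments.\<close>

lemma moments_cyclic:
  assumes P: "admissible P" and e: "e \<in> edges \<T>" "\<not> boundary_edge \<Omega> e"
  shows "loc (elt e (m e + 1)) (P (elt e (m e + 1))) (Edge_nn_loc e (F e (m e + 1)) q) = loc (elt e 1) (P (elt e 1)) (Edge_nn_loc e (F e 1) q)"
    "loc (elt e (m e + 1)) (P (elt e (m e + 1))) (Edge_nt_loc e (F e (m e + 1)) q) = loc (elt e 1) (P (elt e 1)) (Edge_nt_loc e (F e 1) q)"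
proof -
  have i: "1 \<in> {1..m e + 1}" "m e + 1 \<in> {1..m e + 1}" by auto
  note c = interior_labels(2)[OF e]
  note E = elt_props[OF e(1) i(2), unfolded c] and E' = elt_props[OF e(1) i(1)]
  note sh = loc_shared[OF admissibleD(3)[OF P] admissibleD(2)[OF P E(1)] admissibleD(2)[OF P E'(1)] E(1) E'(1) E(2,3) E'(3) E(4)]
  show "loc (elt e (m e + 1)) (P (elt e (m e + 1))) (Edge_nn_loc e (F e (m e + 1)) q) = loc (elt e 1) (P (elt e 1)) (Edge_nn_loc e (F e 1) q)"
    "loc (elt e (m e + 1)) (P (elt e (m e + 1))) (Edge_nt_loc e (F e (m e + 1)) q) = loc (elt e 1) (P (elt e 1)) (Edge_nt_loc e (F e 1) q)"
    unfolding c by (rule sh)+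
qed

text \<open>The listed moments vanish, and the recurrence carries this over to the unlisted ones on
  every face at the edge.\<close>

lemma edge_moments_zero:
  assumes P: "admissible P" and z: "\<And>d. d \<in> D \<Longrightarrow> val (glue \<T> P) d = 0"
    and e: "e \<in> edges \<T>" and q: "q \<in> BE e" and i: "i \<in> {1..m e + 1}"
  shows "loc (elt e i) (P (elt e i)) (Edge_nn_loc e (F e i) q) = 0" "loc (elt e i) (P (elt e i)) (Edge_nt_loc e (F e i) q) = 0"
proof -
  define a where "a i = loc (elt e i) (P (elt e i)) (Edge_nn_loc e (F e i) q)" for i
  define b where "b i = loc (elt e i) (P (elt e i)) (Edge_nt_loc e (F e i) q)" for i
  have rel: "loop_rel (m e) (\<kappa> e) a b" unfolding a_def b_def by (rule moments_loop[OF P e q])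
  have a: "a j = 0" if "j \<in> {1..m e + 1}" "Edge_nn_dof e j q \<in> D" for j
    using val_edge(1)[OF P elt_props[OF e that(1)]] z[OF that(2)] unfolding a_def by metis
  have i1: "1 \<in> {1..m e + 1}" by simp
  have b: "b 1 = 0" if "Edge_nt_dof e q \<in> D"
    using val_edge(2)[OF P elt_props[OF e i1] refl] z[OF that] unfolding b_def by metis
  have cyc: "a (m e + 1) = a 1" "b (m e + 1) = b 1" if "\<not> boundary_edge \<Omega> e"
    unfolding a_def b_def by (rule moments_cyclic[OF P e that])+
  note m1 = patch_size_pos[OF e]
  consider (boundary) "boundary_edge \<Omega> e" | (singular) "singular_edge \<Omega> \<T> e (F e)" | (odd) "\<not> boundary_edge \<Omega> e" "odd (m e)"
    | (even) "\<not> boundary_edge \<Omega> e" "even (m e)" "\<not> singular_edge \<Omega> \<T> e (F e)" by blast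
  then have "a i = 0 \<and> b i = 0"
  proof cases
    case boundary
    have aa: "a j = 0" if "j \<in> {1..m e + 1}" for j by (rule a[OF that]) (use boundary that e q in \<open>simp add: edge_nn_dof_iff\<close>)
    have "b 1 = 0" by (rule b) (use boundary e q in \<open>simp add: edge_nt_dof_iff\<close>)
    then show ?thesis using loop_zero_path[OF rel aa _ i] aa[OF i] by simp
  next
    case singular
    note s = singularD[OF singular, THEN conjunct1] singularD[OF singular, THEN conjunct2]
    have a4: "a j = 0" if "j \<in> {1..4}" for j by (rule a) (use singular s that e q in \<open>simp_all add: edge_nn_dof_iff\<close>)
    have aa: "a j = 0" if "j \<in> {1..m e + 1}" for j
    proof (cases "j = m e + 1")
      case True
      then show ?thesis using cyc(1)[OF s(1)] a4[of 1] by simp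
    next
      case False
      then show ?thesis using a4[of j] that s(2) by simp
    qed
    have "b 1 = 0" by (rule b) (use singular e q in \<open>simp add: edge_nt_dof_iff\<close>)
    then show ?thesis using loop_zero_path[OF rel aa _ i] aa[OF i] by simp
  next
    case odd
    have aa: "a j = 0" if "j \<in> {1..m e}" for j by (rule a) (use odd that e q in \<open>simp_all add: edge_nn_dof_iff\<close>)
    have "a i = 0" using aa[of i] aa[of 1] cyc(1)[OF odd(1)] i m1 by (cases "i = m e + 1") auto
    then show ?thesis using loop_zero_odd[OF rel odd(2) cyc[OF odd(1)] aa i] by simp
  next
    case even
    have aa: "a j = 0" if "j \<in> {2..m e}" for j by (rule a) (use even that e q in \<open>simp_all add: edge_nn_dof_iff\<close>)
    have b1: "b 1 = 0" by (rule b) (use even e q in \<open>simp add: edge_nt_dof_iff\<close>)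
    show ?thesis
      using loop_zero_even[OF rel even(2) interior_patch_size[OF e even(1)] cyc[OF even(1)] kappa_even[OF e even] aa b1 i] by simp
  qed
  then show "loc (elt e i) (P (elt e i)) (Edge_nn_loc e (F e i) q) = 0" "loc (elt e i) (P (elt e i)) (Edge_nt_loc e (F e i) q) = 0"
    unfolding a_def b_def by blast+
qed

lemma dofs_injective:
  assumes P: "admissible P" and z: "\<And>d. d \<in> D \<Longrightarrow> val (glue \<T> P) d = 0"
  shows "glue \<T> P = 0"
proof -
  have "P T x = 0" if T: "T \<in> \<T>" and x: "x \<in> T" for T x
  proof (rule local_injective[OF T admissibleD(1)[OF P T] admissibleD(2)[OF P T] _ x])
    fix d assume d: "is_loc T d"
    show "loc T (P T) d = 0"
    proof (cases d)
      case (Vertex_loc y i j)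
      then have y: "y extreme_point_of T" "i \<le> j" using d by auto
      have "Vertex_dof y i j \<in> D" using y T by (auto simp: dof_iff vertices_def)
      then show ?thesis using val_vertex[OF P T y(1), of i j] z unfolding Vertex_loc by metis
    next
      case (Face_nn_loc f q)
      then have f: "f \<in> facets T" "q \<in> B0 f" using d by auto
      have "Face_nn_dof f q \<in> D" using f facets_faces[OF T] by (simp add: dof_iff)
      then show ?thesis using val_face(1)[OF P T f(1), of q] z unfolding Face_nn_loc by metis
    next
      case (Face_tangential_loc f q)
      then have f: "f \<in> facets T" "q \<in> BN f" using d by auto
      have "Face_tangential_dof f q \<in> D" using f facets_faces[OF T] by (simp add: dof_iff)
      then show ?thesis using val_face(2)[OF P T f(1), of q] z unfolding Face_tangential_loc by metis
    next
      case (Element_loc \<xi>)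
      then have f: "\<xi> \<in> BK T" using d by auto
      have "Element_dof T \<xi> \<in> D" using f T by (simp add: dof_iff)
      then show ?thesis using val_element[OF P T f] z unfolding Element_loc by metis
    next
      case (Edge_nn_loc e f q)
      then have e: "e \<in> tedges T" "f \<in> facets T" "e face_of f" "q \<in> BE e" using d by auto
      note eT = tedges_edges[OF T e(1)]
      obtain i where i: "i \<in> {1..m e + 1}" "F e i = f" by (rule face_label[OF eT facets_faces[OF T e(2)] e(3)])
      note E = elt_props[OF eT i(1), unfolded i(2)]
      have "loc (elt e i) (P (elt e i)) (Edge_nn_loc e f q) = 0" using edge_moments_zero(1)[OF P z eT e(4) i(1)] unfolding i(2) .
      then show ?thesis unfolding Edge_nn_loc
          loc_shared(1)[OF admissibleD(3)[OF P] admissibleD(2)[OF P T] admissibleD(2)[OF P E(1)] T E(1) e(1,2) E(3) e(3)] .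
    next
      case (Edge_nt_loc e f q)
      then have e: "e \<in> tedges T" "f \<in> facets T" "e face_of f" "q \<in> BE e" using d by auto
      note eT = tedges_edges[OF T e(1)]
      obtain i where i: "i \<in> {1..m e + 1}" "F e i = f" by (rule face_label[OF eT facets_faces[OF T e(2)] e(3)])
      note E = elt_props[OF eT i(1), unfolded i(2)]
      have "loc (elt e i) (P (elt e i)) (Edge_nt_loc e f q) = 0" using edge_moments_zero(2)[OF P z eT e(4) i(1)] unfolding i(2) .
      then show ?thesis unfolding Edge_nt_loc
          loc_shared(2)[OF admissibleD(3)[OF P] admissibleD(2)[OF P T] admissibleD(2)[OF P E(1)] T E(1) e(1,2) E(3) e(3)] .
    qed
  qed
  then have "indicat_real (interior T) x *\<^sub>R P T x = 0" if "T \<in> \<T>" for T x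
    using that interior_subset[of T] by (cases "x \<in> interior T") auto
  then show ?thesis by (intro ext) (simp only: glue_def sum.neutral_const zero_fun_apply cong: sum.cong)
qed

section \<open>Extending prescribed edge values to all faces at an edge\<close>

definition loop_data :: "(dof \<Rightarrow> real) \<Rightarrow> (real^3) set \<Rightarrow> (real^3 \<Rightarrow> real) \<Rightarrow> (nat \<Rightarrow> real) \<Rightarrow> (nat \<Rightarrow> real) \<Rightarrow> bool" where
  "loop_data g e q a b \<longleftrightarrow> loop_rel (m e) (\<kappa> e) a b \<and> (\<not> boundary_edge \<Omega> e \<longrightarrow> a (m e + 1) = a 1 \<and> b (m e + 1) = b 1) \<and>
     (\<forall>i. Edge_nn_dof e i q \<in> D \<longrightarrow> a i = g (Edge_nn_dof e i q)) \<and> (Edge_nt_dof e q \<in> D \<longrightarrow> b 1 = g (Edge_nt_dof e q))"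

text \<open>For each kind of edge the listed moments are ones that the recurrence allows to be
  chosen freely; the rest is filled in by the matching existence lemma.\<close>

lemma loop_data_exists:
  assumes e: "e \<in> edges \<T>"
  shows "\<exists>a b. loop_data g e q a b"
proof -
  let ?a = "\<lambda>i. g (Edge_nn_dof e i q)" and ?b = "g (Edge_nt_dof e q)"
  note m1 = patch_size_pos[OF e]
  consider (boundary) "boundary_edge \<Omega> e" | (singular) "singular_edge \<Omega> \<T> e (F e)" | (odd) "\<not> boundary_edge \<Omega> e" "odd (m e)"
    | (even) "\<not> boundary_edge \<Omega> e" "even (m e)" "\<not> singular_edge \<Omega> \<T> e (F e)" by blast
  then show ?thesis
  proof cases
    case boundary
    have "loop_data g e q ?a (loop_seq (\<kappa> e) ?a ?b)" unfolding loop_data_def using loop_rel_seq boundary by (simp del: loop_seq.simps)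
    then show ?thesis by blast
  next
    case singular
    note s = singularD[OF singular, THEN conjunct1] singularD[OF singular, THEN conjunct2]
    \<comment> \<open>Label 5 is the first face again, so its value is copied from label 1.\<close>
    define a where "a i = (if i = 5 then ?a 1 else ?a i)" for i :: nat
    obtain b where b: "loop_rel 4 (\<kappa> e) a b" "b 5 = b 1" "b 1 = ?b"
      using loop_ex_singular[OF kappa_singular[OF e singular], of a ?b] by (auto simp: a_def)
    have "a i = ?a i" if "Edge_nn_dof e i q \<in> D" for i
      using that singular s unfolding edge_nn_dof_iff by (auto simp: a_def)
    moreover have "a 5 = a 1" by (simp add: a_def)
    ultimately have "loop_data g e q a b" unfolding loop_data_def s(2) using b by simp
    then show ?thesis by blast
  next
    case odd
    define a where "a i = (if i = m e + 1 then ?a 1 else ?a i)" for i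
    have cyc: "a (m e + 1) = a 1" using m1 by (simp add: a_def)
    obtain b where b: "loop_rel (m e) (\<kappa> e) a b" "b (m e + 1) = b 1" using loop_ex_odd[of "m e" a "\<kappa> e", OF odd(2) cyc] by blast
    have "a i = ?a i" if "Edge_nn_dof e i q \<in> D" for i
      using that odd singularD[of e] unfolding edge_nn_dof_iff by (auto simp: a_def)
    moreover have "Edge_nt_dof e q \<notin> D" using odd singularD[of e] unfolding edge_nt_dof_iff by auto
    ultimately have "loop_data g e q a b" unfolding loop_data_def using b cyc by simp
    then show ?thesis by blast
  next
    case even
    obtain a b where ab: "loop_rel (m e) (\<kappa> e) a b" "a (m e + 1) = a 1" "b (m e + 1) = b 1" "b 1 = ?b" "\<forall>i\<in>{2..m e}. a i = ?a i"
      using loop_ex_even[of "m e" "\<kappa> e" ?b ?a, OF even(2) interior_patch_size[OF e even(1)] kappa_even[OF e even]] by blast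
    have "a i = ?a i" if "Edge_nn_dof e i q \<in> D" for i
      using that even singularD[of e] ab(5) unfolding edge_nn_dof_iff by auto
    then have "loop_data g e q a b" unfolding loop_data_def using ab(1-4) by simp
    then show ?thesis by blast
  qed
qed

text \<open>At an interior edge the first face carries the labels 1 and \<open>m e + 1\<close>; by
  \<open>idx_value\<close> the choice does not affect data that close up.\<close>

definition idx :: "(real^3) set \<Rightarrow> (real^3) set \<Rightarrow> nat" where
  "idx e f = (SOME i. i \<in> {1..m e + 1} \<and> F e i = f)"

lemma idx_value:
  assumes e: "e \<in> edges \<T>" and i: "i \<in> {1..m e + 1}" and ab: "\<not> boundary_edge \<Omega> e \<longrightarrow> a (m e + 1) = a 1"
  shows "a (idx e (F e i)) = (a i :: real)"
proof -
  have "\<exists>j. j \<in> {1..m e + 1} \<and> F e j = F e i" using i by blast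
  from someI_ex[OF this] have j: "idx e (F e i) \<in> {1..m e + 1}" "F e (idx e (F e i)) = F e i" unfolding idx_def by blast+
  define j where "j = idx e (F e i)"
  note j' = j[folded j_def]
  have "a j = a i"
  proof (cases "boundary_edge \<Omega> e")
    case True
    then show ?thesis using inj_onD[OF bij_betw_imp_inj_on[OF boundary_labels[OF e True]] j'(2) j'(1) i] by simp
  next
    case False
    note c = interior_labels(2)[OF e False] and inj = bij_betw_imp_inj_on[OF interior_labels(1)[OF e False]]
    define r where "r k = (if k = m e + 1 then 1 else k)" for k
    have r: "r k \<in> {1..m e}" "F e (r k) = F e k" "a (r k) = a k" if "k \<in> {1..m e + 1}" for k
      using that c ab False patch_size_pos[OF e] by (auto simp: r_def)
    have "r j = r i" using inj_onD[OF inj _ r(1)[OF j'(1)] r(1)[OF i]] r(2)[OF j'(1)] r(2)[OF i] j'(2) by simp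
    then show ?thesis using r(3)[OF j'(1)] r(3)[OF i] by simp
  qed
  then show ?thesis unfolding j_def .
qed

text \<open>The two facets of \<open>T\<close> at the edge have consecutive labels, in one order or
  the other; reversing the order changes the sign of \<open>kappa\<close> and of the
  difference.\<close>

lemma compatible_data:
  assumes ab: "loop_data g e q a b" and T: "T \<in> \<T>" "e \<in> tedges T"
    and f: "f \<in> facets T" "f' \<in> facets T" "e face_of f" "e face_of f'" "f \<noteq> f'"
  shows "b (idx e f) + b (idx e f') = kappa (tng e) (nrm f) (nrm f') * (a (idx e f') - a (idx e f))"
proof -
  note e = tedges_edges[OF T]
  obtain i where i: "i \<in> {1..m e}" "K e i = T" by (rule element_label[OF T])
  have i': "i \<in> {1..m e + 1}" "i + 1 \<in> {1..m e + 1}" using i by auto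
  have rel: "b i + b (i + 1) = kappa (tng e) (nrm (F e i)) (nrm (F e (i + 1))) * (a (i + 1) - a i)"
    using ab i(1) unfolding loop_data_def loop_rel_def \<kappa>_def by blast
  have cyc: "\<not> boundary_edge \<Omega> e \<longrightarrow> a (m e + 1) = a 1" "\<not> boundary_edge \<Omega> e \<longrightarrow> b (m e + 1) = b 1"
    using ab unfolding loop_data_def by blast+
  note v = idx_value[OF e i'(1), of a, OF cyc(1)] idx_value[OF e i'(2), of a, OF cyc(1)]
    idx_value[OF e i'(1), of b, OF cyc(2)] idx_value[OF e i'(2), of b, OF cyc(2)]
  have "f \<in> {f \<in> facets T. e face_of f}" "f' \<in> {f \<in> facets T. e face_of f}" using f by simp_all
  then have "f = F e i \<and> f' = F e (i + 1) \<or> f = F e (i + 1) \<and> f' = F e i"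
    unfolding facets_at_label[OF e i(1), unfolded i(2)] insert_iff empty_iff using f(5) by argo
  then show ?thesis
  proof (elim disjE conjE)
    assume h: "f = F e i" "f' = F e (i + 1)"
    show ?thesis unfolding h v by (rule rel)
  next
    assume h: "f = F e (i + 1)" "f' = F e i"
    show ?thesis unfolding h v kappa_swap[of "tng e" "nrm (F e (i + 1))" "nrm (F e i)"]
      using rel by (simp add: algebra_simps)
  qed
qed

text \<open>Each element is solved separately from data that neighbours share. On a common facet the
  difference of the two pieces has vanishing vertex values, face moments and edge moments, so
  \<open>face_zero\<close> makes the normal traces agree and the pieces glue to a member of
  \<open>Sigma_h\<close>.\<close>

lemma dofs_surjective: "\<exists>P. admissible P \<and> (\<forall>d\<in>D. val (glue \<T> P) d = g d)"
proof -
  define aa where "aa e q = (SOME a. \<exists>b. loop_data g e q a b)" for e q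
  define bb where "bb e q = (SOME b. loop_data g e q (aa e q) b)" for e q
  have ab: "loop_data g e q (aa e q) (bb e q)" if "e \<in> edges \<T>" for e q
    using someI_ex[OF someI_ex[OF loop_data_exists[OF that, of g q], folded aa_def], folded bb_def] .
  \<comment> \<open>\<open>T\<close> enters only through the element moments; all other data depend
    on the vertex, face or edge alone.\<close>
  define h where "h T d = (case d of Vertex_loc x i j \<Rightarrow> g (Vertex_dof x i j) | Face_nn_loc f q \<Rightarrow> g (Face_nn_dof f q)
    | Face_tangential_loc f v \<Rightarrow> g (Face_tangential_dof f v) | Element_loc \<xi> \<Rightarrow> g (Element_dof T \<xi>)
    | Edge_nn_loc e f q \<Rightarrow> aa e q (idx e f) | Edge_nt_loc e f q \<Rightarrow> bb e q (idx e f))" for T d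
  have "\<exists>p. p \<in> polys 3 \<and> (\<forall>x. p x \<in> sym_mats) \<and> (\<forall>d. is_loc T d \<longrightarrow> loc T p d = h T d)" if T: "T \<in> \<T>" for T
  proof (rule local_surjective[OF T], intro ballI impI, elim conjE)
    fix e f f' q assume e: "e \<in> tedges T" and f: "f \<in> facets T" "f' \<in> facets T" "e face_of f" "e face_of f'" "f \<noteq> f'"
    show "h T (Edge_nt_loc e f q) + h T (Edge_nt_loc e f' q) = kappa (tng e) (nrm f) (nrm f') * (h T (Edge_nn_loc e f' q) - h T (Edge_nn_loc e f q))"
      unfolding h_def local_dof.case by (rule compatible_data[OF ab[OF tedges_edges[OF T e]] T e f])
  qed
  then have "\<forall>T\<in>\<T>. \<exists>p. p \<in> polys 3 \<and> (\<forall>x. p x \<in> sym_mats) \<and> (\<forall>d. is_loc T d \<longrightarrow> loc T p d = h T d)" by (intro ballI)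
  from bchoice[OF this] obtain P where PP: "\<forall>T\<in>\<T>. P T \<in> polys 3 \<and> (\<forall>x. P T x \<in> sym_mats) \<and> (\<forall>d. is_loc T d \<longrightarrow> loc T (P T) d = h T d)"
    by (rule exE)
  have P: "P T \<in> polys 3" "P T x \<in> sym_mats" "is_loc T d \<Longrightarrow> loc T (P T) d = h T d" if "T \<in> \<T>" for T x d
    using PP that by blast+
  have vertex: "P T x = P T' x" if x: "x extreme_point_of T" "x extreme_point_of T'" and T: "T \<in> \<T>" "T' \<in> \<T>" for x T T'
  proof -
    have u: "P T x $ i $ j = P T' x $ i $ j" if "i \<le> j" for i j
      using P(3)[OF T(1), of "Vertex_loc x i j"] P(3)[OF T(2), of "Vertex_loc x i j"] x that by (simp add: h_def)
    have "P T x $ i $ j = P T' x $ i $ j" for i j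
    proof (cases "i \<le> j")
      case False
      then have "P T x $ j $ i = P T' x $ j $ i" using u by simp
      then show ?thesis using sym_mats_component[OF P(2)[OF T(1)], of x i j] sym_mats_component[OF P(2)[OF T(2)], of x i j] by simp
    qed (rule u)
    then show ?thesis by (simp add: vec_eq_iff)
  qed
  have nc: "P T x *v nrm f = P T' x *v nrm f" if T: "T \<in> \<T>" "T' \<in> \<T>" and f: "f \<in> facets T" "f \<in> facets T'" and x: "x \<in> f" for T T' f x
  proof -
    \<comment> \<open>The difference is written as a sum with a multiple so that
      \<open>loc_add\<close> and \<open>loc_scale\<close> apply.\<close>
    define w where "w = (\<lambda>x. P T x + (- 1) *\<^sub>R P T' x)"
    have m1: "(\<lambda>x. (- 1) *\<^sub>R P T' x) \<in> polys 3" by (rule polys_scaleR[OF P(1)[OF T(2)]])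
    have w: "w \<in> polys 3" unfolding w_def by (rule polys_add[OF P(1)[OF T(1)] m1])
    have ws: "w x \<in> sym_mats" for x unfolding w_def by (rule sym_mats_add[OF P(2)[OF T(1)] sym_mats_scaleR[OF P(2)[OF T(2)]]])
    have z: "loc T w d = 0" if d: "is_loc T d" "is_loc T' d" "loc T (P T') d = loc T' (P T') d" "h T d = h T' d" for d
      unfolding w_def loc_add[OF T(1) P(1)[OF T(1)] m1 d(1)] loc_scale d(3) P(3)[OF T(1) d(1)] P(3)[OF T(2) d(2)] d(4) by simp
    have ss: "cross3 (nrm f) (tng e) \<bullet> (w x *v nrm f) = nrm f \<bullet> (w x *v cross3 (nrm f) (tng e))" for e x by (rule sym_mats_inner[OF ws])
    have te: "e \<in> tedges T'" if "e \<in> tedges T" "e face_of f" for e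
      using that f(2) face_of_trans[of e f T'] by (simp add: tedges_def facets_def)
    have "w x *v nrm f = 0"
    proof (rule face_zero[OF T(1) f(1) polys_matrix_vector[OF w] _ _ _ _ _ x])
      fix y assume y: "y extreme_point_of T" "y \<in> f"
      have "y \<in> vertices \<T>" "y \<in> T'" using y T f(2) facet_props(4)[OF f(2) simplex_T[OF T(2)]] by (auto simp: vertices_def)
      then have "P T y = P T' y" using vertex[OF y(1) vertex_extreme T] T(2) by blast
      then show "w y *v nrm f = 0" by (simp add: w_def)
    next
      fix q assume q: "q \<in> B0 f"
      show "face_integral f (\<lambda>x. (nrm f \<bullet> (w x *v nrm f)) * q x) = 0" using z[of "Face_nn_loc f q"] f q by (simp add: h_def)
    next
      fix v assume q: "v \<in> BN f"
      show "face_integral f (\<lambda>x. tangential_part (nrm f) (w x *v nrm f) \<bullet> v x) = 0" using z[of "Face_tangential_loc f v"] f q by (simp add: h_def)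
    next
      fix e q assume e: "e \<in> tedges T" "e face_of f" "q \<in> BE e"
      show "edge_integral e (\<lambda>x. (nrm f \<bullet> (w x *v nrm f)) * q x) = 0" using z[of "Edge_nn_loc e f q"] f e te by (simp add: h_def)
      show "edge_integral e (\<lambda>x. (cross3 (nrm f) (tng e) \<bullet> (w x *v nrm f)) * q x) = 0"
        unfolding ss using z[of "Edge_nt_loc e f q"] f e te by (simp add: h_def)
    qed
    then show ?thesis unfolding w_def matrix_vector_mult_add_rdistrib scaleR_matrix_vector_assoc[symmetric] by simp
  qed
  have adm: "admissible P" unfolding admissible_def normal_continuous_def
  proof (intro conjI ballI allI impI)
    show "P T \<in> polys 3" "P T x \<in> sym_mats" if "T \<in> \<T>" for T x by (rule P(1,2)[OF that])+
    show "P T x = P T' x" if "x \<in> vertices \<T>" "T \<in> \<T>" "T' \<in> \<T>" "x \<in> T \<and> x \<in> T'" for x T T'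
      using vertex[OF vertex_extreme vertex_extreme] that by blast
    fix T T' f x assume T: "T \<in> \<T>" "T' \<in> \<T>" "f \<in> facets T \<and> f \<in> facets T'" and x: "x \<in> f"
    have "outn T f = nrm f \<or> outn T f = - nrm f"
      using facet_unit_normal_cases[OF simplex_T[OF T(1)] _ normal_facet[OF T(1)], of f] T(3) by auto
    then show "P T x *v outn T f = P T' x *v outn T f"
      using nc[OF T(1,2) _ _ x] T(3) linear_neg[OF matrix_vector_mul_linear, of "P T x" "nrm f"]
        linear_neg[OF matrix_vector_mul_linear, of "P T' x" "nrm f"] by auto
  qed
  have "val (glue \<T> P) d = g d" if d: "d \<in> D" for d
  proof (cases d)
    case (Vertex_dof x i j)
    then have x: "x \<in> vertices \<T>" "i \<le> j" using d by (simp_all add: dof_iff)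
    then obtain T where T: "T \<in> \<T>" "x extreme_point_of T" by (auto simp: vertices_def)
    show ?thesis using P(3)[OF T(1), of "Vertex_loc x i j"] T x unfolding Vertex_dof val_vertex[OF adm T] by (simp add: h_def)
  next
    case (Face_nn_dof f q)
    then have f: "f \<in> faces \<T>" "q \<in> B0 f" using d by (simp_all add: dof_iff)
    then obtain T where T: "T \<in> \<T>" "f \<in> facets T" using faces_facets by blast
    show ?thesis using P(3)[OF T(1), of "Face_nn_loc f q"] T f unfolding Face_nn_dof val_face[OF adm T] by (simp add: h_def)
  next
    case (Face_tangential_dof f q)
    then have f: "f \<in> faces \<T>" "q \<in> BN f" using d by (simp_all add: dof_iff)
    then obtain T where T: "T \<in> \<T>" "f \<in> facets T" using faces_facets by blast
    show ?thesis using P(3)[OF T(1), of "Face_tangential_loc f q"] T f unfolding Face_tangential_dof val_face[OF adm T] by (simp add: h_def)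
  next
    case (Element_dof T \<xi>)
    then have T: "T \<in> \<T>" "\<xi> \<in> BK T" using d by (simp_all add: dof_iff)
    show ?thesis using P(3)[OF T(1), of "Element_loc \<xi>"] T unfolding Element_dof val_element[OF adm T] by (simp add: h_def)
  next
    case (Edge_nt_dof e q)
    have e: "e \<in> edges \<T>" "q \<in> BE e" using d unfolding Edge_nt_dof edge_nt_dof_iff by auto
    have i: "1 \<in> {1..m e + 1}" by simp
    note E = elt_props[OF e(1) i]
    have l: "is_loc (elt e 1) (Edge_nt_loc e (F e 1) q)" using E e(2) unfolding is_loc.simps by blast
    have "val (glue \<T> P) (Edge_nt_dof e q) = bb e q (idx e (F e 1))"
      unfolding val_edge(2)[OF adm E refl] P(3)[OF E(1) l] h_def local_dof.case ..
    also have "\<dots> = bb e q 1" by (rule idx_value[OF e(1) i]) (use ab[OF e(1), of q] in \<open>unfold loop_data_def, blast\<close>)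
    also have "\<dots> = g d" using ab[OF e(1), of q] d unfolding Edge_nt_dof loop_data_def by blast
    finally show ?thesis unfolding Edge_nt_dof .
  next
    case (Edge_nn_dof e i q)
    have e: "e \<in> edges \<T>" "q \<in> BE e" using d unfolding Edge_nn_dof edge_nn_dof_iff by auto
    have i: "i \<in> {1..m e + 1}" by (rule edge_dof_index[OF d[unfolded Edge_nn_dof]])
    note E = elt_props[OF e(1) i]
    have l: "is_loc (elt e i) (Edge_nn_loc e (F e i) q)" using E e(2) unfolding is_loc.simps by blast
    have "val (glue \<T> P) (Edge_nn_dof e i q) = aa e q (idx e (F e i))"
      unfolding val_edge(1)[OF adm E] P(3)[OF E(1) l] h_def local_dof.case ..
    also have "\<dots> = aa e q i" by (rule idx_value[OF e(1) i]) (use ab[OF e(1), of q] in \<open>unfold loop_data_def, blast\<close>)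
    also have "\<dots> = g d" using ab[OF e(1), of q] d unfolding Edge_nn_dof loop_data_def by blast
    finally show ?thesis unfolding Edge_nn_dof .
  qed
  then show ?thesis using adm by blast
qed

lemma unisolvent_dofs: "unisolvent (Sigma_h \<Omega> \<T>) D val"
proof (rule unisolventI[OF finite_dofs Sigma_h_subspace])
  fix u v d assume "u \<in> Sigma_h \<Omega> \<T>" "v \<in> Sigma_h \<Omega> \<T>" and d: "d \<in> D"
  then obtain P Q where PQ: "admissible P" "u = glue \<T> P" "admissible Q" "v = glue \<T> Q" by (elim Sigma_hE)
  obtain T d' where T: "T \<in> \<T>" "is_loc T d'" and v: "\<forall>P. admissible P \<longrightarrow> val (glue \<T> P) d = loc T (P T) d'"
    using dof_local[OF d] by blast
  have v': "val (glue \<T> P) d = loc T (P T) d'" if "admissible P" for P using v that by blast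
  show "val (u + v) d = val u d + val v d"
    unfolding PQ(2,4) glue_add v'[OF admissible_add[OF PQ(1,3)]] v'[OF PQ(1)] v'[OF PQ(3)]
    by (rule loc_add[OF T(1) admissibleD(1)[OF PQ(1) T(1)] admissibleD(1)[OF PQ(3) T(1)] T(2)])
next
  fix c v d assume "v \<in> Sigma_h \<Omega> \<T>" and d: "d \<in> D"
  then obtain P where P: "admissible P" "v = glue \<T> P" by (elim Sigma_hE)
  obtain T d' where T: "T \<in> \<T>" "is_loc T d'" and v: "\<forall>P. admissible P \<longrightarrow> val (glue \<T> P) d = loc T (P T) d'"
    using dof_local[OF d] by blast
  have v': "val (glue \<T> P) d = loc T (P T) d'" if "admissible P" for P using v that by blast
  show "val (scale_fun c v) d = c * val v d"
    unfolding P(2) glue_scale v'[OF admissible_scale[OF P(1)]] v'[OF P(1)] by (rule loc_scale)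
next
  fix v assume v: "v \<in> Sigma_h \<Omega> \<T>" and z: "\<And>d. d \<in> D \<Longrightarrow> val v d = 0"
  obtain P where P: "admissible P" "v = glue \<T> P" using Sigma_hE[OF v] .
  show "v = 0" using dofs_injective[OF P(1)] z unfolding P(2) by blast
next
  fix g
  obtain P where "admissible P" "\<forall>d\<in>D. val (glue \<T> P) d = g d" using dofs_surjective[of g] by blast
  then show "\<exists>v\<in>Sigma_h \<Omega> \<T>. \<forall>d\<in>D. val v d = g d" using Sigma_h_glue by blast
qed

end

theorem theorem3p2:
  fixes \<Omega> :: "(real^3) set" and \<T> :: "(real^3) set set"
    and K F :: "(real^3) set \<Rightarrow> nat \<Rightarrow> (real^3) set"
    and nrm tng :: "(real^3) set \<Rightarrow> real^3"
    and B0 BE :: "(real^3) set \<Rightarrow> (real^3 \<Rightarrow> real) set"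
    and BN :: "(real^3) set \<Rightarrow> (real^3 \<Rightarrow> real^3) set"
    and BK :: "(real^3) set \<Rightarrow> (real^3 \<Rightarrow> real^3^3) set"
  assumes "polyhedral_domain \<Omega>" "bounded \<Omega>" "simply_connected \<Omega>"
    and "tet_triangulation \<Omega> \<T>"
    and "\<forall>f\<in>faces \<T>. unit_normal f (nrm f)"
    and "\<forall>e\<in>edges \<T>. tangential e (tng e)"
    and "\<forall>e\<in>edges \<T>. edge_labelling \<Omega> \<T> e (K e) (F e)"
    and "\<forall>e\<in>edges \<T>. \<not> boundary_edge \<Omega> e \<and> even (patch_size \<T> e) \<and>
           \<not> singular_edge \<Omega> \<T> e (F e) \<longrightarrow>
           theta e (F e) 1 + theta e (F e) (patch_size \<T> e) \<noteq> pi"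
    and "\<forall>f\<in>faces \<T>. is_basis (B0 f) (polys_on 0 f UNIV)"
    and "\<forall>f\<in>faces \<T>. is_basis (BN f) (nedelec1 f (nrm f))"
    and "\<forall>T\<in>\<T>. is_basis (BK T) (polys_on 1 T sym_mats)"
    and "\<forall>e\<in>edges \<T>. is_basis (BE e) (polys_on 1 e UNIV)"
  shows "unisolvent (Sigma_h \<Omega> \<T>) (dofs \<Omega> \<T> F B0 BN BK BE) (dof_value \<T> F nrm tng)"
proof -
  interpret elasticity_mesh \<Omega> \<T> K F nrm tng B0 BE BN BK
    by unfold_locales (rule assms)+
  show ?thesis by (rule unisolvent_dofs)
qed

end
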